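(* Let $\alpha>0$, $\beta>0$, $\gamma>0$, $\delta_{in}>0$, $\delta_{out}>0$, and let $d_1\ge2$, $d_2\ge2$ be integers. Let $X(t,d_1,d_2)$ be the number of edges of the random graph $\mathcal G(t)$ whose source has out-degree $d_1$, whose target has in-degree $d_2$, and whose source and target are different. Write $a=\overline{c}_{in}=\frac{1-\gamma}{1+\delta_{in}(\alpha+\gamma)}$, $b=\overline{c}_{out}=\frac{1-\alpha}{1+\delta_{out}(\alpha+\gamma)}$, $P=1+\delta_{in}(\alpha+\gamma)$, $Q=1+\delta_{out}(\alpha+\gamma)$. Then $$\mathbf E X(t,d_1,d_2)=c_X(d_1,d_2)\,t+O_{d_1,d_2}(1),\qquad c_X=c_{X1}+c_{X2}+c_{X3},$$ where $c_{X1},c_{X2},c_{X3}$ depend only on $d_1,d_2,\alpha,\beta,\gamma,\delta_{in},\delta_{out}$ and satisfy the following. (1) $$c_{X1}(d_1,d_2)=d_1^{-\frac1b}d_2^{-\frac ba-1}\sum_{i=0}^1A_i\,\kappa\!\left(\delta_{out}+\tfrac1b+i,\ \delta_{in}+\tfrac ba+1,\ \tfrac ba,\ \tfrac{d_1}{d_2^{b/a}}\right)\left(1+O\left(\tfrac1{d_1}+\tfrac1{d_2}\right)\right),$$ $A_0=\frac{\gamma^2}{Q\,ab\,\Gamma(\delta_{out})\Gamma(1+\delta_{in})}$, $A_1=\frac{\alpha\gamma}{Q\,ab\,\Gamma(1+\delta_{out})\Gamma(1+\delta_{in})}$. (2) $$c_{X2}(d_1,d_2)=d_1^{-\frac ab-1}d_2^{-\frac1a}\sum_{i=0}^1B_i\,\kappa\!\left(\delta_{in}+\tfrac1a+i,\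 \delta_{out}+\tfrac ab+1,\ \tfrac ab,\ \tfrac{d_2}{d_1^{a/b}}\right)\left(1+O\left(\tfrac1{d_1}+\tfrac1{d_2}\right)\right),$$ $B_0=\frac{\alpha^2}{P\,ab\,\Gamma(1+\delta_{out})\Gamma(\delta_{in})}$, $B_1=\frac{\alpha\gamma}{P\,ab\,\Gamma(1+\delta_{out})\Gamma(1+\delta_{in})}$. (3) Put $C_{00}=\frac{\beta\alpha\gamma}{PQ\,ab\,\Gamma(\delta_{out})\Gamma(\delta_{in})}$, $C_{01}=\frac{\beta\gamma^2}{PQ\,ab\,\Gamma(\delta_{out})\Gamma(\delta_{in}+1)}$, $C_{10}=\frac{\beta\alpha^2}{PQ\,ab\,\Gamma(\delta_{out}+1)\Gamma(\delta_{in})}$, $C_{11}=\frac{\beta\alpha\gamma}{PQ\,ab\,\Gamma(\delta_{out}+1)\Gamma(\delta_{in}+1)}$. If $a+b\ne1$, then $$\begin{aligned}c_{X3}(d_1,d_2)=d_1^{-\frac1b}d_2^{-\frac1a}\sum_{i=0}^1\sum_{j=0}^1\frac{C_{ij}}{1-a-b}\Bigg(&d_2^{\frac{1-a-b}a}\kappa\!\left(\delta_{out}+\tfrac1b+i,\ \delta_{in}+\tfrac ba+1+j,\ \tfrac ba,\ \tfrac{d_1}{d_2^{b/a}}\right)\left(1+O\left(\tfrac1{d_1}+\tfrac1{d_2}\right)\right)\\&+d_1^{\frac{1-a-b}b}\kappa\!\left(\delta_{in}+\tfrac1a+j,\ \delta_{out}+\tfrac ab+1+i,\ \tfrac ab,\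 \tfrac{d_2}{d_1^{a/b}}\right)\left(1+O\left(\tfrac1{d_1}+\tfrac1{d_2}\right)\right)\\&-\Gamma\left(\delta_{out}+\tfrac1b+i\right)\Gamma\left(\delta_{in}+\tfrac1a+j\right)+O\left(\tfrac1{d_1}+\tfrac1{d_2}\right)\Bigg).\end{aligned}$$ If $a+b=1$, then $$\begin{aligned}c_{X3}(d_1,d_2)=d_1^{-\frac1b}d_2^{-\frac1a}\sum_{i=0}^1\sum_{j=0}^1C_{ij}\Bigg(&\tfrac1a\kappa\!\left(\delta_{out}+\tfrac1b+i,\ \delta_{in}+\tfrac1a+j,\ \tfrac ba,\ \tfrac{d_1}{d_2^{b/a}}\right)\ln d_2-\tfrac1a\tfrac{\partial\kappa}{\partial c_2}\!\left(\delta_{out}+\tfrac1b+i,\ \delta_{in}+\tfrac1a+j,\ \tfrac ba,\ \tfrac{d_1}{d_2^{b/a}}\right)\\&+\tfrac1b\kappa\!\left(\delta_{in}+\tfrac1a+j,\ \delta_{out}+\tfrac1b+i,\ \tfrac ab,\ \tfrac{d_2}{d_1^{a/b}}\right)\ln d_1-\tfrac1b\tfrac{\partial\kappa}{\partial c_2}\!\left(\delta_{in}+\tfrac1a+j,\ \delta_{out}+\tfrac1b+i,\ \tfrac ab,\ \tfrac{d_2}{d_1^{a/b}}\right)\\&+O\left(\tfrac{\ln d_2}{d_1}+\tfrac{\ln d_1}{d_2}\right)\Bigg).\end{aligned}$$ (4) If $d_1$ and $d_2$ both grow to infinity such that $d_1^{a}/d_2^{b}\to0$, then $$c_X(d_1,d_2)\sim\begin{cases}D_-\,d_1^{-\frac{a+b}b}d_2^{-\frac1a},&a+b<1,\\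 D_0\,d_1^{-\frac1b}d_2^{-\frac1a}\ln d_1,&a+b=1,\\ D_+\,d_1^{-\frac1b}d_2^{-\frac1a},&a+b>1,\end{cases}$$ where $$D_-=\left(B_0\Gamma\left(\delta_{in}+\tfrac1a\right)+B_1\Gamma\left(\delta_{in}+\tfrac1a+1\right)\right)\Gamma\left(\delta_{out}+\tfrac ab+1\right)+\sum_{i=0}^1\sum_{j=0}^1\tfrac{C_{ij}}{1-a-b}\Gamma\left(\delta_{in}+\tfrac1a+j\right)\Gamma\left(\delta_{out}+\tfrac ab+1+i\right),$$ $$D_0=\sum_{i=0}^1\sum_{j=0}^1\tfrac{C_{ij}}{b}\Gamma\left(\delta_{out}+\tfrac1b+i\right)\Gamma\left(\delta_{in}+\tfrac1a+j\right),\qquad D_+=\sum_{i=0}^1\sum_{j=0}^1\tfrac{C_{ij}}{a+b-1}\Gamma\left(\delta_{out}+\tfrac1b+i\right)\Gamma\left(\delta_{in}+\tfrac1a+j\right).$$ (5) If $d_1$ and $d_2$ both grow to infinity such that $d_1^{a}/d_2^{b}\to\infty$, then $$c_X(d_1,d_2)\sim\begin{cases}D'_-\,d_1^{-\frac1b}d_2^{-\frac{a+b}a},&a+b<1,\\ D'_0\,d_1^{-\frac1b}d_2^{-\frac1a}\ln d_2,&a+b=1,\\ D_+\,d_1^{-\frac1b}d_2^{-\frac1a},&a+b>1,\end{cases}$$ where $$D'_-=\left(A_0\Gamma\left(\delta_{out}+\tfrac1b\right)+A_1\Gamma\left(\delta_{out}+\tfrac1b+1\right)\right)\Gamma\left(\delta_{in}+\tfrac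 ba+1\right)+\sum_{i=0}^1\sum_{j=0}^1\tfrac{C_{ij}}{1-a-b}\Gamma\left(\delta_{in}+\tfrac ba+1+j\right)\Gamma\left(\delta_{out}+\tfrac1b+i\right),$$ $$D'_0=\sum_{i=0}^1\sum_{j=0}^1\tfrac{C_{ij}}{a}\Gamma\left(\delta_{out}+\tfrac1b+i\right)\Gamma\left(\delta_{in}+\tfrac1a+j\right).$$
   Context: The model $\mathcal G(t)$. Parameters: $\alpha,\beta,\gamma\in[0,1]$ with $\alpha+\beta+\gamma=1$; reals $\delta_{in}\ge0$, $\delta_{out}\ge0$; a fixed finite directed graph $G_0$ (loops and multiple edges allowed) with at least one vertex, and with at least one edge if $\delta_{in}=0$ or $\delta_{out}=0$. Let $t_0$ be the number of edges of $G_0$. At time $t_0$ the random graph is $G_0$. Given the random graph $G$ at time $t\ge t_0$ (it has $t$ edges; let $n$ be its current number of vertices, $d_{in},d_{out}$ its in- and out-degrees), the graph at time $t+1$ is obtained by one of the following, chosen independently of the past: ($\dagger$) with probability $\alpha$, add a new vertex $v$ and an edge from $v$ to an existing vertex $w\in G$ chosen with probability $\frac{d_{in}(w)+\delta_{in}}{t+\delta_{in}n}$; ($\dagger\dagger$) with probability $\beta$, add an edge from $v\in G$ to $w\in G$, where $v$ is chosen with probability $\frac{d_{out}(v)+\delta_{out}}{t+\delta_{out}n}$ and, independently, $w$ with probability $\frac{d_{in}(w)+\delta_{in}}{t+\delta_{in}n}$; ($\ddagger$) with probability $\gamma$, add a new vertex $w$ and an edge to $w$ from an existing vertex $v\in G$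 chosen with probability $\frac{d_{out}(v)+\delta_{out}}{t+\delta_{out}n}$. $\mathcal G(t)$ denotes the random graph at time $t$. Edges are counted with multiplicity in $X$. For $c_1>0$, $c_2>0$, $r>0$, $x\ge0$, $$\kappa(c_1,c_2,r,x)=\int_0^x z^{c_1-1}\,dz\int_0^\infty\tau^{c_1r+c_2-1}e^{-\tau-z\tau^r}\,d\tau,$$ and $\frac{\partial\kappa}{\partial c_2}$ is the partial derivative with respect to the second argument. Conventions: $O_{d_1,d_2}(1)$ is bounded uniformly in $t$ by a constant depending on $d_1,d_2$ and the model parameters (including $G_0$). All other $O(\cdot)$ have implied constants depending only on $\alpha,\beta,\gamma,\delta_{in},\delta_{out}$, uniformly in $d_1,d_2\ge2$; different occurrences of $O(\cdot)$ (including for different summation indices) may stand for different quantities. *)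

theory Defs
  imports
    "HOL-Probability.Probability"
    "HOL-Library.Landau_Symbols"
    "Graph_Theory.Digraph"
begin

text \<open>
  Directed multigraphs are finite \<^locale>\<open>fin_digraph\<close>s (loops and parallel arcs allowed) whose
  vertices and arcs are named by natural numbers, so that fresh names are always available.
\<close>

type_synonym multigraph = "(nat, nat) pre_digraph"

definition fresh :: "nat set \<Rightarrow> nat" where
  "fresh A = (LEAST n. n \<notin> A)"

text \<open>Adds a new arc from \<open>v\<close> to \<open>w\<close>; endpoints that are not yet vertices become vertices.\<close>

definition insert_edge :: "nat \<Rightarrow> nat \<Rightarrow> multigraph \<Rightarrow> multigraph" where
  "insert_edge v w G =
     (let e = fresh (arcs G)
      in pre_digraph.add_arc (G\<lparr>tail := (tail G)(e := v), head := (head G)(e := w)\<rparr>) e)"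

definition initial_graph :: "real \<Rightarrow> real \<Rightarrow> multigraph \<Rightarrow> bool" where
  "initial_graph \<delta>in \<delta>out G \<longleftrightarrow>
     fin_digraph G \<and> verts G \<noteq> {} \<and> (\<delta>in = 0 \<or> \<delta>out = 0 \<longrightarrow> arcs G \<noteq> {})"

text \<open>
  Preferential choice of an existing vertex, with \<open>deg\<close> the in- or the out-degree of \<open>G\<close>.
  The lemmas \<open>pmf_pref_in\<close> and \<open>pmf_pref_out\<close> below show that the weights sum to 1.
\<close>

definition pref_weight :: "(nat \<Rightarrow> nat) \<Rightarrow> real \<Rightarrow> multigraph \<Rightarrow> nat \<Rightarrow> real" where
  "pref_weight deg \<delta> G v =
     (if v \<in> verts G
      then (real (deg v) + \<delta>) / (real (card (arcs G)) + \<delta> * real (card (verts G))) else 0)"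

definition pref_in :: "real \<Rightarrow> multigraph \<Rightarrow> nat pmf" where
  "pref_in \<delta> G = embed_pmf (pref_weight (in_degree G) \<delta> G)"

definition pref_out :: "real \<Rightarrow> multigraph \<Rightarrow> nat pmf" where
  "pref_out \<delta> G = embed_pmf (pref_weight (out_degree G) \<delta> G)"

definition step ::
    "real \<Rightarrow> real \<Rightarrow> real \<Rightarrow> real \<Rightarrow> real \<Rightarrow> multigraph \<Rightarrow> multigraph pmf" where
  "step \<alpha> \<beta> \<gamma> \<delta>in \<delta>out G = join_pmf (pmf_of_list
     [(map_pmf (\<lambda>w. insert_edge (fresh (verts G)) w G) (pref_in \<delta>in G), \<alpha>),
      (map_pmf (\<lambda>(v, w). insert_edge v w G) (pair_pmf (pref_out \<delta>out G) (pref_in \<delta>in G)), \<beta>),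
      (map_pmf (\<lambda>v. insert_edge v (fresh (verts G)) G) (pref_out \<delta>out G), \<gamma>)])"

text \<open>
  The law of the random graph at time \<open>t \<ge> card (arcs G0)\<close>; the process starts from \<open>G0\<close> at time
  \<open>card (arcs G0)\<close>.
\<close>

definition random_graph ::
    "real \<Rightarrow> real \<Rightarrow> real \<Rightarrow> real \<Rightarrow> real \<Rightarrow> multigraph \<Rightarrow> nat \<Rightarrow> multigraph pmf" where
  "random_graph \<alpha> \<beta> \<gamma> \<delta>in \<delta>out G0 t =
     ((\<lambda>M. bind_pmf M (step \<alpha> \<beta> \<gamma> \<delta>in \<delta>out)) ^^ (t - card (arcs G0))) (return_pmf G0)"

definition num_edges :: "nat \<Rightarrow> nat \<Rightarrow> multigraph \<Rightarrow> nat" where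
  "num_edges d1 d2 G = card {e \<in> arcs G.
     out_degree G (tail G e) = d1 \<and> in_degree G (head G e) = d2 \<and> tail G e \<noteq> head G e}"

definition kappa :: "real \<Rightarrow> real \<Rightarrow> real \<Rightarrow> real \<Rightarrow> real" where
  "kappa c1 c2 r x =
     (LBINT z:{0..x}. z powr (c1 - 1) *
        (LBINT \<tau>:{0..}. \<tau> powr (c1 * r + c2 - 1) * exp (- \<tau> - z * \<tau> powr r)))"

definition kappa_c2 :: "real \<Rightarrow> real \<Rightarrow> real \<Rightarrow> real \<Rightarrow> real" where
  "kappa_c2 c1 c2 r x = deriv (\<lambda>c. kappa c1 c r x) c2"

text \<open>For the principal filter, \<open>O[degs](g)\<close> is a bound that is uniform over all \<open>d1, d2 \<ge> 2\<close>.\<close>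

abbreviation degs :: "(nat \<times> nat) filter" where
  "degs \<equiv> principal ({2..} \<times> {2..})"


subsection \<open>The transition probabilities are well defined\<close>

lemma fresh_notin: "finite A \<Longrightarrow> fresh A \<notin> A"
  unfolding fresh_def by (rule LeastI_ex) (rule ex_new_if_finite[OF infinite_UNIV_nat])

lemma (in fin_digraph) sum_in_degree: "(\<Sum>v\<in>verts G. in_degree G v) = card (arcs G)"
proof -
  have "arcs G = (\<Union>v\<in>verts G. in_arcs G v)" by (auto simp: in_arcs_def)
  also have "card \<dots> = (\<Sum>v\<in>verts G. card (in_arcs G v))"
    by (rule card_UN_disjoint) (auto simp: in_arcs_def)
  finally show ?thesis by (simp add: in_degree_def)
qed

lemma (in fin_digraph) sum_out_degree: "(\<Sum>v\<in>verts G. out_degree G v) = card (arcs G)"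
proof -
  have "arcs G = (\<Union>v\<in>verts G. out_arcs G v)" by (auto simp: out_arcs_def)
  also have "card \<dots> = (\<Sum>v\<in>verts G. card (out_arcs G v))"
    by (rule card_UN_disjoint) (auto simp: out_arcs_def)
  finally show ?thesis by (simp add: out_degree_def)
qed

lemma pmf_pref_weight:
  assumes "fin_digraph G" "verts G \<noteq> {}" "\<delta> \<ge> 0" "\<delta> = 0 \<longrightarrow> arcs G \<noteq> {}"
    and deg: "(\<Sum>v\<in>verts G. deg v) = card (arcs G)"
  shows "pmf (embed_pmf (pref_weight deg \<delta> G)) v = pref_weight deg \<delta> G v"
proof (rule pmf_embed_pmf)
  interpret fin_digraph G by fact
  let ?N = "real (card (arcs G)) + \<delta> * real (card (verts G))"
  have N: "?N > 0"
  proof (cases "\<delta> = 0")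
    case False
    with assms(2,3) have "0 < \<delta> * real (card (verts G))" by (simp add: card_gt_0_iff)
    then show ?thesis by linarith
  qed (use assms(4) in \<open>simp add: card_gt_0_iff\<close>)
  show nn: "0 \<le> pref_weight deg \<delta> G x" for x
    using N assms(3) by (auto simp: pref_weight_def)
  have "(\<integral>\<^sup>+x. ennreal (pref_weight deg \<delta> G x) \<partial>count_space UNIV)
      = (\<Sum>x\<in>verts G. ennreal (pref_weight deg \<delta> G x))"
    by (rule nn_integral_count_space') (auto simp: pref_weight_def)
  also have "\<dots> = ennreal (\<Sum>x\<in>verts G. pref_weight deg \<delta> G x)"
    using nn by (simp add: sum_ennreal)
  also have "(\<Sum>x\<in>verts G. pref_weight deg \<delta> G x) = (\<Sum>x\<in>verts G. real (deg x) + \<delta>) / ?N"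
    by (simp add: pref_weight_def sum_divide_distrib)
  also have "(\<Sum>x\<in>verts G. real (deg x) + \<delta>) = ?N"
    using deg by (simp add: sum.distrib flip: of_nat_sum)
  finally show "(\<integral>\<^sup>+x. ennreal (pref_weight deg \<delta> G x) \<partial>count_space UNIV) = 1"
    using N by simp
qed

lemma pmf_pref_in:
  assumes "initial_graph \<delta>in \<delta>out G" "\<delta>in \<ge> 0"
  shows "pmf (pref_in \<delta>in G) v = pref_weight (in_degree G) \<delta>in G v"
  using assms unfolding pref_in_def initial_graph_def
  by (intro pmf_pref_weight) (auto simp: fin_digraph.sum_in_degree)

lemma pmf_pref_out:
  assumes "initial_graph \<delta>in \<delta>out G" "\<delta>out \<ge> 0"
  shows "pmf (pref_out \<delta>out G) v = pref_weight (out_degree G) \<delta>out G v"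
  using assms unfolding pref_out_def initial_graph_def
  by (intro pmf_pref_weight) (auto simp: fin_digraph.sum_out_degree)

lemma insert_edge_simps:
  "verts (insert_edge v w G) = insert v (insert w (verts G))"
  "arcs (insert_edge v w G) = insert (fresh (arcs G)) (arcs G)"
  "tail (insert_edge v w G) = (tail G)(fresh (arcs G) := v)"
  "head (insert_edge v w G) = (head G)(fresh (arcs G) := w)"
  by (auto simp: insert_edge_def Let_def pre_digraph.add_arc_def)

lemma initial_graph_insert_edge:
  assumes "initial_graph \<delta>in \<delta>out G"
  shows "initial_graph \<delta>in \<delta>out (insert_edge v w G) \<and>
    card (arcs (insert_edge v w G)) = Suc (card (arcs G))"
proof -
  interpret fin_digraph G using assms by (simp add: initial_graph_def)
  have "fin_digraph (insert_edge v w G)"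
    by unfold_locales (auto simp: insert_edge_simps)
  with fresh_notin[OF finite_arcs] show ?thesis
    by (simp add: initial_graph_def insert_edge_simps)
qed

lemma set_pmf_step:
  assumes "\<alpha> \<ge> 0" "\<beta> \<ge> 0" "\<gamma> \<ge> 0" "\<alpha> + \<beta> + \<gamma> = 1" "H \<in> set_pmf (step \<alpha> \<beta> \<gamma> \<delta>in \<delta>out G)"
  shows "\<exists>v w. H = insert_edge v w G"
proof -
  have wf: "pmf_of_list_wf [(p, \<alpha>), (q, \<beta>), (r, \<gamma>)]" for p q r :: "multigraph pmf"
    using assms(1-4) by (intro pmf_of_list_wfI) auto
  show ?thesis
    using assms(5) set_pmf_of_list[OF wf] unfolding step_def by fastforce
qed

lemma random_graph_invariant:
  assumes "\<alpha> \<ge> 0" "\<beta> \<ge> 0" "\<gamma> \<ge> 0" "\<alpha> + \<beta> + \<gamma> = 1"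
    and "initial_graph \<delta>in \<delta>out G0" "t \<ge> card (arcs G0)"
    and "G \<in> set_pmf (random_graph \<alpha> \<beta> \<gamma> \<delta>in \<delta>out G0 t)"
  shows "initial_graph \<delta>in \<delta>out G \<and> card (arcs G) = t"
proof -
  let ?M = "\<lambda>k. ((\<lambda>M. bind_pmf M (step \<alpha> \<beta> \<gamma> \<delta>in \<delta>out)) ^^ k) (return_pmf G0)"
  have "initial_graph \<delta>in \<delta>out G \<and> card (arcs G) = card (arcs G0) + k"
    if "G \<in> set_pmf (?M k)" for k G
    using that
  proof (induction k arbitrary: G)
    case (Suc k)
    then obtain H where H: "H \<in> set_pmf (?M k)" "G \<in> set_pmf (step \<alpha> \<beta> \<gamma> \<delta>in \<delta>out H)"
      by auto
    from set_pmf_step[OF assms(1-4) H(2)] obtain v w where "G = insert_edge v w H" by blast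
    with Suc.IH[OF H(1)] show ?case by (simp add: initial_graph_insert_edge[of \<delta>in \<delta>out])
  qed (use assms(5) in simp)
  from this[of G "t - card (arcs G0)"] assms(6,7) show ?thesis
    by (simp add: random_graph_def)
qed

end

theory Submission
  imports Defs
begin

text \<open>
  Call a statistic of the graph at time \<open>t\<close>, divided by \<open>t\<close>, concentrated at \<open>c\<close> if its mean is
  \<open>c + O(1/t)\<close> and its variance is \<open>O(1/t)\<close>. Products and reciprocals of concentrated statistics
  are concentrated, and so is every statistic whose expected increment is a concentrated quantity
  minus a concentrated multiple of the statistic divided by \<open>t\<close>. This applies in turn to the numbers
  of vertices, of vertices of given out- or in-degree, and of edges with given end degrees; the
  limit \<open>c\<^sub>X\<close> of the last is the solution of a linear recurrence in \<open>d\<^sub>1, d\<^sub>2\<close>.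

  The recurrence is solved by integrals over the relative arrival time \<open>u\<close> of an edge: vertex degrees
  grow like Yule processes, so an edge contributes a product of two negative binomial weights in
  \<open>u\<close>, each weight either evaluated at the birth of a vertex together with the edge (a density) or
  integrated over earlier births (its primitive). Edges of the first two kinds give the integrals \<open>J\<close>
  of a primitive times a density, and these are \<open>c\<^sub>X\<^sub>1\<close> and \<open>c\<^sub>X\<^sub>2\<close>. Edges between old vertices give
  the integrals \<open>H\<close> of two primitives, and integration by parts reduces \<open>H\<close> to \<open>J\<close>; at \<open>a + b = 1\<close> the
  primitive of \<open>1/u\<close> appears instead, hence the logarithms.

  After rescaling, \<open>J\<close> is the double integral \<open>\<kappa>\<close> with binomial kernels \<open>(1 - \<tau>/d)\<^sup>d\<close> in place of
  exponentials. Comparing the kernels pointwise gives a relative error \<open>O(1/d\<^sub>1 + 1/d\<^sub>2)\<close>, uniformly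
  in the upper limit of the integral. As that limit tends to infinity, \<open>\<kappa>\<close> tends to a product
  of two Gamma values, and as it tends to 0, \<open>\<kappa>\<close> is negligible.
\<close>

subsection \<open>Concentration along a Markov chain\<close>

text \<open>The number \<open>n\<close> of vertices is random, hence so are the denominators
  \<open>t + \<delta> n\<close>, and an edge between two old vertices brings in the product of an
  out-degree count and an in-degree count. The means alone therefore satisfy no closed recurrence,
  while the claimed error O(1) leaves room only for a bias O(1/t) of such quotients and products;
  this is why a variance bound is carried along. The indices \<open>i\<close>, \<open>j\<close> in
  {0, 1} are the possible degrees of an old endpoint at its birth: a new vertex has out-degree 1 and
  in-degree 0 or the reverse, and linearity of the recurrence superposes the cases. In
  \<open>cX1\<close> and \<open>cX2\<close> the error is relative to kappa, which itself tends to 0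
  with its last argument \<open>x\<close>. The kernel errors carry factors \<tau> and \<tau>^2,
  which amount to kappa with a larger second argument, so kappa at c + 1 has to be bounded by kappa
  at c uniformly in \<open>x\<close>. For a + b = 1 the factor ln d - ln \<tau> changes sign, and
  the error is absolute.\<close>

lemma pmf_integral_mono:
  fixes f g :: "'a \<Rightarrow> real"
  assumes "finite (set_pmf p)" "\<And>x. x \<in> set_pmf p \<Longrightarrow> f x \<le> g x"
  shows "measure_pmf.expectation p f \<le> measure_pmf.expectation p g"
  using assms by (intro integral_mono_AE integrable_measure_pmf_finite) (auto simp: AE_measure_pmf_iff)

lemma pmf_integral_cong:
  fixes f g :: "'a \<Rightarrow> real"
  assumes "\<And>x. x \<in> set_pmf p \<Longrightarrow> f x = g x"
  shows "measure_pmf.expectation p f = measure_pmf.expectation p g"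
  using assms by (intro integral_cong_AE) (auto simp: AE_measure_pmf_iff)

text \<open>All laws that occur have finite support, which makes every real function integrable; the
  tower property then holds without any condition on \<open>h\<close>.\<close>

lemma pmf_integral_bind:
  fixes h :: "'b \<Rightarrow> real"
  assumes "finite (set_pmf p)" "\<And>x. x \<in> set_pmf p \<Longrightarrow> finite (set_pmf (f x))"
  shows "measure_pmf.expectation (bind_pmf p f) h
    = measure_pmf.expectation p (\<lambda>x. measure_pmf.expectation (f x) h)"
  by (subst pmf_expectation_bind[of "set_pmf p"], use assms in simp_all)
     (subst integral_measure_pmf[of "set_pmf p"], use assms in simp_all)

lemma pmf_integral_bound:
  fixes f :: "'a \<Rightarrow> real"
  assumes "finite (set_pmf p)" "\<And>x. x \<in> set_pmf p \<Longrightarrow> \<bar>f x\<bar> \<le> K"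
  shows "\<bar>measure_pmf.expectation p f\<bar> \<le> K"
proof -
  have "measure_pmf.expectation p f \<le> measure_pmf.expectation p (\<lambda>_. K)"
    using assms by (intro pmf_integral_mono) (auto simp: abs_le_iff)
  moreover have "measure_pmf.expectation p (\<lambda>_. - K) \<le> measure_pmf.expectation p f"
    using assms by (intro pmf_integral_mono) (auto simp: abs_le_iff minus_le_iff)
  ultimately show ?thesis by simp
qed

lemma sum_squares_bound_diff: "((x::real) - y)\<^sup>2 \<le> 2 * x\<^sup>2 + 2 * y\<^sup>2"
proof -
  have "0 \<le> (x + y)\<^sup>2" by simp
  then show ?thesis by (simp add: power2_eq_square algebra_simps)
qed

text \<open>The transition \<open>S\<close> may be independent of time because the graph process
  reads the time off the number of edges. Starting at \<open>T\<close> \<ge> 1 makes division by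
  \<open>t\<close> harmless.\<close>

locale finite_markov_chain =
  fixes M :: "nat \<Rightarrow> 'g pmf" and S :: "'g \<Rightarrow> 'g pmf" and T :: nat
  assumes finite_M: "t \<ge> T \<Longrightarrow> finite (set_pmf (M t))"
    and finite_S: "t \<ge> T \<Longrightarrow> G \<in> set_pmf (M t) \<Longrightarrow> finite (set_pmf (S G))"
    and M_Suc: "t \<ge> T \<Longrightarrow> M (Suc t) = bind_pmf (M t) S"
    and T_pos: "T \<ge> 1"
begin

abbreviation E :: "nat \<Rightarrow> ('g \<Rightarrow> real) \<Rightarrow> real" where
  "E t f \<equiv> measure_pmf.expectation (M t) f"

lemma integrable_M: "t \<ge> T \<Longrightarrow> integrable (measure_pmf (M t)) (f :: 'g \<Rightarrow> real)"
  by (intro integrable_measure_pmf_finite finite_M)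

lemma E_add: "t \<ge> T \<Longrightarrow> E t (\<lambda>G. f G + g G) = E t f + E t g"
  and E_diff: "t \<ge> T \<Longrightarrow> E t (\<lambda>G. f G - g G) = E t f - E t g"
  by (simp_all add: integrable_M)

lemma E_cmult: "E t (\<lambda>G. c * f G) = c * E t f"
  by simp

lemma E_mono: "t \<ge> T \<Longrightarrow> (\<And>G. G \<in> set_pmf (M t) \<Longrightarrow> f G \<le> g G) \<Longrightarrow> E t f \<le> E t g"
  by (intro pmf_integral_mono finite_M)

lemma E_Suc: "t \<ge> T \<Longrightarrow> E (Suc t) f = E t (\<lambda>G. measure_pmf.expectation (S G) f)"
  by (simp add: M_Suc pmf_integral_bind finite_M finite_S)

text \<open>Law of large numbers with fluctuations of order \<open>t\<^sup>-\<^sup>1\<^sup>/\<^sup>2\<close> but bias of order \<open>1/t\<close>. Unlike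
  a bound on the bias alone, this is preserved by products and reciprocals.\<close>

definition conc :: "(nat \<Rightarrow> 'g \<Rightarrow> real) \<Rightarrow> real \<Rightarrow> bool" where
  "conc f c \<longleftrightarrow> (\<exists>K. \<forall>t\<ge>T. (\<forall>G\<in>set_pmf (M t). \<bar>f t G\<bar> \<le> K) \<and>
     E t (\<lambda>G. (f t G - c)\<^sup>2) \<le> K / real t \<and> \<bar>E t (f t) - c\<bar> \<le> K / real t)"

lemma real_pos: "t \<ge> T \<Longrightarrow> real t > 0"
  using T_pos by simp

lemma concE:
  assumes "conc f c"
  obtains K where "K > 0" "\<And>t G. t \<ge> T \<Longrightarrow> G \<in> set_pmf (M t) \<Longrightarrow> \<bar>f t G\<bar> \<le> K"
    "\<And>t. t \<ge> T \<Longrightarrow> E t (\<lambda>G. (f t G - c)\<^sup>2) \<le> K / real t"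
    "\<And>t. t \<ge> T \<Longrightarrow> \<bar>E t (f t) - c\<bar> \<le> K / real t"
proof -
  from assms obtain K where K: "\<forall>t\<ge>T. (\<forall>G\<in>set_pmf (M t). \<bar>f t G\<bar> \<le> K) \<and>
     E t (\<lambda>G. (f t G - c)\<^sup>2) \<le> K / real t \<and> \<bar>E t (f t) - c\<bar> \<le> K / real t"
    unfolding conc_def by blast
  have le: "K / real t \<le> (\<bar>K\<bar> + 1) / real t" for t
    by (intro divide_right_mono) auto
  show ?thesis
  proof (rule that[of "\<bar>K\<bar> + 1"])
    fix t G assume "t \<ge> T" "G \<in> set_pmf (M t)"
    then have "\<bar>f t G\<bar> \<le> K" using K by blast
    then show "\<bar>f t G\<bar> \<le> \<bar>K\<bar> + 1" by linarith
  qed (use K le order_trans in \<open>force+\<close>)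
qed

lemma concI:
  assumes "\<And>t G. t \<ge> T \<Longrightarrow> G \<in> set_pmf (M t) \<Longrightarrow> \<bar>f t G\<bar> \<le> K1"
    "\<And>t. t \<ge> T \<Longrightarrow> E t (\<lambda>G. (f t G - c)\<^sup>2) \<le> K2 / real t"
    "\<And>t. t \<ge> T \<Longrightarrow> \<bar>E t (f t) - c\<bar> \<le> K3 / real t"
  shows "conc f c"
proof -
  let ?K = "max K1 (max K2 K3)"
  have "K2 / real t \<le> ?K / real t" "K3 / real t \<le> ?K / real t" for t
    by (intro divide_right_mono; simp)+
  then show ?thesis
    unfolding conc_def using assms by (intro exI[of _ ?K]) (fastforce intro: order_trans)
qed

lemma conc_const: "conc (\<lambda>_ _. c) c"
  by (rule concI[of _ "\<bar>c\<bar>" _ 0 0]) auto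

text \<open>Deterministic remainders of size O(1/t) enter the calculus here. Their second moment is
  even O(1/t^2), and t \<ge> 1 turns this into O(1/t).\<close>

lemma conc_small:
  assumes "\<And>t G. t \<ge> T \<Longrightarrow> G \<in> set_pmf (M t) \<Longrightarrow> \<bar>f t G - c\<bar> \<le> K / real t"
  shows "conc f c"
proof (rule concI[of _ "\<bar>c\<bar> + K" _ "K * K" K])
  fix t assume t: "t \<ge> T"
  then have t1: "real t \<ge> 1" using T_pos by simp
  from set_pmf_not_empty[of "M t"] obtain G0 where G0: "G0 \<in> set_pmf (M t)" by blast
  have "0 \<le> K / real t" using assms[OF t G0] by linarith
  then have K: "K \<ge> 0" using t1 by (simp add: zero_le_divide_iff)
  then have Kt: "K / real t \<le> K" using t1 by (simp add: divide_le_eq mult_left_mono[of 1 "real t" K, simplified])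
  show "\<bar>f t G\<bar> \<le> \<bar>c\<bar> + K" if "G \<in> set_pmf (M t)" for G
    using assms[OF t that] Kt by linarith
  have "E t (\<lambda>G. (f t G - c)\<^sup>2) \<le> E t (\<lambda>G. K * K / real t)"
  proof (rule E_mono[OF t])
    fix G assume "G \<in> set_pmf (M t)"
    then have "\<bar>f t G - c\<bar> \<le> K / real t" using assms t by blast
    then have "(f t G - c)\<^sup>2 \<le> (K / real t) * (K / real t)"
      by (metis abs_ge_zero abs_mult_self mult_mono' power2_eq_square)
    also have "\<dots> \<le> K * (K / real t)"
      using Kt K t1 by (intro mult_right_mono) auto
    finally show "(f t G - c)\<^sup>2 \<le> K * K / real t" by simp
  qed
  then show "E t (\<lambda>G. (f t G - c)\<^sup>2) \<le> K * K / real t" by simp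
  have "\<bar>E t (\<lambda>G. f t G - c)\<bar> \<le> K / real t"
    using assms t by (intro pmf_integral_bound finite_M) auto
  then show "\<bar>E t (f t) - c\<bar> \<le> K / real t" using t by (simp add: integrable_M)
qed

lemma conc_add:
  assumes "conc f c" "conc g d"
  shows "conc (\<lambda>t G. f t G + g t G) (c + d)"
proof -
  obtain K where K: "K > 0" "\<And>t G. t \<ge> T \<Longrightarrow> G \<in> set_pmf (M t) \<Longrightarrow> \<bar>f t G\<bar> \<le> K"
    "\<And>t. t \<ge> T \<Longrightarrow> E t (\<lambda>G. (f t G - c)\<^sup>2) \<le> K / real t"
    "\<And>t. t \<ge> T \<Longrightarrow> \<bar>E t (f t) - c\<bar> \<le> K / real t" using concE[OF assms(1)] by metis
  obtain L where L: "L > 0" "\<And>t G. t \<ge> T \<Longrightarrow> G \<in> set_pmf (M t) \<Longrightarrow> \<bar>g t G\<bar> \<le> L"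
    "\<And>t. t \<ge> T \<Longrightarrow> E t (\<lambda>G. (g t G - d)\<^sup>2) \<le> L / real t"
    "\<And>t. t \<ge> T \<Longrightarrow> \<bar>E t (g t) - d\<bar> \<le> L / real t" using concE[OF assms(2)] by metis
  show ?thesis
  proof (rule concI[of _ "K + L" _ "2 * (K + L)" "K + L"])
    fix t assume t: "t \<ge> T"
    show "\<bar>f t G + g t G\<bar> \<le> K + L" if "G \<in> set_pmf (M t)" for G
      using K(2)[OF t that] L(2)[OF t that] by linarith
    have "E t (\<lambda>G. (f t G + g t G - (c + d))\<^sup>2) \<le> E t (\<lambda>G. 2 * (f t G - c)\<^sup>2 + 2 * (g t G - d)\<^sup>2)"
    proof (rule E_mono[OF t])
      fix G
      have "0 \<le> ((f t G - c) - (g t G - d))\<^sup>2" by simp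
      then show "(f t G + g t G - (c + d))\<^sup>2 \<le> 2 * (f t G - c)\<^sup>2 + 2 * (g t G - d)\<^sup>2"
        by (simp add: power2_eq_square algebra_simps)
    qed
    also have "\<dots> = 2 * E t (\<lambda>G. (f t G - c)\<^sup>2) + 2 * E t (\<lambda>G. (g t G - d)\<^sup>2)"
      using t by (simp add: E_add integrable_M)
    also have "\<dots> \<le> 2 * (K / real t) + 2 * (L / real t)"
      using K(3)[OF t] L(3)[OF t] by linarith
    finally show "E t (\<lambda>G. (f t G + g t G - (c + d))\<^sup>2) \<le> 2 * (K + L) / real t"
      by (simp add: add_divide_distrib algebra_simps)
    show "\<bar>E t (\<lambda>G. f t G + g t G) - (c + d)\<bar> \<le> (K + L) / real t"
      using K(4)[OF t] L(4)[OF t] t by (simp add: E_add add_divide_distrib)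
  qed
qed

text \<open>Since both fluctuations have order \<open>t\<^sup>-\<^sup>1\<^sup>/\<^sup>2\<close>, their correlation only contributes \<open>1/t\<close>.\<close>

lemma E_prod_bound:
  assumes t: "t \<ge> T" and "E t (\<lambda>G. (f G)\<^sup>2) \<le> K / real t" "E t (\<lambda>G. (g G)\<^sup>2) \<le> L / real t"
  shows "\<bar>E t (\<lambda>G. f G * g G)\<bar> \<le> (K + L) / real t"
proof -
  have "\<bar>E t (\<lambda>G. f G * g G)\<bar> \<le> E t (\<lambda>G. \<bar>f G * g G\<bar>)"
    by (rule integral_abs_bound)
  also have "\<dots> \<le> E t (\<lambda>G. (f G)\<^sup>2 + (g G)\<^sup>2)"
  proof (rule E_mono[OF t])
    fix G
    have "0 \<le> (\<bar>f G\<bar> - \<bar>g G\<bar>)\<^sup>2" by simp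
    then have "2 * (\<bar>f G\<bar> * \<bar>g G\<bar>) \<le> (f G)\<^sup>2 + (g G)\<^sup>2"
      by (simp add: power2_eq_square algebra_simps)
    moreover have "0 \<le> \<bar>f G\<bar> * \<bar>g G\<bar>" by simp
    ultimately show "\<bar>f G * g G\<bar> \<le> (f G)\<^sup>2 + (g G)\<^sup>2" unfolding abs_mult by linarith
  qed
  also have "\<dots> = E t (\<lambda>G. (f G)\<^sup>2) + E t (\<lambda>G. (g G)\<^sup>2)" using t by (rule E_add)
  also have "\<dots> \<le> (K + L) / real t" using assms(2,3) by (simp add: add_divide_distrib)
  finally show ?thesis .
qed

text \<open>For the variance, f g - c d = g (f - c) + c (g - d) with \<open>g\<close> bounded. For
  the bias, f g - c d = (f - c) (g - d) + c (g - d) + d (f - c), where the correlation term is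
  O(1/t) by \<open>E_prod_bound\<close> and the other two are biases.\<close>

lemma conc_mult:
  assumes "conc f c" "conc g d"
  shows "conc (\<lambda>t G. f t G * g t G) (c * d)"
proof -
  obtain K where K: "K > 0" "\<And>t G. t \<ge> T \<Longrightarrow> G \<in> set_pmf (M t) \<Longrightarrow> \<bar>f t G\<bar> \<le> K"
    "\<And>t. t \<ge> T \<Longrightarrow> E t (\<lambda>G. (f t G - c)\<^sup>2) \<le> K / real t"
    "\<And>t. t \<ge> T \<Longrightarrow> \<bar>E t (f t) - c\<bar> \<le> K / real t" using concE[OF assms(1)] by metis
  obtain L where L: "L > 0" "\<And>t G. t \<ge> T \<Longrightarrow> G \<in> set_pmf (M t) \<Longrightarrow> \<bar>g t G\<bar> \<le> L"
    "\<And>t. t \<ge> T \<Longrightarrow> E t (\<lambda>G. (g t G - d)\<^sup>2) \<le> L / real t"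
    "\<And>t. t \<ge> T \<Longrightarrow> \<bar>E t (g t) - d\<bar> \<le> L / real t" using concE[OF assms(2)] by metis
  show ?thesis
  proof (rule concI[of _ "K * L" _ "2 * L\<^sup>2 * K + 2 * c\<^sup>2 * L" "K + L + \<bar>c\<bar> * L + \<bar>d\<bar> * K"])
    fix t assume t: "t \<ge> T"
    show "\<bar>f t G * g t G\<bar> \<le> K * L" if "G \<in> set_pmf (M t)" for G
      using K(2)[OF t that] L(2)[OF t that] by (simp add: abs_mult mult_mono')
    have "E t (\<lambda>G. (f t G * g t G - c * d)\<^sup>2)
        \<le> E t (\<lambda>G. 2 * L\<^sup>2 * (f t G - c)\<^sup>2 + 2 * c\<^sup>2 * (g t G - d)\<^sup>2)"
    proof (rule E_mono[OF t])
      fix G assume G: "G \<in> set_pmf (M t)"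
      have "(g t G)\<^sup>2 \<le> L\<^sup>2" using L(2)[OF t G] by (rule abs_le_square_iff[THEN iffD1, OF order_trans]) simp
      then have 1: "(g t G)\<^sup>2 * (f t G - c)\<^sup>2 \<le> L\<^sup>2 * (f t G - c)\<^sup>2" by (intro mult_right_mono) auto
      have "0 \<le> (g t G * (f t G - c) - c * (g t G - d))\<^sup>2" by simp
      then have "(f t G * g t G - c * d)\<^sup>2 \<le> 2 * ((g t G)\<^sup>2 * (f t G - c)\<^sup>2) + 2 * c\<^sup>2 * (g t G - d)\<^sup>2"
        by (simp add: power2_eq_square algebra_simps)
      then show "(f t G * g t G - c * d)\<^sup>2 \<le> 2 * L\<^sup>2 * (f t G - c)\<^sup>2 + 2 * c\<^sup>2 * (g t G - d)\<^sup>2"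
        using 1 by linarith
    qed
    also have "\<dots> = 2 * L\<^sup>2 * E t (\<lambda>G. (f t G - c)\<^sup>2) + 2 * c\<^sup>2 * E t (\<lambda>G. (g t G - d)\<^sup>2)"
      using t by (simp add: E_add integrable_M)
    also have "\<dots> \<le> 2 * L\<^sup>2 * (K / real t) + 2 * c\<^sup>2 * (L / real t)"
      using K(3)[OF t] L(3)[OF t] by (intro add_mono mult_left_mono) auto
    finally show "E t (\<lambda>G. (f t G * g t G - c * d)\<^sup>2) \<le> (2 * L\<^sup>2 * K + 2 * c\<^sup>2 * L) / real t"
      by (simp add: add_divide_distrib)
    have "E t (\<lambda>G. f t G * g t G)
        = E t (\<lambda>G. ((f t G - c) * (g t G - d) + (c * g t G + d * f t G)) - c * d)"
      by (intro pmf_integral_cong) (simp add: algebra_simps)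
    also have "\<dots> = E t (\<lambda>G. (f t G - c) * (g t G - d)) + (c * E t (g t) + d * E t (f t)) - c * d"
      using t by (simp only: E_add E_diff E_cmult) simp
    finally have eq: "E t (\<lambda>G. f t G * g t G) - c * d
        = E t (\<lambda>G. (f t G - c) * (g t G - d)) + c * (E t (g t) - d) + d * (E t (f t) - c)"
      by (simp add: algebra_simps)
    have "\<bar>E t (\<lambda>G. (f t G - c) * (g t G - d))\<bar> \<le> (K + L) / real t"
      using E_prod_bound[OF t K(3)[OF t] L(3)[OF t]] .
    moreover have "\<bar>c * (E t (g t) - d)\<bar> \<le> \<bar>c\<bar> * (L / real t)" "\<bar>d * (E t (f t) - c)\<bar> \<le> \<bar>d\<bar> * (K / real t)"
      using K(4)[OF t] L(4)[OF t] unfolding abs_mult by (intro mult_left_mono; simp)+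
    ultimately show "\<bar>E t (\<lambda>G. f t G * g t G) - c * d\<bar> \<le> (K + L + \<bar>c\<bar> * L + \<bar>d\<bar> * K) / real t"
      unfolding eq by (simp add: add_divide_distrib)
  qed
qed

lemma conc_cmult: "conc f c \<Longrightarrow> conc (\<lambda>t G. r * f t G) (r * c)"
  using conc_mult[OF conc_const] .

text \<open>The expansion 1/f = 1/c - (f - c)/c^2 + (f - c)^2/(c^2 f) is exact. The linear term
  contributes the bias of \<open>f\<close>, the remainder at most its second moment around
  \<open>c\<close> divided by c^2 \<epsilon>.\<close>

lemma conc_inverse:
  assumes "conc f c" "c \<noteq> 0" "\<epsilon> > 0"
    and f_ge: "\<And>t G. t \<ge> T \<Longrightarrow> G \<in> set_pmf (M t) \<Longrightarrow> \<epsilon> \<le> f t G"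
  shows "conc (\<lambda>t G. 1 / f t G) (1 / c)"
proof -
  obtain K where K: "K > 0" "\<And>t G. t \<ge> T \<Longrightarrow> G \<in> set_pmf (M t) \<Longrightarrow> \<bar>f t G\<bar> \<le> K"
    "\<And>t. t \<ge> T \<Longrightarrow> E t (\<lambda>G. (f t G - c)\<^sup>2) \<le> K / real t"
    "\<And>t. t \<ge> T \<Longrightarrow> \<bar>E t (f t) - c\<bar> \<le> K / real t" using concE[OF assms(1)] by metis
  show ?thesis
  proof (rule concI[of _ "1 / \<epsilon>" _ "1 / (\<epsilon>\<^sup>2 * c\<^sup>2) * K" "1 / c\<^sup>2 * K + 1 / (c\<^sup>2 * \<epsilon>) * K"])
    fix t assume t: "t \<ge> T"
    show "\<bar>1 / f t G\<bar> \<le> 1 / \<epsilon>" if "G \<in> set_pmf (M t)" for G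
      using f_ge[OF t that] \<open>\<epsilon> > 0\<close> by (simp add: frac_le)
    have "E t (\<lambda>G. (1 / f t G - 1 / c)\<^sup>2) \<le> E t (\<lambda>G. 1 / (\<epsilon>\<^sup>2 * c\<^sup>2) * (f t G - c)\<^sup>2)"
    proof (rule E_mono[OF t])
      fix G assume G: "G \<in> set_pmf (M t)"
      note f = f_ge[OF t G]
      have "(1 / f t G - 1 / c)\<^sup>2 = (f t G - c)\<^sup>2 / ((f t G)\<^sup>2 * c\<^sup>2)"
        using f \<open>\<epsilon> > 0\<close> \<open>c \<noteq> 0\<close> by (simp add: diff_frac_eq power_divide power_mult_distrib power2_commute)
      also have "\<dots> \<le> (f t G - c)\<^sup>2 / (\<epsilon>\<^sup>2 * c\<^sup>2)"
        using f \<open>\<epsilon> > 0\<close> \<open>c \<noteq> 0\<close> by (intro divide_left_mono mult_right_mono power_mono mult_pos_pos) auto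
      finally show "(1 / f t G - 1 / c)\<^sup>2 \<le> 1 / (\<epsilon>\<^sup>2 * c\<^sup>2) * (f t G - c)\<^sup>2" by simp
    qed
    also have "\<dots> = 1 / (\<epsilon>\<^sup>2 * c\<^sup>2) * E t (\<lambda>G. (f t G - c)\<^sup>2)" by simp
    also have "\<dots> \<le> 1 / (\<epsilon>\<^sup>2 * c\<^sup>2) * (K / real t)"
      using K(3)[OF t] by (intro mult_left_mono) auto
    finally show "E t (\<lambda>G. (1 / f t G - 1 / c)\<^sup>2) \<le> 1 / (\<epsilon>\<^sup>2 * c\<^sup>2) * K / real t" by simp
    have "E t (\<lambda>G. 1 / f t G) = E t (\<lambda>G. (1 / c - 1 / c\<^sup>2 * (f t G - c)) + (f t G - c)\<^sup>2 / (c\<^sup>2 * f t G))"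
    proof (rule pmf_integral_cong)
      fix G assume G: "G \<in> set_pmf (M t)"
      have "f t G \<noteq> 0" using f_ge[OF t G] \<open>\<epsilon> > 0\<close> by auto
      then show "1 / f t G = (1 / c - 1 / c\<^sup>2 * (f t G - c)) + (f t G - c)\<^sup>2 / (c\<^sup>2 * f t G)"
        using \<open>c \<noteq> 0\<close> by (simp add: field_simps power2_eq_square)
    qed
    also have "\<dots> = (1 / c - 1 / c\<^sup>2 * (E t (f t) - c)) + E t (\<lambda>G. (f t G - c)\<^sup>2 / (c\<^sup>2 * f t G))"
      using t by (subst E_add[OF t], subst E_diff[OF t], subst E_cmult, subst E_diff[OF t]) simp
    finally have eq: "E t (\<lambda>G. 1 / f t G) - 1 / c
      = - (1 / c\<^sup>2 * (E t (f t) - c)) + E t (\<lambda>G. (f t G - c)\<^sup>2 / (c\<^sup>2 * f t G))" by simp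
    have "\<bar>E t (\<lambda>G. (f t G - c)\<^sup>2 / (c\<^sup>2 * f t G))\<bar> \<le> E t (\<lambda>G. \<bar>(f t G - c)\<^sup>2 / (c\<^sup>2 * f t G)\<bar>)"
      by (rule integral_abs_bound)
    also have "\<dots> \<le> E t (\<lambda>G. 1 / (c\<^sup>2 * \<epsilon>) * (f t G - c)\<^sup>2)"
    proof (rule E_mono[OF t])
      fix G assume G: "G \<in> set_pmf (M t)"
      note f = f_ge[OF t G]
      have "\<bar>(f t G - c)\<^sup>2 / (c\<^sup>2 * f t G)\<bar> = (f t G - c)\<^sup>2 / (c\<^sup>2 * f t G)"
        using f \<open>\<epsilon> > 0\<close> by simp
      also have "\<dots> \<le> (f t G - c)\<^sup>2 / (c\<^sup>2 * \<epsilon>)"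
        using f \<open>\<epsilon> > 0\<close> \<open>c \<noteq> 0\<close> by (intro divide_left_mono mult_left_mono mult_pos_pos) auto
      finally show "\<bar>(f t G - c)\<^sup>2 / (c\<^sup>2 * f t G)\<bar> \<le> 1 / (c\<^sup>2 * \<epsilon>) * (f t G - c)\<^sup>2" by simp
    qed
    also have "\<dots> = 1 / (c\<^sup>2 * \<epsilon>) * E t (\<lambda>G. (f t G - c)\<^sup>2)" by simp
    also have "\<dots> \<le> 1 / (c\<^sup>2 * \<epsilon>) * (K / real t)"
      using K(3)[OF t] \<open>\<epsilon> > 0\<close> by (intro mult_left_mono) auto
    finally have "\<bar>E t (\<lambda>G. (f t G - c)\<^sup>2 / (c\<^sup>2 * f t G))\<bar> \<le> 1 / (c\<^sup>2 * \<epsilon>) * (K / real t)" .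
    moreover have "\<bar>- (1 / c\<^sup>2 * (E t (f t) - c))\<bar> \<le> 1 / c\<^sup>2 * (K / real t)"
      using K(4)[OF t] unfolding abs_minus_cancel abs_mult by (intro mult_mono) auto
    ultimately show "\<bar>E t (\<lambda>G. 1 / f t G) - 1 / c\<bar> \<le> (1 / c\<^sup>2 * K + 1 / (c\<^sup>2 * \<epsilon>) * K) / real t"
      unfolding eq add_divide_distrib by (simp only: times_divide_eq_right)
  qed
qed

text \<open>The limit m = c / (1 + l) is forced by stationarity, c - l m = m. The second moment of F
  - m t has to be bounded before its mean, because the bias of the drift contains the correlation of
  \<open>g\<close> with F/t, which is controlled by that bound. For l = 0 nothing damps the mean, so
  \<open>w\<close> and \<open>g\<close> are then required to be exact constants.\<close>

lemma conc_drift: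
  fixes F :: "'g \<Rightarrow> real"
  assumes bound: "\<And>t G. t \<ge> T \<Longrightarrow> G \<in> set_pmf (M t) \<Longrightarrow> \<bar>F G\<bar> \<le> K * real t"
    and incr: "\<And>t G G'. t \<ge> T \<Longrightarrow> G \<in> set_pmf (M t) \<Longrightarrow> G' \<in> set_pmf (S G) \<Longrightarrow> \<bar>F G' - F G\<bar> \<le> K"
    and drift: "\<And>t G. t \<ge> T \<Longrightarrow> G \<in> set_pmf (M t) \<Longrightarrow>
      measure_pmf.expectation (S G) F = F G + w t G - g t G * (F G / real t)"
    and w: "conc w c" and g: "conc g l"
    and l: "l > 0 \<or> l = 0 \<and> w = (\<lambda>_ _. c) \<and> g = (\<lambda>_ _. 0)"
  shows "conc (\<lambda>t G. F G / real t) (c / (1 + l))"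
proof -
  define m where "m = c / (1 + l)"
  have l0: "l \<ge> 0" using l by auto
  then have m: "c - l * m - m = 0" by (simp add: m_def field_simps)
  obtain Kw where Kw: "Kw > 0"
    "\<And>t. t \<ge> T \<Longrightarrow> E t (\<lambda>G. (w t G - c)\<^sup>2) \<le> Kw / real t"
    "\<And>t. t \<ge> T \<Longrightarrow> \<bar>E t (w t) - c\<bar> \<le> Kw / real t" using concE[OF w] by metis
  obtain Kg where Kg: "Kg > 0"
    "\<And>t. t \<ge> T \<Longrightarrow> E t (\<lambda>G. (g t G - l)\<^sup>2) \<le> Kg / real t"
    "\<And>t. t \<ge> T \<Longrightarrow> \<bar>E t (g t) - l\<bar> \<le> Kg / real t" using concE[OF g] by metis
  \<comment> \<open>Deviation of \<open>F\<close> from its linear growth, and below it the noise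
    left in the drift once \<open>w\<close> and \<open>g\<close> are replaced by their limits: the
    drift of \<open>Z\<close> is W - l Z/t.\<close>
  define Z where "Z = (\<lambda>t G. F G - m * real t)"
  define W where "W = (\<lambda>t G. (w t G - c) - (g t G - l) * (F G / real t))"
  have drift': "measure_pmf.expectation (S G) F - F G - m = W t G - l * (Z t G / real t)"
    if "t \<ge> T" "G \<in> set_pmf (M t)" for t G
  proof -
    have "W t G - l * (Z t G / real t) = w t G - g t G * (F G / real t) - (c - l * m)"
      using real_pos[OF that(1)] unfolding W_def Z_def by (simp add: field_simps)
    then show ?thesis using drift[OF that] m by simp
  qed
  have f_bound: "\<bar>F G / real t\<bar> \<le> K" if "t \<ge> T" "G \<in> set_pmf (M t)" for t G
    using bound[OF that] real_pos[OF that(1)] by (simp add: divide_le_eq)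
  define C1 where "C1 = 2 * Kw + 2 * K\<^sup>2 * Kg"
  have W2: "E t (\<lambda>G. (W t G)\<^sup>2) \<le> C1 / real t" if t: "t \<ge> T" for t
  proof -
    have "E t (\<lambda>G. (W t G)\<^sup>2) \<le> E t (\<lambda>G. 2 * (w t G - c)\<^sup>2 + 2 * K\<^sup>2 * (g t G - l)\<^sup>2)"
    proof (rule E_mono[OF t])
      fix G assume G: "G \<in> set_pmf (M t)"
      have "(F G / real t)\<^sup>2 \<le> K\<^sup>2" using f_bound[OF t G]
        by (rule abs_le_square_iff[THEN iffD1, OF order_trans]) simp
      then have 1: "(F G / real t)\<^sup>2 * (g t G - l)\<^sup>2 \<le> K\<^sup>2 * (g t G - l)\<^sup>2" by (intro mult_right_mono) auto
      have "(W t G)\<^sup>2 \<le> 2 * (w t G - c)\<^sup>2 + 2 * ((F G / real t)\<^sup>2 * (g t G - l)\<^sup>2)"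
        using sum_squares_bound_diff[of "w t G - c" "(F G / real t) * (g t G - l)"]
        unfolding W_def power_mult_distrib by (simp only: mult.commute[of "g t G - l"])
      then show "(W t G)\<^sup>2 \<le> 2 * (w t G - c)\<^sup>2 + 2 * K\<^sup>2 * (g t G - l)\<^sup>2" using 1 by linarith
    qed
    also have "\<dots> = 2 * E t (\<lambda>G. (w t G - c)\<^sup>2) + 2 * K\<^sup>2 * E t (\<lambda>G. (g t G - l)\<^sup>2)"
      using t by (simp add: E_add integrable_M)
    also have "\<dots> \<le> 2 * (Kw / real t) + 2 * K\<^sup>2 * (Kg / real t)"
      using Kw(2)[OF t] Kg(2)[OF t] by (intro add_mono mult_left_mono) auto
    finally show ?thesis by (simp add: C1_def add_divide_distrib)
  qed
  define K2 where "K2 = (K + \<bar>m\<bar>)\<^sup>2"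
  \<comment> \<open>Closes the induction for E Z^2 \<le> L t: the summand 2 (2 C1 + K2) makes L/2 +
    2 C1 + K2 \<le> L, and K2 T covers the initial time.\<close>
  define L where "L = 2 * (2 * C1 + K2) + K2 * real T"
  have C1: "C1 \<ge> 0" using Kw(1) Kg(1) by (simp add: C1_def)
  have Z_bound: "(Z t G)\<^sup>2 \<le> K2 * (real t)\<^sup>2" if "t \<ge> T" "G \<in> set_pmf (M t)" for t G
  proof -
    have "\<bar>Z t G\<bar> \<le> \<bar>F G\<bar> + \<bar>m * real t\<bar>" unfolding Z_def by (rule abs_triangle_ineq4)
    also have "\<dots> \<le> (K + \<bar>m\<bar>) * real t"
      using bound[OF that] by (simp add: abs_mult algebra_simps)
    finally have "\<bar>Z t G\<bar> \<le> (K + \<bar>m\<bar>) * real t" .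
    then have "(Z t G)\<^sup>2 \<le> ((K + \<bar>m\<bar>) * real t)\<^sup>2"
      by (rule abs_le_square_iff[THEN iffD1, OF order_trans]) simp
    then show ?thesis by (simp add: K2_def power_mult_distrib)
  qed
  have step2: "measure_pmf.expectation (S G) (\<lambda>G'. (Z (Suc t) G')\<^sup>2)
      \<le> (1 + 1 / (2 * real t)) * (Z t G)\<^sup>2 + 2 * real t * (W t G)\<^sup>2 + K2"
    if t: "t \<ge> T" and G: "G \<in> set_pmf (M t)" for t G
  proof -
    note fS = finite_S[OF t G]
    have i: "integrable (measure_pmf (S G)) h" for h :: "'g \<Rightarrow> real"
      using fS by (rule integrable_measure_pmf_finite)
    have "measure_pmf.expectation (S G) (\<lambda>G'. (Z (Suc t) G')\<^sup>2)
       \<le> measure_pmf.expectation (S G) (\<lambda>G'. (2 * Z t G) * F G' + ((Z t G)\<^sup>2 - 2 * Z t G * (F G + m) + K2))"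
    proof (rule pmf_integral_mono[OF fS])
      fix G' assume G': "G' \<in> set_pmf (S G)"
      have "\<bar>F G' - F G - m\<bar> \<le> K + \<bar>m\<bar>" using incr[OF t G G'] by linarith
      then have "(F G' - F G - m)\<^sup>2 \<le> K2" unfolding K2_def
        by (rule abs_le_square_iff[THEN iffD1, OF order_trans]) simp
      moreover have "Z (Suc t) G' = Z t G + (F G' - F G - m)" by (simp add: Z_def algebra_simps)
      then have "(Z (Suc t) G')\<^sup>2 = (2 * Z t G) * F G' + ((Z t G)\<^sup>2 - 2 * Z t G * (F G + m)) + (F G' - F G - m)\<^sup>2"
        by (simp only: power2_eq_square) (simp add: algebra_simps)
      ultimately show "(Z (Suc t) G')\<^sup>2 \<le> (2 * Z t G) * F G' + ((Z t G)\<^sup>2 - 2 * Z t G * (F G + m) + K2)"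
        by linarith
    qed
    also have "\<dots> = 2 * Z t G * measure_pmf.expectation (S G) F + ((Z t G)\<^sup>2 - 2 * Z t G * (F G + m) + K2)"
      by (simp add: i)
    also have "\<dots> = (Z t G)\<^sup>2 + 2 * Z t G * (measure_pmf.expectation (S G) F - F G - m) + K2"
      by (simp add: algebra_simps)
    also have "\<dots> = (Z t G)\<^sup>2 + 2 * Z t G * W t G - 2 * l * ((Z t G)\<^sup>2 / real t) + K2"
      unfolding drift'[OF t G] by (simp add: algebra_simps power2_eq_square)
    also have "\<dots> \<le> (Z t G)\<^sup>2 + 2 * Z t G * W t G + K2" using l0 by simp
    \<comment> \<open>The weight 2 t balances the two terms: E W^2 = O(1/t) makes the last one O(1),
      while the factor 1 + 1/(2 t) in front of Z^2 alone would only produce growth like t^(1/2),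
      below the linear bound sought.\<close>
    also have "2 * Z t G * W t G \<le> 1 / (2 * real t) * (Z t G)\<^sup>2 + 2 * real t * (W t G)\<^sup>2"
    proof -
      have "0 \<le> 1 / (2 * real t) * (Z t G - 2 * real t * W t G)\<^sup>2" by simp
      then show ?thesis using real_pos[OF t]
        by (simp add: power2_eq_square field_simps)
    qed
    finally show ?thesis by (simp add: algebra_simps)
  qed
  have Z2: "E t (\<lambda>G. (Z t G)\<^sup>2) \<le> L * real t" if "t \<ge> T" for t
    using that
  proof (induction t rule: dec_induct)
    case base
    have "E T (\<lambda>G. (Z T G)\<^sup>2) \<le> E T (\<lambda>G. K2 * (real T)\<^sup>2)"
      using Z_bound by (intro E_mono) auto
    also have "\<dots> = (K2 * real T) * real T" by (simp add: power2_eq_square)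
    also have "\<dots> \<le> L * real T" using C1 by (intro mult_right_mono) (auto simp: L_def K2_def)
    finally show ?case .
  next
    case (step t)
    then have t: "t \<ge> T" by simp
    have "E (Suc t) (\<lambda>G. (Z (Suc t) G)\<^sup>2)
       \<le> E t (\<lambda>G. (1 + 1 / (2 * real t)) * (Z t G)\<^sup>2 + 2 * real t * (W t G)\<^sup>2 + K2)"
      unfolding E_Suc[OF t] using step2[OF t] by (intro E_mono[OF t])
    also have "\<dots> = (1 + 1 / (2 * real t)) * E t (\<lambda>G. (Z t G)\<^sup>2) + 2 * real t * E t (\<lambda>G. (W t G)\<^sup>2) + K2"
      using t by (simp add: E_add integrable_M)
    also have "\<dots> \<le> (1 + 1 / (2 * real t)) * (L * real t) + 2 * real t * (C1 / real t) + K2"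
      using step.IH W2[OF t] by (intro add_mono mult_left_mono) auto
    also have "\<dots> = L * real t + (L / 2 + 2 * C1 + K2)"
      using real_pos[OF t] by (simp add: field_simps)
    also have "\<dots> \<le> L * real t + L"
      using C1 by (simp add: L_def K2_def)
    finally show ?case by (simp add: algebra_simps)
  qed
  have f2: "E t (\<lambda>G. (F G / real t - m)\<^sup>2) \<le> L / real t" if t: "t \<ge> T" for t
  proof -
    have "E t (\<lambda>G. (F G / real t - m)\<^sup>2) = E t (\<lambda>G. 1 / (real t)\<^sup>2 * (Z t G)\<^sup>2)"
      using real_pos[OF t] by (intro pmf_integral_cong) (simp add: Z_def field_simps power2_eq_square)
    also have "\<dots> = 1 / (real t)\<^sup>2 * E t (\<lambda>G. (Z t G)\<^sup>2)" by simp
    also have "\<dots> \<le> 1 / (real t)\<^sup>2 * (L * real t)" using Z2[OF t] by (intro mult_left_mono) auto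
    finally show ?thesis using real_pos[OF t] by (simp add: power2_eq_square)
  qed
  define C2 where "C2 = Kw + (Kg + L) + \<bar>m\<bar> * Kg"
  have W1: "\<bar>E t (W t)\<bar> \<le> C2 / real t" if t: "t \<ge> T" for t
  proof -
    have "E t (W t) = E t (\<lambda>G. ((w t G - c) - (g t G - l) * (F G / real t - m)) - m * (g t G - l))"
      by (intro pmf_integral_cong) (simp add: W_def algebra_simps)
    also have "\<dots> = (E t (w t) - c) - E t (\<lambda>G. (g t G - l) * (F G / real t - m)) - m * (E t (g t) - l)"
      using t by (simp only: E_diff E_cmult) simp
    finally have eq: "E t (W t) = \<dots>" .
    have "\<bar>E t (\<lambda>G. (g t G - l) * (F G / real t - m))\<bar> \<le> (Kg + L) / real t"
      by (rule E_prod_bound[OF t Kg(2)[OF t] f2[OF t]])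
    moreover have "\<bar>m * (E t (g t) - l)\<bar> \<le> \<bar>m\<bar> * (Kg / real t)"
      using Kg(3)[OF t] unfolding abs_mult by (intro mult_left_mono) auto
    ultimately show ?thesis using Kw(3)[OF t] unfolding eq C2_def add_divide_distrib
      by (simp add: abs_le_iff)
  qed
  have Z1_Suc: "E (Suc t) (Z (Suc t)) = E t (Z t) * (1 - l / real t) + E t (W t)" if t: "t \<ge> T" for t
  proof -
    have "E (Suc t) (Z (Suc t)) = E t (\<lambda>G. measure_pmf.expectation (S G) (Z (Suc t)))"
      by (rule E_Suc[OF t])
    also have "\<dots> = E t (\<lambda>G. (1 - l / real t) * Z t G + W t G)"
    proof (rule pmf_integral_cong)
      fix G assume G: "G \<in> set_pmf (M t)"
      have "integrable (measure_pmf (S G)) F" using finite_S[OF t G] by (rule integrable_measure_pmf_finite)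
      then have "measure_pmf.expectation (S G) (Z (Suc t)) = measure_pmf.expectation (S G) F - m * (real t + 1)"
        unfolding Z_def by simp
      also have "\<dots> = Z t G + (measure_pmf.expectation (S G) F - F G - m)" by (simp add: Z_def algebra_simps)
      finally show "measure_pmf.expectation (S G) (Z (Suc t)) = (1 - l / real t) * Z t G + W t G"
        unfolding drift'[OF t G] by (simp add: algebra_simps)
    qed
    finally show ?thesis using t by (simp add: E_add integrable_M)
  qed
  have "\<exists>L1. \<forall>t\<ge>T. \<bar>E t (Z t)\<bar> \<le> L1"
  proof (cases "l > 0")
    \<comment> \<open>Without damping the noise vanishes identically, and the mean of
      \<open>Z\<close> is conserved.\<close>
    case False
    then have l0: "l = 0" "w = (\<lambda>_ _. c)" "g = (\<lambda>_ _. 0)" using l by (simp_all only: False simp_thms)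
    have W0: "E t (W t) = 0" for t unfolding W_def l0 by simp
    have const: "E t (Z t) = E T (Z T)" if "t \<ge> T" for t
      using that
    proof (induction t rule: dec_induct)
      case (step t)
      then show ?case using Z1_Suc[of t] W0[of t] l0(1) by simp
    qed simp
    show ?thesis by (intro exI[of _ "\<bar>E T (Z T)\<bar>"] allI impI) (drule const, simp)
  next
    case True
    \<comment> \<open>Any level \<ge> C2 / l is preserved by x (1 - l/t) + C2/t when t \<ge> l; the
      sum takes care of the finitely many earlier times, at which 1 - l/t may be negative.\<close>
    define L1 where "L1 = C2 / l + (\<Sum>t\<le>T + nat \<lceil>l\<rceil>. \<bar>E t (Z t)\<bar>)"
    have "0 \<le> C2 / real T" using W1[of T] by linarith
    then have "C2 \<ge> 0" using T_pos by (simp add: zero_le_divide_iff)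
    have small: "\<bar>E t (Z t)\<bar> \<le> L1" if "t \<le> T + nat \<lceil>l\<rceil>" for t
    proof -
      have "\<bar>E t (Z t)\<bar> \<le> (\<Sum>t\<le>T + nat \<lceil>l\<rceil>. \<bar>E t (Z t)\<bar>)"
        using that by (intro member_le_sum) auto
      then show ?thesis using divide_nonneg_pos[OF \<open>C2 \<ge> 0\<close> True] by (simp add: L1_def)
    qed
    have "\<bar>E t (Z t)\<bar> \<le> L1" if "t \<ge> T + nat \<lceil>l\<rceil>" for t
      using that
    proof (induction t rule: dec_induct)
      case base then show ?case using small by simp
    next
      case (step t)
      then have t: "t \<ge> T" and lt: "l \<le> real t" by linarith+
      have r: "0 \<le> 1 - l / real t" using lt real_pos[OF t] by simp
      have "\<bar>E (Suc t) (Z (Suc t))\<bar> \<le> \<bar>E t (Z t)\<bar> * (1 - l / real t) + \<bar>E t (W t)\<bar>"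
        unfolding Z1_Suc[OF t] using r by (intro order_trans[OF abs_triangle_ineq]) (simp add: abs_mult)
      also have "\<dots> \<le> L1 * (1 - l / real t) + C2 / real t"
        using step.IH W1[OF t] r by (intro add_mono mult_right_mono) auto
      also have "\<dots> = L1 - (L1 * l - C2) / real t" by (simp add: field_simps diff_divide_distrib)
      also have "\<dots> \<le> L1"
      proof -
        have "C2 / l \<le> L1" by (simp add: L1_def sum_nonneg)
        then have "0 \<le> L1 * l - C2" using True by (simp add: divide_le_eq)
        then show ?thesis by simp
      qed
      finally show ?case .
    qed
    with small show ?thesis by (meson linear)
  qed
  then obtain L1 where L1: "\<And>t. t \<ge> T \<Longrightarrow> \<bar>E t (Z t)\<bar> \<le> L1" by blast
  have "conc (\<lambda>t G. F G / real t) m"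
  proof (rule concI[of _ K _ L L1])
    fix t assume t: "t \<ge> T"
    have "E t (Z t) = E t F - m * real t" unfolding Z_def using t by (simp add: integrable_M)
    then have "E t (\<lambda>G. F G / real t) - m = E t (Z t) / real t"
      using real_pos[OF t] by (simp add: field_simps)
    then show "\<bar>E t (\<lambda>G. F G / real t) - m\<bar> \<le> L1 / real t"
      using L1[OF t] real_pos[OF t] by (simp add: divide_right_mono)
  qed (use f_bound f2 in auto)
  then show ?thesis by (simp add: m_def)
qed

lemma bounded_of_increments:
  fixes F :: "'g \<Rightarrow> real"
  assumes incr: "\<And>t G G'. t \<ge> T \<Longrightarrow> G \<in> set_pmf (M t) \<Longrightarrow> G' \<in> set_pmf (S G) \<Longrightarrow> \<bar>F G' - F G\<bar> \<le> K"
  shows "\<exists>K'. \<forall>t\<ge>T. \<forall>G\<in>set_pmf (M t). \<bar>F G\<bar> \<le> K' * real t"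
proof -
  define K' where "K' = \<bar>K\<bar> + (\<Sum>G\<in>set_pmf (M T). \<bar>F G\<bar>)"
  have "0 \<le> (\<Sum>G\<in>set_pmf (M T). \<bar>F G\<bar>)" by (rule sum_nonneg) simp
  then have K: "K \<le> K'" "0 \<le> K'" unfolding K'_def by linarith+
  have "\<bar>F G\<bar> \<le> K' * real t" if "t \<ge> T" "G \<in> set_pmf (M t)" for t G
    using that
  proof (induction t arbitrary: G rule: dec_induct)
    case base
    have "\<bar>F G\<bar> \<le> (\<Sum>G\<in>set_pmf (M T). \<bar>F G\<bar>)"
      using base finite_M by (intro member_le_sum) auto
    then have "\<bar>F G\<bar> \<le> K'" by (simp add: K'_def)
    also have "K' * 1 \<le> K' * real T"
      using T_pos by (intro mult_left_mono) (use K in auto)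
    finally show ?case by simp
  next
    case (step t)
    have "G \<in> set_pmf (bind_pmf (M t) S)" using step.prems M_Suc[OF step.hyps(1)] by simp
    then obtain H where H: "H \<in> set_pmf (M t)" "G \<in> set_pmf (S H)" by auto
    have "\<bar>F G\<bar> \<le> \<bar>F H\<bar> + K" using incr[OF step(1) H] by linarith
    also have "\<dots> \<le> K' * real t + K'"
      using step.IH[OF H(1)] K by simp
    finally show ?case by (simp add: algebra_simps)
  qed
  then show ?thesis by blast
qed

text \<open>Bounded increments supply the linear bound on \<open>F\<close> that
  \<open>conc_drift\<close> asks for.\<close>

lemma conc_drift':
  fixes F :: "'g \<Rightarrow> real"
  assumes incr: "\<And>t G G'. t \<ge> T \<Longrightarrow> G \<in> set_pmf (M t) \<Longrightarrow> G' \<in> set_pmf (S G) \<Longrightarrow> \<bar>F G' - F G\<bar> \<le> K"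
    and drift: "\<And>t G. t \<ge> T \<Longrightarrow> G \<in> set_pmf (M t) \<Longrightarrow>
      measure_pmf.expectation (S G) F = F G + w t G - g t G * (F G / real t)"
    and w: "conc w c" and g: "conc g l"
    and l: "l > 0 \<or> l = 0 \<and> w = (\<lambda>_ _. c) \<and> g = (\<lambda>_ _. 0)"
  shows "conc (\<lambda>t G. F G / real t) (c / (1 + l))"
proof -
  have "\<exists>K'. \<forall>t\<ge>T. \<forall>G\<in>set_pmf (M t). \<bar>F G\<bar> \<le> K' * real t"
    by (rule bounded_of_increments[where K = K]) (rule incr)
  then obtain K' where K': "\<forall>t\<ge>T. \<forall>G\<in>set_pmf (M t). \<bar>F G\<bar> \<le> K' * real t" ..
  show ?thesis
  proof (rule conc_drift[where F = F and K = "max K K'" and w = w and g = g and c = c and l = l])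
    fix t G assume tG: "t \<ge> T" "G \<in> set_pmf (M t)"
    then have "\<bar>F G\<bar> \<le> K' * real t" using K' by blast
    also have "\<dots> \<le> max K K' * real t" by (intro mult_right_mono) auto
    finally show "\<bar>F G\<bar> \<le> max K K' * real t" .
    show "\<bar>F G' - F G\<bar> \<le> max K K'" if "G' \<in> set_pmf (S G)" for G'
      using incr[OF tG that] by linarith
    show "measure_pmf.expectation (S G) F = F G + w t G - g t G * (F G / real t)" if "t \<ge> T" "G \<in> set_pmf (M t)" for t G
      using drift that .
  qed (fact w g l)+
qed

text \<open>Undoes the division by \<open>t\<close>: the bias O(1/t) becomes the error O(1) of the
  theorem.\<close>

lemma concD_linear:
  assumes "conc (\<lambda>t G. F G / real t) c"
  shows "\<exists>K. \<forall>t\<ge>T. \<bar>E t F - c * real t\<bar> \<le> K"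
proof -
  obtain K where K: "\<And>t. t \<ge> T \<Longrightarrow> \<bar>E t (\<lambda>G. F G / real t) - c\<bar> \<le> K / real t"
    using concE[OF assms] by metis
  have "\<bar>E t F - c * real t\<bar> \<le> K" if t: "t \<ge> T" for t
  proof -
    have "E t F - c * real t = (E t (\<lambda>G. F G / real t) - c) * real t"
      using real_pos[OF t] by (simp add: field_simps)
    then have "\<bar>E t F - c * real t\<bar> = \<bar>E t (\<lambda>G. F G / real t) - c\<bar> * real t"
      by (simp add: abs_mult)
    also have "\<dots> \<le> K / real t * real t" using K[OF t] by (intro mult_right_mono) auto
    finally show ?thesis using real_pos[OF t] by simp
  qed
  then show ?thesis by blast
qed

end

subsection \<open>One step of the graph process\<close>

lemma integral_join_pmf_of_list3:
  fixes F :: "'a \<Rightarrow> real"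
  assumes wf: "\<alpha> \<ge> 0" "\<beta> \<ge> 0" "\<gamma> \<ge> 0" "\<alpha> + \<beta> + \<gamma> = 1"
    and fin: "finite (set_pmf p)" "finite (set_pmf q)" "finite (set_pmf r)"
  shows "measure_pmf.expectation (join_pmf (pmf_of_list [(p, \<alpha>), (q, \<beta>), (r, \<gamma>)])) F =
    \<alpha> * measure_pmf.expectation p F + \<beta> * measure_pmf.expectation q F + \<gamma> * measure_pmf.expectation r F"
proof -
  let ?P = "pmf_of_list [(p, \<alpha>), (q, \<beta>), (r, \<gamma>)]"
  have wf': "pmf_of_list_wf [(p, \<alpha>), (q, \<beta>), (r, \<gamma>)]"
    using wf by (intro pmf_of_list_wfI) auto
  have sub: "set_pmf ?P \<subseteq> {p, q, r}" using set_pmf_of_list[OF wf'] by simp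
  have "measure_pmf.expectation (join_pmf ?P) F
      = measure_pmf.expectation ?P (\<lambda>x. measure_pmf.expectation x F)"
    unfolding join_pmf_def using sub fin
    by (intro pmf_integral_bind finite_set_pmf_of_list wf') auto
  also have "\<dots> = (\<Sum>x\<in>{p, q, r}. measure_pmf.expectation x F * pmf ?P x)"
    using sub by (intro integral_measure_pmf_real) auto
  \<comment> \<open>The three laws may coincide, and the list then adds up their weights.
    Conditional summands cover all coincidences at once.\<close>
  also have "\<dots> = (\<Sum>x\<in>{p, q, r}. (if x = p then \<alpha> * measure_pmf.expectation p F else 0)
      + (if x = q then \<beta> * measure_pmf.expectation q F else 0)
      + (if x = r then \<gamma> * measure_pmf.expectation r F else 0))"
    by (intro sum.cong refl) (auto simp: pmf_pmf_of_list[OF wf'] algebra_simps)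
  also have "\<dots> = \<alpha> * measure_pmf.expectation p F + \<beta> * measure_pmf.expectation q F
      + \<gamma> * measure_pmf.expectation r F"
    by (simp only: sum.distrib) (simp add: sum.delta)
  finally show ?thesis .
qed

section \<open>Effect of one step on the degree counts\<close>

definition count_deg :: "(nat \<Rightarrow> nat) \<Rightarrow> nat \<Rightarrow> nat set \<Rightarrow> real" where
  "count_deg d k V = (\<Sum>x\<in>V. of_bool (d x = k))"

text \<open>Change of the indicator of degree \<open>k\<close> when a vertex of degree
  \<open>d\<close> gains one edge.\<close>

definition deg_jump :: "nat \<Rightarrow> nat \<Rightarrow> real" where
  "deg_jump k d = of_bool (Suc d = k) - of_bool (d = k)"

lemma of_bool_bump: "(of_bool ((d x + of_bool (x = v)) = k) :: real)
    = of_bool (d x = k) + of_bool (x = v) * deg_jump k (d x)"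
  by (auto simp: deg_jump_def)

lemma abs_deg_jump: "\<bar>deg_jump k d\<bar> \<le> 1"
  by (auto simp: deg_jump_def)

lemma count_deg_bump:
  assumes "finite V" "v \<in> V"
  shows "count_deg (\<lambda>x. d x + of_bool (x = v)) k V = count_deg d k V + deg_jump k (d v)"
proof -
  have "(\<Sum>x\<in>V. of_bool (x = v) * deg_jump k (d x)) = deg_jump k (d v)"
    using assms by (subst sum.remove[of _ v]) auto
  then show ?thesis unfolding count_deg_def of_bool_bump sum.distrib by simp
qed

lemma count_deg_bump_fresh:
  assumes "v \<notin> V"
  shows "count_deg (\<lambda>x. d x + of_bool (x = v)) k V = count_deg d k V"
  unfolding count_deg_def using assms by (intro sum.cong) auto

lemma count_deg_insert:
  assumes "finite V" "v \<notin> V"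
  shows "count_deg d k (insert v V) = of_bool (d v = k) + count_deg d k V"
  using assms by (simp add: count_deg_def)

text \<open>\<open>num_edges\<close> as a sum of products of indicators, so that the effect of a new
  edge can be computed by multiplying out.\<close>

definition edge_count :: "nat \<Rightarrow> nat \<Rightarrow> multigraph \<Rightarrow> real" where
  "edge_count k l G = (\<Sum>e\<in>arcs G. of_bool (tail G e \<noteq> head G e)
     * (of_bool (out_degree G (tail G e) = k) * of_bool (in_degree G (head G e) = l)))"

lemma edge_count_eq:
  fixes G :: multigraph
  assumes fin: "finite (arcs G)"
  shows "edge_count k l G = real (num_edges k l G)"
proof -
  let ?P = "\<lambda>e. out_degree G (tail G e) = k \<and> in_degree G (head G e) = l \<and> tail G e \<noteq> head G e"
  have "edge_count k l G = (\<Sum>e\<in>arcs G. of_bool (?P e))"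
    unfolding edge_count_def by (intro sum.cong) auto
  also have "\<dots> = real (card (arcs G \<inter> Collect ?P))" by (rule sum_of_bool_eq; rule fin)
  also have "arcs G \<inter> Collect ?P = {e \<in> arcs G. ?P e}" by blast
  finally show ?thesis by (simp add: num_edges_def)
qed

locale pref_graph =
  fixes \<alpha> \<beta> \<gamma> \<delta>in \<delta>out :: real and G :: multigraph
  assumes params: "\<alpha> > 0" "\<beta> > 0" "\<gamma> > 0" "\<alpha> + \<beta> + \<gamma> = 1" "\<delta>in > 0" "\<delta>out > 0"
    and init: "initial_graph \<delta>in \<delta>out G"
begin

sublocale fin_digraph G
  using init by (simp add: initial_graph_def)

abbreviation "od \<equiv> out_degree G"
abbreviation "ind \<equiv> in_degree G"
abbreviation "V \<equiv> verts G"
abbreviation "tm \<equiv> real (card (arcs G))"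
definition "No = tm + \<delta>out * real (card V)"
definition "Ni = tm + \<delta>in * real (card V)"
definition "po v = (real (od v) + \<delta>out) / No"
definition "pn v = (real (ind v) + \<delta>in) / Ni"
abbreviation "fr \<equiv> fresh V"
abbreviation "ins \<equiv> \<lambda>v w. insert_edge v w G"

lemma No_ge: "tm \<le> No" "0 < No" and Ni_ge: "tm \<le> Ni" "0 < Ni"
proof -
  have "0 < real (card V)" using init by (simp add: initial_graph_def card_gt_0_iff)
  then have "0 < \<delta>out * real (card V)" "0 < \<delta>in * real (card V)" using params by simp_all
  then show "tm \<le> No" "0 < No" "tm \<le> Ni" "0 < Ni"
    unfolding No_def Ni_def by (simp_all add: add_nonneg_pos)
qed

lemma fr: "fr \<notin> V"
  by (rule fresh_notin) simp

lemma deg_outside: assumes "x \<notin> V" shows "od x = 0" "ind x = 0"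
proof -
  have "out_arcs G x = {}" "in_arcs G x = {}" using assms by auto
  then show "od x = 0" "ind x = 0" by (simp_all add: out_degree_def in_degree_def)
qed

lemma po_nonneg: "po v \<ge> 0" and pn_nonneg: "pn v \<ge> 0"
  using params No_ge Ni_ge by (simp_all add: po_def pn_def)

lemma sum_po: "(\<Sum>v\<in>V. po v) = 1" and sum_pn: "(\<Sum>v\<in>V. pn v) = 1"
proof -
  have "(\<Sum>v\<in>V. real (od v)) = tm" "(\<Sum>v\<in>V. real (ind v)) = tm"
    using sum_out_degree sum_in_degree by (simp_all flip: of_nat_sum)
  then show "(\<Sum>v\<in>V. po v) = 1" "(\<Sum>v\<in>V. pn v) = 1"
    using No_ge(2) Ni_ge(2)
    unfolding po_def pn_def sum_divide_distrib[symmetric] sum.distrib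
    by (simp_all add: No_def Ni_def)
qed

lemma pmf_po: "pmf (pref_out \<delta>out G) v = (if v \<in> V then po v else 0)"
  and pmf_pn: "pmf (pref_in \<delta>in G) v = (if v \<in> V then pn v else 0)"
  using pmf_pref_out[OF init, of v] pmf_pref_in[OF init, of v] params
  by (simp_all add: pref_weight_def po_def pn_def No_def Ni_def)

lemma set_po: "set_pmf (pref_out \<delta>out G) \<subseteq> V" and set_pn: "set_pmf (pref_in \<delta>in G) \<subseteq> V"
  by (auto simp: set_pmf_iff pmf_po pmf_pn split: if_splits)

lemma finite_pref: "finite (set_pmf (pref_out \<delta>out G))" "finite (set_pmf (pref_in \<delta>in G))"
  using finite_subset[OF set_po] finite_subset[OF set_pn] by auto

lemma expectation_po: "measure_pmf.expectation (pref_out \<delta>out G) h = (\<Sum>v\<in>V. po v * h v)"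
  and expectation_pn: "measure_pmf.expectation (pref_in \<delta>in G) h = (\<Sum>v\<in>V. pn v * h v)"
  for h :: "nat \<Rightarrow> real"
proof -
  show "measure_pmf.expectation (pref_out \<delta>out G) h = (\<Sum>v\<in>V. po v * h v)"
    using set_po by (subst integral_measure_pmf_real[of V]) (auto simp: pmf_po mult.commute intro!: sum.cong)
  show "measure_pmf.expectation (pref_in \<delta>in G) h = (\<Sum>v\<in>V. pn v * h v)"
    using set_pn by (subst integral_measure_pmf_real[of V]) (auto simp: pmf_pn mult.commute intro!: sum.cong)
qed

lemma set_step_subset: "set_pmf (step \<alpha> \<beta> \<gamma> \<delta>in \<delta>out G)
    \<subseteq> (\<lambda>w. ins fr w) ` V \<union> (\<lambda>(v, w). ins v w) ` (V \<times> V) \<union> (\<lambda>v. ins v fr) ` V"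
proof
  fix H assume "H \<in> set_pmf (step \<alpha> \<beta> \<gamma> \<delta>in \<delta>out G)"
  moreover have wf: "pmf_of_list_wf [(p, \<alpha>), (q, \<beta>), (r, \<gamma>)]" for p q r :: "multigraph pmf"
    using params by (intro pmf_of_list_wfI) auto
  ultimately obtain p where H: "H \<in> set_pmf p" and
    "p \<in> set (map fst [(map_pmf (\<lambda>w. ins fr w) (pref_in \<delta>in G), \<alpha>),
      (map_pmf (\<lambda>(v, w). ins v w) (pair_pmf (pref_out \<delta>out G) (pref_in \<delta>in G)), \<beta>),
      (map_pmf (\<lambda>v. ins v fr) (pref_out \<delta>out G), \<gamma>)])"
    unfolding step_def set_pmf_join_pmf using set_pmf_of_list[OF wf] by blast
  then consider "p = map_pmf (\<lambda>w. ins fr w) (pref_in \<delta>in G)"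
    | "p = map_pmf (\<lambda>(v, w). ins v w) (pair_pmf (pref_out \<delta>out G) (pref_in \<delta>in G))"
    | "p = map_pmf (\<lambda>v. ins v fr) (pref_out \<delta>out G)" by auto
  then show "H \<in> (\<lambda>w. ins fr w) ` V \<union> (\<lambda>(v, w). ins v w) ` (V \<times> V) \<union> (\<lambda>v. ins v fr) ` V"
    using H set_po set_pn by cases auto
qed

lemma finite_step: "finite (set_pmf (step \<alpha> \<beta> \<gamma> \<delta>in \<delta>out G))"
  by (rule finite_subset[OF set_step_subset]) auto

lemma set_step:
  assumes "H \<in> set_pmf (step \<alpha> \<beta> \<gamma> \<delta>in \<delta>out G)"
  obtains w where "H = ins fr w" "w \<in> V" | v w where "H = ins v w" "v \<in> V" "w \<in> V"
    | v where "H = ins v fr" "v \<in> V"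
proof -
  have "(\<exists>w\<in>V. H = ins fr w) \<or> (\<exists>v\<in>V. \<exists>w\<in>V. H = ins v w) \<or> (\<exists>v\<in>V. H = ins v fr)"
    using subsetD[OF set_step_subset assms] by (auto simp: image_iff)
  then show ?thesis using that by blast
qed

lemma expectation_step:
  fixes F :: "multigraph \<Rightarrow> real"
  shows "measure_pmf.expectation (step \<alpha> \<beta> \<gamma> \<delta>in \<delta>out G) F =
    \<alpha> * (\<Sum>w\<in>V. pn w * F (ins fr w)) + \<beta> * (\<Sum>v\<in>V. po v * (\<Sum>w\<in>V. pn w * F (ins v w)))
    + \<gamma> * (\<Sum>v\<in>V. po v * F (ins v fr))"
proof -
  have pair: "measure_pmf.expectation (pair_pmf (pref_out \<delta>out G) (pref_in \<delta>in G)) (\<lambda>(v, w). F (ins v w))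
    = (\<Sum>v\<in>V. po v * (\<Sum>w\<in>V. pn w * F (ins v w)))"
    unfolding pair_pmf_def
    by (simp add: pmf_integral_bind finite_pref expectation_po expectation_pn)
  have 1: "measure_pmf.expectation (step \<alpha> \<beta> \<gamma> \<delta>in \<delta>out G) F =
      \<alpha> * measure_pmf.expectation (map_pmf (\<lambda>w. ins fr w) (pref_in \<delta>in G)) F
      + \<beta> * measure_pmf.expectation (map_pmf (\<lambda>(v, w). ins v w) (pair_pmf (pref_out \<delta>out G) (pref_in \<delta>in G))) F
      + \<gamma> * measure_pmf.expectation (map_pmf (\<lambda>v. ins v fr) (pref_out \<delta>out G)) F"
    unfolding step_def using params finite_pref by (intro integral_join_pmf_of_list3) auto
  show ?thesis
    unfolding 1 integral_map_pmf expectation_po expectation_pn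
    using pair by (simp add: case_prod_unfold)
qed

lemma od_ins: "out_degree (ins v w) x = od x + of_bool (x = v)"
  and ind_ins: "in_degree (ins v w) x = ind x + of_bool (x = w)"
proof -
  have f: "fresh (arcs G) \<notin> arcs G" by (rule fresh_notin) simp
  have "out_arcs (ins v w) x = (if x = v then insert (fresh (arcs G)) (out_arcs G x) else out_arcs G x)"
    "in_arcs (ins v w) x = (if x = w then insert (fresh (arcs G)) (in_arcs G x) else in_arcs G x)"
    using f by (auto simp: insert_edge_simps out_arcs_def in_arcs_def)
  moreover have "fresh (arcs G) \<notin> out_arcs G x" "fresh (arcs G) \<notin> in_arcs G x" for x using f by auto
  ultimately show "out_degree (ins v w) x = od x + of_bool (x = v)"
    "in_degree (ins v w) x = ind x + of_bool (x = w)"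
    by (simp_all add: out_degree_def in_degree_def finite_out_arcs finite_in_arcs)
qed

lemma sum_po_const: "(\<Sum>v\<in>V. po v * c) = c" and sum_pn_const: "(\<Sum>v\<in>V. pn v * c) = c"
  by (simp_all flip: sum_distrib_right add: sum_po sum_pn)

lemma sum_po_add: "(\<Sum>v\<in>V. po v * (c + h v)) = c + (\<Sum>v\<in>V. po v * h v)"
  and sum_pn_add: "(\<Sum>v\<in>V. pn v * (c + h v)) = c + (\<Sum>v\<in>V. pn v * h v)"
  by (simp_all add: distrib_left sum.distrib sum_po_const sum_pn_const)

lemma count_out_ins:
  "v \<in> V \<Longrightarrow> w \<in> V \<Longrightarrow> count_deg (out_degree (ins v w)) k (verts (ins v w)) = count_deg od k V + deg_jump k (od v)"
  "v \<in> V \<Longrightarrow> count_deg (out_degree (ins v fr)) k (verts (ins v fr)) = (count_deg od k V + of_bool (k = 0)) + deg_jump k (od v)"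
  "w \<in> V \<Longrightarrow> count_deg (out_degree (ins fr w)) k (verts (ins fr w)) = count_deg od k V + of_bool (k = 1)"
proof -
  have o: "out_degree (ins v w) = (\<lambda>x. od x + of_bool (x = v))" for v w by (rule ext) (rule od_ins)
  show "v \<in> V \<Longrightarrow> w \<in> V \<Longrightarrow> count_deg (out_degree (ins v w)) k (verts (ins v w)) = count_deg od k V + deg_jump k (od v)"
    unfolding o by (simp add: insert_edge_simps insert_absorb count_deg_bump)
  show "v \<in> V \<Longrightarrow> count_deg (out_degree (ins v fr)) k (verts (ins v fr)) = (count_deg od k V + of_bool (k = 0)) + deg_jump k (od v)"
    unfolding o using fr deg_outside[OF fr]
    by (auto simp: insert_edge_simps insert_absorb insert_commute[of v] count_deg_insert count_deg_bump)
  show "w \<in> V \<Longrightarrow> count_deg (out_degree (ins fr w)) k (verts (ins fr w)) = count_deg od k V + of_bool (k = 1)"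
    unfolding o using fr deg_outside[OF fr]
    by (auto simp: insert_edge_simps insert_absorb count_deg_insert count_deg_bump_fresh)
qed

lemma count_in_ins:
  "v \<in> V \<Longrightarrow> w \<in> V \<Longrightarrow> count_deg (in_degree (ins v w)) k (verts (ins v w)) = count_deg ind k V + deg_jump k (ind w)"
  "w \<in> V \<Longrightarrow> count_deg (in_degree (ins fr w)) k (verts (ins fr w)) = (count_deg ind k V + of_bool (k = 0)) + deg_jump k (ind w)"
  "v \<in> V \<Longrightarrow> count_deg (in_degree (ins v fr)) k (verts (ins v fr)) = count_deg ind k V + of_bool (k = 1)"
proof -
  have o: "in_degree (ins v w) = (\<lambda>x. ind x + of_bool (x = w))" for v w by (rule ext) (rule ind_ins)
  show "v \<in> V \<Longrightarrow> w \<in> V \<Longrightarrow> count_deg (in_degree (ins v w)) k (verts (ins v w)) = count_deg ind k V + deg_jump k (ind w)"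
    unfolding o by (simp add: insert_edge_simps insert_absorb count_deg_bump)
  show "w \<in> V \<Longrightarrow> count_deg (in_degree (ins fr w)) k (verts (ins fr w)) = (count_deg ind k V + of_bool (k = 0)) + deg_jump k (ind w)"
    unfolding o using fr deg_outside[OF fr]
    by (auto simp: insert_edge_simps insert_absorb count_deg_insert count_deg_bump)
  show "v \<in> V \<Longrightarrow> count_deg (in_degree (ins v fr)) k (verts (ins v fr)) = count_deg ind k V + of_bool (k = 1)"
    unfolding o using fr deg_outside[OF fr]
    by (auto simp: insert_edge_simps insert_absorb insert_commute[of v] count_deg_insert count_deg_bump_fresh)
qed

text \<open>Source of all recurrences in the degree: with weights proportional to d + \<delta>,
  objects of degree k - 1 enter the class \<open>k\<close> at rate k - 1 + \<delta>, and objects of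
  degree \<open>k\<close> leave it at rate k + \<delta>. The factor \<open>h\<close> lets the same
  identity serve for vertices and for edges, the latter weighted by their other endpoint.\<close>

lemma sum_weight_jump:
  assumes "finite X"
  shows "(\<Sum>x\<in>X. (real (d x) + \<delta>) / N * (h x * deg_jump k (d x))) =
    ((real k - 1 + \<delta>) * (\<Sum>x\<in>X. h x * of_bool (Suc (d x) = k))
      - (real k + \<delta>) * (\<Sum>x\<in>X. h x * of_bool (d x = k))) / N"
  unfolding sum_distrib_left sum_subtractf[symmetric] sum_divide_distrib
  by (intro sum.cong) (auto simp: deg_jump_def algebra_simps simp flip: add_divide_distrib)

text \<open>At k = 0 the truncated difference k - 1 would be 0 again, hence the explicit case: no
  vertex enters from below degree 0.\<close>

definition "count_pred d k = (if k = 0 then 0 else count_deg d (k - 1) V)"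

lemma count_pred_eq: "(\<Sum>x\<in>V. of_bool (Suc (d x) = k)) = count_pred d k"
  by (cases k) (auto simp: count_pred_def count_deg_def)

lemma sum_po_jump: "(\<Sum>v\<in>V. po v * deg_jump k (od v)) =
    ((real k - 1 + \<delta>out) * count_pred od k - (real k + \<delta>out) * count_deg od k V) / No"
  and sum_pn_jump: "(\<Sum>v\<in>V. pn v * deg_jump k (ind v)) =
    ((real k - 1 + \<delta>in) * count_pred ind k - (real k + \<delta>in) * count_deg ind k V) / Ni"
  using sum_weight_jump[of V od \<delta>out No "\<lambda>_. 1" k] sum_weight_jump[of V ind \<delta>in Ni "\<lambda>_. 1" k]
  by (simp_all add: po_def pn_def count_pred_eq count_deg_def)

lemma card_verts_ins:
  "v \<in> V \<Longrightarrow> w \<in> V \<Longrightarrow> card (verts (ins v w)) = card V"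
  "v \<in> V \<Longrightarrow> card (verts (ins v fr)) = Suc (card V)"
  "v \<in> V \<Longrightarrow> card (verts (ins fr v)) = Suc (card V)"
  using fr by (auto simp: insert_edge_simps insert_absorb insert_commute[of v fr])

lemma drift_verts:
  "measure_pmf.expectation (step \<alpha> \<beta> \<gamma> \<delta>in \<delta>out G) (\<lambda>G. real (card (verts G))) = real (card V) + (\<alpha> + \<gamma>)"
proof -
  have \<beta>: "\<beta> = 1 - \<alpha> - \<gamma>" using params by simp
  show ?thesis unfolding expectation_step
    by (simp only: card_verts_ins sum_po_const sum_pn_const cong: sum.cong) (simp add: \<beta> algebra_simps)
qed

text \<open>Out-degrees of old vertices change in the steps with probabilities \<beta> and \<gamma>.
  A new vertex has out-degree 1 in the step with probability \<alpha> and 0 in the one with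
  probability \<gamma>.\<close>

lemma drift_out: "measure_pmf.expectation (step \<alpha> \<beta> \<gamma> \<delta>in \<delta>out G) (\<lambda>G. count_deg (out_degree G) k (verts G))
   = count_deg od k V + \<alpha> * of_bool (k = 1) + \<gamma> * of_bool (k = 0)
     + (\<beta> + \<gamma>) * (((real k - 1 + \<delta>out) * count_pred od k - (real k + \<delta>out) * count_deg od k V) / No)"
proof -
  have \<beta>: "\<beta> = 1 - \<alpha> - \<gamma>" using params by simp
  show ?thesis unfolding expectation_step sum_po_jump[symmetric]
    by (simp only: count_out_ins sum_po_add sum_pn_add sum_po_const sum_pn_const cong: sum.cong)
      (simp add: \<beta> algebra_simps)
qed

lemma drift_in: "measure_pmf.expectation (step \<alpha> \<beta> \<gamma> \<delta>in \<delta>out G) (\<lambda>G. count_deg (in_degree G) k (verts G))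
   = count_deg ind k V + \<gamma> * of_bool (k = 1) + \<alpha> * of_bool (k = 0)
     + (\<alpha> + \<beta>) * (((real k - 1 + \<delta>in) * count_pred ind k - (real k + \<delta>in) * count_deg ind k V) / Ni)"
proof -
  have \<beta>: "\<beta> = 1 - \<alpha> - \<gamma>" using params by simp
  show ?thesis unfolding expectation_step sum_pn_jump[symmetric]
    by (simp only: count_in_ins sum_po_add sum_pn_add sum_po_const sum_pn_const cong: sum.cong)
      (simp add: \<beta> algebra_simps)
qed

section \<open>Effect of one step on the number of edges with given end degrees\<close>

definition "nonloop e = (of_bool (tail G e \<noteq> head G e) :: real)"

definition "tail_jump k l v = (\<Sum>e\<in>arcs G. nonloop e * of_bool (ind (head G e) = l)
  * deg_jump k (od (tail G e)) * of_bool (tail G e = v))"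

definition "head_jump k l w = (\<Sum>e\<in>arcs G. nonloop e * of_bool (od (tail G e) = k)
  * deg_jump l (ind (head G e)) * of_bool (head G e = w))"

definition "both_jump k l v w = (\<Sum>e\<in>arcs G. nonloop e * deg_jump k (od (tail G e))
  * deg_jump l (ind (head G e)) * of_bool (tail G e = v) * of_bool (head G e = w))"

definition "new_edge k l v w = (of_bool (v \<noteq> w) * (of_bool (Suc (od v) = k) * of_bool (Suc (ind w) = l)) :: real)"

text \<open>The edge from \<open>v\<close> to \<open>w\<close> raises the out-degree of
  \<open>v\<close> and the in-degree of \<open>w\<close> only. In the product of the two updated
  indicators one change concerns the edges leaving \<open>v\<close>, the other those entering
  \<open>w\<close>, and the product of both changes survives only for edges parallel to the new
  one.\<close>

lemma edge_count_ins: "edge_count k l (ins v w) = edge_count k l G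
    + tail_jump k l v + head_jump k l w + both_jump k l v w + new_edge k l v w"
proof -
  let ?f = "fresh (arcs G)"
  have f: "?f \<notin> arcs G" by (rule fresh_notin) simp
  let ?t = "\<lambda>e. of_bool (od (tail G e) = k) + of_bool (tail G e = v) * deg_jump k (od (tail G e)) :: real"
  let ?h = "\<lambda>e. of_bool (ind (head G e) = l) + of_bool (head G e = w) * deg_jump l (ind (head G e)) :: real"
  have "edge_count k l (ins v w) = new_edge k l v w + (\<Sum>e\<in>arcs G. nonloop e * (?t e * ?h e))"
    unfolding edge_count_def insert_edge_simps(2)
    using f by (subst sum.insert)
      (auto simp: insert_edge_simps od_ins ind_ins new_edge_def nonloop_def of_bool_bump intro!: sum.cong)
  also have "(\<Sum>e\<in>arcs G. nonloop e * (?t e * ?h e)) = edge_count k l G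
    + tail_jump k l v + head_jump k l w + both_jump k l v w"
    unfolding edge_count_def tail_jump_def head_jump_def both_jump_def nonloop_def sum.distrib[symmetric]
    by (intro sum.cong refl) (simp add: algebra_simps)
  finally show ?thesis by simp
qed

lemma jumps_fresh:
  "tail_jump k l fr = 0" "head_jump k l fr = 0" "both_jump k l fr w = 0" "both_jump k l v fr = 0"
proof -
  have "tail G e \<noteq> fr" "head G e \<noteq> fr" if "e \<in> arcs G" for e
    using that fr wellformed by metis+
  then show "tail_jump k l fr = 0" "head_jump k l fr = 0" "both_jump k l fr w = 0" "both_jump k l v fr = 0"
    unfolding tail_jump_def head_jump_def both_jump_def by (auto intro!: sum.neutral)
qed

text \<open>Each edge has exactly one tail and one head, so averaging over the chosen vertex becomes
  a sum over edges, weighted by the probability of the relevant endpoint.\<close>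

lemma sum_at_tail: "(\<Sum>v\<in>V. p v * (\<Sum>e\<in>arcs G. f e * of_bool (tail G e = v))) = (\<Sum>e\<in>arcs G. f e * p (tail G e))"
  and sum_at_head: "(\<Sum>v\<in>V. p v * (\<Sum>e\<in>arcs G. f e * of_bool (head G e = v))) = (\<Sum>e\<in>arcs G. f e * p (head G e))"
  for f :: "nat \<Rightarrow> real"
proof -
  have "(\<Sum>v\<in>V. p v * (\<Sum>e\<in>arcs G. f e * of_bool (g e = v))) = (\<Sum>e\<in>arcs G. f e * p (g e))"
    if g: "\<And>e. e \<in> arcs G \<Longrightarrow> g e \<in> V" for g
  proof -
    have "(\<Sum>v\<in>V. p v * (\<Sum>e\<in>arcs G. f e * of_bool (g e = v)))
        = (\<Sum>e\<in>arcs G. \<Sum>v\<in>V. p v * (f e * of_bool (g e = v)))"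
      unfolding sum_distrib_left by (rule sum.swap)
    also have "\<dots> = (\<Sum>e\<in>arcs G. f e * p (g e))"
      by (intro sum.cong refl, subst sum.remove[OF _ g]) (auto intro!: sum.neutral)
    finally show ?thesis .
  qed
  from this[of "tail G"] this[of "head G"]
  show "(\<Sum>v\<in>V. p v * (\<Sum>e\<in>arcs G. f e * of_bool (tail G e = v))) = (\<Sum>e\<in>arcs G. f e * p (tail G e))"
    "(\<Sum>v\<in>V. p v * (\<Sum>e\<in>arcs G. f e * of_bool (head G e = v))) = (\<Sum>e\<in>arcs G. f e * p (head G e))"
    by simp_all
qed

lemma sum_po_tail_jump:
  assumes "k \<ge> 1"
  shows "(\<Sum>v\<in>V. po v * tail_jump k l v) =
    ((real k - 1 + \<delta>out) * edge_count (k - 1) l G - (real k + \<delta>out) * edge_count k l G) / No"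
proof -
  have S: "Suc d = k \<longleftrightarrow> d = k - 1" for d using assms by auto
  have "(\<Sum>v\<in>V. po v * tail_jump k l v) = (\<Sum>e\<in>arcs G. (real (od (tail G e)) + \<delta>out) / No
      * ((nonloop e * of_bool (ind (head G e) = l)) * deg_jump k (od (tail G e))))"
    unfolding tail_jump_def sum_at_tail by (intro sum.cong) (auto simp: po_def)
  also have "\<dots> = ((real k - 1 + \<delta>out) * edge_count (k - 1) l G - (real k + \<delta>out) * edge_count k l G) / No"
    by (subst sum_weight_jump) (simp_all add: edge_count_def nonloop_def S mult_ac)
  finally show ?thesis .
qed

lemma sum_pn_head_jump:
  assumes "l \<ge> 1"
  shows "(\<Sum>w\<in>V. pn w * head_jump k l w) =
    ((real l - 1 + \<delta>in) * edge_count k (l - 1) G - (real l + \<delta>in) * edge_count k l G) / Ni"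
proof -
  have S: "Suc d = l \<longleftrightarrow> d = l - 1" for d using assms by auto
  have "(\<Sum>w\<in>V. pn w * head_jump k l w) = (\<Sum>e\<in>arcs G. (real (ind (head G e)) + \<delta>in) / Ni
      * ((nonloop e * of_bool (od (tail G e) = k)) * deg_jump l (ind (head G e))))"
    unfolding head_jump_def sum_at_head by (intro sum.cong) (auto simp: pn_def)
  also have "\<dots> = ((real l - 1 + \<delta>in) * edge_count k (l - 1) G - (real l + \<delta>in) * edge_count k l G) / Ni"
    by (subst sum_weight_jump) (simp_all add: edge_count_def nonloop_def S mult_ac)
  finally show ?thesis .
qed

lemma sum_po_hit: "k \<ge> 1 \<Longrightarrow> (\<Sum>v\<in>V. po v * of_bool (Suc (od v) = k)) = (real k - 1 + \<delta>out) * count_deg od (k - 1) V / No"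
  and sum_pn_hit: "l \<ge> 1 \<Longrightarrow> (\<Sum>v\<in>V. pn v * of_bool (Suc (ind v) = l)) = (real l - 1 + \<delta>in) * count_deg ind (l - 1) V / Ni"
  unfolding po_def pn_def count_deg_def sum_distrib_left sum_divide_distrib
  by (intro sum.cong; auto)+

end

text \<open>With at least one edge, error bounds with denominator \<open>tm\<close> make
  sense.\<close>

locale pref_graph_arcs = pref_graph +
  assumes arcs_pos: "card (arcs G) \<ge> 1"
begin

lemma tm_pos: "tm \<ge> 1"
  using arcs_pos by simp

text \<open>A vertex of large degree may be chosen with probability of order 1, but a jump into or
  out of degree \<open>k\<close> only happens at degree at most \<open>k\<close>, where the
  probability is O(1/tm).\<close>

lemma po_jump_bound: "po v * \<bar>deg_jump k (od v)\<bar> \<le> (real k + \<delta>out) / tm"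
  and pn_jump_bound: "pn v * \<bar>deg_jump k (ind v)\<bar> \<le> (real k + \<delta>in) / tm"
  and pn_hit_bound: "pn v * of_bool (Suc (ind v) = k) \<le> (real k + \<delta>in) / tm"
proof -
  have "(real d + \<delta>) / N * \<bar>deg_jump k d\<bar> \<le> (real k + \<delta>) / tm \<and>
      (real d + \<delta>) / N * of_bool (Suc d = k) \<le> (real k + \<delta>) / tm"
    if "\<delta> > 0" "tm \<le> N" for \<delta> N d
  proof (cases "d \<le> k")
    case True
    have le: "(real d + \<delta>) / N \<le> (real k + \<delta>) / tm"
      using that True tm_pos by (intro frac_le) auto
    have "0 \<le> (real d + \<delta>) / N" using that tm_pos by simp
    then have "(real d + \<delta>) / N * \<bar>deg_jump k d\<bar> \<le> (real d + \<delta>) / N"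
      "(real d + \<delta>) / N * of_bool (Suc d = k) \<le> (real d + \<delta>) / N"
      by (intro mult_left_le; simp add: abs_deg_jump)+
    then show ?thesis using le by (intro conjI) (erule order_trans, assumption)+
  next
    case False
    then have "deg_jump k d = 0" "Suc d \<noteq> k" by (auto simp: deg_jump_def)
    then show ?thesis using that tm_pos by simp
  qed
  from this[of \<delta>out No "od v"] this[of \<delta>in Ni "ind v"] show "po v * \<bar>deg_jump k (od v)\<bar> \<le> (real k + \<delta>out) / tm"
    "pn v * \<bar>deg_jump k (ind v)\<bar> \<le> (real k + \<delta>in) / tm"
    "pn v * of_bool (Suc (ind v) = k) \<le> (real k + \<delta>in) / tm"
    using params No_ge Ni_ge unfolding po_def pn_def by simp_all
qed

text \<open>There are \<open>tm\<close> edges, and both ends of a given one are hit with a change of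
  indicator with probability O(1/tm^2); simultaneous changes therefore contribute only
  O(1/tm).\<close>

lemma sum_both_jump: "\<bar>\<Sum>v\<in>V. po v * (\<Sum>w\<in>V. pn w * both_jump k l v w)\<bar> \<le> (real k + \<delta>out) * (real l + \<delta>in) / tm"
proof -
  let ?j = "\<lambda>e. deg_jump k (od (tail G e))" and ?i = "\<lambda>e. deg_jump l (ind (head G e))"
  have 1: "(\<Sum>w\<in>V. pn w * both_jump k l v w)
      = (\<Sum>e\<in>arcs G. (nonloop e * ?j e * ?i e * pn (head G e)) * of_bool (tail G e = v))" for v
    unfolding both_jump_def by (subst sum_at_head) (intro sum.cong refl, simp only: mult_ac)
  have "\<bar>\<Sum>v\<in>V. po v * (\<Sum>w\<in>V. pn w * both_jump k l v w)\<bar>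
      = \<bar>\<Sum>e\<in>arcs G. (nonloop e * ?j e * ?i e * pn (head G e)) * po (tail G e)\<bar>"
    by (simp only: 1) (rule arg_cong[OF sum_at_tail])
  also have "\<dots> \<le> (\<Sum>e\<in>arcs G. \<bar>(nonloop e * ?j e * ?i e * pn (head G e)) * po (tail G e)\<bar>)"
    by (rule sum_abs)
  also have "\<dots> \<le> (\<Sum>e\<in>arcs G. ((real k + \<delta>out) / tm) * ((real l + \<delta>in) / tm))"
  proof (rule sum_mono)
    fix e
    have nl: "\<bar>nonloop e\<bar> = nonloop e" "nonloop e \<le> 1" by (simp_all add: nonloop_def)
    have j: "0 \<le> (po (tail G e) * \<bar>?j e\<bar>) * (pn (head G e) * \<bar>?i e\<bar>)"
      by (intro mult_nonneg_nonneg po_nonneg pn_nonneg abs_ge_zero)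
    have "0 \<le> pn (head G e) * \<bar>?i e\<bar>" by (intro mult_nonneg_nonneg pn_nonneg abs_ge_zero)
    moreover have "0 \<le> (real k + \<delta>out) / tm" using params by (intro divide_nonneg_nonneg) auto
    ultimately
    have jj: "(po (tail G e) * \<bar>?j e\<bar>) * (pn (head G e) * \<bar>?i e\<bar>) \<le> ((real k + \<delta>out) / tm) * ((real l + \<delta>in) / tm)"
      by (intro mult_mono po_jump_bound pn_jump_bound)
    have "\<bar>(nonloop e * ?j e * ?i e * pn (head G e)) * po (tail G e)\<bar>
        = nonloop e * ((po (tail G e) * \<bar>?j e\<bar>) * (pn (head G e) * \<bar>?i e\<bar>))"
      by (simp only: abs_mult abs_of_nonneg[OF po_nonneg] abs_of_nonneg[OF pn_nonneg] nl mult_ac)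
    also have "\<dots> \<le> 1 * (((real k + \<delta>out) / tm) * ((real l + \<delta>in) / tm))"
      by (rule mult_mono[OF nl(2) jj]) (use j in simp_all)
    finally show "\<bar>(nonloop e * ?j e * ?i e * pn (head G e)) * po (tail G e)\<bar>
      \<le> ((real k + \<delta>out) / tm) * ((real l + \<delta>in) / tm)" by simp
  qed
  also have "\<dots> = tm * (((real k + \<delta>out) / tm) * ((real l + \<delta>in) / tm))" by (simp only: sum_constant)
  also have "\<dots> = (real k + \<delta>out) * (real l + \<delta>in) / tm"
  proof -
    have "T * ((x / T) * (y / T)) = x * y / T" if "T \<ge> 1" for T x y :: real using that by simp
    then show ?thesis using tm_pos .
  qed
  finally show ?thesis .
qed

text \<open>The endpoints are chosen independently, so the sum would factorise exactly if loops
  counted. Excluding them removes the diagonal terms, whose total is O(1/tm).\<close>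

lemma sum_new_edge: "\<bar>(\<Sum>v\<in>V. po v * (\<Sum>w\<in>V. pn w * new_edge k l v w))
    - (\<Sum>v\<in>V. po v * of_bool (Suc (od v) = k)) * (\<Sum>w\<in>V. pn w * of_bool (Suc (ind w) = l))\<bar>
  \<le> (real l + \<delta>in) / tm"
proof -
  let ?p = "\<lambda>v. po v * of_bool (Suc (od v) = k)" and ?q = "\<lambda>w. pn w * of_bool (Suc (ind w) = l)"
  have 1: "(\<Sum>w\<in>V. pn w * new_edge k l v w) = of_bool (Suc (od v) = k) * ((\<Sum>w\<in>V. ?q w) - ?q v)" if "v \<in> V" for v
  proof -
    have "(\<Sum>w\<in>V. pn w * new_edge k l v w) = (\<Sum>w\<in>V - {v}. of_bool (Suc (od v) = k) * ?q w)"
      by (intro sum.mono_neutral_cong_right) (auto simp: new_edge_def)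
    also have "\<dots> = of_bool (Suc (od v) = k) * ((\<Sum>w\<in>V. ?q w) - ?q v)"
      unfolding sum_distrib_left[symmetric] using that by (subst sum_diff1) auto
    finally show ?thesis .
  qed
  have "(\<Sum>v\<in>V. po v * (\<Sum>w\<in>V. pn w * new_edge k l v w)) = (\<Sum>v\<in>V. ?p v * (\<Sum>w\<in>V. ?q w) - ?p v * ?q v)"
    by (intro sum.cong) (auto simp: 1 algebra_simps)
  also have "\<dots> = (\<Sum>v\<in>V. ?p v) * (\<Sum>w\<in>V. ?q w) - (\<Sum>v\<in>V. ?p v * ?q v)"
    by (simp only: sum_subtractf sum_distrib_right)
  finally have eq: "(\<Sum>v\<in>V. po v * (\<Sum>w\<in>V. pn w * new_edge k l v w))
    - (\<Sum>v\<in>V. ?p v) * (\<Sum>w\<in>V. ?q w) = - (\<Sum>v\<in>V. ?p v * ?q v)" by simp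
  have "(\<Sum>v\<in>V. ?p v * ?q v) \<le> (\<Sum>v\<in>V. po v * ((real l + \<delta>in) / tm))"
  proof (rule sum_mono)
    fix v
    have "?p v * ?q v \<le> po v * ?q v"
      using po_nonneg pn_nonneg by (intro mult_right_mono mult_left_le) auto
    also have "\<dots> \<le> po v * ((real l + \<delta>in) / tm)"
      using pn_hit_bound po_nonneg by (intro mult_left_mono) auto
    finally show "?p v * ?q v \<le> po v * ((real l + \<delta>in) / tm)" .
  qed
  also have "\<dots> = (real l + \<delta>in) / tm" by (rule sum_po_const)
  moreover have "0 \<le> (\<Sum>v\<in>V. ?p v * ?q v)" using po_nonneg pn_nonneg by (intro sum_nonneg) auto
  ultimately show ?thesis unfolding eq by simp
qed

text \<open>The drift up to O(1/t): degree changes at tails and at heads, then new edges from a new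
  vertex, to a new vertex and between old vertices. A new tail has out-degree 1 and a new head
  in-degree 1, whence the conditions k = 1 and l = 1.\<close>

definition "edge_drift k l =
  (\<beta> + \<gamma>) * (((real k - 1 + \<delta>out) * edge_count (k - 1) l G - (real k + \<delta>out) * edge_count k l G) / No)
  + (\<alpha> + \<beta>) * (((real l - 1 + \<delta>in) * edge_count k (l - 1) G - (real l + \<delta>in) * edge_count k l G) / Ni)
  + \<alpha> * of_bool (k = 1) * ((real l - 1 + \<delta>in) * count_deg ind (l - 1) V / Ni)
  + \<gamma> * of_bool (l = 1) * ((real k - 1 + \<delta>out) * count_deg od (k - 1) V / No)
  + \<beta> * (((real k - 1 + \<delta>out) * count_deg od (k - 1) V / No) * ((real l - 1 + \<delta>in) * count_deg ind (l - 1) V / Ni))"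

lemma drift_edges:
  assumes kl: "k \<ge> 1" "l \<ge> 1"
  shows "\<bar>measure_pmf.expectation (step \<alpha> \<beta> \<gamma> \<delta>in \<delta>out G) (edge_count k l) - edge_count k l G - edge_drift k l\<bar>
    \<le> ((real k + \<delta>out) * (real l + \<delta>in) + (real l + \<delta>in)) / tm"
proof -
  let ?N = "edge_count k l G"
  let ?R3 = "\<Sum>v\<in>V. po v * (\<Sum>w\<in>V. pn w * both_jump k l v w)"
  let ?R4 = "\<Sum>v\<in>V. po v * (\<Sum>w\<in>V. pn w * new_edge k l v w)"
  have 1: "edge_count k l (ins fr w) = ?N + (head_jump k l w + of_bool (k = 1) * of_bool (Suc (ind w) = l))" if "w \<in> V" for w
    using that fr by (auto simp: edge_count_ins jumps_fresh new_edge_def deg_outside[OF fr])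
  have 2: "edge_count k l (ins v fr) = ?N + (tail_jump k l v + of_bool (l = 1) * of_bool (Suc (od v) = k))" if "v \<in> V" for v
    using that fr by (auto simp: edge_count_ins jumps_fresh new_edge_def deg_outside[OF fr])
  have A: "(\<Sum>w\<in>V. pn w * edge_count k l (ins fr w))
      = ?N + (\<Sum>w\<in>V. pn w * head_jump k l w) + of_bool (k = 1) * (\<Sum>w\<in>V. pn w * of_bool (Suc (ind w) = l))"
    by (simp only: 1 sum_pn_add cong: sum.cong)
      (simp only: distrib_left sum.distrib sum_distrib_left mult.left_commute add.assoc)
  have C: "(\<Sum>v\<in>V. po v * edge_count k l (ins v fr))
      = ?N + (\<Sum>v\<in>V. po v * tail_jump k l v) + of_bool (l = 1) * (\<Sum>v\<in>V. po v * of_bool (Suc (od v) = k))"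
    by (simp only: 2 sum_po_add cong: sum.cong)
      (simp only: distrib_left sum.distrib sum_distrib_left mult.left_commute add.assoc)
  have "(\<Sum>w\<in>V. pn w * edge_count k l (ins v w)) = (?N + tail_jump k l v) + (\<Sum>w\<in>V. pn w * head_jump k l w)
      + (\<Sum>w\<in>V. pn w * both_jump k l v w) + (\<Sum>w\<in>V. pn w * new_edge k l v w)" for v
    unfolding edge_count_ins by (simp only: distrib_left sum.distrib sum_pn_const add.assoc)
  then have B: "(\<Sum>v\<in>V. po v * (\<Sum>w\<in>V. pn w * edge_count k l (ins v w)))
      = ?N + (\<Sum>v\<in>V. po v * tail_jump k l v) + (\<Sum>w\<in>V. pn w * head_jump k l w) + ?R3 + ?R4"
    by (simp only: distrib_left sum.distrib sum_po_const add.assoc)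
  have \<beta>: "\<beta> \<ge> 0" "\<beta> \<le> 1" using params by simp_all
  have "\<alpha> * ?N + \<beta> * ?N + \<gamma> * ?N = (\<alpha> + \<beta> + \<gamma>) * ?N" by (simp only: distrib_right)
  then have N: "\<alpha> * ?N + \<beta> * ?N + \<gamma> * ?N = ?N" using params by simp
  have "measure_pmf.expectation (step \<alpha> \<beta> \<gamma> \<delta>in \<delta>out G) (edge_count k l) - ?N - edge_drift k l =
    \<beta> * (?R3 + (?R4 - (\<Sum>v\<in>V. po v * of_bool (Suc (od v) = k)) * (\<Sum>w\<in>V. pn w * of_bool (Suc (ind w) = l))))"
    unfolding expectation_step A B C edge_drift_def
      sum_po_tail_jump[OF kl(1), symmetric] sum_pn_head_jump[OF kl(2), symmetric]
      sum_po_hit[OF kl(1), symmetric] sum_pn_hit[OF kl(2), symmetric]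
    using N by (simp add: algebra_simps)
  also have "\<bar>\<dots>\<bar> \<le> 1 * ((real k + \<delta>out) * (real l + \<delta>in) / tm + (real l + \<delta>in) / tm)"
    unfolding abs_mult using \<beta> sum_both_jump sum_new_edge
    by (intro mult_mono order_trans[OF abs_triangle_ineq] add_mono) auto
  finally show ?thesis by (simp add: add_divide_distrib)
qed

text \<open>As many edges leave \<open>v\<close> as its out-degree d, but the jump vanishes unless d
  is k - 1 or k. One step thus changes the edge count by an amount bounded in terms of
  \<open>k\<close> and \<open>l\<close>, however large the degrees of other vertices are.\<close>

lemma incident_jump_bound:
  "(\<Sum>e\<in>arcs G. of_bool (tail G e = v) * \<bar>deg_jump k (od (tail G e))\<bar>) \<le> real k"
  "(\<Sum>e\<in>arcs G. of_bool (head G e = v) * \<bar>deg_jump k (ind (head G e))\<bar>) \<le> real k"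
proof -
  have j: "real d * \<bar>deg_jump k d\<bar> \<le> real k" for d by (auto simp: deg_jump_def)
  have "(\<Sum>e\<in>arcs G. of_bool (tail G e = v) * \<bar>deg_jump k (od (tail G e))\<bar>)
      = (\<Sum>e\<in>arcs G. of_bool (tail G e = v)) * \<bar>deg_jump k (od v)\<bar>"
    unfolding sum_distrib_right by (intro sum.cong) auto
  also have "(\<Sum>e\<in>arcs G. of_bool (tail G e = v)) = real (od v)"
    by (simp add: sum_of_bool_eq out_degree_def out_arcs_def Int_def)
  finally show "(\<Sum>e\<in>arcs G. of_bool (tail G e = v) * \<bar>deg_jump k (od (tail G e))\<bar>) \<le> real k"
    by (simp only: j)
  have "(\<Sum>e\<in>arcs G. of_bool (head G e = v) * \<bar>deg_jump k (ind (head G e))\<bar>)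
      = (\<Sum>e\<in>arcs G. of_bool (head G e = v)) * \<bar>deg_jump k (ind v)\<bar>"
    unfolding sum_distrib_right by (intro sum.cong) auto
  also have "(\<Sum>e\<in>arcs G. of_bool (head G e = v)) = real (ind v)"
    by (simp add: sum_of_bool_eq in_degree_def in_arcs_def Int_def)
  finally show "(\<Sum>e\<in>arcs G. of_bool (head G e = v) * \<bar>deg_jump k (ind (head G e))\<bar>) \<le> real k"
    by (simp only: j)
qed

lemma increment_edges: "\<bar>edge_count k l (ins v w) - edge_count k l G\<bar> \<le> 2 * real k + real l + 1"
proof -
  let ?t = "\<lambda>e. of_bool (tail G e = v) * \<bar>deg_jump k (od (tail G e))\<bar>"
  let ?h = "\<lambda>e. of_bool (head G e = w) * \<bar>deg_jump l (ind (head G e))\<bar>"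
  have "\<bar>tail_jump k l v\<bar> \<le> (\<Sum>e\<in>arcs G. ?t e)"
    unfolding tail_jump_def by (rule order_trans[OF sum_abs sum_mono]) (auto simp: abs_mult nonloop_def)
  moreover have "\<bar>head_jump k l w\<bar> \<le> (\<Sum>e\<in>arcs G. ?h e)"
    unfolding head_jump_def by (rule order_trans[OF sum_abs sum_mono]) (auto simp: abs_mult nonloop_def)
  moreover have "\<bar>both_jump k l v w\<bar> \<le> (\<Sum>e\<in>arcs G. ?t e)"
    unfolding both_jump_def using abs_deg_jump
    by (intro order_trans[OF sum_abs sum_mono]) (auto simp: abs_mult nonloop_def intro!: mult_left_le)
  moreover have "\<bar>new_edge k l v w\<bar> \<le> 1" by (simp add: new_edge_def)
  ultimately show ?thesis
    using incident_jump_bound(1)[of v k] incident_jump_bound(2)[of w l] unfolding edge_count_ins by linarith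
qed

lemma increment_step:
  assumes "H \<in> set_pmf (step \<alpha> \<beta> \<gamma> \<delta>in \<delta>out G)"
  shows "\<bar>edge_count k l H - edge_count k l G\<bar> \<le> 2 * real k + real l + 1"
    "\<bar>count_deg (out_degree H) k (verts H) - count_deg od k V\<bar> \<le> 2"
    "\<bar>count_deg (in_degree H) k (verts H) - count_deg ind k V\<bar> \<le> 2"
    "\<bar>real (card (verts H)) - real (card V)\<bar> \<le> 1"
proof -
  have j: "\<bar>deg_jump k d\<bar> \<le> 2" "\<bar>of_bool b + deg_jump k d\<bar> \<le> 2" for d b
    by (auto simp: deg_jump_def)
  show "\<bar>edge_count k l H - edge_count k l G\<bar> \<le> 2 * real k + real l + 1"
    by (rule set_step[OF assms]) (simp_all only: increment_edges)
  show "\<bar>count_deg (out_degree H) k (verts H) - count_deg od k V\<bar> \<le> 2"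
    by (rule set_step[OF assms]; simp add: count_out_ins j)
  show "\<bar>count_deg (in_degree H) k (verts H) - count_deg ind k V\<bar> \<le> 2"
    by (rule set_step[OF assms]; simp add: count_in_ins j)
  show "\<bar>real (card (verts H)) - real (card V)\<bar> \<le> 1"
    by (rule set_step[OF assms]) (simp_all add: card_verts_ins)
qed

end

subsection \<open>Linear growth of the expected number of edges\<close>

locale pref_process =
  fixes \<alpha> \<beta> \<gamma> \<delta>in \<delta>out :: real and G0 :: multigraph
  assumes params: "\<alpha> > 0" "\<beta> > 0" "\<gamma> > 0" "\<alpha> + \<beta> + \<gamma> = 1" "\<delta>in > 0" "\<delta>out > 0"
    and init: "initial_graph \<delta>in \<delta>out G0"
begin

abbreviation "M \<equiv> random_graph \<alpha> \<beta> \<gamma> \<delta>in \<delta>out G0"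
abbreviation "S \<equiv> step \<alpha> \<beta> \<gamma> \<delta>in \<delta>out"
text \<open>With both \<delta> positive the initial graph may have no edge; the analysis then starts
  at time 1.\<close>

definition "T = max 1 (card (arcs G0))"

lemma T_leD: "t \<ge> T \<Longrightarrow> t \<ge> 1" "t \<ge> T \<Longrightarrow> t \<ge> card (arcs G0)"
  by (simp_all add: T_def)

lemma M_Suc: "t \<ge> card (arcs G0) \<Longrightarrow> M (Suc t) = bind_pmf (M t) S"
  by (simp add: random_graph_def Suc_diff_le)

lemma supp_M:
  assumes "t \<ge> card (arcs G0)" "G \<in> set_pmf (M t)"
  shows "initial_graph \<delta>in \<delta>out G" "card (arcs G) = t"
  using random_graph_invariant[OF _ _ _ params(4) init assms] params by auto

lemma supp_pref_graph: "t \<ge> card (arcs G0) \<Longrightarrow> G \<in> set_pmf (M t) \<Longrightarrow> pref_graph \<alpha> \<beta> \<gamma> \<delta>in \<delta>out G"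
  using supp_M(1) params by unfold_locales auto

lemma supp_pref_graph_arcs: "t \<ge> T \<Longrightarrow> G \<in> set_pmf (M t) \<Longrightarrow> pref_graph_arcs \<alpha> \<beta> \<gamma> \<delta>in \<delta>out G"
  using supp_M[of t G] T_leD[of t] params by unfold_locales auto

lemma finite_supp: "t \<ge> card (arcs G0) \<Longrightarrow> finite (set_pmf (M t))"
proof (induction t rule: dec_induct)
  case base
  show ?case by (simp add: random_graph_def)
next
  case (step t)
  then show ?case using pref_graph.finite_step[OF supp_pref_graph] by (simp add: M_Suc)
qed

sublocale finite_markov_chain M S T
proof
  show "finite (set_pmf (M t))" if "t \<ge> T" for t using finite_supp T_leD(2)[OF that] .
  show "finite (set_pmf (S G))" if "t \<ge> T" "G \<in> set_pmf (M t)" for t G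
    using pref_graph.finite_step[OF supp_pref_graph[OF T_leD(2)]] that .
  show "M (Suc t) = bind_pmf (M t) S" if "t \<ge> T" for t using M_Suc T_leD(2)[OF that] .
  show "T \<ge> 1" by (simp add: T_def)
qed

definition "P = 1 + \<delta>in * (\<alpha> + \<gamma>)"
definition "Q = 1 + \<delta>out * (\<alpha> + \<gamma>)"
text \<open>The numerators are 1 - \<gamma> and 1 - \<alpha>. To leading order a vertex of in-degree
  d gains an incoming edge with probability a (d + \<delta>in) / t, so that in-degrees grow like
  t^a; likewise out-degrees like t^b.\<close>

definition "a = (\<alpha> + \<beta>) / P"
definition "b = (\<beta> + \<gamma>) / Q"

lemma PQ_pos: "P > 0" "Q > 0" "a > 0" "b > 0"
proof -
  show "P > 0" "Q > 0" using params unfolding P_def Q_def by (simp_all add: add_pos_pos)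
  then show "a > 0" "b > 0" using params by (simp_all add: a_def b_def)
qed

text \<open>The drift of the vertex number is constant, so this is the undamped case l = 0 of
  \<open>conc_drift'\<close>.\<close>

lemma conc_verts: "conc (\<lambda>t G. real (card (verts G)) / real t) (\<alpha> + \<gamma>)"
proof -
  have "conc (\<lambda>t G. real (card (verts G)) / real t) ((\<alpha> + \<gamma>) / (1 + 0))"
  proof (rule conc_drift'[where w = "\<lambda>_ _. \<alpha> + \<gamma>" and g = "\<lambda>_ _. 0" and K = 1])
    fix t G assume tG: "t \<ge> T" "G \<in> set_pmf (M t)"
    interpret pref_graph_arcs \<alpha> \<beta> \<gamma> \<delta>in \<delta>out G using tG by (rule supp_pref_graph_arcs)
    show "measure_pmf.expectation (S G) (\<lambda>G. real (card (verts G))) = real (card V) + (\<alpha> + \<gamma>) - 0 * (real (card V) / real t)"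
      using drift_verts by simp
    show "\<bar>real (card (verts H)) - real (card V)\<bar> \<le> 1" if "H \<in> set_pmf (S G)" for H
      using increment_step(4)[OF that] .
  qed (simp_all add: conc_const)
  then show ?thesis by simp
qed

text \<open>The random factor t / \<open>No\<close>, which carries all randomness of the
  normalisation.\<close>

definition inv_out :: "nat \<Rightarrow> multigraph \<Rightarrow> real" where "inv_out t G = 1 / (1 + \<delta>out * (real (card (verts G)) / real t))"
definition inv_in :: "nat \<Rightarrow> multigraph \<Rightarrow> real" where "inv_in t G = 1 / (1 + \<delta>in * (real (card (verts G)) / real t))"

lemma conc_inv: "conc inv_out (1 / Q)" "conc inv_in (1 / P)"
proof -
  have "conc (\<lambda>t G. 1 + \<delta> * (real (card (verts G)) / real t)) (1 + \<delta> * (\<alpha> + \<gamma>))" for \<delta>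
    by (intro conc_add conc_const conc_cmult conc_verts)
  then have "conc (\<lambda>t G. 1 / (1 + \<delta> * (real (card (verts G)) / real t))) (1 / (1 + \<delta> * (\<alpha> + \<gamma>)))"
    if "\<delta> > 0" for \<delta>
    using that params by (intro conc_inverse[where \<epsilon> = 1]) (auto simp: add_pos_pos add_nonneg_eq_0_iff)
  from this[OF params(5)] this[OF params(6)] show "conc inv_out (1 / Q)" "conc inv_in (1 / P)"
    unfolding inv_out_def inv_in_def P_def Q_def by simp_all
qed

lemma divide_No:
  assumes "t \<ge> T" "G \<in> set_pmf (M t)"
  shows "x / pref_graph.No \<delta>out G = inv_out t G * (x / real t)"
    "x / pref_graph.Ni \<delta>in G = inv_in t G * (x / real t)"
proof -
  interpret pref_graph_arcs \<alpha> \<beta> \<gamma> \<delta>in \<delta>out G using assms by (rule supp_pref_graph_arcs)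
  have t: "real t > 0" "tm = real t" using assms supp_M(2)[of t G] T_leD[of t] by auto
  have "No = real t * (1 + \<delta>out * (real (card V) / real t))" "Ni = real t * (1 + \<delta>in * (real (card V) / real t))"
    using t by (simp_all add: No_def Ni_def field_simps)
  then show "x / No = inv_out t G * (x / real t)" "x / Ni = inv_in t G * (x / real t)"
    by (simp_all add: inv_out_def inv_in_def)
qed

text \<open>The limits are only assumed to solve the recurrences, each of which is the equation (1 +
  l) m = c of \<open>conc_drift\<close> with the limiting drift inserted; explicit solutions are
  supplied later. They are unique, as every recurrence determines a value from those at smaller
  degrees.\<close>

context
  fixes \<nu>o \<nu>i :: "nat \<Rightarrow> real" and c :: "nat \<Rightarrow> nat \<Rightarrow> real"
  assumes \<nu>o: "\<And>k. (1 + b * (real k + \<delta>out)) * \<nu>o k =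
      b * (real k - 1 + \<delta>out) * (if k = 0 then 0 else \<nu>o (k - 1)) + \<alpha> * of_bool (k = 1) + \<gamma> * of_bool (k = 0)"
    and \<nu>i: "\<And>k. (1 + a * (real k + \<delta>in)) * \<nu>i k =
      a * (real k - 1 + \<delta>in) * (if k = 0 then 0 else \<nu>i (k - 1)) + \<gamma> * of_bool (k = 1) + \<alpha> * of_bool (k = 0)"
    and c_0: "\<And>k. c k 0 = 0" "\<And>l. c 0 l = 0"
    and c_rec: "\<And>k l. k \<ge> 1 \<Longrightarrow> l \<ge> 1 \<Longrightarrow> (1 + (b * (real k + \<delta>out) + a * (real l + \<delta>in))) * c k l =
      b * (real k - 1 + \<delta>out) * c (k - 1) l + a * (real l - 1 + \<delta>in) * c k (l - 1)
      + \<alpha> * of_bool (k = 1) * ((real l - 1 + \<delta>in) * \<nu>i (l - 1) / P)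
      + \<gamma> * of_bool (l = 1) * ((real k - 1 + \<delta>out) * \<nu>o (k - 1) / Q)
      + \<beta> * (((real k - 1 + \<delta>out) * \<nu>o (k - 1) / Q) * ((real l - 1 + \<delta>in) * \<nu>i (l - 1) / P))"
begin

lemma conc_out: "conc (\<lambda>t G. count_deg (out_degree G) k (verts G) / real t) (\<nu>o k)"
proof (induction k rule: less_induct)
  case IH: (less k)
  let ?N = "\<lambda>k G. count_deg (out_degree G) k (verts G)"
  let ?pr = "\<lambda>t G. (if k = 0 then 0 else ?N (k - 1) G) / real t"
  let ?pc = "if k = 0 then 0 else \<nu>o (k - 1)"
  have pr: "conc ?pr ?pc"
    using IH[of "k - 1"] conc_const[of 0] by (cases k) auto
  let ?w = "\<lambda>t G. (\<alpha> * of_bool (k = 1) + \<gamma> * of_bool (k = 0)) + (\<beta> + \<gamma>) * (real k - 1 + \<delta>out) * (inv_out t G * ?pr t G)"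
  let ?c = "(\<alpha> * of_bool (k = 1) + \<gamma> * of_bool (k = 0)) + (\<beta> + \<gamma>) * (real k - 1 + \<delta>out) * (1 / Q * ?pc)"
  let ?g = "\<lambda>t G. (\<beta> + \<gamma>) * (real k + \<delta>out) * inv_out t G"
  let ?l = "(\<beta> + \<gamma>) * (real k + \<delta>out) * (1 / Q)"
  have "?l > 0" using params PQ_pos by simp
  have "conc (\<lambda>t G. ?N k G / real t) (?c / (1 + ?l))"
  proof (rule conc_drift'[where w = ?w and g = ?g and K = 2])
    fix t G assume tG: "t \<ge> T" "G \<in> set_pmf (M t)"
    interpret pref_graph_arcs \<alpha> \<beta> \<gamma> \<delta>in \<delta>out G using tG by (rule supp_pref_graph_arcs)
    show "\<bar>?N k H - ?N k G\<bar> \<le> 2" if "H \<in> set_pmf (S G)" for H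
      using increment_step(2)[OF that] .
    show "measure_pmf.expectation (S G) (?N k) = ?N k G + ?w t G - ?g t G * (?N k G / real t)"
      unfolding drift_out divide_No[OF tG] count_pred_def by (simp add: divide_inverse algebra_simps)
  next
    show "conc ?w ?c" by (intro conc_add conc_cmult conc_mult conc_const conc_inv pr)
    show "conc ?g ?l" by (intro conc_cmult conc_inv)
  qed (use \<open>?l > 0\<close> in blast)
  also have "?c / (1 + ?l) = \<nu>o k"
  proof -
    have "1 + ?l = 1 + b * (real k + \<delta>out)" by (simp add: b_def)
    moreover have "?c = (1 + b * (real k + \<delta>out)) * \<nu>o k" unfolding \<nu>o by (simp add: b_def)
    ultimately show ?thesis using \<open>?l > 0\<close> by simp
  qed
  finally show ?case .
qed

lemma conc_in: "conc (\<lambda>t G. count_deg (in_degree G) k (verts G) / real t) (\<nu>i k)"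
proof (induction k rule: less_induct)
  case IH: (less k)
  let ?N = "\<lambda>k G. count_deg (in_degree G) k (verts G)"
  let ?pr = "\<lambda>t G. (if k = 0 then 0 else ?N (k - 1) G) / real t"
  let ?pc = "if k = 0 then 0 else \<nu>i (k - 1)"
  have pr: "conc ?pr ?pc"
    using IH[of "k - 1"] conc_const[of 0] by (cases k) auto
  let ?w = "\<lambda>t G. (\<gamma> * of_bool (k = 1) + \<alpha> * of_bool (k = 0)) + (\<alpha> + \<beta>) * (real k - 1 + \<delta>in) * (inv_in t G * ?pr t G)"
  let ?c = "(\<gamma> * of_bool (k = 1) + \<alpha> * of_bool (k = 0)) + (\<alpha> + \<beta>) * (real k - 1 + \<delta>in) * (1 / P * ?pc)"
  let ?g = "\<lambda>t G. (\<alpha> + \<beta>) * (real k + \<delta>in) * inv_in t G"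
  let ?l = "(\<alpha> + \<beta>) * (real k + \<delta>in) * (1 / P)"
  have "?l > 0" using params PQ_pos by simp
  have "conc (\<lambda>t G. ?N k G / real t) (?c / (1 + ?l))"
  proof (rule conc_drift'[where w = ?w and g = ?g and K = 2])
    fix t G assume tG: "t \<ge> T" "G \<in> set_pmf (M t)"
    interpret pref_graph_arcs \<alpha> \<beta> \<gamma> \<delta>in \<delta>out G using tG by (rule supp_pref_graph_arcs)
    show "\<bar>?N k H - ?N k G\<bar> \<le> 2" if "H \<in> set_pmf (S G)" for H
      using increment_step(3)[OF that] .
    show "measure_pmf.expectation (S G) (?N k) = ?N k G + ?w t G - ?g t G * (?N k G / real t)"
      unfolding drift_in divide_No[OF tG] count_pred_def by (simp add: divide_inverse algebra_simps)
  next
    show "conc ?w ?c" by (intro conc_add conc_cmult conc_mult conc_const conc_inv pr)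
    show "conc ?g ?l" by (intro conc_cmult conc_inv)
  qed (use \<open>?l > 0\<close> in blast)
  also have "?c / (1 + ?l) = \<nu>i k"
  proof -
    have "1 + ?l = 1 + a * (real k + \<delta>in)" by (simp add: a_def)
    moreover have "?c = (1 + a * (real k + \<delta>in)) * \<nu>i k" unfolding \<nu>i by (simp add: a_def)
    ultimately show ?thesis using \<open>?l > 0\<close> by simp
  qed
  finally show ?case .
qed

lemma conc_edges_step:
  assumes kl: "k \<ge> 1" "l \<ge> 1"
    and k': "conc (\<lambda>t G. edge_count (k - 1) l G / real t) (c (k - 1) l)"
    and l': "conc (\<lambda>t G. edge_count k (l - 1) G / real t) (c k (l - 1))"
  shows "conc (\<lambda>t G. edge_count k l G / real t) (c k l)"
proof -
  let ?No = "\<lambda>t G. count_deg (out_degree G) (k - 1) (verts G) / real t"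
  let ?Ni = "\<lambda>t G. count_deg (in_degree G) (l - 1) (verts G) / real t"
  \<comment> \<open>Simultaneous changes at both ends and excluded loops: by
    \<open>drift_edges\<close> a deterministic O(1/t).\<close>
  define r where "r t G = measure_pmf.expectation (S G) (edge_count k l) - edge_count k l G
    - pref_graph_arcs.edge_drift \<alpha> \<beta> \<gamma> \<delta>in \<delta>out G k l" for t :: nat and G
  have r: "conc r 0"
  proof (rule conc_small)
    fix t G assume tG: "t \<ge> T" "G \<in> set_pmf (M t)"
    interpret pref_graph_arcs \<alpha> \<beta> \<gamma> \<delta>in \<delta>out G using supp_pref_graph_arcs tG by simp
    show "\<bar>r t G - 0\<bar> \<le> ((real k + \<delta>out) * (real l + \<delta>in) + (real l + \<delta>in)) / real t"
      using drift_edges[OF kl] supp_M(2)[of t G] tG T_leD[of t] unfolding r_def by simp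
  qed
  let ?w = "\<lambda>t G. (((((\<beta> + \<gamma>) * (real k - 1 + \<delta>out)) * (inv_out t G * (edge_count (k - 1) l G / real t))
    + ((\<alpha> + \<beta>) * (real l - 1 + \<delta>in)) * (inv_in t G * (edge_count k (l - 1) G / real t)))
    + (\<alpha> * of_bool (k = 1) * (real l - 1 + \<delta>in)) * (inv_in t G * ?Ni t G))
    + (\<gamma> * of_bool (l = 1) * (real k - 1 + \<delta>out)) * (inv_out t G * ?No t G))
    + (\<beta> * (real k - 1 + \<delta>out) * (real l - 1 + \<delta>in)) * ((inv_out t G * ?No t G) * (inv_in t G * ?Ni t G)) + r t G"
  let ?c = "(((((\<beta> + \<gamma>) * (real k - 1 + \<delta>out)) * (1 / Q * c (k - 1) l)
    + ((\<alpha> + \<beta>) * (real l - 1 + \<delta>in)) * (1 / P * c k (l - 1)))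
    + (\<alpha> * of_bool (k = 1) * (real l - 1 + \<delta>in)) * (1 / P * \<nu>i (l - 1)))
    + (\<gamma> * of_bool (l = 1) * (real k - 1 + \<delta>out)) * (1 / Q * \<nu>o (k - 1)))
    + (\<beta> * (real k - 1 + \<delta>out) * (real l - 1 + \<delta>in)) * ((1 / Q * \<nu>o (k - 1)) * (1 / P * \<nu>i (l - 1))) + 0"
  let ?g = "\<lambda>t G. ((\<beta> + \<gamma>) * (real k + \<delta>out)) * inv_out t G + ((\<alpha> + \<beta>) * (real l + \<delta>in)) * inv_in t G"
  let ?l = "((\<beta> + \<gamma>) * (real k + \<delta>out)) * (1 / Q) + ((\<alpha> + \<beta>) * (real l + \<delta>in)) * (1 / P)"
  have "?l > 0" using params PQ_pos by (intro add_pos_pos) simp_all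
  have "conc (\<lambda>t G. edge_count k l G / real t) (?c / (1 + ?l))"
  proof (rule conc_drift'[where w = ?w and g = ?g and K = "2 * real k + real l + 1"])
    fix t G assume tG: "t \<ge> T" "G \<in> set_pmf (M t)"
    interpret pref_graph_arcs \<alpha> \<beta> \<gamma> \<delta>in \<delta>out G using tG by (rule supp_pref_graph_arcs)
    show "\<bar>edge_count k l H - edge_count k l G\<bar> \<le> 2 * real k + real l + 1" if "H \<in> set_pmf (S G)" for H
      using increment_step(1)[OF that] .
    have "measure_pmf.expectation (S G) (edge_count k l) = edge_count k l G + edge_drift k l + r t G"
      by (simp add: r_def)
    then show "measure_pmf.expectation (S G) (edge_count k l)
        = edge_count k l G + ?w t G - ?g t G * (edge_count k l G / real t)"
      unfolding edge_drift_def divide_No[OF tG] by (simp add: divide_inverse algebra_simps)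
  next
    show "conc ?w ?c" by (intro conc_add conc_cmult conc_mult conc_inv r k' l' conc_out conc_in)
    show "conc ?g ?l" by (intro conc_add conc_cmult conc_inv)
  qed (use \<open>?l > 0\<close> in blast)
  also have "?c / (1 + ?l) = c k l"
  proof -
    have "1 + ?l = 1 + (b * (real k + \<delta>out) + a * (real l + \<delta>in))" by (simp add: a_def b_def)
    moreover have "?c = (1 + (b * (real k + \<delta>out) + a * (real l + \<delta>in))) * c k l"
      unfolding c_rec[OF kl] by (simp add: a_def b_def divide_inverse mult_ac)
    ultimately show ?thesis using \<open>?l > 0\<close> by simp
  qed
  finally show ?thesis .
qed

lemma edge_count_0:
  assumes "t \<ge> T" "G \<in> set_pmf (M t)"
  shows "edge_count 0 l G = 0" "edge_count k 0 G = 0"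
proof -
  interpret pref_graph_arcs \<alpha> \<beta> \<gamma> \<delta>in \<delta>out G using assms by (rule supp_pref_graph_arcs)
  have "od (tail G e) \<noteq> 0" "ind (head G e) \<noteq> 0" if "e \<in> arcs G" for e
  proof -
    have "e \<in> out_arcs G (tail G e)" "e \<in> in_arcs G (head G e)" using that by auto
    then show "od (tail G e) \<noteq> 0" "ind (head G e) \<noteq> 0"
      by (auto simp: out_degree_def in_degree_def finite_out_arcs finite_in_arcs)
  qed
  then show "edge_count 0 l G = 0" "edge_count k 0 G = 0"
    unfolding edge_count_def by (intro sum.neutral ballI; simp)+
qed

text \<open>Induction over k + l, as the recurrence refers to (k - 1, l) and (k, l - 1). An edge has
  no end of degree 0, which settles the boundary.\<close>

lemma conc_edges: "conc (\<lambda>t G. edge_count k l G / real t) (c k l)"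
proof (induction "k + l" arbitrary: k l rule: less_induct)
  case less
  consider "k = 0" | "l = 0" | "k \<ge> 1" "l \<ge> 1" by linarith
  then show ?case
  proof cases
    case 1
    show ?thesis unfolding 1 c_0 by (rule conc_small[where K = 0]) (simp add: edge_count_0)
  next
    case 2
    show ?thesis unfolding 2 c_0 by (rule conc_small[where K = 0]) (simp add: edge_count_0)
  next
    case 3
    have "k - 1 + l < k + l" "k + (l - 1) < k + l" using 3 by simp_all
    from less[OF this(1)] less[OF this(2)] show ?thesis by (rule conc_edges_step[OF 3])
  qed
qed

lemma expected_num_edges:
  "\<exists>K. \<forall>t\<ge>card (arcs G0). \<bar>measure_pmf.expectation (M t) (\<lambda>G. real (num_edges k l G)) - c k l * real t\<bar> \<le> K"
proof -
  obtain K where K: "\<And>t. t \<ge> T \<Longrightarrow> \<bar>E t (edge_count k l) - c k l * real t\<bar> \<le> K"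
    using concD_linear[OF conc_edges] by blast
  let ?D = "\<lambda>t. \<bar>E t (\<lambda>G. real (num_edges k l G)) - c k l * real t\<bar>"
  \<comment> \<open>Time 0, which occurs if \<open>G0\<close> has no edge, is the only time below
    \<open>T\<close>; it costs a constant.\<close>
  have "?D t \<le> max K (?D 0)" if t: "t \<ge> card (arcs G0)" for t
  proof (cases "t = 0")
    case False
    then have T: "t \<ge> T" using t by (simp add: T_def)
    have "E t (\<lambda>G. real (num_edges k l G)) = E t (edge_count k l)"
    proof (rule pmf_integral_cong)
      fix G assume "G \<in> set_pmf (M t)"
      then interpret pref_graph \<alpha> \<beta> \<gamma> \<delta>in \<delta>out G using t by (intro supp_pref_graph)
      show "real (num_edges k l G) = edge_count k l G" by (simp add: edge_count_eq)
    qed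
    then show ?thesis using K[OF T] by simp
  qed simp
  then show ?thesis by blast
qed

end

end

subsection \<open>Incomplete beta functions\<close>

text \<open>The lemmas on it assume q > 1, which makes the integrand continuous at 0, so that no
  improper integral arises. For the degree processes this is ensured by 1/b > 1.\<close>

definition inc_beta :: "real \<Rightarrow> nat \<Rightarrow> real \<Rightarrow> real" where
  "inc_beta q m y = integral {0..y} (\<lambda>s. s powr (q - 1) * (1 - s) ^ m)"

lemma continuous_on_powr_nonneg:
  fixes A :: "real set"
  assumes "p > 0" "A \<subseteq> {0..}"
  shows "continuous_on A (\<lambda>s. s powr p)"
  using assms by (intro continuous_on_powr' continuous_intros) auto

lemma inc_beta_integrand_continuous: "q > 1 \<Longrightarrow> A \<subseteq> {0..} \<Longrightarrow> continuous_on A (\<lambda>s::real. s powr (q - 1) * (1 - s) ^ m)"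
  by (intro continuous_intros continuous_on_powr_nonneg) auto

lemma inc_beta_deriv_within:
  assumes "q > 1" "y \<in> {0..1}"
  shows "(inc_beta q m has_real_derivative y powr (q - 1) * (1 - y) ^ m) (at y within {0..1})"
  unfolding inc_beta_def
  using assms by (intro integral_has_real_derivative inc_beta_integrand_continuous) auto

lemma inc_beta_continuous: "q > 1 \<Longrightarrow> continuous_on {0..1} (inc_beta q m)"
  by (rule DERIV_continuous_on) (rule inc_beta_deriv_within)

text \<open>Integral of the derivative of s^q (1 - s)^m, with one factor s written as 1 - (1 - s).
  The step from m - 1 to m will be the step from degree k - 1 to k. At m = 0 the truncated m - 1 is
  harmless because of the factor \<open>real m\<close>.\<close>

lemma inc_beta_rec:
  assumes q: "q > 1" and y: "y \<in> {0..1}"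
  shows "y powr q * (1 - y) ^ m = (q + real m) * inc_beta q m y - real m * inc_beta q (m - 1) y"
proof -
  let ?f = "\<lambda>m s. s powr (q - 1) * (1 - s) ^ m"
  have int: "?f m integrable_on {0..y}" for m
    using q by (intro integrable_continuous_real inc_beta_integrand_continuous) auto
  have "((\<lambda>s. (q + real m) * ?f m s - real m * ?f (m - 1) s) has_integral
      (\<lambda>s. s powr q * (1 - s) ^ m) y - (\<lambda>s. s powr q * (1 - s) ^ m) 0) {0..y}"
  proof (rule fundamental_theorem_of_calculus_interior)
    show "continuous_on {0..y} (\<lambda>s. s powr q * (1 - s) ^ m)"
      using q by (intro continuous_intros continuous_on_powr_nonneg) auto
    fix s assume s: "s \<in> {0<..<y}"
    have "((\<lambda>s. s powr q * (1 - s) ^ m) has_real_derivative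
        q * s powr (q - 1) * (1 - s) ^ m - real m * (s powr q * (1 - s) ^ (m - 1))) (at s)"
      using s by (auto intro!: derivative_eq_intros)
    also have "q * s powr (q - 1) * (1 - s) ^ m - real m * (s powr q * (1 - s) ^ (m - 1))
        = (q + real m) * ?f m s - real m * ?f (m - 1) s"
    proof (cases m)
      case (Suc n)
      have "s powr q = s * s powr (q - 1)" using s by (simp add: powr_mult_base)
      then show ?thesis by (simp add: Suc algebra_simps)
    qed simp
    finally show "((\<lambda>s. s powr q * (1 - s) ^ m) has_vector_derivative
        (q + real m) * ?f m s - real m * ?f (m - 1) s) (at s)"
      by (simp add: has_real_derivative_iff_has_vector_derivative)
  qed (use y in auto)
  moreover have "((\<lambda>s. (q + real m) * ?f m s - real m * ?f (m - 1) s) has_integral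
      ((q + real m) * inc_beta q m y - real m * inc_beta q (m - 1) y)) {0..y}"
    unfolding inc_beta_def using int
    by (intro has_integral_diff has_integral_mult_right integrable_integral)
  ultimately have "(\<lambda>s. s powr q * (1 - s) ^ m) y - (\<lambda>s. s powr q * (1 - s) ^ m) 0
    = (q + real m) * inc_beta q m y - real m * inc_beta q (m - 1) y" by (rule has_integral_unique)
  then show ?thesis by simp
qed

lemma inc_beta_nonneg: "q > 1 \<Longrightarrow> y \<in> {0..1} \<Longrightarrow> 0 \<le> inc_beta q m y"
  unfolding inc_beta_def by (intro integral_nonneg integrable_continuous_real inc_beta_integrand_continuous) auto

lemma inc_beta_le:
  assumes "q > 1" "y \<in> {0..1}"
  shows "inc_beta q m y \<le> y powr q"
proof -
  have "inc_beta q m y \<le> inc_beta q 0 y"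
    unfolding inc_beta_def using assms
    by (intro integral_le integrable_continuous_real inc_beta_integrand_continuous)
      (auto intro!: mult_left_le power_le_one)
  also have "\<dots> \<le> q * inc_beta q 0 y"
    using inc_beta_nonneg[OF assms, of 0] assms by (simp add: mult_right_mono[of 1 q, simplified])
  also have "\<dots> = y powr q" using inc_beta_rec[OF assms, of 0] by simp
  finally show ?thesis .
qed

text \<open>The complete beta integral; it serves to express Gamma ratios at large arguments by an
  integral.\<close>

lemma inc_beta_one:
  assumes "q > 1"
  shows "inc_beta q m 1 = fact m * Gamma q / Gamma (q + real m + 1)"
proof (induction m)
  case 0
  have "Gamma q \<noteq> 0" using assms Gamma_real_pos[of q] by linarith
  moreover have "Gamma (q + 1) = q * Gamma q" using assms by (intro Gamma_plus1) (auto simp: nonpos_Ints_def)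
  ultimately have "Gamma q / Gamma (q + 1) = 1 / q" by simp
  moreover have "inc_beta q 0 1 = 1 / q"
    using inc_beta_rec[OF assms, of 1 0] assms by (simp add: eq_divide_eq mult.commute)
  ultimately show ?case by simp
next
  case (Suc m)
  have pos: "q + real (Suc m) > 0" using assms by simp
  have "(q + real (Suc m)) * inc_beta q (Suc m) 1 = real (Suc m) * inc_beta q m 1"
    using inc_beta_rec[OF assms, of 1 "Suc m"] by simp
  then have "inc_beta q (Suc m) 1 = real (Suc m) * inc_beta q m 1 / (q + real (Suc m))"
    using pos by (simp only: eq_divide_eq mult.commute) simp
  also have "\<dots> = real (Suc m) * fact m * Gamma q / ((q + real (Suc m)) * Gamma (q + real (Suc m)))"
    unfolding Suc.IH by (simp add: add_ac mult_ac)
  also have "(q + real (Suc m)) * Gamma (q + real (Suc m)) = Gamma (q + real (Suc m) + 1)"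
    using pos by (intro Gamma_plus1[symmetric]) (auto simp: nonpos_Ints_def)
  finally show ?case by (simp only: fact_Suc of_nat_mult of_nat_fact)
qed

subsection \<open>Birth and marking densities\<close>

text \<open>For k > i this is k - i times the negative binomial coefficient Gamma (k + \<delta>) /
  (Gamma (i + \<delta>) (k - i)!), the factor k - i counting the choices of the marked later edge.
  The sum over the degree at the arrival of that edge collapses by the binomial theorem, so its
  arrival time enters only through a power. For k \<le> i the truncated difference would give the
  factorial 1, hence the explicit 0.\<close>

definition yule_coeff :: "real \<Rightarrow> nat \<Rightarrow> nat \<Rightarrow> real" where
  "yule_coeff \<delta> i k = (if k \<le> i then 0 else Gamma (real k + \<delta>) / (Gamma (real i + \<delta>) * fact (k - 1 - i)))"

text \<open>A vertex enters with degree \<open>i\<close> and its degree grows as a Yule process with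
  immigration, time being measured by the logarithm of the number of edges. \<open>yule_dens\<close> is the density, at birth time
  \<open>u\<close>, of pairs of such a vertex of final degree \<open>k\<close> and one of its later edges, up to the powers
  of the arrival time of that edge, and \<open>yule_cum\<close> is its primitive.\<close>

definition yule_dens :: "real \<Rightarrow> real \<Rightarrow> nat \<Rightarrow> nat \<Rightarrow> real \<Rightarrow> real" where
  "yule_dens b \<delta> i k u = yule_coeff \<delta> i k * (u powr (b * (real i + \<delta>)) * (1 - u powr b) ^ (k - 1 - i))"

definition yule_cum :: "real \<Rightarrow> real \<Rightarrow> nat \<Rightarrow> nat \<Rightarrow> real \<Rightarrow> real" where
  "yule_cum b \<delta> i k u = yule_coeff \<delta> i k / b * inc_beta (real i + \<delta> + 1 / b) (k - 1 - i) (u powr b)"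

text \<open>For k \<le> i + 1 both sides vanish, the left one by the truncated difference, the right
  one by the convention in \<open>yule_coeff\<close>.\<close>

lemma yule_coeff_rec:
  assumes "\<delta> > 0"
  shows "real (k - 1 - i) * yule_coeff \<delta> i k = (real k - 1 + \<delta>) * yule_coeff \<delta> i (k - 1)"
proof (cases "k \<le> i + 1")
  case True
  then show ?thesis by (auto simp: yule_coeff_def)
next
  case False
  define n where "n = k - 2 - i"
  have idx: "k - 1 - i = Suc n" "k - 1 - 1 - i = n" "\<not> k \<le> i" "\<not> k - 1 \<le> i" using False by (auto simp: n_def)
  have "Gamma ((real k - 1 + \<delta>) + 1) = (real k - 1 + \<delta>) * Gamma (real k - 1 + \<delta>)"
    using assms False by (intro Gamma_plus1) (auto simp: nonpos_Ints_def)
  then have G: "Gamma (real k + \<delta>) = (real k - 1 + \<delta>) * Gamma (real k - 1 + \<delta>)" by simp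
  have K: "real (k - 1) = real k - 1" using False by simp
  show ?thesis unfolding yule_coeff_def idx fact_Suc K
    using idx G by (simp add: field_simps del: of_nat_Suc)
qed

locale yule =
  fixes b \<delta> :: real
  assumes b: "0 < b" "b < 1" and \<delta>: "\<delta> > 0"
begin

abbreviation "dens \<equiv> yule_dens b \<delta>"
abbreviation "cum \<equiv> yule_cum b \<delta>"
abbreviation "cf \<equiv> yule_coeff \<delta>"

lemma exponent_gt_1: "real i + \<delta> + 1 / b > 1"
proof -
  have "1 / b > 1" using b by simp
  then show ?thesis using \<delta> by (simp add: add_nonneg_pos add.commute)
qed

lemma powr_b: "u \<in> {0..1} \<Longrightarrow> u powr b \<in> {0..1}"
  using b by (auto intro: powr_le1)

lemma cf_nonneg: "cf i k \<ge> 0"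
  using \<delta> Gamma_real_pos[of "real k + \<delta>"] Gamma_real_pos[of "real i + \<delta>"] by (simp add: yule_coeff_def)

text \<open>\<open>inc_beta_rec\<close> at y = u^b, with \<open>yule_coeff_rec\<close> turning the
  lower exponent into degree k - 1. Multiplied by \<open>u\<close>, the density is thus expressed by
  its primitives at degrees k and k - 1; at u = 1 this becomes the recurrence of the limiting degree
  frequencies.\<close>

lemma cum_rec:
  assumes "u \<in> {0..1}"
  shows "u * dens i k u = (1 + b * (real k - 1 + \<delta>)) * cum i k u - b * (real k - 1 + \<delta>) * cum i (k - 1) u"
proof (cases "k \<le> i")
  case True
  then show ?thesis by (simp add: yule_dens_def yule_cum_def yule_coeff_def)
next
  case False
  let ?q = "real i + \<delta> + 1 / b" and ?m = "k - 1 - i"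
  have m: "real ?m = real k - 1 - real i" "k - 1 - 1 - i = ?m - 1" using False by auto
  have "u * dens i k u = cf i k * ((u powr b) powr ?q * (1 - u powr b) ^ ?m)"
  proof (cases "u = 0")
    case False
    have "u * u powr (b * (real i + \<delta>)) = u powr (b * (real i + \<delta>) + 1)"
      using assms False by (simp add: powr_mult_base add.commute)
    also have "b * (real i + \<delta>) + 1 = b * ?q" using b by (simp add: field_simps)
    finally show ?thesis by (simp add: yule_dens_def powr_powr mult_ac)
  qed simp
  also have "\<dots> = cf i k * (?q + real ?m) * inc_beta ?q ?m (u powr b)
      - (real ?m * cf i k) * inc_beta ?q (?m - 1) (u powr b)"
    unfolding inc_beta_rec[OF exponent_gt_1 powr_b[OF assms]] by (simp add: algebra_simps)
  also have "\<dots> = cf i k * (?q + real ?m) * inc_beta ?q ?m (u powr b)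
      - ((real k - 1 + \<delta>) * yule_coeff \<delta> i (k - 1)) * inc_beta ?q (?m - 1) (u powr b)"
    by (simp only: yule_coeff_rec[OF \<delta>])
  also have "?q + real ?m = (1 + b * (real k - 1 + \<delta>)) / b"
    unfolding m using b by (simp add: field_simps)
  also have "cf i k * ((1 + b * (real k - 1 + \<delta>)) / b) * inc_beta ?q ?m (u powr b)
      - ((real k - 1 + \<delta>) * yule_coeff \<delta> i (k - 1)) * inc_beta ?q (?m - 1) (u powr b)
    = (1 + b * (real k - 1 + \<delta>)) * cum i k u - b * (real k - 1 + \<delta>) * cum i (k - 1) u"
    unfolding yule_cum_def m(2) using b by simp
  finally show ?thesis .
qed

lemma cum_deriv:
  assumes u: "0 < u" "u < 1"
  shows "(cum i k has_real_derivative dens i k u) (at u)"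
proof -
  let ?q = "real i + \<delta> + 1 / b" and ?m = "k - 1 - i"
  have ub: "0 < u powr b" "u powr b < 1" using u b powr_less_mono2[of b u 1] by auto
  have "(inc_beta ?q ?m has_real_derivative (u powr b) powr (?q - 1) * (1 - u powr b) ^ ?m) (at (u powr b))"
    using inc_beta_deriv_within[OF exponent_gt_1, of "u powr b" i ?m] ub
    by (simp add: at_within_Icc_at)
  moreover have "((\<lambda>u. u powr b) has_real_derivative b * u powr (b - 1)) (at u)"
    using u by (auto intro!: derivative_eq_intros)
  ultimately have "((\<lambda>u. inc_beta ?q ?m (u powr b)) has_real_derivative
      (u powr b) powr (?q - 1) * (1 - u powr b) ^ ?m * (b * u powr (b - 1))) (at u)"
    by (rule DERIV_chain2)
  then have "(cum i k has_real_derivative cf i k / b *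
      ((u powr b) powr (?q - 1) * (1 - u powr b) ^ ?m * (b * u powr (b - 1)))) (at u)"
    unfolding yule_cum_def by (rule DERIV_cmult)
  also have "cf i k / b * ((u powr b) powr (?q - 1) * (1 - u powr b) ^ ?m * (b * u powr (b - 1))) = dens i k u"
  proof -
    have "b * (?q - 1) + (b - 1) = b * (real i + \<delta>)" using b by (simp add: field_simps)
    then have "(u powr b) powr (?q - 1) * u powr (b - 1) = u powr (b * (real i + \<delta>))"
      unfolding powr_powr powr_add[symmetric] by simp
    then show ?thesis unfolding yule_dens_def using b by (simp add: mult_ac)
  qed
  finally show ?thesis .
qed

text \<open>Counterpart of the forward equation of the Yule process: differentiation in the birth
  time becomes a difference in the final degree. Together with \<open>cum_rec\<close> it removes all
  derivatives in \<open>J_rec\<close>.\<close>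

lemma dens_deriv:
  assumes u: "0 < u" "u < 1"
  shows "(dens i k has_real_derivative b * (real k - 1 + \<delta>) * (dens i k u - dens i (k - 1) u) / u) (at u)"
proof -
  let ?p = "b * (real i + \<delta>)" and ?m = "k - 1 - i"
  have "((\<lambda>u. u powr ?p * (1 - u powr b) ^ ?m) has_real_derivative
     ?p * u powr (?p - 1) * (1 - u powr b) ^ ?m - real ?m * (u powr ?p * (1 - u powr b) ^ (?m - 1) * (b * u powr (b - 1)))) (at u)"
    using u by (auto intro!: derivative_eq_intros)
  then have "(dens i k has_real_derivative cf i k * (?p * u powr (?p - 1) * (1 - u powr b) ^ ?m
      - real ?m * (u powr ?p * (1 - u powr b) ^ (?m - 1) * (b * u powr (b - 1))))) (at u)"
    unfolding yule_dens_def by (rule DERIV_cmult)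
  also have "cf i k * (?p * u powr (?p - 1) * (1 - u powr b) ^ ?m
      - real ?m * (u powr ?p * (1 - u powr b) ^ (?m - 1) * (b * u powr (b - 1))))
    = b * (real k - 1 + \<delta>) * (dens i k u - dens i (k - 1) u) / u"
  proof (cases "k \<le> i")
    case True
    then show ?thesis by (simp add: yule_dens_def yule_coeff_def)
  next
    case False
    have m: "real ?m = real k - 1 - real i" "k - 1 - 1 - i = ?m - 1" using False by auto
    let ?U = "u powr ?p" and ?Y = "u powr b"
    have p1: "u powr (?p - 1) = ?U / u" "u powr (b - 1) = ?Y / u"
      using u by (simp_all add: powr_diff)
    have pw: "real ?m * (?Y * (1 - ?Y) ^ (?m - 1)) = real ?m * ((1 - ?Y) ^ (?m - 1) - (1 - ?Y) ^ ?m)"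
      by (cases ?m) (simp_all add: algebra_simps)
    have "cf i k * (?p * u powr (?p - 1) * (1 - ?Y) ^ ?m
      - real ?m * (?U * (1 - ?Y) ^ (?m - 1) * (b * u powr (b - 1))))
      = cf i k * ?U / u * (?p * (1 - ?Y) ^ ?m - b * (real ?m * (?Y * (1 - ?Y) ^ (?m - 1))))"
      unfolding p1 using u by (simp add: field_simps)
    also have "\<dots> = ?U / u * (cf i k * (?p + b * real ?m) * (1 - ?Y) ^ ?m - b * (real ?m * cf i k) * (1 - ?Y) ^ (?m - 1))"
      unfolding pw by (simp add: algebra_simps)
    also have "\<dots> = ?U / u * (cf i k * (?p + b * real ?m) * (1 - ?Y) ^ ?m
        - b * ((real k - 1 + \<delta>) * yule_coeff \<delta> i (k - 1)) * (1 - ?Y) ^ (?m - 1))"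
      by (simp only: yule_coeff_rec[OF \<delta>])
    also have "?p + b * real ?m = b * (real k - 1 + \<delta>)"
      unfolding m(1) by (simp add: algebra_simps)
    also have "?U / u * (cf i k * (b * (real k - 1 + \<delta>)) * (1 - ?Y) ^ ?m
        - b * ((real k - 1 + \<delta>) * yule_coeff \<delta> i (k - 1)) * (1 - ?Y) ^ (?m - 1))
      = b * (real k - 1 + \<delta>) * (dens i k u - dens i (k - 1) u) / u"
      unfolding yule_dens_def m(2) by (simp add: diff_divide_distrib right_diff_distrib mult_ac)
    finally show ?thesis .
  qed
  finally show ?thesis .
qed

text \<open>A vertex born at the final time has no time for edges other than the marked one, and 0^0
  = 1 singles out k = i + 1. These boundary values feed the inhomogeneous terms of the
  recurrences.\<close>

lemma dens_one: "dens i k 1 = (if k = i + 1 then real i + \<delta> else 0)"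
proof -
  have "Gamma (real i + \<delta> + 1) = (real i + \<delta>) * Gamma (real i + \<delta>)"
    using \<delta> by (intro Gamma_plus1) (auto simp: nonpos_Ints_def)
  moreover have "Gamma (real i + \<delta>) > 0" using \<delta> by (intro Gamma_real_pos) simp
  ultimately show ?thesis by (auto simp: yule_dens_def yule_coeff_def power_0_left add_ac)
qed

lemma dens_nonneg: "u \<in> {0..1} \<Longrightarrow> 0 \<le> dens i k u"
  using cf_nonneg powr_b[of u] by (auto simp: yule_dens_def)

lemma dens_le:
  assumes "u \<in> {0..1}"
  shows "dens i k u \<le> cf i k"
proof -
  have "u powr (b * (real i + \<delta>)) \<le> 1" using assms b \<delta> by (intro powr_le1) auto
  moreover have "(1 - u powr b) ^ (k - 1 - i) \<le> 1" using powr_b[OF assms] by (intro power_le_one) auto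
  ultimately show ?thesis unfolding yule_dens_def using powr_b[OF assms] cf_nonneg
    by (intro mult_left_le mult_le_one) auto
qed

lemma cum_nonneg: "u \<in> {0..1} \<Longrightarrow> 0 \<le> cum i k u"
  using cf_nonneg inc_beta_nonneg[OF exponent_gt_1 powr_b] b by (auto simp: yule_cum_def)

lemma cum_le:
  assumes "u \<in> {0..1}"
  shows "cum i k u \<le> cf i k / b * u"
proof -
  let ?q = "real i + \<delta> + 1 / b"
  have "inc_beta ?q (k - 1 - i) (u powr b) \<le> (u powr b) powr ?q"
    by (rule inc_beta_le[OF exponent_gt_1 powr_b[OF assms]])
  also have "\<dots> = u powr (b * ?q)" by (simp add: powr_powr)
  also have "b * ?q = b * (real i + \<delta>) + 1" using b by (simp add: field_simps)
  also have "u powr (b * (real i + \<delta>) + 1) \<le> u powr 1" using assms b \<delta> by (intro powr_mono') auto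
  finally show ?thesis unfolding yule_cum_def using assms cf_nonneg b by (intro mult_left_mono) auto
qed

lemma dens_continuous: "continuous_on {0..1} (dens i k)"
  unfolding yule_dens_def using b \<delta>
  by (intro continuous_intros continuous_on_powr_nonneg) auto

lemma cum_continuous: "continuous_on {0..1} (cum i k)"
proof -
  have "continuous_on {0..1} (\<lambda>u. inc_beta (real i + \<delta> + 1 / b) (k - 1 - i) (u powr b))"
    using powr_b b
    by (intro continuous_on_compose2[OF inc_beta_continuous[OF exponent_gt_1]] continuous_on_powr_nonneg) auto
  then show ?thesis unfolding yule_cum_def by (intro continuous_intros)
qed

lemma dens_le_index: "k \<le> i \<Longrightarrow> dens i k u = 0" and cum_le_index: "k \<le> i \<Longrightarrow> cum i k u = 0"
  by (simp_all add: yule_dens_def yule_cum_def yule_coeff_def)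

end

subsection \<open>Integrals over the arrival time of an edge\<close>

text \<open>The integrands carry a possibly negative power of \<open>u\<close> or a logarithm; at 0
  they vanish by the conventions for powr and ln. A bound by a positive power then gives continuity
  on the closed interval, and the fundamental theorem applies without improper integrals.\<close>

lemma continuous_on_squeeze:
  fixes g :: "real \<Rightarrow> real"
  assumes cont: "continuous_on {0<..1} g" and "g 0 = 0" "r > 0"
    and bound: "\<And>u. 0 < u \<Longrightarrow> u \<le> 1 \<Longrightarrow> \<bar>g u\<bar> \<le> C * u powr r"
  shows "continuous_on {0..1} g"
proof -
  have "continuous (at u within {0..1}) g" if u: "u \<in> {0..1}" for u
  proof (cases "u = 0")
    case False
    then have "u \<in> {0<..1}" using u by auto
    then have "continuous (at u within {0<..1}) g" using cont by (simp add: continuous_on_eq_continuous_within)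
    moreover have "at u within {0<..1} = at u within {0..1}"
      using False u by (intro at_within_nhd[of _ "{0<..}"]) auto
    ultimately show ?thesis by simp
  next
    case True
    have "continuous_on {0..1} (\<lambda>u. C * u powr r)"
      using assms(3) by (intro continuous_intros continuous_on_powr_nonneg) auto
    then have "((\<lambda>u. C * u powr r) \<longlongrightarrow> C * 0 powr r) (at 0 within {0..1})"
      unfolding continuous_on by (rule bspec) auto
    then have lim: "((\<lambda>u. C * u powr r) \<longlongrightarrow> 0) (at 0 within {0..1})" by simp
    have "((\<lambda>u. g u) \<longlongrightarrow> 0) (at 0 within {0..1})"
      by (rule Lim_null_comparison[OF _ lim]) (auto simp: eventually_at_filter bound)
    then show ?thesis using True assms(2) by (simp add: continuous_within)
  qed
  then show ?thesis by (simp add: continuous_on_eq_continuous_within)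
qed

lemma continuous_on_powr_mult:
  fixes f :: "real \<Rightarrow> real"
  assumes "continuous_on {0..1} f" "e + p > 0"
    and bound: "\<And>u. 0 < u \<Longrightarrow> u \<le> 1 \<Longrightarrow> \<bar>f u\<bar> \<le> C * u powr p"
  shows "continuous_on {0..1} (\<lambda>u. u powr e * f u)"
proof (rule continuous_on_squeeze[where r = "e + p" and C = C])
  show "continuous_on {0<..1} (\<lambda>u. u powr e * f u)"
    by (intro continuous_intros continuous_on_subset[OF assms(1)]) auto
  fix u :: real assume u: "0 < u" "u \<le> 1"
  have "\<bar>u powr e * f u\<bar> \<le> u powr e * (C * u powr p)"
    using bound[OF u] by (simp add: abs_mult mult_left_mono)
  then show "\<bar>u powr e * f u\<bar> \<le> C * u powr (e + p)" by (simp add: powr_add mult_ac)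
qed (use assms in auto)

text \<open>The inequality ln x \<le> x - 1 at x = u^(-1/2).\<close>

lemma abs_ln_le:
  assumes "0 < u" "(u::real) \<le> 1"
  shows "\<bar>ln u\<bar> \<le> 2 * u powr (- (1 / 2))"
proof -
  have "ln (u powr (- (1/2))) \<le> u powr (- (1/2))"
    using assms ln_le_minus_one[of "u powr (- (1/2))"] by simp
  then have "- ln u \<le> 2 * u powr (- (1/2))" using assms by (simp add: ln_powr)
  then show ?thesis using assms by simp
qed

lemma continuous_on_ln_mult:
  fixes f :: "real \<Rightarrow> real"
  assumes "continuous_on {0..1} f" and bound: "\<And>u. 0 < u \<Longrightarrow> u \<le> 1 \<Longrightarrow> \<bar>f u\<bar> \<le> C * u"
  shows "continuous_on {0..1} (\<lambda>u. ln u * f u)"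
proof (rule continuous_on_squeeze[where r = "1/2" and C = "2 * C"])
  show "continuous_on {0<..1} (\<lambda>u. ln u * f u)"
    by (intro continuous_intros continuous_on_subset[OF assms(1)]) auto
  fix u :: real assume u: "0 < u" "u \<le> 1"
  have "\<bar>ln u * f u\<bar> \<le> (2 * u powr (- (1 / 2))) * (C * u)"
    unfolding abs_mult using bound[OF u] abs_ln_le[OF u] by (intro mult_mono) auto
  also have "\<dots> = 2 * C * (u powr (- (1/2)) * u powr 1)" using u by simp
  also have "\<dots> = 2 * C * u powr (1/2)" unfolding powr_add[symmetric] by simp
  finally show "\<bar>ln u * f u\<bar> \<le> 2 * C * u powr (1/2)" .
qed simp_all

text \<open>\<open>src\<close> describes the out-degree of the source of an edge, \<open>tgt\<close>
  the in-degree of its target. Interpreting the locale with exchanged parameters yields every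
  mirrored statement.\<close>

locale yule_pair = src: yule b \<delta> + tgt: yule a \<delta>'
  for b \<delta> a \<delta>' :: real
begin

text \<open>The weight u^(a + b - 2) of \<open>H\<close> has an exponent above -2 and calls for the
  quadratic bound; against the logarithm the linear one suffices.\<close>

lemma bound_cc:
  assumes "0 < u" "u \<le> 1"
  shows "\<bar>src.cum i k u * tgt.cum j l u\<bar> \<le> (src.cf i k / b * (tgt.cf j l / a)) * u powr 2"
    "\<bar>src.cum i k u * tgt.cum j l u\<bar> \<le> (src.cf i k / b * (tgt.cf j l / a)) * u"
proof -
  have u: "u \<in> {0..1}" using assms by simp
  have "\<bar>src.cum i k u * tgt.cum j l u\<bar> = src.cum i k u * tgt.cum j l u"
    using src.cum_nonneg[OF u] tgt.cum_nonneg[OF u] by simp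
  also have "\<dots> \<le> (src.cf i k / b * u) * (tgt.cf j l / a * u)"
    using src.cum_le[OF u] tgt.cum_le[OF u] src.cum_nonneg[OF u] tgt.cum_nonneg[OF u]
      src.cf_nonneg src.b assms by (intro mult_mono) auto
  finally have 1: "\<bar>src.cum i k u * tgt.cum j l u\<bar> \<le> (src.cf i k / b * u) * (tgt.cf j l / a * u)" .
  have "u powr 2 = u * u" using assms powr_realpow[of u 2] by (simp add: power2_eq_square)
  with 1 show "\<bar>src.cum i k u * tgt.cum j l u\<bar> \<le> (src.cf i k / b * (tgt.cf j l / a)) * u powr 2"
    by (simp add: mult_ac)
  have "(src.cf i k / b * u) * (tgt.cf j l / a * u) \<le> (src.cf i k / b * u) * (tgt.cf j l / a)"
    using assms src.cf_nonneg tgt.cf_nonneg src.b tgt.b by (intro mult_left_mono mult_left_le) auto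
  with 1 show "\<bar>src.cum i k u * tgt.cum j l u\<bar> \<le> (src.cf i k / b * (tgt.cf j l / a)) * u"
    by (simp add: mult_ac)
qed

lemma bound_cd:
  assumes "0 < u" "u \<le> 1"
  shows "\<bar>src.cum i k u * tgt.dens j l u\<bar> \<le> (src.cf i k / b * tgt.cf j l) * u"
proof -
  have u: "u \<in> {0..1}" using assms by simp
  have "\<bar>src.cum i k u * tgt.dens j l u\<bar> = src.cum i k u * tgt.dens j l u"
    using src.cum_nonneg[OF u] tgt.dens_nonneg[OF u] by simp
  also have "\<dots> \<le> (src.cf i k / b * u) * tgt.cf j l"
    using src.cum_le[OF u] tgt.dens_le[OF u] src.cum_nonneg[OF u] tgt.dens_nonneg[OF u]
      src.cf_nonneg src.b assms by (intro mult_mono) auto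
  finally show ?thesis by (simp add: mult_ac)
qed

text \<open>Origin of the weights: an old endpoint contributes u^(b - 1) or u^(a - 1) for being
  chosen at time \<open>u\<close> and growing afterwards, an endpoint born with the edge contributes
  u^b or u^a. An old source with a new target gives u^(a + b - 1), two old endpoints give u^(a + b -
  2) as in \<open>H\<close>. The weight of \<open>Jlog\<close> is a primitive of - 1/u.\<close>

definition J :: "nat \<Rightarrow> nat \<Rightarrow> nat \<Rightarrow> nat \<Rightarrow> real" where
  "J i k j l = integral {0..1} (\<lambda>u. u powr (a + b - 1) * (src.cum i k u * tgt.dens j l u))"

definition Jlog :: "nat \<Rightarrow> nat \<Rightarrow> nat \<Rightarrow> nat \<Rightarrow> real" where
  "Jlog i k j l = integral {0..1} (\<lambda>u. - (ln u * (src.cum i k u * tgt.dens j l u)))"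

definition H :: "nat \<Rightarrow> nat \<Rightarrow> nat \<Rightarrow> nat \<Rightarrow> real" where
  "H i k j l = integral {0..1} (\<lambda>u. u powr (a + b - 2) * (src.cum i k u * tgt.cum j l u))"

lemma J_continuous: "continuous_on {0..1} (\<lambda>u. u powr (a + b - 1) * (src.cum i k u * tgt.dens j l u))"
  using bound_cd[of _ i k j l] src.b tgt.b
  by (intro continuous_on_powr_mult[where p = 1 and C = "src.cf i k / b * tgt.cf j l"] continuous_intros src.cum_continuous tgt.dens_continuous) auto

lemma H_continuous: "continuous_on {0..1} (\<lambda>u. u powr (a + b - 2) * (src.cum i k u * tgt.cum j l u))"
  using bound_cc(1)[of _ i k j l] src.b tgt.b
  by (intro continuous_on_powr_mult[where p = 2 and C = "src.cf i k / b * (tgt.cf j l / a)"] continuous_intros src.cum_continuous tgt.cum_continuous) auto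

lemma Jlog_continuous: "continuous_on {0..1} (\<lambda>u. - (ln u * (src.cum i k u * tgt.dens j l u)))"
  using bound_cd[of _ i k j l]
  by (intro continuous_on_minus continuous_on_ln_mult continuous_intros src.cum_continuous tgt.dens_continuous)

lemma powr_minus_one: "0 < (u::real) \<Longrightarrow> u powr (e - 1) = u powr e / u"
  by (simp add: powr_diff)

text \<open>Integral of the derivative of u^(a + b) times primitive times density.
  \<open>cum_rec\<close> trades u times the source density for degrees k and k - 1,
  \<open>dens_deriv\<close> does the like for the target degree, so only integrals of the same type
  remain. The boundary value at 1 is the inhomogeneous term.\<close>

lemma J_rec:
  "(1 + (b * (real k + \<delta>) + a * (real l + \<delta>'))) * J i k j l =
    src.cum i k 1 * tgt.dens j l 1 + b * (real k - 1 + \<delta>) * J i (k - 1) j l + a * (real l - 1 + \<delta>') * J i k j (l - 1)"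
proof -
  let ?f = "\<lambda>k l u. u powr (a + b - 1) * (src.cum i k u * tgt.dens j l u)"
  let ?W = "\<lambda>u. u powr (a + b) * (src.cum i k u * tgt.dens j l u)"
  let ?x = "1 + (b * (real k + \<delta>) + a * (real l + \<delta>'))"
  let ?h = "\<lambda>u. ?x * ?f k l u - b * (real k - 1 + \<delta>) * ?f (k - 1) l u - a * (real l - 1 + \<delta>') * ?f k (l - 1) u"
  have "(?h has_integral ?W 1 - ?W 0) {0..1}"
  proof (rule fundamental_theorem_of_calculus_interior)
    show "continuous_on {0..1} ?W"
      using src.b tgt.b by (intro continuous_intros continuous_on_powr_nonneg src.cum_continuous tgt.dens_continuous) auto
    fix u :: real assume "u \<in> {0<..<1}"
    then have u: "0 < u" "u < 1" "u \<in> {0..1}" by auto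
    have "(?W has_real_derivative (a + b) * u powr (a + b - 1) * (src.cum i k u * tgt.dens j l u)
        + u powr (a + b) * (src.dens i k u * tgt.dens j l u
          + src.cum i k u * (a * (real l - 1 + \<delta>') * (tgt.dens j l u - tgt.dens j (l - 1) u) / u))) (at u)"
      using u by (auto intro!: derivative_eq_intros src.cum_deriv tgt.dens_deriv)
    also have "(a + b) * u powr (a + b - 1) * (src.cum i k u * tgt.dens j l u)
        + u powr (a + b) * (src.dens i k u * tgt.dens j l u
          + src.cum i k u * (a * (real l - 1 + \<delta>') * (tgt.dens j l u - tgt.dens j (l - 1) u) / u))
      = u powr (a + b) / u * ((a + b) * (src.cum i k u * tgt.dens j l u) + (u * src.dens i k u) * tgt.dens j l u
          + src.cum i k u * (a * (real l - 1 + \<delta>') * (tgt.dens j l u - tgt.dens j (l - 1) u)))"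
      using u by (simp add: powr_minus_one field_simps)
    also have "\<dots> = ?h u"
      unfolding src.cum_rec[OF u(3)] powr_minus_one[OF u(1)] by (simp add: divide_inverse algebra_simps)
    finally show "(?W has_vector_derivative ?h u) (at u)"
      by (simp add: has_real_derivative_iff_has_vector_derivative)
  qed simp
  moreover have "(?h has_integral ?x * J i k j l - b * (real k - 1 + \<delta>) * J i (k - 1) j l
      - a * (real l - 1 + \<delta>') * J i k j (l - 1)) {0..1}"
    unfolding J_def
    by (intro has_integral_diff has_integral_mult_right integrable_integral integrable_continuous_real J_continuous)
  ultimately have "?W 1 - ?W 0 = ?x * J i k j l - b * (real k - 1 + \<delta>) * J i (k - 1) j l
      - a * (real l - 1 + \<delta>') * J i k j (l - 1)" by (rule has_integral_unique)
  then show ?thesis by simp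
qed

text \<open>The same with weight u^(a + b - 1); here differentiation produces the density of either
  factor, and \<open>cum_rec\<close> is applied to both.\<close>

lemma H_rec:
  "(1 + (b * (real k + \<delta>) + a * (real l + \<delta>'))) * H i k j l =
    src.cum i k 1 * tgt.cum j l 1 + b * (real k - 1 + \<delta>) * H i (k - 1) j l + a * (real l - 1 + \<delta>') * H i k j (l - 1)"
proof -
  let ?f = "\<lambda>k l u. u powr (a + b - 2) * (src.cum i k u * tgt.cum j l u)"
  let ?W = "\<lambda>u. u powr (a + b - 1) * (src.cum i k u * tgt.cum j l u)"
  let ?x = "1 + (b * (real k + \<delta>) + a * (real l + \<delta>'))"
  let ?h = "\<lambda>u. ?x * ?f k l u - b * (real k - 1 + \<delta>) * ?f (k - 1) l u - a * (real l - 1 + \<delta>') * ?f k (l - 1) u"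
  have "(?h has_integral ?W 1 - ?W 0) {0..1}"
  proof (rule fundamental_theorem_of_calculus_interior)
    show "continuous_on {0..1} ?W"
      using bound_cc(1)[of _ i k j l] src.b tgt.b
      by (intro continuous_on_powr_mult[where p = 2 and C = "src.cf i k / b * (tgt.cf j l / a)"] continuous_intros src.cum_continuous tgt.cum_continuous) auto
    fix u :: real assume "u \<in> {0<..<1}"
    then have u: "0 < u" "u < 1" "u \<in> {0..1}" by auto
    have "(?W has_real_derivative (a + b - 1) * u powr (a + b - 1 - 1) * (src.cum i k u * tgt.cum j l u)
        + u powr (a + b - 1) * (src.dens i k u * tgt.cum j l u + src.cum i k u * tgt.dens j l u)) (at u)"
      using u by (auto intro!: derivative_eq_intros src.cum_deriv tgt.cum_deriv)
    also have "(a + b - 1) * u powr (a + b - 1 - 1) * (src.cum i k u * tgt.cum j l u)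
        + u powr (a + b - 1) * (src.dens i k u * tgt.cum j l u + src.cum i k u * tgt.dens j l u)
      = u powr (a + b - 1) / u * ((a + b - 1) * (src.cum i k u * tgt.cum j l u)
          + (u * src.dens i k u) * tgt.cum j l u + src.cum i k u * (u * tgt.dens j l u))"
    proof -
      have "u * (inverse u * x) = x" for x using u by simp
      note this [simp]
      show ?thesis
        unfolding powr_minus_one[OF u(1), of "a + b - 1"] by (simp add: divide_inverse algebra_simps)
    qed
    also have "\<dots> = u powr (a + b - 1) / u * (?x * (src.cum i k u * tgt.cum j l u)
        - b * (real k - 1 + \<delta>) * (src.cum i (k - 1) u * tgt.cum j l u)
        - a * (real l - 1 + \<delta>') * (src.cum i k u * tgt.cum j (l - 1) u))"
      unfolding src.cum_rec[OF u(3)] tgt.cum_rec[OF u(3)] by (simp add: algebra_simps)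
    also have "u powr (a + b - 1) / u = u powr (a + b - 2)"
      using powr_minus_one[OF u(1), of "a + b - 1"] by (simp add: algebra_simps)
    finally show "(?W has_vector_derivative ?h u) (at u)"
      by (simp add: has_real_derivative_iff_has_vector_derivative algebra_simps)
  qed simp
  moreover have "(?h has_integral ?x * H i k j l - b * (real k - 1 + \<delta>) * H i (k - 1) j l
      - a * (real l - 1 + \<delta>') * H i k j (l - 1)) {0..1}"
    unfolding H_def
    by (intro has_integral_diff has_integral_mult_right integrable_integral integrable_continuous_real H_continuous)
  ultimately have "?W 1 - ?W 0 = ?x * H i k j l - b * (real k - 1 + \<delta>) * H i (k - 1) j l
      - a * (real l - 1 + \<delta>') * H i k j (l - 1)" by (rule has_integral_unique)
  then show ?thesis by simp
qed

text \<open>The power u^(a + b - 2) is integrated and the product of primitives differentiated. This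
  is the origin of the denominators 1 - a - b, and the boundary term at 1 becomes the product of
  Gamma values in \<open>cX3\<close>.\<close>

lemma H_eq: "(1 - a - b) * H i k j l =
    J i k j l + yule_pair.J a \<delta>' b \<delta> j l i k - src.cum i k 1 * tgt.cum j l 1"
proof -
  interpret swap: yule_pair a \<delta>' b \<delta> by unfold_locales
  let ?W = "\<lambda>u. u powr (a + b - 1) * (src.cum i k u * tgt.cum j l u)"
  let ?h = "\<lambda>u. (a + b - 1) * (u powr (a + b - 2) * (src.cum i k u * tgt.cum j l u))
    + u powr (a + b - 1) * (src.cum i k u * tgt.dens j l u) + u powr (b + a - 1) * (tgt.cum j l u * src.dens i k u)"
  have "(?h has_integral ?W 1 - ?W 0) {0..1}"
  proof (rule fundamental_theorem_of_calculus_interior)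
    show "continuous_on {0..1} ?W"
      using bound_cc(1)[of _ i k j l] src.b tgt.b
      by (intro continuous_on_powr_mult[where p = 2 and C = "src.cf i k / b * (tgt.cf j l / a)"] continuous_intros src.cum_continuous tgt.cum_continuous) auto
    fix u :: real assume "u \<in> {0<..<1}"
    then have u: "0 < u" "u < 1" by auto
    have "(?W has_real_derivative (a + b - 1) * u powr (a + b - 1 - 1) * (src.cum i k u * tgt.cum j l u)
        + u powr (a + b - 1) * (src.dens i k u * tgt.cum j l u + src.cum i k u * tgt.dens j l u)) (at u)"
      using u by (auto intro!: derivative_eq_intros src.cum_deriv tgt.cum_deriv)
    then show "(?W has_vector_derivative ?h u) (at u)"
      by (simp add: has_real_derivative_iff_has_vector_derivative algebra_simps)
  qed simp
  moreover have "(?h has_integral (a + b - 1) * H i k j l + J i k j l + swap.J j l i k) {0..1}"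
    unfolding H_def J_def swap.J_def
    by (intro has_integral_add has_integral_mult_right integrable_integral integrable_continuous_real
        H_continuous J_continuous swap.J_continuous)
  ultimately have "?W 1 - ?W 0 = (a + b - 1) * H i k j l + J i k j l + swap.J j l i k" by (rule has_integral_unique)
  then show ?thesis by (simp add: algebra_simps)
qed

lemma H_eq_log:
  assumes "a + b = 1"
  shows "H i k j l = Jlog i k j l + yule_pair.Jlog a \<delta>' b \<delta> j l i k"
proof -
  interpret swap: yule_pair a \<delta>' b \<delta> by unfold_locales
  let ?W = "\<lambda>u. - (ln u * (src.cum i k u * tgt.cum j l u))"
  let ?h = "\<lambda>u. - (u powr (a + b - 2) * (src.cum i k u * tgt.cum j l u))
    + - (ln u * (src.cum i k u * tgt.dens j l u)) + - (ln u * (tgt.cum j l u * src.dens i k u))"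
  have "(?h has_integral ?W 1 - ?W 0) {0..1}"
  proof (rule fundamental_theorem_of_calculus_interior)
    show "continuous_on {0..1} ?W"
      using bound_cc(2)[of _ i k j l]
      by (intro continuous_on_minus continuous_on_ln_mult continuous_intros src.cum_continuous tgt.cum_continuous)
    fix u :: real assume "u \<in> {0<..<1}"
    then have u: "0 < u" "u < 1" by auto
    have "(?W has_real_derivative - (1 / u * (src.cum i k u * tgt.cum j l u)
        + ln u * (src.dens i k u * tgt.cum j l u + src.cum i k u * tgt.dens j l u))) (at u)"
      using u by (auto intro!: derivative_eq_intros src.cum_deriv tgt.cum_deriv)
    moreover have "1 / u = u powr (a + b - 2)" using u assms by (simp add: powr_minus_divide)
    ultimately show "(?W has_vector_derivative ?h u) (at u)"
      by (simp add: has_real_derivative_iff_has_vector_derivative algebra_simps)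
  qed simp
  moreover have "(?h has_integral - H i k j l + Jlog i k j l + swap.Jlog j l i k) {0..1}"
    unfolding H_def Jlog_def swap.Jlog_def
    by (intro has_integral_add has_integral_neg integrable_integral integrable_continuous_real
        H_continuous Jlog_continuous swap.Jlog_continuous)
  ultimately have "?W 1 - ?W 0 = - H i k j l + Jlog i k j l + swap.Jlog j l i k" by (rule has_integral_unique)
  then show ?thesis by simp
qed

end

subsection \<open>Incomplete gamma functions\<close>

lemma gamma_density_has_integral:
  fixes c :: real
  assumes "c > 0"
  shows "((\<lambda>w. w powr (c - 1) * exp (- w)) has_integral Gamma c) {0..}"
    "((\<lambda>w. w powr (c - 1) * exp (- w)) has_integral Gamma c) {0<..}"
proof -
  show 1: "((\<lambda>w. w powr (c - 1) * exp (- w)) has_integral Gamma c) {0..}"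
    using Gamma_integral_real[OF assms] by (simp add: exp_minus divide_inverse)
  have "negligible {w \<in> {0..} - {0<..}. w powr (c - 1) * exp (- w) \<noteq> 0}"
    "negligible {w \<in> {0<..} - {0..}. w powr (c - 1) * exp (- w) \<noteq> 0}"
    by (auto intro: negligible_subset[of "{0}"])
  from has_integral_spike_set_eq[OF this] 1
  show "((\<lambda>w. w powr (c - 1) * exp (- w)) has_integral Gamma c) {0<..}" by (simp only:)
qed

lemma integrable_on_pos_dominated:
  fixes f g :: "real \<Rightarrow> real"
  assumes "continuous_on {0<..} f" "g integrable_on {0<..}" "\<And>x. x > 0 \<Longrightarrow> \<bar>f x\<bar> \<le> g x"
  shows "f integrable_on {0<..}"
proof (rule measurable_bounded_by_integrable_imp_integrable)
  show "f \<in> borel_measurable (lebesgue_on {0<..})"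
    by (rule continuous_imp_measurable_on_sets_lebesgue[OF assms(1)]) simp
qed (use assms in simp_all)

text \<open>The lower incomplete gamma function; the integral over \<open>z\<close> in
  \<open>kappa\<close> produces it.\<close>

definition lgam :: "real \<Rightarrow> real \<Rightarrow> real" where
  "lgam c y = integral {0..y} (\<lambda>w. w powr (c - 1) * exp (- w))"

lemma lgam_integrand_continuous:
  "c > 1 \<Longrightarrow> A \<subseteq> {0..} \<Longrightarrow> continuous_on A (\<lambda>w::real. w powr (c - 1) * exp (- (k * w)))"
  by (intro continuous_intros continuous_on_powr_nonneg) auto

lemma lgam_integrand_integrable:
  "c > 1 \<Longrightarrow> (\<lambda>w::real. w powr (c - 1) * exp (- (k * w))) integrable_on {0..y}"
  by (intro integrable_continuous_real lgam_integrand_continuous) auto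

lemma lgam_zero: "lgam c 0 = 0"
  by (simp add: lgam_def)

lemma lgam_deriv:
  assumes "c > 1" "y > 0"
  shows "(lgam c has_real_derivative y powr (c - 1) * exp (- y)) (at y)"
proof -
  have "(lgam c has_real_derivative y powr (c - 1) * exp (- y)) (at y within {0..y + 1})"
    unfolding lgam_def using assms lgam_integrand_continuous[of c _ 1]
    by (intro integral_has_real_derivative) auto
  then show ?thesis using assms by (simp add: at_within_Icc_at)
qed

lemma lgam_continuous:
  assumes "c > 1"
  shows "continuous_on {0..} (lgam c)"
proof -
  have "continuous_on {0..y} (lgam c)" for y
    unfolding lgam_def using assms lgam_integrand_integrable[of c 1]
    by (intro indefinite_integral_continuous_1) simp
  then have "continuous (at y within {0..}) (lgam c)" if "y \<ge> 0" for y
  proof -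
    have "continuous (at y within {0..y + 1}) (lgam c)"
      using \<open>\<And>y. continuous_on {0..y} (lgam c)\<close> that by (simp add: continuous_on_eq_continuous_within)
    moreover have "at y within {0..y + 1} = at y within {0..}"
      using that by (intro at_within_nhd[of _ "{..<y + 1}"]) auto
    ultimately show ?thesis by simp
  qed
  then show ?thesis by (simp add: continuous_on_eq_continuous_within)
qed

lemma lgam_nonneg: "c > 1 \<Longrightarrow> 0 \<le> lgam c y"
  unfolding lgam_def using lgam_integrand_integrable[of c 1]
  by (intro integral_nonneg) auto

lemma lgam_le_Gamma:
  assumes "c > 1"
  shows "lgam c y \<le> Gamma c"
proof -
  note G = gamma_density_has_integral(1)[of c]
  have "lgam c y \<le> integral {0..} (\<lambda>w. w powr (c - 1) * exp (- w))"
    unfolding lgam_def using assms lgam_integrand_integrable[of c 1] G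
    by (intro integral_subset_le) auto
  then show ?thesis using G assms by (simp add: integral_unique)
qed

text \<open>On the omitted range w > y one has 1 \<le> w / y, which raises the exponent by
  1.\<close>

lemma Gamma_le_lgam:
  assumes "c > 1" "y > 0"
  shows "Gamma c \<le> lgam c y + Gamma (c + 1) / y"
proof -
  have "((\<lambda>w. if w \<in> {0..y} then w powr (c - 1) * exp (- w) else 0) has_integral lgam c y) {0..}"
    unfolding lgam_def using assms lgam_integrand_integrable[of c 1]
    by (subst has_integral_restrict) (auto intro: integrable_integral)
  moreover have "((\<lambda>w. (1 / y) * (w powr c * exp (- w))) has_integral (1 / y) * Gamma (c + 1)) {0..}"
    using gamma_density_has_integral(1)[of "c + 1"] assms by (intro has_integral_mult_right) auto
  ultimately have "((\<lambda>w. (if w \<in> {0..y} then w powr (c - 1) * exp (- w) else 0) + (1 / y) * (w powr c * exp (- w)))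
      has_integral lgam c y + (1 / y) * Gamma (c + 1)) {0..}"
    by (rule has_integral_add)
  with gamma_density_has_integral(1)[of c] assms(1)
  have "Gamma c \<le> lgam c y + (1 / y) * Gamma (c + 1)"
  proof (rule_tac has_integral_le)
    fix w :: real assume w: "w \<in> {0..}"
    show "w powr (c - 1) * exp (- w) \<le> (if w \<in> {0..y} then w powr (c - 1) * exp (- w) else 0) + 1 / y * (w powr c * exp (- w))"
    proof (cases "w \<le> y")
      case False
      then have "w powr c = w * w powr (c - 1)" using w assms by (simp add: powr_mult_base)
      moreover have "1 * (w powr (c - 1) * exp (- w)) \<le> (w / y) * (w powr (c - 1) * exp (- w))"
        using False assms w by (intro mult_right_mono) auto
      ultimately show ?thesis using False by simp
    qed (use w assms in simp)
  qed auto
  then show ?thesis by simp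
qed

lemma lgam_le_powr:
  assumes "c > 1" "y \<ge> 0"
  shows "lgam c y \<le> y powr c"
proof -
  have "lgam c y \<le> integral {0..y} (\<lambda>w. y powr (c - 1))"
    unfolding lgam_def
  proof (rule integral_le)
    fix w assume w: "w \<in> {0..y}"
    have "w powr (c - 1) * exp (- w) \<le> w powr (c - 1) * 1" using w by (intro mult_left_mono) auto
    also have "\<dots> \<le> y powr (c - 1)" using w assms by (simp add: powr_mono2)
    finally show "w powr (c - 1) * exp (- w) \<le> y powr (c - 1)" .
  qed (use assms lgam_integrand_integrable[of c 1] in auto)
  also have "\<dots> = y * y powr (c - 1)" using assms by simp
  also have "\<dots> = y powr c" using assms by (cases "y = 0") (simp_all add: powr_mult_base)
  finally show ?thesis .
qed

lemma lgam_rec: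
  assumes c: "c > 1" and y: "y \<ge> 0"
  shows "lgam (c + 1) y = c * lgam c y - y powr c * exp (- y)"
proof -
  let ?W = "\<lambda>w. w powr c * exp (- w)"
  have "((\<lambda>w. c * (w powr (c - 1) * exp (- w)) - w powr (c + 1 - 1) * exp (- w)) has_integral ?W y - ?W 0) {0..y}"
  proof (rule fundamental_theorem_of_calculus_interior)
    show "continuous_on {0..y} ?W" using c by (intro continuous_intros continuous_on_powr_nonneg) auto
    fix w assume "w \<in> {0<..<y}"
    then have "(?W has_real_derivative c * (w powr (c - 1) * exp (- w)) - w powr (c + 1 - 1) * exp (- w)) (at w)"
      by (auto intro!: derivative_eq_intros)
    then show "(?W has_vector_derivative c * (w powr (c - 1) * exp (- w)) - w powr (c + 1 - 1) * exp (- w)) (at w)"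
      by (simp add: has_real_derivative_iff_has_vector_derivative)
  qed (use y in auto)
  moreover have "((\<lambda>w. c * (w powr (c - 1) * exp (- w)) - w powr (c + 1 - 1) * exp (- w)) has_integral
      c * lgam c y - lgam (c + 1) y) {0..y}"
    unfolding lgam_def using c lgam_integrand_integrable[of c 1] lgam_integrand_integrable[of "c + 1" 1]
    by (intro has_integral_diff has_integral_mult_right integrable_integral) auto
  ultimately have "?W y - ?W 0 = c * lgam c y - lgam (c + 1) y" by (rule has_integral_unique)
  then show ?thesis by simp
qed

text \<open>A bound relative to \<open>lgam c y\<close> and uniform in \<open>y\<close>: extra
  powers in the kernel errors are absorbed without losing the smallness of the integral at small
  \<open>y\<close>.\<close>

lemma lgam_plus1_le: "c > 1 \<Longrightarrow> y \<ge> 0 \<Longrightarrow> lgam (c + 1) y \<le> c * lgam c y"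
  by (simp add: lgam_rec)

lemma lgam_scale:
  assumes c: "c > 1" and k: "k > 0" and y: "y \<ge> 0"
  shows "((\<lambda>s. s powr (c - 1) * exp (- (k * s))) has_integral lgam c (k * y) / k powr c) {0..y}"
proof -
  have "((\<lambda>s. k powr c * (s powr (c - 1) * exp (- (k * s)))) has_integral lgam c (k * y) - lgam c (k * 0)) {0..y}"
  proof (rule fundamental_theorem_of_calculus_interior)
    show "continuous_on {0..y} (\<lambda>s. lgam c (k * s))"
      using k by (intro continuous_on_compose2[OF lgam_continuous[OF c]] continuous_intros) auto
    fix s assume "s \<in> {0<..<y}"
    then have s: "s > 0" by simp
    have "((\<lambda>s. lgam c (k * s)) has_real_derivative (k * s) powr (c - 1) * exp (- (k * s)) * k) (at s)"
      using s k c by (intro DERIV_chain2[OF lgam_deriv]) (auto intro!: derivative_eq_intros)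
    moreover have "k powr c = k * k powr (c - 1)" using k by (simp add: powr_mult_base)
    then have "(k * s) powr (c - 1) * exp (- (k * s)) * k = k powr c * (s powr (c - 1) * exp (- (k * s)))"
      using k s by (simp add: powr_mult)
    ultimately show "((\<lambda>s. lgam c (k * s)) has_vector_derivative k powr c * (s powr (c - 1) * exp (- (k * s)))) (at s)"
      by (simp add: has_real_derivative_iff_has_vector_derivative)
  qed (use y in auto)
  then have "((\<lambda>s. 1 / k powr c * (k powr c * (s powr (c - 1) * exp (- (k * s))))) has_integral
      1 / k powr c * (lgam c (k * y) - lgam c (k * 0))) {0..y}"
    by (rule has_integral_mult_right)
  then show ?thesis using k by (simp add: lgam_zero)
qed

text \<open>Rescaling turns the claim into exp (- h s) \<le> exp (- s). Growth at most polynomial is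
  what the doubling argument for kappa relies on.\<close>

lemma lgam_growth:
  assumes c: "c > 1" and "h \<ge> 1" "y \<ge> 0"
  shows "lgam c (h * y) \<le> h powr c * lgam c y"
proof -
  have "lgam c (h * y) / h powr c \<le> lgam c y"
  proof (rule has_integral_le)
    show "((\<lambda>s. s powr (c - 1) * exp (- (h * s))) has_integral lgam c (h * y) / h powr c) {0..y}"
      using assms by (intro lgam_scale) auto
    show "((\<lambda>s. s powr (c - 1) * exp (- s)) has_integral lgam c y) {0..y}"
      unfolding lgam_def using lgam_integrand_integrable[of c 1 y] c by (intro integrable_integral) simp
    show "s powr (c - 1) * exp (- (h * s)) \<le> s powr (c - 1) * exp (- s)" if "s \<in> {0..y}" for s
      using that assms by (intro mult_left_mono) (auto intro: mult_right_mono[of 1 h s, simplified])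
  qed
  then show ?thesis using assms by (simp add: field_simps)
qed

subsection \<open>Binomial against exponential kernels\<close>

text \<open>By convexity the chord over [0, 2] lies above; its slope is at most 7/2 because e^2
  \<le> 8.\<close>

lemma exp_le_chord:
  assumes "0 \<le> x" "x \<le> (2::real)"
  shows "exp x \<le> 1 + 7 / 2 * x"
proof -
  have "exp ((1 - x / 2) *\<^sub>R 0 + (x / 2) *\<^sub>R 2) \<le> (1 - x / 2) * exp 0 + (x / 2) * exp (2::real)"
    using assms by (intro convex_onD[OF exp_convex]) auto
  moreover have "exp (2::real) \<le> 8"
  proof -
    have "exp (2::real) = exp 1 * exp 1" by (simp flip: exp_add)
    also have "\<dots> \<le> 272/100 * (272/100)" using e_less_272 by (intro mult_mono) auto
    finally show ?thesis by simp
  qed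
  then have "(x / 2) * exp (2::real) \<le> (x / 2) * 8" using assms by (intro mult_left_mono) auto
  ultimately show ?thesis by simp
qed

text \<open>Upper bound: 1 - s \<le> e^(-s), and the 1 + i missing factors cost e^((1 + i) s) \<le>
  1 + 7 s. Lower bound: (1 - s^2)^k = (1 - s)^k (1 + s)^k, with Bernoulli's inequality on the left
  and 1 + s \<le> e^s on the right. The error stays proportional to the exponential kernel.\<close>

lemma binomial_exp_compare:
  fixes s :: real
  assumes s: "0 \<le> s" "s \<le> 1" and k: "k \<ge> 2" "i \<le> 1"
  shows "\<bar>(1 - s) ^ (k - 1 - i) - exp (- (real k * s))\<bar>
    \<le> 7 / real k * (real k * s + (real k * s)\<^sup>2) * exp (- (real k * s))"
proof -
  let ?e = "exp (- (real k * s))" and ?m = "k - 1 - i"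
  have m: "real ?m = real k - 1 - real i" using k by auto
  have "(1 - s) ^ ?m \<le> exp (- s) ^ ?m"
    using s exp_ge_add_one_self[of "- s"] by (intro power_mono) auto
  also have "\<dots> = ?e * exp ((1 + real i) * s)"
    unfolding exp_of_nat_mult[symmetric] exp_add[symmetric] m by (simp add: algebra_simps)
  finally have 1: "(1 - s) ^ ?m \<le> ?e * exp ((1 + real i) * s)" .
  have "(1 + real i) * s \<le> 2 * s" using s k by (intro mult_right_mono) auto
  then have "exp ((1 + real i) * s) \<le> exp (2 * s)" by simp
  also have "\<dots> \<le> 1 + 7 * s" using exp_le_chord[of "2 * s"] s by simp
  finally have "?e * exp ((1 + real i) * s) \<le> ?e * (1 + 7 * s)" by (rule mult_left_mono) simp
  with 1 have "(1 - s) ^ ?m \<le> ?e * (1 + 7 * s)" by (rule order_trans)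
  then have upper: "(1 - s) ^ ?m - ?e \<le> 7 * s * ?e" by (simp add: algebra_simps)
  have "?e * (1 - real k * s\<^sup>2) \<le> ?e * (1 - s\<^sup>2) ^ k"
    using Bernoulli_inequality[of "- s\<^sup>2" k] s by (intro mult_left_mono) (auto simp: power_le_one)
  also have "(1 - s\<^sup>2) ^ k = (1 - s) ^ k * (1 + s) ^ k"
    by (simp add: power_mult_distrib[symmetric] power2_eq_square algebra_simps)
  also have "?e * \<dots> \<le> ?e * ((1 - s) ^ k * exp (real k * s))"
    unfolding exp_of_nat_mult
    using s exp_ge_add_one_self[of s] by (intro mult_left_mono power_mono) auto
  also have "\<dots> = (1 - s) ^ k" by (simp add: exp_minus)
  also have "\<dots> \<le> (1 - s) ^ ?m" using s by (intro power_decreasing) auto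
  finally have lower: "?e - (1 - s) ^ ?m \<le> real k * s\<^sup>2 * ?e" by (simp add: algebra_simps)
  have "7 / real k * (real k * s + (real k * s)\<^sup>2) = 7 * s + 7 * (real k * s\<^sup>2)"
    using k by (simp add: field_simps power2_eq_square)
  then have eq: "7 / real k * (real k * s + (real k * s)\<^sup>2) * ?e = 7 * s * ?e + 7 * (real k * s\<^sup>2 * ?e)"
    by (simp add: algebra_simps)
  have "0 \<le> 7 * s * ?e" "0 \<le> real k * s\<^sup>2 * ?e" using s by simp_all
  then show ?thesis unfolding eq abs_le_iff using upper lower by linarith
qed

text \<open>The error k s + (k s)^2 raises the exponent by 1 and by 2, and
  \<open>lgam_plus1_le\<close> brings it back at the price of q and (q + 1) q; 7 is the constant of
  the kernel comparison.\<close>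

definition cmp_const :: "real \<Rightarrow> real" where
  "cmp_const q = 7 * (q + (q + 1) * q)"

lemma cmp_const_nonneg: "q > 1 \<Longrightarrow> cmp_const q \<ge> 0"
  by (simp add: cmp_const_def)

text \<open>The kernel comparison integrated. The error is relative to \<open>lgam\<close>, hence
  uniform down to y = 0, where both quantities vanish.\<close>

lemma inc_beta_compare:
  assumes q: "q > 1" and y: "y \<in> {0..1}" and k: "k \<ge> 2" "i \<le> 1"
  shows "\<bar>real k powr q * inc_beta q (k - 1 - i) y - lgam q (real k * y)\<bar>
    \<le> cmp_const q / real k * lgam q (real k * y)"
proof -
  have k0: "real k > 0" using k by simp
  let ?Y = "real k * y"
  let ?d = "\<lambda>c s. s powr (c - 1) * exp (- (real k * s))"
  have I: "(?d c has_integral lgam c ?Y / real k powr c) {0..y}" if "c > 1" for c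
    using that y k0 by (intro lgam_scale) auto
  have "((\<lambda>s. s powr (q - 1) * (1 - s) ^ (k - 1 - i)) has_integral inc_beta q (k - 1 - i) y) {0..y}"
    unfolding inc_beta_def using q
    by (intro integrable_integral integrable_continuous_real inc_beta_integrand_continuous) auto
  then have D: "((\<lambda>s. s powr (q - 1) * (1 - s) ^ (k - 1 - i) - ?d q s) has_integral
      inc_beta q (k - 1 - i) y - lgam q ?Y / real k powr q) {0..y}"
    using I[OF q] by (rule has_integral_diff)
  have B: "((\<lambda>s. 7 * ?d (q + 1) s + (7 * real k) * ?d (q + 2) s) has_integral
      7 * (lgam (q + 1) ?Y / real k powr (q + 1)) + (7 * real k) * (lgam (q + 2) ?Y / real k powr (q + 2))) {0..y}"
    using q by (intro has_integral_add has_integral_mult_right I) auto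
  have "\<bar>inc_beta q (k - 1 - i) y - lgam q ?Y / real k powr q\<bar>
    \<le> 7 * (lgam (q + 1) ?Y / real k powr (q + 1)) + (7 * real k) * (lgam (q + 2) ?Y / real k powr (q + 2))"
    unfolding integral_unique[OF D, symmetric] integral_unique[OF B, symmetric] real_norm_def[symmetric]
  proof (rule Henstock_Kurzweil_Integration.integral_norm_bound_integral)
    fix s assume s: "s \<in> {0..y}"
    then have s1: "0 \<le> s" "s \<le> 1" using y by auto
    have "norm (s powr (q - 1) * (1 - s) ^ (k - 1 - i) - ?d q s)
        = s powr (q - 1) * \<bar>(1 - s) ^ (k - 1 - i) - exp (- (real k * s))\<bar>"
      by (simp add: abs_mult flip: right_diff_distrib)
    also have "\<dots> \<le> s powr (q - 1) * (7 / real k * (real k * s + (real k * s)\<^sup>2) * exp (- (real k * s)))"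
      using binomial_exp_compare[OF s1 k] by (intro mult_left_mono) auto
    also have "\<dots> = 7 * (s * s powr (q - 1) * exp (- (real k * s))) + 7 * real k * (s * (s * s powr (q - 1)) * exp (- (real k * s)))"
      using k0 by (simp add: field_simps power2_eq_square)
    also have "s * s powr (q - 1) = s powr (q + 1 - 1)" using s1 by (cases "s = 0") (simp_all add: powr_mult_base)
    also have "s * s powr (q + 1 - 1) = s powr (q + 2 - 1)" using s1 by (cases "s = 0") (simp_all add: powr_mult_base add_ac)
    finally show "norm (s powr (q - 1) * (1 - s) ^ (k - 1 - i) - ?d q s) \<le> 7 * ?d (q + 1) s + (7 * real k) * ?d (q + 2) s" .
  qed (use D B in \<open>auto simp: has_integral_integrable\<close>)
  then have "real k powr q * \<bar>inc_beta q (k - 1 - i) y - lgam q ?Y / real k powr q\<bar>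
    \<le> real k powr q * (7 * (lgam (q + 1) ?Y / real k powr (q + 1)) + (7 * real k) * (lgam (q + 2) ?Y / real k powr (q + 2)))"
    by (intro mult_left_mono) auto
  also have "\<dots> = 7 / real k * (lgam (q + 1) ?Y + lgam (q + 2) ?Y)"
    using k0 by (simp add: powr_add field_simps power2_eq_square)
  also have "\<dots> \<le> 7 / real k * (q * lgam q ?Y + (q + 1) * (q * lgam q ?Y))"
  proof (intro mult_left_mono add_mono)
    show 1: "lgam (q + 1) ?Y \<le> q * lgam q ?Y" using lgam_plus1_le[of q ?Y] q y by auto
    have "lgam (q + 2) ?Y \<le> (q + 1) * lgam (q + 1) ?Y"
      using lgam_plus1_le[of "q + 1" ?Y] q y by (simp add: add_ac)
    also have "\<dots> \<le> (q + 1) * (q * lgam q ?Y)" using 1 q by (intro mult_left_mono) auto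
    finally show "lgam (q + 2) ?Y \<le> (q + 1) * (q * lgam q ?Y)" .
  qed simp
  finally have "real k powr q * \<bar>inc_beta q (k - 1 - i) y - lgam q ?Y / real k powr q\<bar>
    \<le> 7 / real k * (q * lgam q ?Y + (q + 1) * (q * lgam q ?Y))" .
  moreover have "real k powr q * \<bar>inc_beta q (k - 1 - i) y - lgam q ?Y / real k powr q\<bar>
      = \<bar>real k powr q * inc_beta q (k - 1 - i) y - lgam q ?Y\<bar>"
  proof -
    have "real k powr q * inc_beta q (k - 1 - i) y - lgam q ?Y = real k powr q * (inc_beta q (k - 1 - i) y - lgam q ?Y / real k powr q)"
      using k0 by (simp add: right_diff_distrib)
    then show ?thesis by (simp add: abs_mult)
  qed
  ultimately show ?thesis by (simp add: cmp_const_def algebra_simps add_divide_distrib)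
qed

lemma inc_beta_one_compare:
  assumes q: "q > 1" and k: "k \<ge> 2" "i \<le> 1"
  shows "\<bar>real k powr q * inc_beta q (k - 1 - i) 1 - Gamma q\<bar>
    \<le> (cmp_const q * Gamma q + Gamma (q + 1)) / real k"
proof -
  have k0: "real k > 0" using k by simp
  have "\<bar>real k powr q * inc_beta q (k - 1 - i) 1 - lgam q (real k)\<bar> \<le> cmp_const q / real k * lgam q (real k)"
    using inc_beta_compare[OF q, of 1 k i] k by simp
  also have "\<dots> \<le> cmp_const q / real k * Gamma q"
    using lgam_le_Gamma[OF q] cmp_const_nonneg[OF q] by (intro mult_left_mono) auto
  finally show ?thesis using lgam_le_Gamma[OF q, of "real k"] Gamma_le_lgam[OF q k0]
    by (simp add: add_divide_distrib abs_le_iff)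
qed

text \<open>Closeness to 1 keeps \<open>f\<close> above 1/2 only for large \<open>k\<close>; over
  the finitely many remaining \<open>k\<close> the minimum is positive by assumption. The resulting
  lower bound \<open>e\<close> enlarges the constant to C / e.\<close>

lemma inverse_one_plus_O:
  fixes f :: "nat \<Rightarrow> real"
  assumes "\<And>k. k \<ge> 2 \<Longrightarrow> \<bar>f k - 1\<bar> \<le> C / real k" "\<And>k. k \<ge> 2 \<Longrightarrow> f k > 0"
  shows "\<exists>C'. \<forall>k\<ge>2. \<bar>1 / f k - 1\<bar> \<le> C' / real k"
proof -
  have C: "C \<ge> 0" using order_trans[OF abs_ge_zero assms(1)[of 2]] by simp
  define N where "N = max 2 (nat \<lceil>2 * C\<rceil>)"
  define e where "e = Min (insert (1/2) (f ` {2..N}))"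
  have e: "e > 0" unfolding e_def using assms(2) by (subst Min_gr_iff) auto
  have fe: "f k \<ge> e" if "k \<ge> 2" for k
  proof (cases "k \<le> N")
    case True
    then show ?thesis unfolding e_def using that by (intro Min_le) auto
  next
    case False
    then have "2 * C \<le> real k" unfolding N_def by linarith
    then have "C / real k \<le> 1 / 2" using that by (simp add: field_simps)
    then have "f k \<ge> 1 / 2" using assms(1)[OF that] by linarith
    moreover have "e \<le> 1/2" unfolding e_def by (intro Min_le) auto
    ultimately show ?thesis by linarith
  qed
  have "\<bar>1 / f k - 1\<bar> \<le> (C / e) / real k" if k: "k \<ge> 2" for k
  proof -
    have "\<bar>1 / f k - 1\<bar> = \<bar>f k - 1\<bar> / f k"
      using assms(2)[OF k] by (simp add: field_simps abs_if)
    also have "\<dots> \<le> (C / real k) / e"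
      using assms(1)[OF k] fe[OF k] e C by (intro frac_le) auto
    finally show ?thesis by (simp add: mult.commute)
  qed
  then show ?thesis by blast
qed

text \<open>Proved without Stirling's formula: up to elementary factors the ratio is an inverse beta
  integral, which the kernel comparison evaluates.\<close>

lemma yule_coeff_asymp:
  assumes "\<delta> > 0" "i \<le> 1"
  shows "\<exists>C. \<forall>k\<ge>2. \<bar>yule_coeff \<delta> i k * Gamma (real i + \<delta>) / real k powr (\<delta> + real i) - 1\<bar> \<le> C / real k"
proof -
  \<comment> \<open>Chosen so that s + (k - 1 - i) + 1 = k + \<delta> + 1 in
    \<open>inc_beta_one\<close>. The surplus 1 ensures s > 1 and is repaid by Gamma (k + \<delta> +
    1) = (k + \<delta>) Gamma (k + \<delta>), the source of the factor 1 + \<delta>/k.\<close>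
  define s where "s = \<delta> + real i + 1"
  have s: "s > 1" using assms by (simp add: s_def)
  have Gs: "Gamma s > 0" using s by (intro Gamma_real_pos) simp
  define L where "L k = real k powr s * inc_beta s (k - 1 - i) 1 / Gamma s" for k
  define C where "C = (cmp_const s * Gamma s + Gamma (s + 1)) / Gamma s"
  have L: "\<bar>L k - 1\<bar> \<le> C / real k" if k: "k \<ge> 2" for k
  proof -
    have "L k - 1 = (real k powr s * inc_beta s (k - 1 - i) 1 - Gamma s) / Gamma s"
      using Gs by (simp add: L_def diff_divide_distrib)
    then have "\<bar>L k - 1\<bar> = \<bar>real k powr s * inc_beta s (k - 1 - i) 1 - Gamma s\<bar> / Gamma s"
      using Gs by simp
    also have "\<dots> \<le> ((cmp_const s * Gamma s + Gamma (s + 1)) / real k) / Gamma s"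
      using inc_beta_one_compare[OF s k assms(2)] Gs by (intro divide_right_mono) auto
    finally show ?thesis by (simp add: C_def mult.commute)
  qed
  have eq: "yule_coeff \<delta> i k * Gamma (real i + \<delta>) / real k powr (\<delta> + real i) = 1 / ((1 + \<delta> / real k) * L k)"
    and pos: "(1 + \<delta> / real k) * L k > 0" if k: "k \<ge> 2" for k
  proof -
    have m: "real (k - 1 - i) = real k - 1 - real i" using k assms by auto
    have k0: "real k > 0" using k by simp
    have "s + real (k - 1 - i) + 1 = (real k + \<delta>) + 1" unfolding m s_def by simp
    then have "Gamma (s + real (k - 1 - i) + 1) = (real k + \<delta>) * Gamma (real k + \<delta>)"
      using assms Gamma_plus1[of "real k + \<delta>"] by (auto simp: nonpos_Ints_def)
    then have Lk: "L k = real k powr s * fact (k - 1 - i) / ((real k + \<delta>) * Gamma (real k + \<delta>))"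
      unfolding L_def inc_beta_one[OF s] using Gs by simp
    have G: "Gamma (real k + \<delta>) > 0" "Gamma (real i + \<delta>) > 0" using assms k0 by (auto intro!: Gamma_real_pos)
    have kp: "real k powr s = real k * real k powr (\<delta> + real i)"
      using k0 unfolding s_def by (simp add: powr_add)
    show "(1 + \<delta> / real k) * L k > 0" unfolding Lk using G k0 assms by (intro mult_pos_pos divide_pos_pos add_pos_pos) auto
    have "Gamma (real i + \<delta>) \<noteq> 0" using G(2) by (metis less_irrefl)
    then have "yule_coeff \<delta> i k * Gamma (real i + \<delta>) = Gamma (real k + \<delta>) / fact (k - 1 - i)"
      using k assms by (simp add: yule_coeff_def)
    moreover have "(1 + \<delta> / real k) * L k = real k powr (\<delta> + real i) * fact (k - 1 - i) / Gamma (real k + \<delta>)"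
    proof -
      have "1 + \<delta> / real k = (real k + \<delta>) / real k" "real k + \<delta> \<noteq> 0" using k0 assms by (auto simp: add_divide_distrib)
      then show ?thesis unfolding Lk kp using k0 by simp
    qed
    ultimately show "yule_coeff \<delta> i k * Gamma (real i + \<delta>) / real k powr (\<delta> + real i) = 1 / ((1 + \<delta> / real k) * L k)"
      by simp
  qed
  have "\<bar>(1 + \<delta> / real k) * L k - 1\<bar> \<le> (C + \<delta> * (1 + C)) / real k" if k: "k \<ge> 2" for k
  proof -
    have C0: "C \<ge> 0" using cmp_const_nonneg[OF s] Gs Gamma_real_pos[of "s + 1"] s by (simp add: C_def)
    have "C / real k \<le> C" using k C0 by (simp add: divide_le_eq mult_left_mono[of 1 "real k" C, simplified])
    then have "\<bar>L k\<bar> \<le> 1 + C" using L[OF k] by linarith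
    then have "\<bar>\<delta> / real k * L k\<bar> \<le> \<delta> / real k * (1 + C)"
      using assms unfolding abs_mult by (intro mult_mono) auto
    moreover have "(1 + \<delta> / real k) * L k - 1 = (L k - 1) + \<delta> / real k * L k" by (simp add: algebra_simps)
    ultimately have "\<bar>(1 + \<delta> / real k) * L k - 1\<bar> \<le> C / real k + \<delta> / real k * (1 + C)"
      using L[OF k] abs_triangle_ineq[of "L k - 1" "\<delta> / real k * L k"] by (simp only:)
    then show ?thesis by (simp add: add_divide_distrib)
  qed
  from inverse_one_plus_O[OF this pos] show ?thesis using eq by simp
qed

subsection \<open>The function kappa\<close>

lemma set_integrable_gamma_density:
  assumes "c > 0"
  shows "set_integrable lborel {0..} (\<lambda>w::real. w powr (c - 1) * exp (- w))"
proof -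
  have "(\<lambda>w::real. w powr (c - 1) * exp (- w)) absolutely_integrable_on {0..}"
    using gamma_density_has_integral(1)[OF assms]
    by (intro nonnegative_absolutely_integrable_1) (auto simp: has_integral_integrable)
  then show ?thesis
    unfolding set_integrable_def by (subst (asm) integrable_completion) auto
qed

text \<open>With the order of integration exchanged, the integral over \<open>z\<close> is
  \<open>lgam c1 (x * \<tau> powr r)\<close> divided by \<tau>^(c1 r), and this power cancels. In
  this form kappa has a nonnegative kernel that can be compared pointwise with those of
  \<open>J\<close> and \<open>Jlog\<close>.\<close>

lemma kappa_eq:
  assumes c1: "c1 > 1" and c2: "c2 > 0" and r: "r > 0" and x: "x \<ge> 0"
  shows "kappa c1 c2 r x = integral {0<..} (\<lambda>\<tau>. \<tau> powr (c2 - 1) * (exp (- \<tau>) * lgam c1 (x * \<tau> powr r)))"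
proof -
  define p where "p = c1 * r + c2 - 1"
  have p: "p + 1 > 0" using c1 c2 r by (simp add: p_def add_pos_pos)
  define u where "u = (\<lambda>z::real. indicator {0..x} z * z powr (c1 - 1))"
  define v where "v = (\<lambda>\<tau>::real. indicator {0..} \<tau> * (\<tau> powr p * exp (- \<tau>)))"
  define f where "f = (\<lambda>z \<tau>. u z * (v \<tau> * exp (- (z * \<tau> powr r))))"
  have u_int: "integrable lborel u"
    using borel_integrable_atLeastAtMost'[of 0 x "\<lambda>z. z powr (c1 - 1)"] continuous_on_powr_nonneg[of "c1 - 1" "{0..x}"] c1
    by (auto simp: u_def set_integrable_def)
  have v_int: "integrable lborel v"
    using set_integrable_gamma_density[OF p] by (simp add: v_def set_integrable_def)
  have [measurable]: "u \<in> borel_measurable lborel" "v \<in> borel_measurable lborel"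
    using u_int v_int by auto
  have uv: "u z \<ge> 0" "v \<tau> \<ge> 0" for z \<tau> by (auto simp: u_def v_def)
  have "integrable (lborel \<Otimes>\<^sub>M lborel) (\<lambda>(z, \<tau>). u z * v \<tau>)"
  proof (rule lborel_pair.Fubini_integrable)
    have "integrable lborel (\<lambda>z. u z * (\<integral>\<tau>. v \<tau> \<partial>lborel))"
      by (rule integrable_mult_left) (rule u_int)
    then show "integrable lborel (\<lambda>z. \<integral>\<tau>. norm (case (z, \<tau>) of (z, \<tau>) \<Rightarrow> u z * v \<tau>) \<partial>lborel)"
      using uv by simp
    show "AE z in lborel. integrable lborel (\<lambda>\<tau>. case (z, \<tau>) of (z, \<tau>) \<Rightarrow> u z * v \<tau>)"
      using v_int by simp
  qed simp
  then have f_int: "integrable (lborel \<Otimes>\<^sub>M lborel) (case_prod f)"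
  proof (rule Bochner_Integration.integrable_bound)
    show "case_prod f \<in> borel_measurable (lborel \<Otimes>\<^sub>M lborel)" unfolding f_def by simp
    have "norm (f z \<tau>) \<le> norm (u z * v \<tau>)" for z \<tau>
    proof (cases "z \<ge> 0")
      case True
      have "u z * (v \<tau> * exp (- (z * \<tau> powr r))) \<le> u z * (v \<tau> * 1)"
        using uv True by (intro mult_left_mono) auto
      then show ?thesis using uv by (simp add: f_def)
    qed (simp add: f_def u_def)
    then show "AE y in lborel \<Otimes>\<^sub>M lborel. norm (case_prod f y) \<le> norm (case y of (z, \<tau>) \<Rightarrow> u z * v \<tau>)" by auto
  qed
  have v_eq: "v \<tau> * exp (- (z * \<tau> powr r)) = indicator {0..} \<tau> *\<^sub>R (\<tau> powr (c1 * r + c2 - 1) * exp (- \<tau> - z * \<tau> powr r))" for z \<tau>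
  proof -
    have "- \<tau> - z * \<tau> powr r = - \<tau> + - (z * \<tau> powr r)" by simp
    then show ?thesis unfolding v_def p_def by (simp only: exp_add real_scaleR_def mult.assoc)
  qed
  have "kappa c1 c2 r x = (\<integral>z. (\<integral>\<tau>. f z \<tau> \<partial>lborel) \<partial>lborel)"
    unfolding kappa_def set_lebesgue_integral_def f_def v_eq integral_mult_right_zero
    by (simp only: u_def real_scaleR_def mult.assoc)
  also have "\<dots> = (\<integral>\<tau>. (\<integral>z. f z \<tau> \<partial>lborel) \<partial>lborel)"
    by (rule lborel_pair.Fubini_integral[OF f_int, symmetric])
  finally have k: "kappa c1 c2 r x = \<dots>" .
  let ?h = "\<lambda>\<tau>. \<tau> powr (c2 - 1) * (exp (- \<tau>) * lgam c1 (x * \<tau> powr r))"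
  have inner: "(\<integral>z. f z \<tau> \<partial>lborel) = indicator {0<..} \<tau> *\<^sub>R ?h \<tau>" for \<tau>
  proof (cases "\<tau> > 0")
    case False
    then show ?thesis by (cases "\<tau> = 0") (auto simp: f_def v_def)
  next
    case True
    have si: "set_integrable lborel {0..x} (\<lambda>z. z powr (c1 - 1) * exp (- (\<tau> powr r * z)))"
      using c1 by (intro borel_integrable_atLeastAtMost' lgam_integrand_continuous) auto
    have "(\<integral>z. f z \<tau> \<partial>lborel) = (\<integral>z. v \<tau> * (indicator {0..x} z *\<^sub>R (z powr (c1 - 1) * exp (- (\<tau> powr r * z)))) \<partial>lborel)"
      unfolding f_def u_def by (intro Bochner_Integration.integral_cong refl) (simp add: mult_ac)
    also have "\<dots> = v \<tau> * (LINT z:{0..x}|lborel. z powr (c1 - 1) * exp (- (\<tau> powr r * z)))"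
      unfolding set_lebesgue_integral_def by (rule integral_mult_right_zero)
    also have "(LINT z:{0..x}|lborel. z powr (c1 - 1) * exp (- (\<tau> powr r * z))) = lgam c1 (\<tau> powr r * x) / (\<tau> powr r) powr c1"
      unfolding set_borel_integral_eq_integral(2)[OF si]
      using True c1 x by (intro integral_unique lgam_scale) auto
    also have "v \<tau> * (lgam c1 (\<tau> powr r * x) / (\<tau> powr r) powr c1) = ?h \<tau>"
    proof -
      have "\<tau> powr p / (\<tau> powr r) powr c1 = \<tau> powr (c2 - 1)"
        unfolding powr_powr powr_diff[symmetric] by (simp add: p_def algebra_simps)
      then have "v \<tau> * (lgam c1 (\<tau> powr r * x) / (\<tau> powr r) powr c1) = \<tau> powr (c2 - 1) * exp (- \<tau>) * lgam c1 (\<tau> powr r * x)"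
        using True by (simp add: v_def flip: times_divide_eq_left times_divide_eq_right) (simp add: field_simps)
      then show ?thesis by (simp add: mult_ac)
    qed
    finally show ?thesis using True by simp
  qed
  have "integrable lborel (\<lambda>\<tau>. \<integral>z. f z \<tau> \<partial>lborel)" by (rule lborel_pair.integrable_snd[OF f_int])
  then have "set_integrable lborel {0<..} ?h" unfolding inner set_integrable_def .
  from set_borel_integral_eq_integral(2)[OF this] show ?thesis
    unfolding k inner set_lebesgue_integral_def .
qed

lemma abs_ln_le_powr:
  assumes "(t::real) > 0"
  shows "\<bar>ln t\<bar> \<le> 2 * (t powr (1/2) + t powr (- (1/2)))"
proof (cases "t \<le> 1")
  case True
  have "2 * t powr (- (1/2)) \<le> 2 * (t powr (1/2) + t powr (- (1/2)))" by simp
  with abs_ln_le[OF assms True] show ?thesis by (rule order_trans)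
next
  case False
  have "\<bar>ln (1 / t)\<bar> \<le> 2 * (1 / t) powr (- (1/2))" using False by (intro abs_ln_le) auto
  moreover have "(1 / t) powr (- (1/2)) = t powr (1/2)" using assms by (simp add: powr_divide powr_minus_divide)
  ultimately have "\<bar>ln t\<bar> \<le> 2 * t powr (1/2)" using assms by (simp add: ln_div)
  also have "\<dots> \<le> 2 * (t powr (1/2) + t powr (- (1/2)))" by simp
  finally show ?thesis .
qed

lemma exp_taylor_bound: "\<bar>exp y - 1 - y\<bar> \<le> y\<^sup>2 * exp \<bar>y\<bar>" for y :: real
proof -
  have "exp y * (1 - y) \<le> exp y * exp (- y)"
    using exp_ge_add_one_self[of "- y"] by (intro mult_left_mono) auto
  then have 1: "exp y - 1 \<le> y * exp y" by (simp add: exp_minus algebra_simps)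
  have "exp y - 1 - y \<le> y\<^sup>2 * exp \<bar>y\<bar>"
  proof (cases "y \<ge> 0")
    case True
    have "y * (exp y - 1) \<le> y * (y * exp y)" using 1 True by (intro mult_left_mono) auto
    then show ?thesis using 1 True by (simp add: power2_eq_square algebra_simps)
  next
    case False
    have "(- y) * (1 - exp y) \<le> (- y) * (- y)"
      using exp_ge_add_one_self[of y] False by (intro mult_left_mono) linarith+
    then have "exp y - 1 - y \<le> y\<^sup>2 * 1" using 1 by (simp add: power2_eq_square algebra_simps)
    also have "\<dots> \<le> y\<^sup>2 * exp \<bar>y\<bar>" by (intro mult_left_mono) auto
    finally show ?thesis .
  qed
  moreover have "0 \<le> y\<^sup>2 * exp \<bar>y\<bar>" by simp
  ultimately show ?thesis using exp_ge_add_one_self[of y] unfolding abs_le_iff by linarith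
qed

text \<open>The other arguments of kappa are fixed because shifts and derivatives concern only the
  second one.\<close>

locale kappa_params =
  fixes c1 r x :: real
  assumes c1: "c1 > 1" and r: "r > 0" and x: "x \<ge> 0"
begin

definition L :: "real \<Rightarrow> real" where "L \<tau> = exp (- \<tau>) * lgam c1 (x * \<tau> powr r)"

lemma L_continuous: "continuous_on {0<..} L"
  unfolding L_def using c1 x
  by (intro continuous_intros continuous_on_compose2[OF lgam_continuous]) auto

lemma L_nonneg: "0 \<le> L \<tau>"
  using lgam_nonneg[OF c1] by (simp add: L_def)

lemma L_le: "L \<tau> \<le> Gamma c1 * exp (- \<tau>)"
  using lgam_le_Gamma[OF c1] by (simp add: L_def mult.commute)

definition K :: "real \<Rightarrow> real" where "K c = integral {0<..} (\<lambda>\<tau>. \<tau> powr (c - 1) * L \<tau>)"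
definition Kln :: "real \<Rightarrow> real" where "Kln c = integral {0<..} (\<lambda>\<tau>. ln \<tau> * (\<tau> powr (c - 1) * L \<tau>))"

lemma kappa_K: "c > 0 \<Longrightarrow> kappa c1 c r x = K c"
  using kappa_eq[OF c1 _ r x] by (simp add: K_def L_def)

lemma L_integrand_continuous: "continuous_on {0<..} (\<lambda>\<tau>. \<tau> powr (c - 1) * L \<tau>)"
  by (intro continuous_intros L_continuous) auto

lemma L_integrand_le: "\<bar>\<tau> powr (c - 1) * L \<tau>\<bar> \<le> Gamma c1 * (\<tau> powr (c - 1) * exp (- \<tau>))"
  using mult_left_mono[OF L_le[of \<tau>], of "\<tau> powr (c - 1)"] L_nonneg[of \<tau>] by (simp add: mult_ac)

lemma gamma_majorant:
  fixes M c :: real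
  shows "c > 0 \<Longrightarrow> ((\<lambda>\<tau>. M * (\<tau> powr (c - 1) * exp (- \<tau>))) has_integral M * Gamma c) {0<..}"
  by (intro has_integral_mult_right gamma_density_has_integral)

lemma K_integrable:
  assumes "c > 0"
  shows "(\<lambda>\<tau>. \<tau> powr (c - 1) * L \<tau>) integrable_on {0<..}"
  by (rule integrable_on_pos_dominated[OF L_integrand_continuous has_integral_integrable[OF gamma_majorant[OF assms]] L_integrand_le])

lemma K_nonneg: "c > 0 \<Longrightarrow> 0 \<le> K c"
  unfolding K_def using K_integrable L_nonneg by (intro integral_nonneg) auto

lemma K_le: "c > 0 \<Longrightarrow> K c \<le> Gamma c1 * Gamma c"
  unfolding K_def using gamma_majorant[of c "Gamma c1"] K_integrable[of c] L_integrand_le[of _ c]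
  by (intro has_integral_le[OF integrable_integral]) (auto simp: abs_le_iff)

text \<open>For small \<open>x\<close>: lgam c1 y \<le> y^c1 makes kappa O(x^c1).\<close>

lemma K_le_powr:
  assumes "c > 0"
  shows "K c \<le> x powr c1 * Gamma (c1 * r + c)"
proof -
  have "c1 * r + c > 0" using assms c1 r by (simp add: add_pos_pos)
  from gamma_majorant[OF this, of "x powr c1"] K_integrable[OF assms]
  show ?thesis unfolding K_def
  proof (intro has_integral_le[OF integrable_integral])
    fix \<tau> :: real assume \<tau>: "\<tau> \<in> {0<..}"
    have "lgam c1 (x * \<tau> powr r) \<le> (x * \<tau> powr r) powr c1" using c1 x by (intro lgam_le_powr) auto
    also have "\<dots> = x powr c1 * \<tau> powr (c1 * r)" using x by (simp add: powr_mult powr_powr mult.commute)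
    finally have "\<tau> powr (c - 1) * L \<tau> \<le> \<tau> powr (c - 1) * (exp (- \<tau>) * (x powr c1 * \<tau> powr (c1 * r)))"
      unfolding L_def by (intro mult_left_mono) auto
    also have "\<dots> = x powr c1 * (\<tau> powr (c1 * r) * \<tau> powr (c - 1) * exp (- \<tau>))" by (simp add: mult_ac)
    also have "\<tau> powr (c1 * r) * \<tau> powr (c - 1) = \<tau> powr (c1 * r + c - 1)"
      unfolding powr_add[symmetric] by (simp add: algebra_simps)
    finally show "\<tau> powr (c - 1) * L \<tau> \<le> x powr c1 * (\<tau> powr (c1 * r + c - 1) * exp (- \<tau>))" .
  qed
qed

text \<open>For large \<open>x\<close>: the tail bound \<open>Gamma_le_lgam\<close> costs a term
  with the factor 1/(x \<tau>^r), integrable against the gamma density because c > r. With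
  \<open>K_le\<close> it pins down the limit.\<close>

lemma K_ge:
  assumes "c > r" "x > 0"
  shows "Gamma c1 * Gamma c - Gamma (c1 + 1) * Gamma (c - r) / x \<le> K c"
proof -
  have c: "c > 0" using assms r by simp
  have "((\<lambda>\<tau>. Gamma c1 * (\<tau> powr (c - 1) * exp (- \<tau>)) - Gamma (c1 + 1) / x * (\<tau> powr (c - r - 1) * exp (- \<tau>)))
    has_integral Gamma c1 * Gamma c - Gamma (c1 + 1) / x * Gamma (c - r)) {0<..}"
    using assms c by (intro has_integral_diff gamma_majorant) auto
  then have "Gamma c1 * Gamma c - Gamma (c1 + 1) / x * Gamma (c - r) \<le> K c"
    unfolding K_def
  proof (rule has_integral_le[OF _ integrable_integral[OF K_integrable[OF c]]])
    fix \<tau> :: real assume \<tau>: "\<tau> \<in> {0<..}"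
    have "Gamma c1 - Gamma (c1 + 1) / (x * \<tau> powr r) \<le> lgam c1 (x * \<tau> powr r)"
      using Gamma_le_lgam[OF c1, of "x * \<tau> powr r"] assms \<tau> by auto
    then have "\<tau> powr (c - 1) * (exp (- \<tau>) * (Gamma c1 - Gamma (c1 + 1) / (x * \<tau> powr r))) \<le> \<tau> powr (c - 1) * L \<tau>"
      unfolding L_def by (intro mult_left_mono) auto
    moreover have "\<tau> powr (c - r - 1) = \<tau> powr (c - 1) / \<tau> powr r"
      unfolding powr_diff[symmetric] by (simp add: algebra_simps)
    ultimately show "Gamma c1 * (\<tau> powr (c - 1) * exp (- \<tau>)) - Gamma (c1 + 1) / x * (\<tau> powr (c - r - 1) * exp (- \<tau>)) \<le> \<tau> powr (c - 1) * L \<tau>"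
      by (simp add: algebra_simps)
  qed
  then show ?thesis by simp
qed

lemma L_double: "\<tau> > 0 \<Longrightarrow> L (2 * \<tau>) \<le> 2 powr (r * c1) * exp (- \<tau>) * L \<tau>"
proof -
  assume \<tau>: "\<tau> > 0"
  have "lgam c1 (x * (2 * \<tau>) powr r) = lgam c1 (2 powr r * (x * \<tau> powr r))"
    using \<tau> by (simp add: powr_mult mult_ac)
  also have "\<dots> \<le> (2 powr r) powr c1 * lgam c1 (x * \<tau> powr r)"
    using r x c1 by (intro lgam_growth ge_one_powr_ge_zero) auto
  finally have "L (2 * \<tau>) \<le> exp (- (2 * \<tau>)) * (2 powr (r * c1) * lgam c1 (x * \<tau> powr r))"
    unfolding L_def by (simp add: powr_powr)
  also have "exp (- (2 * \<tau>)) = exp (- \<tau>) * exp (- \<tau>)" by (simp flip: exp_add)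
  finally show ?thesis by (simp add: L_def mult_ac)
qed

text \<open>After the substitution of 2 \<tau> for \<tau>, \<open>L_double\<close> bounds the kernel
  by a constant times its old value and yields an extra exp (- \<tau>); the surplus power is
  absorbed by \<tau> exp (- \<tau>) \<le> 1. The constant does not depend on \<open>x\<close>, which
  makes the errors of \<open>cX1\<close> and \<open>cX2\<close> relative ones.\<close>

lemma K_plus1_le:
  assumes "c > 0"
  shows "K (c + 1) \<le> 2 powr (c + 1 + r * c1) * K c"
proof -
  let ?f = "\<lambda>\<tau>. \<tau> powr c * L \<tau>"
  have f: "?f integrable_on {0<..}" "K (c + 1) = integral {0<..} ?f"
    using K_integrable[of "c + 1"] assms by (simp_all add: K_def)
  then have "?f absolutely_integrable_on {0<..}"
    using L_nonneg by (intro nonnegative_absolutely_integrable_1) auto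
  moreover have im: "(\<lambda>\<tau>::real. 2 * \<tau>) ` {0<..} = {0<..}"
  proof (intro set_eqI iffI)
    fix y :: real assume "y \<in> {0<..}"
    then show "y \<in> (\<lambda>\<tau>. 2 * \<tau>) ` {0<..}" by (intro image_eqI[of _ _ "y / 2"]) auto
  qed auto
  ultimately have sub: "(\<lambda>\<tau>. \<bar>2\<bar> * ?f (2 * \<tau>)) absolutely_integrable_on {0<..} \<and> integral {0<..} (\<lambda>\<tau>. \<bar>2\<bar> * ?f (2 * \<tau>)) = K (c + 1)"
    using has_absolute_integral_change_of_variables_1'[of "{0<..}" "\<lambda>\<tau>. 2 * \<tau>" "\<lambda>_. 2" ?f "K (c + 1)"] f(2)
    by (auto intro!: derivative_eq_intros simp: inj_on_def)
  then have "K (c + 1) = integral {0<..} (\<lambda>\<tau>. \<bar>2\<bar> * ?f (2 * \<tau>))" by simp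
  also have "\<dots> \<le> integral {0<..} (\<lambda>\<tau>. 2 powr (c + 1 + r * c1) * (\<tau> powr (c - 1) * L \<tau>))"
  proof (rule integral_le)
    show "(\<lambda>\<tau>. \<bar>2\<bar> * ?f (2 * \<tau>)) integrable_on {0<..}"
      using sub set_lebesgue_integral_eq_integral(1) by blast
    show "(\<lambda>\<tau>. 2 powr (c + 1 + r * c1) * (\<tau> powr (c - 1) * L \<tau>)) integrable_on {0<..}"
      using K_integrable[OF assms] by (rule integrable_on_mult_right)
    fix \<tau> :: real assume "\<tau> \<in> {0<..}"
    then have \<tau>: "\<tau> > 0" by simp
    have "\<tau> * exp (- \<tau>) \<le> exp \<tau> * exp (- \<tau>)"
      using exp_ge_add_one_self[of \<tau>] by (intro mult_right_mono[OF _ exp_ge_zero]) linarith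
    then have e: "\<tau> * exp (- \<tau>) \<le> 1" by (simp add: exp_minus)
    have "\<bar>2\<bar> * ?f (2 * \<tau>) \<le> 2 * ((2 * \<tau>) powr c * (2 powr (r * c1) * exp (- \<tau>) * L \<tau>))"
      using L_double[OF \<tau>] by (simp add: mult_left_mono)
    also have "\<dots> = (2 powr 1 * 2 powr c * 2 powr (r * c1)) * (\<tau> powr (c - 1) * L \<tau>) * (\<tau> * exp (- \<tau>))"
    proof -
      have "\<tau> powr c = \<tau> * \<tau> powr (c - 1)" using \<tau> by (simp add: powr_mult_base)
      then show ?thesis using \<tau> by (simp add: powr_mult mult_ac)
    qed
    also have "\<dots> \<le> (2 powr 1 * 2 powr c * 2 powr (r * c1)) * (\<tau> powr (c - 1) * L \<tau>) * 1"
      using e L_nonneg by (intro mult_left_mono) auto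
    also have "2 powr 1 * 2 powr c * 2 powr (r * c1) = (2::real) powr (c + 1 + r * c1)"
      unfolding powr_add[symmetric] by (simp add: add_ac)
    finally show "\<bar>2\<bar> * ?f (2 * \<tau>) \<le> 2 powr (c + 1 + r * c1) * (\<tau> powr (c - 1) * L \<tau>)" by simp
  qed
  finally show ?thesis by (simp add: K_def)
qed

text \<open>Bounds the integral of |ln \<tau>| \<tau>^(c - 1) e^(- \<tau>) for c > 1/2, through |ln
  \<tau>| \<le> 2 (\<tau>^(1/2) + \<tau>^(-1/2)).\<close>

definition ln_const :: "real \<Rightarrow> real" where "ln_const c = 2 * (Gamma (c + 1/2) + Gamma (c - 1/2))"

lemma powr_half_shift:
  fixes \<tau> :: real
  shows "\<tau> powr (1/2) * \<tau> powr (c - 1) = \<tau> powr (c + 1/2 - 1)" "\<tau> powr (- (1/2)) * \<tau> powr (c - 1) = \<tau> powr (c - 1/2 - 1)"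
  unfolding powr_add[symmetric] by (simp_all add: algebra_simps)

lemma ln_majorant:
  assumes "c > 1/2"
  shows "((\<lambda>\<tau>. M * 2 * (\<tau> powr (c + 1/2 - 1) * exp (- \<tau>)) + M * 2 * (\<tau> powr (c - 1/2 - 1) * exp (- \<tau>)))
    has_integral M * ln_const c) {0<..}"
proof -
  have "((\<lambda>\<tau>. M * 2 * (\<tau> powr (c + 1/2 - 1) * exp (- \<tau>)) + M * 2 * (\<tau> powr (c - 1/2 - 1) * exp (- \<tau>)))
    has_integral M * 2 * Gamma (c + 1/2) + M * 2 * Gamma (c - 1/2)) {0<..}"
    using assms by (intro has_integral_add gamma_majorant) auto
  then show ?thesis by (simp add: ln_const_def algebra_simps)
qed

lemma ln_integrand_le:
  assumes "\<tau> > 0"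
  shows "\<bar>ln \<tau>\<bar> * (\<tau> powr (c - 1) * L \<tau>)
    \<le> Gamma c1 * 2 * (\<tau> powr (c + 1/2 - 1) * exp (- \<tau>)) + Gamma c1 * 2 * (\<tau> powr (c - 1/2 - 1) * exp (- \<tau>))"
proof -
  have "\<bar>ln \<tau>\<bar> * (\<tau> powr (c - 1) * L \<tau>) \<le> (2 * (\<tau> powr (1/2) + \<tau> powr (- (1/2)))) * (Gamma c1 * (\<tau> powr (c - 1) * exp (- \<tau>)))"
    by (rule mult_mono[OF abs_ln_le_powr[OF assms] abs_le_D1[OF L_integrand_le]]) (simp_all add: L_nonneg)
  then show ?thesis unfolding powr_half_shift[symmetric] by (simp add: algebra_simps)
qed

lemma ln_integrable:
  assumes "c > 1/2"
  shows "(\<lambda>\<tau>. ln \<tau> * (\<tau> powr (c - 1) * L \<tau>)) integrable_on {0<..}"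
    "(\<lambda>\<tau>. \<bar>ln \<tau>\<bar> * (\<tau> powr (c - 1) * L \<tau>)) integrable_on {0<..}"
  using ln_integrand_le[of _ c] L_nonneg
  by (intro integrable_on_pos_dominated[OF _ has_integral_integrable[OF ln_majorant[OF assms, of "Gamma c1"]]]
      continuous_intros L_continuous; auto simp: abs_mult)+

lemma abs_ln_integral_le:
  assumes "c > 1/2"
  shows "integral {0<..} (\<lambda>\<tau>. \<bar>ln \<tau>\<bar> * (\<tau> powr (c - 1) * L \<tau>)) \<le> Gamma c1 * ln_const c"
  using ln_integrand_le[of _ c] ln_integrable(2)[OF assms]
  by (intro has_integral_le[OF integrable_integral ln_majorant[OF assms]]) auto

lemma abs_Kln_le:
  assumes "c > 1/2"
  shows "\<bar>Kln c\<bar> \<le> Gamma c1 * ln_const c"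
proof -
  have "norm (Kln c) \<le> integral {0<..} (\<lambda>\<tau>. \<bar>ln \<tau>\<bar> * (\<tau> powr (c - 1) * L \<tau>))"
    unfolding Kln_def using ln_integrable[OF assms] L_nonneg
    by (intro Henstock_Kurzweil_Integration.integral_norm_bound_integral) (auto simp: abs_mult)
  then show ?thesis using abs_ln_integral_le[OF assms] by simp
qed

text \<open>Taylor remainder of exp at h ln \<tau>. With l = |ln \<tau>| the square is absorbed by
  l^2 \<le> 32 e^(l/4), and |h| \<le> 1/4 gives another e^(l/4); together they form e^(l/2), which
  is \<tau>^(1/2) or \<tau>^(-1/2).\<close>

lemma powr_taylor_bound:
  fixes \<tau> h :: real
  assumes \<tau>: "\<tau> > 0" and h: "\<bar>h\<bar> \<le> 1/4"
  shows "\<bar>\<tau> powr h - 1 - h * ln \<tau>\<bar> \<le> 32 * h\<^sup>2 * (\<tau> powr (1/2) + \<tau> powr (- (1/2)))"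
proof -
  define l where "l = \<bar>ln \<tau>\<bar>"
  have "(l / 4) ^ 2 / 2 \<le> exp (l / 4)"
    using exp_lower_Taylor_quadratic[of "l / 4"] by (simp add: l_def)
  then have l2: "l\<^sup>2 \<le> 32 * exp (l / 4)" by (simp add: power2_eq_square)
  have "\<bar>\<tau> powr h - 1 - h * ln \<tau>\<bar> \<le> (h * ln \<tau>)\<^sup>2 * exp \<bar>h * ln \<tau>\<bar>"
    using exp_taylor_bound[of "h * ln \<tau>"] \<tau> by (simp add: powr_def)
  also have "\<dots> = h\<^sup>2 * (l\<^sup>2 * exp (\<bar>h\<bar> * l))" by (simp add: l_def abs_mult power_mult_distrib)
  also have "\<dots> \<le> h\<^sup>2 * ((32 * exp (l / 4)) * exp (l / 4))"
    using l2 mult_right_mono[OF h, of l] by (intro mult_left_mono mult_mono) (auto simp: l_def)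
  also have "\<dots> = 32 * h\<^sup>2 * exp (l / 2)" by (simp flip: exp_add)
  also have "exp (l / 2) \<le> \<tau> powr (1/2) + \<tau> powr (- (1/2))"
  proof (cases "ln \<tau> \<ge> 0")
    case True
    then have "exp (l / 2) = \<tau> powr (1/2)" using \<tau> by (simp add: l_def powr_def)
    then show ?thesis by simp
  next
    case False
    then have "exp (l / 2) = \<tau> powr (- (1/2))" using \<tau> by (simp add: l_def powr_def)
    then show ?thesis by simp
  qed
  finally show ?thesis by (simp add: mult_left_mono)
qed

text \<open>Differentiation under the integral sign with the explicit error D |h| for the difference
  quotient, obtained by integrating \<open>powr_taylor_bound\<close>. From c > 3/4 and |h| \<le> 1/4
  it follows that the majorants are integrable and c + h stays positive.\<close>

lemma K_deriv:
  assumes c: "c > 3/4"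
  shows "(K has_real_derivative Kln c) (at c)"
proof -
  define D where "D = 16 * (Gamma c1 * ln_const c)"
  have bound: "\<bar>(K (c + h) - K c) / h - Kln c\<bar> \<le> D * \<bar>h\<bar>" if h: "h \<noteq> 0" "\<bar>h\<bar> \<le> 1/4" for h
  proof -
    let ?f = "\<lambda>\<tau>. \<tau> powr (c + h - 1) * L \<tau> - \<tau> powr (c - 1) * L \<tau> - h * (ln \<tau> * (\<tau> powr (c - 1) * L \<tau>))"
    have hl: "c + h > 0" "c > 0" "c > 1/2" using c h by linarith+
    have I: "(?f has_integral K (c + h) - K c - h * Kln c) {0<..}"
      unfolding K_def Kln_def using hl
      by (intro has_integral_diff has_integral_mult_right integrable_integral K_integrable ln_integrable(1))
    let ?M = "Gamma c1 * (16 * h\<^sup>2)"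
    have "norm (integral {0<..} ?f) \<le> integral {0<..} (\<lambda>\<tau>. ?M * 2 * (\<tau> powr (c + 1/2 - 1) * exp (- \<tau>)) + ?M * 2 * (\<tau> powr (c - 1/2 - 1) * exp (- \<tau>)))"
    proof (rule Henstock_Kurzweil_Integration.integral_norm_bound_integral)
      fix \<tau> :: real assume "\<tau> \<in> {0<..}"
      then have \<tau>: "\<tau> > 0" by simp
      have "\<tau> powr (c + h - 1) = \<tau> powr h * \<tau> powr (c - 1)"
        unfolding powr_add[symmetric] by (simp add: algebra_simps)
      then have "?f \<tau> = (\<tau> powr h - 1 - h * ln \<tau>) * (\<tau> powr (c - 1) * L \<tau>)"
        by (simp add: algebra_simps)
      then have "norm (?f \<tau>) = \<bar>\<tau> powr h - 1 - h * ln \<tau>\<bar> * \<bar>\<tau> powr (c - 1) * L \<tau>\<bar>"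
        by (simp only: real_norm_def abs_mult)
      also have "\<dots> \<le> (32 * h\<^sup>2 * (\<tau> powr (1/2) + \<tau> powr (- (1/2)))) * (Gamma c1 * (\<tau> powr (c - 1) * exp (- \<tau>)))"
        by (intro mult_mono powr_taylor_bound \<tau> h L_integrand_le) auto
      finally show "norm (?f \<tau>) \<le> ?M * 2 * (\<tau> powr (c + 1/2 - 1) * exp (- \<tau>)) + ?M * 2 * (\<tau> powr (c - 1/2 - 1) * exp (- \<tau>))"
        unfolding powr_half_shift[symmetric] by (simp add: algebra_simps)
    qed (use I ln_majorant[OF hl(3), of ?M] in \<open>auto simp: has_integral_integrable\<close>)
    then have "\<bar>K (c + h) - K c - h * Kln c\<bar> \<le> ?M * ln_const c"
      unfolding integral_unique[OF I] integral_unique[OF ln_majorant[OF hl(3), of ?M]] by simp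
    then have "\<bar>K (c + h) - K c - h * Kln c\<bar> / \<bar>h\<bar> \<le> (?M * ln_const c) / \<bar>h\<bar>"
      by (intro divide_right_mono) auto
    also have "(?M * ln_const c) / \<bar>h\<bar> = D * \<bar>h\<bar>"
      using h by (simp add: D_def power2_eq_square abs_if field_simps)
    also have "\<bar>K (c + h) - K c - h * Kln c\<bar> / \<bar>h\<bar> = \<bar>(K (c + h) - K c) / h - Kln c\<bar>"
      using h by (simp add: diff_divide_distrib flip: abs_divide)
    finally show ?thesis .
  qed
  have "((\<lambda>h. (K (c + h) - K c) / h - Kln c) \<longlongrightarrow> 0) (at 0)"
  proof (rule Lim_null_comparison)
    show "\<forall>\<^sub>F h in at 0. norm ((K (c + h) - K c) / h - Kln c) \<le> D * \<bar>h\<bar>"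
      unfolding eventually_at by (rule exI[of _ "1/4"]) (auto intro!: bound)
    show "((\<lambda>h. D * \<bar>h\<bar>) \<longlongrightarrow> 0) (at 0)" by (auto intro!: tendsto_eq_intros)
  qed
  then show ?thesis unfolding DERIV_def by (simp add: LIM_zero_iff)
qed

lemma kappa_c2_eq:
  assumes "c > 3/4"
  shows "kappa_c2 c1 c r x = Kln c"
proof -
  have "((\<lambda>c. kappa c1 c r x) has_real_derivative Kln c) (at c)"
  proof (rule has_field_derivative_transform_within_open[OF K_deriv[OF assms]])
    show "open {0::real<..}" "c \<in> {0<..}" using assms by auto
    show "K c' = kappa c1 c' r x" if "c' \<in> {0<..}" for c' using kappa_K that by simp
  qed
  then show ?thesis unfolding kappa_c2_def by (rule DERIV_imp_deriv)
qed

end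

subsection \<open>Comparison of the integrals with kappa\<close>

context kappa_params
begin

text \<open>Integrals of the kernel against majorants: \<open>T\<close> uses 1 + 2 (\<tau>^(1/2) +
  \<tau>^(-1/2)), which dominates 1 + |ln \<tau>|, and \<open>S\<close> has the additional factor 1
  + \<tau> + \<tau>^2 from the kernel errors.\<close>

definition T :: "real \<Rightarrow> real" where "T c = K c + 2 * K (c + 1/2) + 2 * K (c - 1/2)"
definition S :: "real \<Rightarrow> real" where "S c = T c + T (c + 1) + T (c + 2)"

lemma K_has_integral: "c > 0 \<Longrightarrow> ((\<lambda>\<tau>. \<tau> powr (c - 1) * L \<tau>) has_integral K c) {0<..}"
  unfolding K_def using K_integrable by (rule integrable_integral)

lemma T_has_integral:
  assumes "c > 1/2"
  shows "((\<lambda>\<tau>. (1 + 2 * (\<tau> powr (1/2) + \<tau> powr (- (1/2)))) * (\<tau> powr (c - 1) * L \<tau>)) has_integral T c) {0<..}"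
proof -
  have "((\<lambda>\<tau>. \<tau> powr (c - 1) * L \<tau> + 2 * (\<tau> powr (c + 1/2 - 1) * L \<tau>) + 2 * (\<tau> powr (c - 1/2 - 1) * L \<tau>)) has_integral T c) {0<..}"
    unfolding T_def using assms by (intro has_integral_add has_integral_mult_right K_has_integral) auto
  then show ?thesis unfolding powr_half_shift[symmetric] by (simp add: algebra_simps)
qed

lemma S_has_integral:
  assumes "c > 1/2"
  shows "((\<lambda>\<tau>. (1 + 2 * (\<tau> powr (1/2) + \<tau> powr (- (1/2)))) * ((1 + \<tau> + \<tau>\<^sup>2) * (\<tau> powr (c - 1) * L \<tau>))) has_integral S c) {0<..}"
proof -
  let ?h = "\<lambda>\<tau>::real. 1 + 2 * (\<tau> powr (1/2) + \<tau> powr (- (1/2)))"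
  have "((\<lambda>\<tau>. ?h \<tau> * (\<tau> powr (c - 1) * L \<tau>) + ?h \<tau> * (\<tau> powr (c + 1 - 1) * L \<tau>) + ?h \<tau> * (\<tau> powr (c + 2 - 1) * L \<tau>)) has_integral S c) {0<..}"
    unfolding S_def using assms by (intro has_integral_add T_has_integral) auto
  then show ?thesis
  proof (rule has_integral_eq[rotated])
    fix \<tau> :: real assume "\<tau> \<in> {0<..}"
    then have "\<tau> powr (c + 1 - 1) = \<tau> * \<tau> powr (c - 1)" "\<tau> powr (c + 2 - 1) = \<tau>\<^sup>2 * \<tau> powr (c - 1)"
      by (simp_all add: powr_mult_base power2_eq_square mult.assoc add_ac)
    then show "?h \<tau> * (\<tau> powr (c - 1) * L \<tau>) + ?h \<tau> * (\<tau> powr (c + 1 - 1) * L \<tau>) + ?h \<tau> * (\<tau> powr (c + 2 - 1) * L \<tau>)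
      = ?h \<tau> * ((1 + \<tau> + \<tau>\<^sup>2) * (\<tau> powr (c - 1) * L \<tau>))" by (simp add: algebra_simps)
  qed
qed

lemma two_K_le: "d > 0 \<Longrightarrow> 2 * K d \<le> Gamma c1 * (2 * Gamma d)"
  and two_K_le_powr: "d > 0 \<Longrightarrow> 2 * K d \<le> x powr c1 * (2 * Gamma (c1 * r + d))"
  using K_le[of d] K_le_powr[of d] by simp_all

text \<open>This bound is uniform in \<open>x\<close> and serves the error terms; the companion with
  x^c1 serves the regime in which \<open>x\<close> tends to 0.\<close>

lemma S_le: "c > 1/2 \<Longrightarrow> S c \<le> Gamma c1 *
   ((Gamma c + 2 * Gamma (c + 1/2) + 2 * Gamma (c - 1/2))
    + (Gamma (c + 1) + 2 * Gamma (c + 1 + 1/2) + 2 * Gamma (c + 1 - 1/2))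
    + (Gamma (c + 2) + 2 * Gamma (c + 2 + 1/2) + 2 * Gamma (c + 2 - 1/2)))"
  unfolding S_def T_def distrib_left
  by (intro add_mono two_K_le K_le; simp)

lemma S_le_powr: "c > 1/2 \<Longrightarrow> S c \<le> x powr c1 *
   ((Gamma (c1 * r + c) + 2 * Gamma (c1 * r + (c + 1/2)) + 2 * Gamma (c1 * r + (c - 1/2)))
    + (Gamma (c1 * r + (c + 1)) + 2 * Gamma (c1 * r + (c + 1 + 1/2)) + 2 * Gamma (c1 * r + (c + 1 - 1/2)))
    + (Gamma (c1 * r + (c + 2)) + 2 * Gamma (c1 * r + (c + 2 + 1/2)) + 2 * Gamma (c1 * r + (c + 2 - 1/2))))"
  unfolding S_def T_def distrib_left
  by (intro add_mono two_K_le_powr K_le_powr; simp)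

lemma S_nonneg: "c > 1/2 \<Longrightarrow> S c \<ge> 0"
  unfolding S_def T_def by (intro add_nonneg_nonneg mult_nonneg_nonneg K_nonneg) auto

text \<open>\<open>X\<close> stands for the rescaled binomial kernel. Two sources of error are kept
  apart: \<open>e1\<close> will be of order 1/k from the incomplete beta function, \<open>e2\<close>
  of order 1/l from the power of 1 - \<tau>/l, where \<tau> + \<tau>^2 appears.\<close>

context
  fixes X :: "real \<Rightarrow> real" and e1 e2 c :: real
  assumes X: "\<And>\<tau>. \<tau> > 0 \<Longrightarrow> \<bar>X \<tau> - L \<tau>\<bar> \<le> (e1 + e2 * (\<tau> + \<tau>\<^sup>2)) * L \<tau>"
    and e: "e1 \<ge> 0" "e2 \<ge> 0" and c: "c > 1/2"
begin

lemma perturb_K: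
  assumes I: "((\<lambda>\<tau>. \<tau> powr (c - 1) * X \<tau>) has_integral I) {0<..}"
  shows "\<bar>I - K c\<bar> \<le> e1 * K c + e2 * (K (c + 1) + K (c + 2))"
proof -
  have D: "((\<lambda>\<tau>. \<tau> powr (c - 1) * X \<tau> - \<tau> powr (c - 1) * L \<tau>) has_integral I - K c) {0<..}"
    using c by (intro has_integral_diff I K_has_integral) auto
  have B: "((\<lambda>\<tau>. e1 * (\<tau> powr (c - 1) * L \<tau>) + e2 * (\<tau> powr (c + 1 - 1) * L \<tau> + \<tau> powr (c + 2 - 1) * L \<tau>))
      has_integral e1 * K c + e2 * (K (c + 1) + K (c + 2))) {0<..}"
    using c by (intro has_integral_add has_integral_mult_right K_has_integral) auto
  have "norm (integral {0<..} (\<lambda>\<tau>. \<tau> powr (c - 1) * X \<tau> - \<tau> powr (c - 1) * L \<tau>))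
    \<le> integral {0<..} (\<lambda>\<tau>. e1 * (\<tau> powr (c - 1) * L \<tau>) + e2 * (\<tau> powr (c + 1 - 1) * L \<tau> + \<tau> powr (c + 2 - 1) * L \<tau>))"
  proof (rule Henstock_Kurzweil_Integration.integral_norm_bound_integral)
    fix \<tau> :: real assume "\<tau> \<in> {0<..}"
    then have \<tau>: "\<tau> > 0" by simp
    have p: "\<tau> powr (c + 1 - 1) = \<tau> * \<tau> powr (c - 1)" "\<tau> powr (c + 2 - 1) = \<tau>\<^sup>2 * \<tau> powr (c - 1)"
      using \<tau> by (simp_all add: powr_mult_base power2_eq_square mult.assoc add_ac)
    have "norm (\<tau> powr (c - 1) * X \<tau> - \<tau> powr (c - 1) * L \<tau>) = \<tau> powr (c - 1) * \<bar>X \<tau> - L \<tau>\<bar>"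
      by (simp add: abs_mult flip: right_diff_distrib)
    also have "\<dots> \<le> \<tau> powr (c - 1) * ((e1 + e2 * (\<tau> + \<tau>\<^sup>2)) * L \<tau>)"
      using X[OF \<tau>] by (intro mult_left_mono) auto
    also have "\<dots> = e1 * (\<tau> powr (c - 1) * L \<tau>) + e2 * (\<tau> powr (c + 1 - 1) * L \<tau> + \<tau> powr (c + 2 - 1) * L \<tau>)"
      unfolding p by (simp add: algebra_simps)
    finally show "norm (\<tau> powr (c - 1) * X \<tau> - \<tau> powr (c - 1) * L \<tau>)
      \<le> e1 * (\<tau> powr (c - 1) * L \<tau>) + e2 * (\<tau> powr (c + 1 - 1) * L \<tau> + \<tau> powr (c + 2 - 1) * L \<tau>)" .
  qed (use D B in \<open>simp_all only: has_integral_integrable\<close>)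
  then show ?thesis unfolding integral_unique[OF D] integral_unique[OF B] by simp
qed

lemma perturb_ln_bound:
  assumes Y: "\<And>\<tau>. \<tau> > 0 \<Longrightarrow> \<bar>Y \<tau>\<bar> \<le> E * ((1 + \<tau> + \<tau>\<^sup>2) * L \<tau>)" and "E \<ge> 0" "\<Lambda> \<ge> 0"
    and I: "((\<lambda>\<tau>. (\<Lambda> - ln \<tau>) * (\<tau> powr (c - 1) * Y \<tau>)) has_integral I) {0<..}"
  shows "\<bar>I\<bar> \<le> E * (1 + \<Lambda>) * S c"
proof -
  let ?h = "\<lambda>\<tau>::real. 1 + 2 * (\<tau> powr (1/2) + \<tau> powr (- (1/2)))"
  have B: "((\<lambda>\<tau>. E * (1 + \<Lambda>) * (?h \<tau> * ((1 + \<tau> + \<tau>\<^sup>2) * (\<tau> powr (c - 1) * L \<tau>)))) has_integral E * (1 + \<Lambda>) * S c) {0<..}"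
    by (intro has_integral_mult_right S_has_integral c)
  have "norm (integral {0<..} (\<lambda>\<tau>. (\<Lambda> - ln \<tau>) * (\<tau> powr (c - 1) * Y \<tau>)))
    \<le> integral {0<..} (\<lambda>\<tau>. E * (1 + \<Lambda>) * (?h \<tau> * ((1 + \<tau> + \<tau>\<^sup>2) * (\<tau> powr (c - 1) * L \<tau>))))"
  proof (rule Henstock_Kurzweil_Integration.integral_norm_bound_integral)
    fix \<tau> :: real assume "\<tau> \<in> {0<..}"
    then have \<tau>: "\<tau> > 0" by simp
    have h: "1 \<le> ?h \<tau>" by simp
    have "\<bar>\<Lambda> - ln \<tau>\<bar> \<le> \<Lambda> + \<bar>ln \<tau>\<bar>" using assms(3) by linarith
    also have "\<dots> \<le> \<Lambda> + (?h \<tau> - 1)" using abs_ln_le_powr[OF \<tau>] by simp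
    also have "\<dots> \<le> (1 + \<Lambda>) * ?h \<tau>"
    proof -
      have "\<Lambda> + (H - 1) \<le> (1 + \<Lambda>) * H" if "1 \<le> H" for H
        using mult_left_mono[OF that assms(3)] by (simp add: distrib_right)
      then show ?thesis using h by blast
    qed
    finally have 1: "\<bar>\<Lambda> - ln \<tau>\<bar> \<le> (1 + \<Lambda>) * ?h \<tau>" .
    have "norm ((\<Lambda> - ln \<tau>) * (\<tau> powr (c - 1) * Y \<tau>)) = \<bar>\<Lambda> - ln \<tau>\<bar> * (\<tau> powr (c - 1) * \<bar>Y \<tau>\<bar>)"
      by (simp add: abs_mult)
    also have "\<dots> \<le> ((1 + \<Lambda>) * ?h \<tau>) * (\<tau> powr (c - 1) * (E * ((1 + \<tau> + \<tau>\<^sup>2) * L \<tau>)))"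
      using 1 h assms(3) by (intro mult_mono mult_left_mono Y \<tau> mult_nonneg_nonneg) auto
    also have "\<dots> = E * (1 + \<Lambda>) * (?h \<tau> * ((1 + \<tau> + \<tau>\<^sup>2) * (\<tau> powr (c - 1) * L \<tau>)))"
      by (simp only: mult_ac)
    finally show "norm ((\<Lambda> - ln \<tau>) * (\<tau> powr (c - 1) * Y \<tau>))
      \<le> E * (1 + \<Lambda>) * (?h \<tau> * ((1 + \<tau> + \<tau>\<^sup>2) * (\<tau> powr (c - 1) * L \<tau>)))" .
  qed (use I B in \<open>simp_all only: has_integral_integrable\<close>)
  then show ?thesis unfolding integral_unique[OF I] integral_unique[OF B] by simp
qed

lemma perturb_ln:
  assumes I: "((\<lambda>\<tau>. (\<Lambda> - ln \<tau>) * (\<tau> powr (c - 1) * X \<tau>)) has_integral I) {0<..}" and \<Lambda>: "\<Lambda> \<ge> 0"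
  shows "\<bar>I - (\<Lambda> * K c - Kln c)\<bar> \<le> (e1 + e2) * (1 + \<Lambda>) * S c"
    and "\<bar>I\<bar> \<le> (1 + e1 + e2) * (1 + \<Lambda>) * S c"
proof -
  have le: "(e1 + e2 * (\<tau> + \<tau>\<^sup>2)) * L \<tau> \<le> (e1 + e2) * ((1 + \<tau> + \<tau>\<^sup>2) * L \<tau>)"
    and le1: "L \<tau> \<le> (1 + \<tau> + \<tau>\<^sup>2) * L \<tau>" if "\<tau> > 0" for \<tau>
  proof -
    have "0 \<le> e1 * (\<tau> + \<tau>\<^sup>2) + e2" using that e by simp
    then have "e1 + e2 * (\<tau> + \<tau>\<^sup>2) \<le> (e1 + e2) * (1 + \<tau> + \<tau>\<^sup>2)" by (simp add: algebra_simps)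
    from mult_right_mono[OF this L_nonneg[of \<tau>]]
    show "(e1 + e2 * (\<tau> + \<tau>\<^sup>2)) * L \<tau> \<le> (e1 + e2) * ((1 + \<tau> + \<tau>\<^sup>2) * L \<tau>)"
      by (simp only: mult.assoc)
    have "1 * L \<tau> \<le> (1 + \<tau> + \<tau>\<^sup>2) * L \<tau>" using that L_nonneg by (intro mult_right_mono) auto
    then show "L \<tau> \<le> (1 + \<tau> + \<tau>\<^sup>2) * L \<tau>" by simp
  qed
  have KI: "((\<lambda>\<tau>. \<Lambda> * (\<tau> powr (c - 1) * L \<tau>) - ln \<tau> * (\<tau> powr (c - 1) * L \<tau>)) has_integral \<Lambda> * K c - Kln c) {0<..}"
    unfolding Kln_def using c by (intro has_integral_diff has_integral_mult_right K_has_integral integrable_integral ln_integrable(1)) auto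
  have H: "((\<lambda>\<tau>. (\<Lambda> - ln \<tau>) * (\<tau> powr (c - 1) * (X \<tau> - L \<tau>))) has_integral I - (\<Lambda> * K c - Kln c)) {0<..}"
    using has_integral_diff[OF I KI] by (simp add: algebra_simps)
  show "\<bar>I - (\<Lambda> * K c - Kln c)\<bar> \<le> (e1 + e2) * (1 + \<Lambda>) * S c"
  proof (rule perturb_ln_bound[OF _ _ \<Lambda> H])
    fix \<tau> :: real assume \<tau>: "\<tau> > 0"
    show "\<bar>X \<tau> - L \<tau>\<bar> \<le> (e1 + e2) * ((1 + \<tau> + \<tau>\<^sup>2) * L \<tau>)"
      using X[OF \<tau>] le[OF \<tau>] by (rule order_trans)
  qed (use e in simp)
  show "\<bar>I\<bar> \<le> (1 + e1 + e2) * (1 + \<Lambda>) * S c"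
  proof (rule perturb_ln_bound[OF _ _ \<Lambda> I])
    fix \<tau> :: real assume \<tau>: "\<tau> > 0"
    have "(1 + e1 + e2) * ((1 + \<tau> + \<tau>\<^sup>2) * L \<tau>) = (1 + \<tau> + \<tau>\<^sup>2) * L \<tau> + (e1 + e2) * ((1 + \<tau> + \<tau>\<^sup>2) * L \<tau>)"
      by (simp add: distrib_right)
    then show "\<bar>X \<tau>\<bar> \<le> (1 + e1 + e2) * ((1 + \<tau> + \<tau>\<^sup>2) * L \<tau>)"
      using X[OF \<tau>] le[OF \<tau>] le1[OF \<tau>] L_nonneg[of \<tau>] by linarith
  qed (use e in simp)
qed

end

end

text \<open>u = (\<tau>/l)^(1/a) turns u^a into \<tau>/l, so that the target weight (1 - u^a)^(l - 1
  - j) approaches e^(- \<tau>) as \<open>l\<close> grows.\<close>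

lemma power_substitution:
  fixes F :: "real \<Rightarrow> real"
  assumes a: "a > 0" and l: "l > 0" and F: "continuous_on {0..1} F"
  shows "((\<lambda>\<tau>. 1 / (a * l) * (\<tau> / l) powr (1 / a - 1) * F ((\<tau> / l) powr (1 / a))) has_integral integral {0..1} F) {0<..l}"
proof -
  let ?g = "\<lambda>\<tau>. (\<tau> / l) powr (1 / a)" and ?g' = "\<lambda>\<tau>. 1 / (a * l) * (\<tau> / l) powr (1 / a - 1)"
  have "F absolutely_integrable_on {0..1}" using F by (rule absolutely_integrable_continuous_real)
  then have F1: "F absolutely_integrable_on {0<..1}" by (rule set_integrable_subset) auto
  have "negligible {u \<in> {0..1} - {0<..1}. F u \<noteq> 0}" "negligible {u \<in> {0<..1} - {0..1}. F u \<noteq> 0}"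
    by (auto intro: negligible_subset[of "{0::real}"])
  from has_integral_spike_set_eq[OF this] integrable_integral[OF integrable_continuous_real[OF F]]
  have F2: "integral {0<..1} F = integral {0..1} F" by (intro integral_unique) (simp only:)
  have im: "?g ` {0<..l} = {0<..1}"
  proof (intro set_eqI iffI)
    fix u :: real assume u: "u \<in> {0<..1}"
    then have "l * u powr a \<in> {0<..l}" using a l by (auto intro: powr_le1)
    moreover have "?g (l * u powr a) = u" using u a l by (simp add: powr_powr)
    ultimately show "u \<in> ?g ` {0<..l}" by (intro image_eqI[of _ _ "l * u powr a"]) auto
  qed (use a l in \<open>auto intro!: powr_le1\<close>)
  have inj: "inj_on ?g {0<..l}"
  proof (rule inj_onI)
    fix s t assume "s \<in> {0<..l}" "t \<in> {0<..l}" "?g s = ?g t"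
    then have "(?g s) powr a = (?g t) powr a" "s > 0" "t > 0" by auto
    then show "s = t" using a l by (simp add: powr_powr)
  qed
  have der: "(?g has_field_derivative ?g' \<tau>) (at \<tau> within {0<..l})" if "\<tau> \<in> {0<..l}" for \<tau>
    using that a l by (auto intro!: derivative_eq_intros simp: field_simps)
  have S: "{0<..l} \<in> sets lebesgue" by simp
  have H: "(\<lambda>\<tau>. \<bar>?g' \<tau>\<bar> * F (?g \<tau>)) absolutely_integrable_on {0<..l} \<and>
      integral {0<..l} (\<lambda>\<tau>. \<bar>?g' \<tau>\<bar> * F (?g \<tau>)) = integral {0..1} F"
    by (rule has_absolute_integral_change_of_variables_1'[OF S der inj, THEN iffD2, unfolded im])
      (use F1 F2 in blast)+
  have "((\<lambda>\<tau>. \<bar>?g' \<tau>\<bar> * F (?g \<tau>)) has_integral integral {0<..l} (\<lambda>\<tau>. \<bar>?g' \<tau>\<bar> * F (?g \<tau>))) {0<..l}"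
    by (rule integrable_integral[OF set_lebesgue_integral_eq_integral(1)[OF conjunct1[OF H]]])
  then have "((\<lambda>\<tau>. \<bar>?g' \<tau>\<bar> * F (?g \<tau>)) has_integral integral {0..1} F) {0<..l}"
    by (simp only: conjunct2[OF H])
  moreover have "\<bar>?g' \<tau>\<bar> = ?g' \<tau>" for \<tau>
    using a l by (intro abs_of_nonneg mult_nonneg_nonneg) auto
  ultimately show ?thesis by (simp only:)
qed

lemma perturb_product:
  fixes R R' M I :: real
  assumes R: "\<bar>R - 1\<bar> \<le> C / k" "\<bar>R' - 1\<bar> \<le> C' / l" and kl: "k \<ge> 1" "l \<ge> 1" and C: "C \<ge> 0" "C' \<ge> 0"
    and I: "\<bar>I - M\<bar> \<le> E"
  shows "\<bar>R * R' * I - M\<bar> \<le> (1 + C) * (1 + C') * E + (C * (1 + C') + C') * (1 / k + 1 / l) * \<bar>M\<bar>"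
proof -
  have "C / k \<le> C" "C' / l \<le> C'" using kl C by (simp_all add: divide_le_eq mult_le_cancel_left1)
  then have b: "\<bar>R\<bar> \<le> 1 + C" "\<bar>R'\<bar> \<le> 1 + C'" using R by linarith+
  have E: "E \<ge> 0" using I by linarith
  have eq: "R * R' * I - M = R * R' * (I - M) + ((R - 1) * R' + (R' - 1)) * M" by (simp add: algebra_simps)
  have "\<bar>R * R' * I - M\<bar> \<le> \<bar>R * R' * (I - M)\<bar> + \<bar>((R - 1) * R' + (R' - 1)) * M\<bar>"
    unfolding eq by (rule abs_triangle_ineq)
  also have "\<bar>R * R' * (I - M)\<bar> \<le> (1 + C) * (1 + C') * E"
    unfolding abs_mult using b I C E by (intro mult_mono) auto
  also have "\<bar>((R - 1) * R' + (R' - 1)) * M\<bar> \<le> (C * (1 + C') + C') * (1 / k + 1 / l) * \<bar>M\<bar>"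
    unfolding abs_mult
  proof (rule mult_right_mono)
    have "\<bar>(R - 1) * R'\<bar> \<le> C / k * (1 + C')"
      unfolding abs_mult using R b kl C by (intro mult_mono) auto
    then have "\<bar>(R - 1) * R' + (R' - 1)\<bar> \<le> C / k * (1 + C') + C' / l" using R(2) by linarith
    \<comment> \<open>Nonnegative terms are added to complete the product with 1/k + 1/l.\<close>
    also have "\<dots> \<le> C / k * (1 + C') + C' / l + (C' / k + C * (1 + C') / l)" using kl C by simp
    also have "\<dots> = (C * (1 + C') + C') * (1 / k + 1 / l)" by (simp add: algebra_simps add_divide_distrib)
    finally show "\<bar>(R - 1) * R' + (R' - 1)\<bar> \<le> (C * (1 + C') + C') * (1 / k + 1 / l)" .
  qed simp
  finally show ?thesis by simp
qed

section \<open>Rescaling of \<open>J\<close> and \<open>Jlog\<close> to the kernel of kappa\<close>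

context yule_pair
begin

text \<open>The arguments of kappa: \<open>q i\<close> is the exponent of the incomplete beta
  function in the source primitive, \<open>c j\<close> - 1 the power of \<tau> left by the
  substitution \<tau> = l u^a, and \<open>xx\<close> arises from k u^b = \<open>xx\<close>
  \<tau>^(b/a).\<close>

abbreviation "q i \<equiv> \<delta> + 1 / b + real i"
abbreviation "c j \<equiv> \<delta>' + b / a + 1 + real j"
abbreviation "xx k l \<equiv> real k / real l powr (b / a)"
abbreviation "kap i j k l \<equiv> kappa (q i) (c j) (b / a) (xx k l)"
text \<open>The size of \<open>J\<close> apart from kappa; \<open>R\<close> and \<open>R'\<close>
  below are the coefficients divided by their asymptotic values, and tend to 1.\<close>

definition "N0 i j k l = real k powr (- (1 / b)) * real l powr (- (b / a) - 1) / (a * b * Gamma (real i + \<delta>) * Gamma (real j + \<delta>'))"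
definition "R i k = src.cf i k * Gamma (real i + \<delta>) / real k powr (\<delta> + real i)"
definition "R' j l = tgt.cf j l * Gamma (real j + \<delta>') / real l powr (\<delta>' + real j)"
text \<open>Extended by 0 beyond \<tau> = l, which corresponds to u = 1, so that it lives on the
  half-line of kappa.\<close>

definition "X i j k l \<tau> = (if \<tau> \<in> {0<..real l}
   then (1 - \<tau> / real l) ^ (l - 1 - j) * (real k powr q i * inc_beta (q i) (k - 1 - i) ((\<tau> / real l) powr (b / a))) else 0)"

lemma q_gt_1: "q i > 1" and c_gt_1: "c j > 1" and c_gt_r: "c j > b / a" and r_pos: "b / a > 0"
proof -
  show "b / a > 0" using src.b tgt.b by simp
  then show "q i > 1" "c j > 1" "c j > b / a" using src.exponent_gt_1[of i] tgt.\<delta> by (simp_all add: add_ac add_nonneg_pos)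
qed

lemma kappa_params: "kappa_params (q i) (b / a) (xx k l)"
  using q_gt_1 r_pos by unfold_locales auto

lemma N0_nonneg: "N0 i j k l \<ge> 0"
proof -
  have "Gamma (real i + \<delta>) > 0" "Gamma (real j + \<delta>') > 0" using src.\<delta> tgt.\<delta> by (auto intro!: Gamma_real_pos)
  then show ?thesis unfolding N0_def using src.b tgt.b by (intro divide_nonneg_nonneg mult_nonneg_nonneg) auto
qed

lemma prefactor:
  assumes "k \<ge> 2" "l \<ge> 2"
  shows "src.cf i k / b * tgt.cf j l / a * real k powr (- q i) * real l powr (- c j) = N0 i j k l * (R i k * R' j l)"
proof -
  have G: "Gamma (real i + \<delta>) \<noteq> 0" "Gamma (real j + \<delta>') \<noteq> 0"
    using src.\<delta> tgt.\<delta> Gamma_real_pos[of "real i + \<delta>"] Gamma_real_pos[of "real j + \<delta>'"] by linarith+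
  have kl: "real k > 0" "real l > 0" using assms by auto
  have 1: "real k powr (- q i) = real k powr (- (1 / b)) / real k powr (\<delta> + real i)"
    unfolding powr_diff[symmetric] by (rule arg_cong[where f = "\<lambda>e. real k powr e"]) simp
  have 2: "real l powr (- c j) = real l powr (- (b / a) - 1) / real l powr (\<delta>' + real j)"
    unfolding powr_diff[symmetric] by (rule arg_cong[where f = "\<lambda>e. real l powr e"]) simp
  show ?thesis unfolding 1 2 N0_def R_def R'_def using G by (simp add: mult_ac)
qed

lemma integrand_subst:
  assumes kl: "k \<ge> 2" "l \<ge> 2" and \<tau>: "\<tau> \<in> {0<..real l}"
  defines "u \<equiv> (\<tau> / real l) powr (1 / a)"
  shows "1 / (a * real l) * (\<tau> / real l) powr (1 / a - 1) * (u powr (a + b - 1) * (src.cum i k u * tgt.dens j l u))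
    = N0 i j k l * (R i k * R' j l) * (\<tau> powr (c j - 1) * X i j k l \<tau>)"
    and "ln u = (ln \<tau> - ln (real l)) / a" and "u > 0"
proof -
  have p: "\<tau> / real l > 0" "real l > 0" "\<tau> > 0" using \<tau> kl by auto
  let ?t = "\<tau> / real l"
  show "ln u = (ln \<tau> - ln (real l)) / a" "u > 0" using p by (simp_all add: u_def ln_powr ln_div)
  have ua: "u powr a = ?t" "u powr b = ?t powr (b / a)" using tgt.b p by (simp_all add: u_def powr_powr)
  have "?t powr (1 / a - 1) * (u powr (a + b - 1) * u powr (a * (real j + \<delta>'))) = ?t powr (c j - 1)"
  proof -
    have "1 / a - 1 + (1 / a * (a + b - 1) + 1 / a * (a * (real j + \<delta>'))) = c j - 1"
      using tgt.b by (simp add: field_simps)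
    then show ?thesis unfolding u_def powr_powr powr_add[symmetric] by simp
  qed
  also have "?t powr (c j - 1) = real l * real l powr (- c j) * \<tau> powr (c j - 1)"
  proof -
    have "real l * real l powr (- c j) = real l powr (1 + - c j)" using p by (intro powr_mult_base) simp
    also have "\<dots> = real l powr (- (c j - 1))" by (rule arg_cong[where f = "\<lambda>e. real l powr e"]) simp
    also have "\<dots> = 1 / real l powr (c j - 1)" by (rule powr_minus_divide)
    finally have "real l * real l powr (- c j) = 1 / real l powr (c j - 1)" .
    then show ?thesis using p by (simp add: powr_divide)
  qed
  finally have key: "?t powr (1 / a - 1) * (u powr (a + b - 1) * u powr (a * (real j + \<delta>'))) = real l * real l powr (- c j) * \<tau> powr (c j - 1)" .
  have kk: "real k powr (- q i) * real k powr q i = 1" using kl by (simp flip: powr_add)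
  let ?I = "inc_beta (q i) (k - 1 - i) (?t powr (b / a))" and ?p = "(1 - ?t) ^ (l - 1 - j)"
  have cum: "src.cum i k u = src.cf i k / b * ?I" unfolding yule_cum_def ua by (simp add: add_ac)
  have "1 / (a * real l) * ?t powr (1 / a - 1) * (u powr (a + b - 1) * (src.cum i k u * tgt.dens j l u))
    = 1 / (a * real l) * (src.cf i k / b * tgt.cf j l) * (?t powr (1 / a - 1) * (u powr (a + b - 1) * u powr (a * (real j + \<delta>')))) * (?I * ?p)"
    unfolding cum yule_dens_def ua by (simp only: mult_ac times_divide_eq_left times_divide_eq_right)
  also have "\<dots> = (src.cf i k / b * tgt.cf j l / a * real l powr (- c j)) * (\<tau> powr (c j - 1) * (?p * ?I))"
    unfolding key using p by (simp add: mult_ac)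
  also have "\<dots> = (src.cf i k / b * tgt.cf j l / a * real l powr (- c j)) * (real k powr (- q i) * real k powr q i) * (\<tau> powr (c j - 1) * (?p * ?I))"
    unfolding kk by simp
  also have "\<dots> = (src.cf i k / b * tgt.cf j l / a * real k powr (- q i) * real l powr (- c j)) * (\<tau> powr (c j - 1) * X i j k l \<tau>)"
    unfolding X_def using \<tau> by (simp only: mult_ac if_True)
  finally show "1 / (a * real l) * ?t powr (1 / a - 1) * (u powr (a + b - 1) * (src.cum i k u * tgt.dens j l u))
    = N0 i j k l * (R i k * R' j l) * (\<tau> powr (c j - 1) * X i j k l \<tau>)"
    unfolding prefactor[OF kl] .
qed

lemma X_restrict: "(\<lambda>\<tau>. if \<tau> \<in> {0<..real l} then f \<tau> * (g \<tau> * X i j k l \<tau>) else 0) = (\<lambda>\<tau>. f \<tau> * (g \<tau> * X i j k l \<tau>))"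
  by (auto simp: X_def)

lemma R_pos: "k \<ge> 2 \<Longrightarrow> i \<le> 1 \<Longrightarrow> R i k > 0" and R'_pos: "l \<ge> 2 \<Longrightarrow> j \<le> 1 \<Longrightarrow> R' j l > 0"
proof -
  have G: "Gamma (real n + \<delta>) > 0" "Gamma (real n + \<delta>') > 0" for n
    using src.\<delta> tgt.\<delta> by (auto intro!: Gamma_real_pos add_nonneg_pos)
  have f: "yule_coeff d i k > 0" if "k \<ge> 2" "i \<le> 1" "Gamma (real k + d) > 0" "Gamma (real i + d) > 0" for d i k
    unfolding yule_coeff_def using that by (subst if_not_P) (auto intro!: divide_pos_pos mult_pos_pos)
  show "k \<ge> 2 \<Longrightarrow> i \<le> 1 \<Longrightarrow> R i k > 0" unfolding R_def by (intro divide_pos_pos mult_pos_pos f G) auto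
  show "l \<ge> 2 \<Longrightarrow> j \<le> 1 \<Longrightarrow> R' j l > 0" unfolding R'_def by (intro divide_pos_pos mult_pos_pos f G) auto
qed

lemma N0_pos:
  assumes "k \<ge> 2" "l \<ge> 2"
  shows "N0 i j k l > 0"
proof -
  have "Gamma (real i + \<delta>) > 0" "Gamma (real j + \<delta>') > 0"
    using src.\<delta> tgt.\<delta> by (auto intro!: Gamma_real_pos add_nonneg_pos)
  then show ?thesis unfolding N0_def using assms src.b tgt.b by (intro divide_pos_pos mult_pos_pos) auto
qed

lemma J_eq:
  assumes kl: "k \<ge> 2" "l \<ge> 2" and ij: "i \<le> 1" "j \<le> 1"
  shows "\<exists>I. ((\<lambda>\<tau>. \<tau> powr (c j - 1) * X i j k l \<tau>) has_integral I) {0<..} \<and> J i k j l = N0 i j k l * (R i k * R' j l * I)"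
proof -
  define A where "A = N0 i j k l * (R i k * R' j l)"
  have l0: "real l > 0" using kl by simp
  have "((\<lambda>\<tau>. A * (\<tau> powr (c j - 1) * X i j k l \<tau>)) has_integral J i k j l) {0<..real l}"
    unfolding J_def
    by (rule has_integral_eq[OF _ power_substitution[OF tgt.b(1) l0 J_continuous]]) (simp only: A_def integrand_subst(1)[OF kl])
  then have "((\<lambda>\<tau>. if \<tau> \<in> {0<..real l} then A * (\<tau> powr (c j - 1) * X i j k l \<tau>) else 0) has_integral J i k j l) {0<..}"
    by (subst has_integral_restrict) auto
  then have H: "((\<lambda>\<tau>. A * (\<tau> powr (c j - 1) * X i j k l \<tau>)) has_integral J i k j l) {0<..}"
    by (simp only: X_restrict[where f = "\<lambda>_. A"])
  have A: "A \<noteq> 0" using R_pos[OF kl(1) ij(1)] R'_pos[OF kl(2) ij(2)] N0_pos[OF kl, of i j] tgt.b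
    unfolding A_def by auto
  have "((\<lambda>\<tau>. inverse A * (A * (\<tau> powr (c j - 1) * X i j k l \<tau>))) has_integral inverse A * J i k j l) {0<..}"
    using H by (rule has_integral_mult_right)
  moreover have "inverse A * (A * y) = y" for y using A by simp
  ultimately have "((\<lambda>\<tau>. \<tau> powr (c j - 1) * X i j k l \<tau>) has_integral inverse A * J i k j l) {0<..}" by simp
  moreover have "J i k j l = N0 i j k l * (R i k * R' j l * (inverse A * J i k j l))"
  proof -
    have e: "A * (inverse A * J i k j l) = J i k j l" using A by simp
    have "A * y = N0 i j k l * (R i k * R' j l * y)" for y by (simp add: A_def)
    from this[of "inverse A * J i k j l"] show ?thesis by (simp only: e)
  qed
  ultimately show ?thesis by blast
qed

lemma Jlog_eq:
  assumes kl: "k \<ge> 2" "l \<ge> 2" and ij: "i \<le> 1" "j \<le> 1" and ab: "a + b = 1"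
  shows "\<exists>I. ((\<lambda>\<tau>. (ln (real l) - ln \<tau>) * (\<tau> powr (c j - 1) * X i j k l \<tau>)) has_integral I) {0<..}
    \<and> Jlog i k j l = N0 i j k l * (1 / a * (R i k * R' j l * I))"
proof -
  define A where "A = N0 i j k l * (R i k * R' j l) / a"
  have l0: "real l > 0" using kl by simp
  have "((\<lambda>\<tau>. A * ((ln (real l) - ln \<tau>) * (\<tau> powr (c j - 1) * X i j k l \<tau>))) has_integral Jlog i k j l) {0<..real l}"
    unfolding Jlog_def
  proof (rule has_integral_eq[OF _ power_substitution[OF tgt.b(1) l0 Jlog_continuous]])
    fix \<tau> assume \<tau>: "\<tau> \<in> {0<..real l}"
    let ?u = "(\<tau> / real l) powr (1 / a)"
    note s = integrand_subst[OF kl \<tau>]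
    have "1 / (a * real l) * (\<tau> / real l) powr (1 / a - 1) * (- (ln ?u * (src.cum i k ?u * tgt.dens j l ?u)))
      = - ln ?u * (1 / (a * real l) * (\<tau> / real l) powr (1 / a - 1) * (?u powr (a + b - 1) * (src.cum i k ?u * tgt.dens j l ?u)))"
      using s(3) ab by (simp add: mult_ac)
    also have "\<dots> = A * ((ln (real l) - ln \<tau>) * (\<tau> powr (c j - 1) * X i j k l \<tau>))"
      unfolding s(1) s(2) A_def by (simp add: algebra_simps diff_divide_distrib)
    finally show "1 / (a * real l) * (\<tau> / real l) powr (1 / a - 1) * (- (ln ?u * (src.cum i k ?u * tgt.dens j l ?u)))
      = A * ((ln (real l) - ln \<tau>) * (\<tau> powr (c j - 1) * X i j k l \<tau>))" .
  qed
  then have "((\<lambda>\<tau>. if \<tau> \<in> {0<..real l} then A * ((ln (real l) - ln \<tau>) * (\<tau> powr (c j - 1) * X i j k l \<tau>)) else 0) has_integral Jlog i k j l) {0<..}"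
    by (subst has_integral_restrict) auto
  then have H: "((\<lambda>\<tau>. A * ((ln (real l) - ln \<tau>) * (\<tau> powr (c j - 1) * X i j k l \<tau>))) has_integral Jlog i k j l) {0<..}"
    using X_restrict[where f = "\<lambda>\<tau>. A * (ln (real l) - ln \<tau>)"] by (simp only: mult.assoc)
  have A: "A \<noteq> 0" using R_pos[OF kl(1) ij(1)] R'_pos[OF kl(2) ij(2)] N0_pos[OF kl, of i j] tgt.b
    unfolding A_def by auto
  have "((\<lambda>\<tau>. inverse A * (A * ((ln (real l) - ln \<tau>) * (\<tau> powr (c j - 1) * X i j k l \<tau>)))) has_integral inverse A * Jlog i k j l) {0<..}"
    using H by (rule has_integral_mult_right)
  moreover have "inverse A * (A * y) = y" for y using A by simp
  ultimately have "((\<lambda>\<tau>. (ln (real l) - ln \<tau>) * (\<tau> powr (c j - 1) * X i j k l \<tau>)) has_integral inverse A * Jlog i k j l) {0<..}" by simp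
  moreover have "Jlog i k j l = N0 i j k l * (1 / a * (R i k * R' j l * (inverse A * Jlog i k j l)))"
  proof -
    have e: "A * (inverse A * Jlog i k j l) = Jlog i k j l" using A by simp
    have "A * y = N0 i j k l * (1 / a * (R i k * R' j l * y))" for y by (simp add: A_def)
    from this[of "inverse A * Jlog i k j l"] show ?thesis by (simp only: e)
  qed
  ultimately show ?thesis by blast
qed

text \<open>For \<tau> \<le> l the difference of products splits into the binomial error times the
  incomplete beta factor, which is at most 1 + \<open>cmp_const\<close> times its limit, and the
  exponential times the incomplete beta error. For \<tau> > l the exact kernel is 0 and the whole of
  \<open>L\<close> is charged to the error, since then 1 < \<tau>/l.\<close>

lemma X_compare:
  assumes kl: "k \<ge> 2" "l \<ge> 2" and ij: "i \<le> 1" "j \<le> 1" and \<tau>: "\<tau> > 0"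
  defines "D \<equiv> 7 * (1 + cmp_const (q i))"
  shows "\<bar>X i j k l \<tau> - kappa_params.L (q i) (b / a) (xx k l) \<tau>\<bar>
    \<le> (D / real k + D / real l * (\<tau> + \<tau>\<^sup>2)) * kappa_params.L (q i) (b / a) (xx k l) \<tau>"
proof -
  interpret kappa_params "q i" "b / a" "xx k l" by (rule kappa_params)
  have C: "cmp_const (q i) \<ge> 0" by (rule cmp_const_nonneg[OF q_gt_1])
  have k0: "real k \<ge> 1" "real l > 0" using kl by auto
  have D: "D \<ge> 7" "D \<ge> cmp_const (q i)" using C by (auto simp: D_def)
  show ?thesis
  proof (cases "\<tau> \<le> real l")
    case True
    let ?y = "(\<tau> / real l) powr (b / a)"
    let ?G = "lgam (q i) (xx k l * \<tau> powr (b / a))"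
    let ?B = "real k powr q i * inc_beta (q i) (k - 1 - i) ?y"
    let ?p = "(1 - \<tau> / real l) ^ (l - 1 - j)"
    have y: "?y \<in> {0..1}" using True \<tau> k0 r_pos by (auto intro!: powr_le1)
    have ky: "real k * ?y = xx k l * \<tau> powr (b / a)" using \<tau> k0 by (simp add: powr_divide)
    have G: "?G \<ge> 0" by (rule lgam_nonneg[OF q_gt_1])
    have BG: "\<bar>?B - ?G\<bar> \<le> cmp_const (q i) / real k * ?G"
      using inc_beta_compare[OF q_gt_1 y kl(1) ij(1)] unfolding ky .
    also have "cmp_const (q i) / real k * ?G \<le> cmp_const (q i) * ?G"
      using C k0 G by (intro mult_right_mono) (auto simp: divide_le_eq mult_le_cancel_left1)
    finally have B: "\<bar>?B\<bar> \<le> (1 + cmp_const (q i)) * ?G" using G unfolding distrib_right by linarith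
    have "real l * (\<tau> / real l) = \<tau>" using k0 by simp
    then have pe: "\<bar>?p - exp (- \<tau>)\<bar> \<le> 7 / real l * (\<tau> + \<tau>\<^sup>2) * exp (- \<tau>)"
      using binomial_exp_compare[of "\<tau> / real l" l j] kl ij True \<tau> by simp
    have "X i j k l \<tau> - L \<tau> = (?p - exp (- \<tau>)) * ?B + exp (- \<tau>) * (?B - ?G)"
    proof -
      have "X i j k l \<tau> = ?p * ?B" using True \<tau> by (simp add: X_def)
      moreover have "(p - e) * B + e * (B - G) = p * B - e * G" for p e B G :: real
        by (simp add: algebra_simps)
      ultimately show ?thesis by (simp only: L_def)
    qed
    then have "\<bar>X i j k l \<tau> - L \<tau>\<bar> \<le> \<bar>?p - exp (- \<tau>)\<bar> * \<bar>?B\<bar> + exp (- \<tau>) * \<bar>?B - ?G\<bar>"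
      using abs_triangle_ineq[of "(?p - exp (- \<tau>)) * ?B" "exp (- \<tau>) * (?B - ?G)"]
      by (simp only: abs_mult abs_exp_cancel)
    also have "\<dots> \<le> (7 / real l * (\<tau> + \<tau>\<^sup>2) * exp (- \<tau>)) * ((1 + cmp_const (q i)) * ?G) + exp (- \<tau>) * (cmp_const (q i) / real k * ?G)"
      using pe B BG \<tau> k0 by (intro add_mono mult_mono mult_left_mono) auto
    also have "\<dots> = (cmp_const (q i) / real k + D / real l * (\<tau> + \<tau>\<^sup>2)) * L \<tau>"
    proof -
      have "(7 / l * s * e) * ((1 + C) * G) + e * (C / k * G) = (C / k + (7 * (1 + C)) / l * s) * (e * G)"
        for l s e C G k :: real by (simp add: divide_inverse algebra_simps)
      then show ?thesis unfolding D_def L_def .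
    qed
    also have "\<dots> \<le> (D / real k + D / real l * (\<tau> + \<tau>\<^sup>2)) * L \<tau>"
      using D k0 L_nonneg by (intro mult_right_mono add_right_mono divide_right_mono) auto
    finally show ?thesis .
  next
    case False
    have "L \<tau> * 1 \<le> L \<tau> * (\<tau> / real l)" using False k0 L_nonneg by (intro mult_left_mono) auto
    also have "\<dots> \<le> L \<tau> * (D / real k + D / real l * (\<tau> + \<tau>\<^sup>2))"
    proof (intro mult_left_mono L_nonneg)
      have "\<tau> / real l \<le> 1 * ((\<tau> + \<tau>\<^sup>2) / real l)" using \<tau> k0 by (simp add: divide_right_mono)
      also have "\<dots> \<le> D * ((\<tau> + \<tau>\<^sup>2) / real l)" using D \<tau> k0 by (intro mult_right_mono) auto
      finally have "\<tau> / real l \<le> D / real l * (\<tau> + \<tau>\<^sup>2)" by simp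
      moreover have "0 \<le> D / real k" using D by simp
      ultimately show "\<tau> / real l \<le> D / real k + D / real l * (\<tau> + \<tau>\<^sup>2)" by linarith
    qed
    finally show ?thesis using False L_nonneg[of \<tau>] by (simp add: X_def mult.commute)
  qed
qed

lemma R_asymp:
  assumes "i \<le> 1"
  obtains C where "C \<ge> 0" "\<And>k. k \<ge> 2 \<Longrightarrow> \<bar>R i k - 1\<bar> \<le> C / real k"
proof -
  obtain C where C: "\<forall>k\<ge>2. \<bar>R i k - 1\<bar> \<le> C / real k"
    using yule_coeff_asymp[OF src.\<delta> assms] unfolding R_def by blast
  moreover have "0 \<le> C / 2" using order_trans[OF abs_ge_zero C[rule_format, of 2]] by simp
  ultimately show ?thesis using that[of C] by simp
qed

lemma R'_asymp:
  assumes "j \<le> 1"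
  obtains C where "C \<ge> 0" "\<And>l. l \<ge> 2 \<Longrightarrow> \<bar>R' j l - 1\<bar> \<le> C / real l"
proof -
  obtain C where C: "\<forall>l\<ge>2. \<bar>R' j l - 1\<bar> \<le> C / real l"
    using yule_coeff_asymp[OF tgt.\<delta> assms] unfolding R'_def by blast
  moreover have "0 \<le> C / 2" using order_trans[OF abs_ge_zero C[rule_format, of 2]] by simp
  ultimately show ?thesis using that[of C] by simp
qed

lemma J_asymp:
  assumes ij: "i \<le> 1" "j \<le> 1"
  shows "\<exists>C\<ge>0. \<forall>k\<ge>2. \<forall>l\<ge>2. \<bar>J i k j l - N0 i j k l * kap i j k l\<bar>
    \<le> C * (1 / real k + 1 / real l) * (N0 i j k l * kap i j k l)"
proof -
  obtain C1 where C1: "C1 \<ge> 0" "\<And>k. k \<ge> 2 \<Longrightarrow> \<bar>R i k - 1\<bar> \<le> C1 / real k" using R_asymp[OF ij(1)] by metis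
  obtain C2 where C2: "C2 \<ge> 0" "\<And>l. l \<ge> 2 \<Longrightarrow> \<bar>R' j l - 1\<bar> \<le> C2 / real l" using R'_asymp[OF ij(2)] by metis
  define D where "D = 7 * (1 + cmp_const (q i))"
  have D: "D \<ge> 0" using cmp_const_nonneg[OF q_gt_1] by (simp add: D_def)
  \<comment> \<open>Constants of two successive applications of \<open>K_plus1_le\<close>, at
    \<open>c j\<close> and at \<open>c j + 1\<close>; neither depends on \<open>k\<close> or
    \<open>l\<close>.\<close>
  define g where "g = (2::real) powr (c j + 1 + (b / a) * q i)"
  define g' where "g' = (2::real) powr (c j + 1 + 1 + (b / a) * q i)"
  define B where "B = D * (1 + g + g' * g)"
  define C where "C = (1 + C1) * (1 + C2) * B + (C1 * (1 + C2) + C2)"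
  have B: "B \<ge> 0" using D by (simp add: B_def g_def g'_def)
  have "\<bar>J i k j l - N0 i j k l * kap i j k l\<bar> \<le> C * (1 / real k + 1 / real l) * (N0 i j k l * kap i j k l)"
    if kl: "k \<ge> 2" "l \<ge> 2" for k l
  proof -
    interpret kappa_params "q i" "b / a" "xx k l" by (rule kappa_params)
    obtain I where I: "((\<lambda>\<tau>. \<tau> powr (c j - 1) * X i j k l \<tau>) has_integral I) {0<..}"
      and J: "J i k j l = N0 i j k l * (R i k * R' j l * I)" using J_eq[OF kl ij] by blast
    have cj: "c j > 0" "c j > 1/2" using c_gt_1[of j] by linarith+
    have kap: "kap i j k l = K (c j)" using cj by (intro kappa_K)
    note K0 = K_nonneg[OF cj(1)]
    have g0: "g \<ge> 0" "g' \<ge> 0" by (simp_all add: g_def g'_def)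
    have k1: "K (c j + 1) \<le> g * K (c j)" unfolding g_def using cj by (intro K_plus1_le)
    have "K (c j + 2) \<le> g' * K (c j + 1)" unfolding g'_def using K_plus1_le[of "c j + 1"] cj by (simp add: add_ac)
    also have "\<dots> \<le> g' * (g * K (c j))" using k1 g0 by (intro mult_left_mono)
    finally have k2: "K (c j + 2) \<le> g' * (g * K (c j))" .
    have "\<bar>I - K (c j)\<bar> \<le> D / real k * K (c j) + D / real l * (K (c j + 1) + K (c j + 2))"
      using X_compare[OF kl ij] D kl cj unfolding D_def[symmetric] by (intro perturb_K[OF _ _ _ _ I]) auto
    also have "\<dots> \<le> D / real k * K (c j) + D / real l * (g * K (c j) + g' * (g * K (c j)))"
      using k1 k2 D by (intro add_mono mult_left_mono) auto
    also have "\<dots> \<le> D / real k * K (c j) + D / real l * (g * K (c j) + g' * (g * K (c j)))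
        + (D / real k * (g * K (c j) + g' * (g * K (c j))) + D / real l * K (c j))"
      using D K0 g0 by simp
    also have "\<dots> = B * (1 / real k + 1 / real l) * K (c j)"
      by (simp add: B_def algebra_simps)
    finally have "\<bar>I - K (c j)\<bar> \<le> B * (1 / real k + 1 / real l) * K (c j)" .
    from perturb_product[OF C1(2)[OF kl(1)] C2(2)[OF kl(2)] _ _ C1(1) C2(1) this] kl
    have "\<bar>R i k * R' j l * I - K (c j)\<bar> \<le> (1 + C1) * (1 + C2) * (B * (1 / real k + 1 / real l) * K (c j))
        + (C1 * (1 + C2) + C2) * (1 / real k + 1 / real l) * \<bar>K (c j)\<bar>" by simp
    also have "\<dots> = C * (1 / real k + 1 / real l) * K (c j)"
    proof -
      have "(1 + C1) * (1 + C2) * (B * d * y) + e * d * y = ((1 + C1) * (1 + C2) * B + e) * d * y" for d y e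
        by (simp add: algebra_simps)
      then show ?thesis using K0 by (simp only: C_def abs_of_nonneg)
    qed
    finally have "\<bar>R i k * R' j l * I - K (c j)\<bar> \<le> C * (1 / real k + 1 / real l) * K (c j)" .
    then have "N0 i j k l * \<bar>R i k * R' j l * I - K (c j)\<bar> \<le> N0 i j k l * (C * (1 / real k + 1 / real l) * K (c j))"
      using N0_nonneg by (intro mult_left_mono)
    moreover have "\<bar>J i k j l - N0 i j k l * K (c j)\<bar> = N0 i j k l * \<bar>R i k * R' j l * I - K (c j)\<bar>"
      unfolding J right_diff_distrib[symmetric] abs_mult using N0_nonneg[of i j k l] by simp
    ultimately show ?thesis unfolding kap by (simp only: mult_ac)
  qed
  moreover have "C \<ge> 0" using C1(1) C2(1) B by (simp add: C_def)
  ultimately show ?thesis by blast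
qed

text \<open>ln l - ln \<tau> changes sign, so the error is measured against the prefactor
  \<open>N0\<close> instead of kappa, with the additional factor 1 + ln l. The second estimate is
  small when \<open>xx\<close> is small and serves the limits with one dominating degree.\<close>

lemma Jlog_asymp:
  assumes ij: "i \<le> 1" "j \<le> 1" and ab: "a + b = 1"
  shows "\<exists>C\<ge>0. \<forall>k\<ge>2. \<forall>l\<ge>2. \<bar>Jlog i k j l - N0 i j k l * (1 / a * (ln (real l) * kap i j k l
      - kappa_c2 (q i) (c j) (b / a) (xx k l)))\<bar> \<le> C * N0 i j k l * ((1 + ln (real l)) * (1 / real k + 1 / real l))
    \<and> \<bar>Jlog i k j l\<bar> \<le> C * N0 i j k l * ((1 + ln (real l)) * xx k l powr q i)"
proof -
  obtain C1 where C1: "C1 \<ge> 0" "\<And>k. k \<ge> 2 \<Longrightarrow> \<bar>R i k - 1\<bar> \<le> C1 / real k" using R_asymp[OF ij(1)] by metis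
  obtain C2 where C2: "C2 \<ge> 0" "\<And>l. l \<ge> 2 \<Longrightarrow> \<bar>R' j l - 1\<bar> \<le> C2 / real l" using R'_asymp[OF ij(2)] by metis
  define D where "D = 7 * (1 + cmp_const (q i))"
  have D: "D \<ge> 0" using cmp_const_nonneg[OF q_gt_1] by (simp add: D_def)
  define S1 where "S1 = Gamma (q i) * ((Gamma (c j) + 2 * Gamma (c j + 1/2) + 2 * Gamma (c j - 1/2))
    + (Gamma (c j + 1) + 2 * Gamma (c j + 1 + 1/2) + 2 * Gamma (c j + 1 - 1/2))
    + (Gamma (c j + 2) + 2 * Gamma (c j + 2 + 1/2) + 2 * Gamma (c j + 2 - 1/2)))"
  define S2 where "S2 = (let e = q i * (b / a) in (Gamma (e + c j) + 2 * Gamma (e + (c j + 1/2)) + 2 * Gamma (e + (c j - 1/2)))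
    + (Gamma (e + (c j + 1)) + 2 * Gamma (e + (c j + 1 + 1/2)) + 2 * Gamma (e + (c j + 1 - 1/2)))
    + (Gamma (e + (c j + 2)) + 2 * Gamma (e + (c j + 2 + 1/2)) + 2 * Gamma (e + (c j + 2 - 1/2))))"
  define G where "G = Gamma (q i) * Gamma (c j) + Gamma (q i) * kappa_params.ln_const (c j)"
  define B1 where "B1 = (1 + C1) * (1 + C2) * (D * S1) + (C1 * (1 + C2) + C2) * G"
  define B2 where "B2 = (1 + C1) * (1 + C2) * ((1 + D + D) * S2)"
  define C where "C = 1 / a * (\<bar>B1\<bar> + \<bar>B2\<bar>)"
  have "\<bar>Jlog i k j l - N0 i j k l * (1 / a * (ln (real l) * kap i j k l - kappa_c2 (q i) (c j) (b / a) (xx k l)))\<bar>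
      \<le> C * N0 i j k l * ((1 + ln (real l)) * (1 / real k + 1 / real l))
    \<and> \<bar>Jlog i k j l\<bar> \<le> C * N0 i j k l * ((1 + ln (real l)) * xx k l powr q i)"
    if kl: "k \<ge> 2" "l \<ge> 2" for k l
  proof -
    interpret kappa_params "q i" "b / a" "xx k l" by (rule kappa_params)
    obtain I where I: "((\<lambda>\<tau>. (ln (real l) - ln \<tau>) * (\<tau> powr (c j - 1) * X i j k l \<tau>)) has_integral I) {0<..}"
      and J: "Jlog i k j l = N0 i j k l * (1 / a * (R i k * R' j l * I))" using Jlog_eq[OF kl ij ab] by blast
    have cj: "c j > 0" "c j > 1/2" "c j > 3/4" using c_gt_1[of j] by linarith+
    define \<Lambda> where "\<Lambda> = ln (real l)"
    have \<Lambda>: "\<Lambda> \<ge> 0" using kl by (simp add: \<Lambda>_def)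
    have kap: "kap i j k l = K (c j)" using cj by (intro kappa_K)
    have kc: "kappa_c2 (q i) (c j) (b / a) (xx k l) = Kln (c j)" using cj by (intro kappa_c2_eq)
    have s: "S (c j) \<le> S1" "S (c j) \<le> xx k l powr q i * S2"
      using S_le[OF cj(2)] S_le_powr[OF cj(2)] by (simp_all only: S1_def S2_def Let_def)
    have e: "D / real k \<ge> 0" "D / real l \<ge> 0" "D / real k \<le> D" "D / real l \<le> D"
      using D kl by (auto simp: divide_le_eq mult_le_cancel_left1)
    define M where "M = \<Lambda> * K (c j) - Kln (c j)"
    have XC: "\<And>\<tau>. \<tau> > 0 \<Longrightarrow> \<bar>X i j k l \<tau> - L \<tau>\<bar> \<le> (D / real k + D / real l * (\<tau> + \<tau>\<^sup>2)) * L \<tau>"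
      using X_compare[OF kl ij] unfolding D_def .
    have P: "\<bar>I - (\<Lambda> * K (c j) - Kln (c j))\<bar> \<le> (D / real k + D / real l) * (1 + \<Lambda>) * S (c j)"
      "\<bar>I\<bar> \<le> (1 + D / real k + D / real l) * (1 + \<Lambda>) * S (c j)"
      by (rule perturb_ln[OF _ e(1,2) cj(2) I[folded \<Lambda>_def] \<Lambda>]; rule XC; assumption)+
    have M: "\<bar>M\<bar> \<le> (1 + \<Lambda>) * G"
    proof -
      have "\<Lambda> * K (c j) \<le> (1 + \<Lambda>) * (Gamma (q i) * Gamma (c j))"
        using K_le[OF cj(1)] K_nonneg[OF cj(1)] \<Lambda> by (intro mult_mono) auto
      moreover have "0 \<le> \<Lambda> * K (c j)" using K_nonneg[OF cj(1)] \<Lambda> by simp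
      moreover have "1 * (Gamma (q i) * ln_const (c j)) \<le> (1 + \<Lambda>) * (Gamma (q i) * ln_const (c j))"
        using abs_Kln_le[OF cj(2)] \<Lambda> by (intro mult_right_mono) auto
      ultimately show ?thesis using abs_Kln_le[OF cj(2)] unfolding M_def G_def distrib_left by linarith
    qed
    have d: "1 / real k + 1 / real l \<ge> 0" by simp
    have "(D / real k + D / real l) * (1 + \<Lambda>) * S (c j) \<le> (D / real k + D / real l) * (1 + \<Lambda>) * S1"
      using s(1) e \<Lambda> by (intro mult_left_mono) auto
    with P(1) have "\<bar>I - M\<bar> \<le> (D / real k + D / real l) * (1 + \<Lambda>) * S1" unfolding M_def by linarith
    from perturb_product[OF C1(2)[OF kl(1)] C2(2)[OF kl(2)] _ _ C1(1) C2(1) this] kl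
    have "\<bar>R i k * R' j l * I - M\<bar> \<le> (1 + C1) * (1 + C2) * ((D / real k + D / real l) * (1 + \<Lambda>) * S1)
        + (C1 * (1 + C2) + C2) * (1 / real k + 1 / real l) * \<bar>M\<bar>" by simp
    also have "\<dots> \<le> (1 + C1) * (1 + C2) * ((D / real k + D / real l) * (1 + \<Lambda>) * S1)
        + (C1 * (1 + C2) + C2) * (1 / real k + 1 / real l) * ((1 + \<Lambda>) * G)"
      using M C1(1) C2(1) d by (intro add_left_mono mult_left_mono) auto
    also have "\<dots> = B1 * ((1 + \<Lambda>) * (1 / real k + 1 / real l))"
      unfolding B1_def by (simp add: divide_inverse algebra_simps)
    also have "\<dots> \<le> (\<bar>B1\<bar> + \<bar>B2\<bar>) * ((1 + \<Lambda>) * (1 / real k + 1 / real l))"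
      using \<Lambda> by (intro mult_right_mono) auto
    finally have r1: "\<bar>R i k * R' j l * I - M\<bar> \<le> (\<bar>B1\<bar> + \<bar>B2\<bar>) * ((1 + \<Lambda>) * (1 / real k + 1 / real l))" .
    have Rb: "\<bar>R i k\<bar> \<le> 1 + C1" "\<bar>R' j l\<bar> \<le> 1 + C2"
    proof -
      have "C1 / real k \<le> C1" "C2 / real l \<le> C2" using kl C1(1) C2(1) by (auto simp: divide_le_eq mult_le_cancel_left1)
      then show "\<bar>R i k\<bar> \<le> 1 + C1" "\<bar>R' j l\<bar> \<le> 1 + C2" using C1(2)[OF kl(1)] C2(2)[OF kl(2)] by linarith+
    qed
    have "\<bar>I\<bar> \<le> (1 + D + D) * (1 + \<Lambda>) * (xx k l powr q i * S2)"
    proof -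
      have "(1 + D / real k + D / real l) * (1 + \<Lambda>) * S (c j) \<le> (1 + D + D) * (1 + \<Lambda>) * (xx k l powr q i * S2)"
        using s(2) e \<Lambda> D S_nonneg[OF cj(2)] by (intro mult_mono) auto
      then show ?thesis using P(2) by linarith
    qed
    then have "\<bar>R i k * R' j l * I\<bar> \<le> (1 + C1) * (1 + C2) * ((1 + D + D) * (1 + \<Lambda>) * (xx k l powr q i * S2))"
      unfolding abs_mult using Rb C1(1) C2(1) by (intro mult_mono) auto
    also have "\<dots> = B2 * ((1 + \<Lambda>) * xx k l powr q i)" by (simp only: B2_def mult_ac)
    also have "\<dots> \<le> (\<bar>B1\<bar> + \<bar>B2\<bar>) * ((1 + \<Lambda>) * xx k l powr q i)"
      using \<Lambda> by (intro mult_right_mono) auto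
    finally have r2: "\<bar>R i k * R' j l * I\<bar> \<le> (\<bar>B1\<bar> + \<bar>B2\<bar>) * ((1 + \<Lambda>) * xx k l powr q i)" .
    have Na: "N0 i j k l * (1 / a) \<ge> 0" using N0_nonneg tgt.b by simp
    have "\<bar>Jlog i k j l - N0 i j k l * (1 / a * M)\<bar> = N0 i j k l * (1 / a) * \<bar>R i k * R' j l * I - M\<bar>"
    proof -
      have "Jlog i k j l - N0 i j k l * (1 / a * M) = N0 i j k l * (1 / a) * (R i k * R' j l * I - M)"
        unfolding J by (simp add: algebra_simps diff_divide_distrib)
      then show ?thesis by (simp only: abs_mult[of "N0 i j k l * (1 / a)"] abs_of_nonneg[OF Na])
    qed
    also have "\<dots> \<le> N0 i j k l * (1 / a) * ((\<bar>B1\<bar> + \<bar>B2\<bar>) * ((1 + \<Lambda>) * (1 / real k + 1 / real l)))"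
      using r1 Na by (intro mult_left_mono)
    also have "\<dots> = C * N0 i j k l * ((1 + \<Lambda>) * (1 / real k + 1 / real l))" by (simp only: C_def mult_ac)
    finally have 1: "\<bar>Jlog i k j l - N0 i j k l * (1 / a * M)\<bar> \<le> C * N0 i j k l * ((1 + \<Lambda>) * (1 / real k + 1 / real l))" .
    have "\<bar>Jlog i k j l\<bar> = N0 i j k l * (1 / a) * \<bar>R i k * R' j l * I\<bar>"
    proof -
      have "Jlog i k j l = N0 i j k l * (1 / a) * (R i k * R' j l * I)" unfolding J by simp
      then show ?thesis by (simp only: abs_mult[of "N0 i j k l * (1 / a)"] abs_of_nonneg[OF Na])
    qed
    also have "\<dots> \<le> N0 i j k l * (1 / a) * ((\<bar>B1\<bar> + \<bar>B2\<bar>) * ((1 + \<Lambda>) * xx k l powr q i))"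
      using r2 Na by (intro mult_left_mono)
    also have "\<dots> = C * N0 i j k l * ((1 + \<Lambda>) * xx k l powr q i)" by (simp only: C_def mult_ac)
    finally show ?thesis using 1 unfolding kap kc M_def \<Lambda>_def by blast
  qed
  moreover have "C \<ge> 0" using tgt.b by (simp add: C_def)
  ultimately show ?thesis by blast
qed

end

context yule
begin

text \<open>At u = 1, the boundary of the integration by parts, the incomplete beta function is
  complete and yields a Gamma value in place of kappa.\<close>

lemma cum_one_asymp:
  assumes i: "i \<le> 1"
  shows "\<exists>C\<ge>0. \<forall>k\<ge>2. \<bar>cum i k 1 - real k powr (- (1 / b)) / (b * Gamma (real i + \<delta>)) * Gamma (\<delta> + 1 / b + real i)\<bar>
    \<le> C / real k * (real k powr (- (1 / b)) / (b * Gamma (real i + \<delta>)))"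
proof -
  let ?q = "\<delta> + 1 / b + real i"
  have q: "?q > 1" using exponent_gt_1[of i] by (simp add: add_ac)
  obtain C0 where C0: "\<forall>k\<ge>2. \<bar>yule_coeff \<delta> i k * Gamma (real i + \<delta>) / real k powr (\<delta> + real i) - 1\<bar> \<le> C0 / real k"
    using yule_coeff_asymp[OF \<delta> i] by blast
  have C0': "C0 \<ge> 0" using order_trans[OF abs_ge_zero C0[rule_format, of 2]] by simp
  define B where "B = cmp_const ?q * Gamma ?q + Gamma (?q + 1)"
  define C where "C = (1 + C0) * (1 + 0) * B + (C0 * (1 + 0) + 0) * (2 * Gamma ?q)"
  have Gq: "Gamma ?q > 0" "Gamma (?q + 1) > 0" using q by (auto intro!: Gamma_real_pos)
  have B: "B \<ge> 0" using Gq cmp_const_nonneg[OF q] by (simp add: B_def)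
  have Gi: "Gamma (real i + \<delta>) > 0" using \<delta> by (auto intro!: Gamma_real_pos)
  have "\<bar>cum i k 1 - real k powr (- (1 / b)) / (b * Gamma (real i + \<delta>)) * Gamma ?q\<bar>
    \<le> C / real k * (real k powr (- (1 / b)) / (b * Gamma (real i + \<delta>)))" if k: "k \<ge> 2" for k
  proof -
    define R where "R = yule_coeff \<delta> i k * Gamma (real i + \<delta>) / real k powr (\<delta> + real i)"
    define I where "I = real k powr ?q * inc_beta ?q (k - 1 - i) 1"
    define N where "N = real k powr (- (1 / b)) / (b * Gamma (real i + \<delta>))"
    have N: "N \<ge> 0" using b Gi by (simp add: N_def)
    have k0: "real k \<ge> 1" using k by simp
    have "real k powr ?q = real k powr (\<delta> + real i) * real k powr (1 / b)"
      unfolding powr_add[symmetric] by (simp add: algebra_simps)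
    moreover have "real k powr (- (1 / b)) * real k powr (1 / b) = 1" using k by (simp flip: powr_add)
    ultimately have "N * (R * I) = yule_coeff \<delta> i k / b * inc_beta ?q (k - 1 - i) 1 * (real k powr (- (1 / b)) * real k powr (1 / b))"
      unfolding N_def R_def I_def using Gi k0 by (simp add: field_simps)
    also have "\<dots> = cum i k 1"
      unfolding yule_cum_def \<open>real k powr (- (1 / b)) * real k powr (1 / b) = 1\<close> by (simp add: add_ac)
    finally have eq: "cum i k 1 = N * (R * I)" by simp
    have IG: "\<bar>I - Gamma ?q\<bar> \<le> B / real k" unfolding I_def B_def using inc_beta_one_compare[OF q k i] .
    have R: "\<bar>R - 1\<bar> \<le> C0 / real k" unfolding R_def using C0 k by blast
    \<comment> \<open>\<open>perturb_product\<close> with second factor 1 and second index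
      \<open>k\<close>, whence the factor 2 in \<open>C\<close>.\<close>
    have "\<bar>R * 1 * I - Gamma ?q\<bar> \<le> (1 + C0) * (1 + 0) * (B / real k) + (C0 * (1 + 0) + 0) * (1 / real k + 1 / real k) * \<bar>Gamma ?q\<bar>"
      using R k0 C0' IG by (intro perturb_product) auto
    also have "\<dots> = C / real k" using Gq by (simp add: C_def add_divide_distrib algebra_simps)
    finally have "N * \<bar>R * I - Gamma ?q\<bar> \<le> N * (C / real k)" using N by (intro mult_left_mono) auto
    moreover have "\<bar>cum i k 1 - N * Gamma ?q\<bar> = N * \<bar>R * I - Gamma ?q\<bar>"
      unfolding eq right_diff_distrib[symmetric] abs_mult using N by simp
    ultimately show ?thesis unfolding N_def[symmetric] by (simp only: mult_ac)
  qed
  moreover have "C \<ge> 0" using C0' B Gq by (simp add: C_def)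
  ultimately show ?thesis by blast
qed

end

subsection \<open>One degree dominating the other\<close>

context yule_pair
begin

lemma inverse_sum_le_1:
  assumes "k \<ge> 2" "l \<ge> (2::nat)"
  shows "1 / real k + 1 / real l \<le> 1"
proof -
  have "1 / real k \<le> 1 / 2" "1 / real l \<le> 1 / 2" using assms by (auto intro!: divide_left_mono)
  then show ?thesis by linarith
qed

lemma kap_le: "kap i j k l \<le> Gamma (q i) * Gamma (c j)" "0 \<le> kap i j k l"
  "kap i j k l \<le> xx k l powr q i * Gamma (q i * (b / a) + c j)"
proof -
  interpret kappa_params "q i" "b / a" "xx k l" by (rule kappa_params)
  have "c j > 0" using c_gt_1[of j] by linarith
  then show "kap i j k l \<le> Gamma (q i) * Gamma (c j)" "0 \<le> kap i j k l"
    "kap i j k l \<le> xx k l powr q i * Gamma (q i * (b / a) + c j)"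
    using K_le K_nonneg K_le_powr kappa_K by (simp_all only:)
qed

text \<open>The first bound is for cases where a power of a degree or a logarithm already separates
  \<open>J\<close> from the main term, the second for those where smallness has to come from
  \<open>xx\<close>.\<close>

lemma J_le:
  assumes "i \<le> 1" "j \<le> 1"
  shows "\<exists>C\<ge>0. \<forall>k\<ge>2. \<forall>l\<ge>2. \<bar>J i k j l\<bar> \<le> C * N0 i j k l \<and> \<bar>J i k j l\<bar> \<le> C * (N0 i j k l * xx k l powr q i)"
proof -
  obtain C where C: "C \<ge> 0" "\<And>k l. k \<ge> 2 \<Longrightarrow> l \<ge> 2 \<Longrightarrow> \<bar>J i k j l - N0 i j k l * kap i j k l\<bar>
    \<le> C * (1 / real k + 1 / real l) * (N0 i j k l * kap i j k l)" using J_asymp[OF assms] by blast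
  define C' where "C' = (1 + C) * (\<bar>Gamma (q i) * Gamma (c j)\<bar> + \<bar>Gamma (q i * (b / a) + c j)\<bar>)"
  have "\<bar>J i k j l\<bar> \<le> C' * N0 i j k l \<and> \<bar>J i k j l\<bar> \<le> C' * (N0 i j k l * xx k l powr q i)"
    if kl: "k \<ge> 2" "l \<ge> 2" for k l
  proof -
    let ?z = "N0 i j k l * kap i j k l"
    have z: "?z \<ge> 0" using N0_nonneg kap_le(2) by simp
    have "C * (1 / real k + 1 / real l) * ?z \<le> C * 1 * ?z"
      using inverse_sum_le_1[OF kl] C(1) z by (intro mult_right_mono mult_left_mono)
    then have J: "\<bar>J i k j l\<bar> \<le> (1 + C) * ?z" using C(2)[OF kl] z unfolding distrib_right by linarith
    have "kap i j k l \<le> \<bar>Gamma (q i) * Gamma (c j)\<bar> + \<bar>Gamma (q i * (b / a) + c j)\<bar>"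
      using kap_le(1)[of i j k l] by linarith
    then have "(1 + C) * ?z \<le> (1 + C) * (N0 i j k l * (\<bar>Gamma (q i) * Gamma (c j)\<bar> + \<bar>Gamma (q i * (b / a) + c j)\<bar>))"
      using C(1) N0_nonneg by (intro mult_left_mono) auto
    moreover have "kap i j k l \<le> xx k l powr q i * (\<bar>Gamma (q i) * Gamma (c j)\<bar> + \<bar>Gamma (q i * (b / a) + c j)\<bar>)"
      by (rule order_trans[OF kap_le(3)]) (intro mult_left_mono; simp add: add_increasing)
    then have "(1 + C) * ?z \<le> (1 + C) * (N0 i j k l * (xx k l powr q i * (\<bar>Gamma (q i) * Gamma (c j)\<bar> + \<bar>Gamma (q i * (b / a) + c j)\<bar>)))"
      using C(1) N0_nonneg by (intro mult_left_mono) auto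
    ultimately show ?thesis using J unfolding C'_def by (simp only: mult_ac) (meson order_trans)
  qed
  moreover have "C' \<ge> 0" using C(1) by (simp add: C'_def)
  ultimately show ?thesis by blast
qed

lemma inverse_sum_tendsto:
  assumes "filterlim u at_top sequentially" "filterlim v at_top sequentially"
  shows "(\<lambda>n. 1 / real (u n) + 1 / real (v n)) \<longlonglongrightarrow> 0"
proof -
  have "(\<lambda>n. 1 / real (w n)) \<longlonglongrightarrow> 0" if "filterlim w at_top sequentially" for w
    using filterlim_compose[OF filterlim_real_sequentially that]
    by (intro tendsto_divide_0[OF tendsto_const] filterlim_at_top_imp_at_infinity)
  from tendsto_add[OF this[OF assms(1)] this[OF assms(2)]] show ?thesis by simp
qed

lemma kap_tendsto:
  assumes "filterlim (\<lambda>n. xx (u n) (v n)) at_top sequentially"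
  shows "(\<lambda>n. kap i j (u n) (v n)) \<longlonglongrightarrow> Gamma (q i) * Gamma (c j)"
proof (rule tendsto_sandwich)
  let ?f = "\<lambda>n. Gamma (q i) * Gamma (c j) - Gamma (q i + 1) * Gamma (c j - b / a) / xx (u n) (v n)"
  show "\<forall>\<^sub>F n in sequentially. ?f n \<le> kap i j (u n) (v n)"
    using filterlim_at_top_dense[THEN iffD1, OF assms, rule_format, of 0]
  proof eventually_elim
    case (elim n)
    interpret kappa_params "q i" "b / a" "xx (u n) (v n)" by (rule kappa_params)
    have "c j > 0" using c_gt_1[of j] by linarith
    then show ?case using K_ge[OF c_gt_r elim, of j] kappa_K by (simp only:)
  qed
  show "\<forall>\<^sub>F n in sequentially. kap i j (u n) (v n) \<le> Gamma (q i) * Gamma (c j)"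
    using kap_le(1) by (intro always_eventually) blast
  have "(\<lambda>n. Gamma (q i + 1) * Gamma (c j - b / a) / xx (u n) (v n)) \<longlonglongrightarrow> 0"
    using assms by (intro tendsto_divide_0[OF tendsto_const] filterlim_at_top_imp_at_infinity)
  from tendsto_diff[OF tendsto_const this] show "?f \<longlonglongrightarrow> Gamma (q i) * Gamma (c j)" by simp
qed (rule tendsto_const)

lemma eventually_ge_2:
  assumes "filterlim (u :: nat \<Rightarrow> nat) at_top sequentially"
  shows "\<forall>\<^sub>F n in sequentially. u n \<ge> 2"
  using assms by (simp add: filterlim_at_top)

lemma J_limit:
  assumes ij: "i \<le> 1" "j \<le> 1"
    and uv: "filterlim u at_top sequentially" "filterlim v at_top sequentially"
    and x: "filterlim (\<lambda>n. xx (u n) (v n)) at_top sequentially"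
  shows "(\<lambda>n. J i (u n) j (v n) / N0 i j (u n) (v n)) \<longlonglongrightarrow> Gamma (q i) * Gamma (c j)"
proof -
  obtain C where C: "C \<ge> 0" "\<And>k l. k \<ge> 2 \<Longrightarrow> l \<ge> 2 \<Longrightarrow> \<bar>J i k j l - N0 i j k l * kap i j k l\<bar>
    \<le> C * (1 / real k + 1 / real l) * (N0 i j k l * kap i j k l)" using J_asymp[OF ij] by blast
  have "(\<lambda>n. J i (u n) j (v n) / N0 i j (u n) (v n) - kap i j (u n) (v n)) \<longlonglongrightarrow> 0"
  proof (rule Lim_null_comparison)
    show "\<forall>\<^sub>F n in sequentially. norm (J i (u n) j (v n) / N0 i j (u n) (v n) - kap i j (u n) (v n))
      \<le> C * (1 / real (u n) + 1 / real (v n)) * kap i j (u n) (v n)"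
      using eventually_ge_2[OF uv(1)] eventually_ge_2[OF uv(2)]
    proof eventually_elim
      case (elim n)
      let ?N = "N0 i j (u n) (v n)"
      have N: "?N > 0" by (rule N0_pos[OF elim])
      have "J i (u n) j (v n) / ?N - kap i j (u n) (v n) = (J i (u n) j (v n) - ?N * kap i j (u n) (v n)) / ?N"
        using N by (simp add: diff_divide_distrib)
      then have "norm (J i (u n) j (v n) / ?N - kap i j (u n) (v n)) = \<bar>J i (u n) j (v n) - ?N * kap i j (u n) (v n)\<bar> / ?N"
        using N by simp
      also have "\<dots> \<le> C * (1 / real (u n) + 1 / real (v n)) * (?N * kap i j (u n) (v n)) / ?N"
        using C(2)[OF elim] N by (intro divide_right_mono) auto
      finally show ?case using N by simp
    qed
    show "(\<lambda>n. C * (1 / real (u n) + 1 / real (v n)) * kap i j (u n) (v n)) \<longlonglongrightarrow> 0"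
      using tendsto_mult[OF tendsto_mult[OF tendsto_const[of C] inverse_sum_tendsto[OF uv]] kap_tendsto[OF x, of i j]] by simp
  qed
  from tendsto_add[OF this kap_tendsto[OF x, of i j]] show ?thesis by simp
qed

text \<open>The derivative of kappa stays bounded, so division by the logarithm of the target degree
  leaves only the kappa term.\<close>

lemma Jlog_limit:
  assumes ij: "i \<le> 1" "j \<le> 1" and ab: "a + b = 1"
    and uv: "filterlim u at_top sequentially" "filterlim v at_top sequentially"
    and x: "filterlim (\<lambda>n. xx (u n) (v n)) at_top sequentially"
  shows "(\<lambda>n. Jlog i (u n) j (v n) / (N0 i j (u n) (v n) * ln (real (v n)))) \<longlonglongrightarrow> 1 / a * (Gamma (q i) * Gamma (c j))"
proof -
  obtain C where C: "C \<ge> 0" "\<And>k l. k \<ge> 2 \<Longrightarrow> l \<ge> 2 \<Longrightarrow> \<bar>Jlog i k j l - N0 i j k l * (1 / a * (ln (real l) * kap i j k l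
      - kappa_c2 (q i) (c j) (b / a) (xx k l)))\<bar> \<le> C * N0 i j k l * ((1 + ln (real l)) * (1 / real k + 1 / real l))"
    using Jlog_asymp[OF ij ab] by blast
  define D where "D = Gamma (q i) * kappa_params.ln_const (c j)"
  have kc: "\<bar>kappa_c2 (q i) (c j) (b / a) (xx k l)\<bar> \<le> D" for k l
  proof -
    interpret kappa_params "q i" "b / a" "xx k l" by (rule kappa_params)
    have "c j > 3/4" "c j > 1/2" using c_gt_1[of j] by linarith+
    then show ?thesis using abs_Kln_le kappa_c2_eq unfolding D_def by (simp only:)
  qed
  have lnv: "filterlim (\<lambda>n. ln (real (v n))) at_top sequentially"
    by (intro filterlim_compose[OF ln_at_top] filterlim_compose[OF filterlim_real_sequentially] uv)
  have il: "(\<lambda>n. y / ln (real (v n))) \<longlonglongrightarrow> 0" for y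
    using lnv by (intro tendsto_divide_0[OF tendsto_const] filterlim_at_top_imp_at_infinity)
  have "(\<lambda>n. Jlog i (u n) j (v n) / (N0 i j (u n) (v n) * ln (real (v n))) - 1 / a * kap i j (u n) (v n)) \<longlonglongrightarrow> 0"
  proof (rule Lim_null_comparison)
    show "\<forall>\<^sub>F n in sequentially. norm (Jlog i (u n) j (v n) / (N0 i j (u n) (v n) * ln (real (v n))) - 1 / a * kap i j (u n) (v n))
      \<le> C * ((1 / ln (real (v n)) + 1) * (1 / real (u n) + 1 / real (v n))) + 1 / a * (D / ln (real (v n)))"
      using eventually_ge_2[OF uv(1)] eventually_ge_2[OF uv(2)]
    proof eventually_elim
      case (elim n)
      define N where "N = N0 i j (u n) (v n)"
      define l where "l = ln (real (v n))"
      define e where "e = 1 / real (u n) + 1 / real (v n)"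
      define y where "y = kap i j (u n) (v n)"
      define z where "z = kappa_c2 (q i) (c j) (b / a) (xx (u n) (v n))"
      define Jl where "Jl = Jlog i (u n) j (v n)"
      have N: "N > 0" unfolding N_def by (rule N0_pos[OF elim])
      have l: "l > 0" using elim by (simp add: l_def)
      have B: "\<bar>Jl - N * (1 / a * (l * y - z))\<bar> \<le> C * N * ((1 + l) * e)"
        using C(2)[OF elim] unfolding N_def l_def e_def y_def z_def Jl_def .
      have eq: "Jl / (N * l) - 1 / a * y = (Jl - N * (1 / a * (l * y - z))) / (N * l) + - (1 / a * (z / l))"
        using N l tgt.b by (simp add: field_simps)
      have "\<bar>(Jl - N * (1 / a * (l * y - z))) / (N * l)\<bar> \<le> C * N * ((1 + l) * e) / (N * l)"
        unfolding abs_div_pos[OF mult_pos_pos[OF N l], symmetric]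
        by (rule divide_right_mono[OF B]) (use N l in simp)
      also have "\<dots> = C * ((1 / l + 1) * e)" using N l by (simp add: field_simps)
      finally have 1: "\<bar>(Jl - N * (1 / a * (l * y - z))) / (N * l)\<bar> \<le> C * ((1 / l + 1) * e)" .
      have "\<bar>- (1 / a * (z / l))\<bar> = 1 / a * (\<bar>z\<bar> / l)" using l tgt.b by (simp add: abs_mult)
      also have "\<dots> \<le> 1 / a * (D / l)"
        using kc[of "u n" "v n"] l tgt.b unfolding z_def by (intro mult_left_mono divide_right_mono) auto
      finally have "norm (Jl / (N * l) - 1 / a * y) \<le> C * ((1 / l + 1) * e) + 1 / a * (D / l)"
        unfolding eq real_norm_def using 1 by (intro order_trans[OF abs_triangle_ineq] add_mono)
      then show ?case unfolding N_def l_def e_def y_def z_def Jl_def .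
    qed
    have "(\<lambda>n. C * ((1 / ln (real (v n)) + 1) * (1 / real (u n) + 1 / real (v n))) + 1 / a * (D / ln (real (v n))))
      \<longlonglongrightarrow> C * ((0 + 1) * 0) + 1 / a * 0"
      by (intro tendsto_intros il inverse_sum_tendsto uv)
    then show "(\<lambda>n. C * ((1 / ln (real (v n)) + 1) * (1 / real (u n) + 1 / real (v n))) + 1 / a * (D / ln (real (v n)))) \<longlonglongrightarrow> 0"
      by simp
  qed
  from tendsto_add[OF this tendsto_mult[OF tendsto_const[of "1 / a"] kap_tendsto[OF x, of i j]]] show ?thesis by simp
qed

text \<open>Up to \<open>P\<close>, \<open>Q\<close> and factors \<delta>in or \<delta>out, the
  denominators of the constants \<open>A\<close>, \<open>B\<close> and \<open>C\<close> in the
  theorem.\<close>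

definition wt :: "nat \<Rightarrow> nat \<Rightarrow> real" where
  "wt i j = a * b * Gamma (real i + \<delta>) * Gamma (real j + \<delta>')"

lemma wt_pos: "wt i j > 0"
  unfolding wt_def using src.b tgt.b src.\<delta> tgt.\<delta> by (intro mult_pos_pos Gamma_real_pos add_nonneg_pos) auto

lemma N0_wt: "N0 i j k l = real k powr (- (1 / b)) * real l powr (- (b / a) - 1) / wt i j"
  by (simp add: N0_def wt_def)

lemma swap_N0_wt: "yule_pair.N0 a \<delta>' b \<delta> j i l k = real l powr (- (1 / a)) * real k powr (- (a / b) - 1) / wt i j"
proof -
  interpret swap: yule_pair a \<delta>' b \<delta> by unfold_locales
  show ?thesis by (simp add: swap.N0_def wt_def mult_ac)
qed

text \<open>The contributions of edges to a new target, from a new source and between old vertices.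
  With abstract weights the form is preserved when source and target are exchanged, so only one of
  the two dominating regimes has to be treated.\<close>

definition total :: "(nat \<Rightarrow> real) \<Rightarrow> (nat \<Rightarrow> real) \<Rightarrow> (nat \<Rightarrow> nat \<Rightarrow> real) \<Rightarrow> nat \<Rightarrow> nat \<Rightarrow> real" where
  "total W1 W2 W3 k l = (\<Sum>i\<le>1. W1 i * J i k 0 l) + (\<Sum>j\<le>1. W2 j * yule_pair.J a \<delta>' b \<delta> j l 0 k)
    + (\<Sum>i\<le>1. \<Sum>j\<le>1. W3 i j * H i k j l)"

lemma total_tendsto:
  assumes "\<And>i j. i \<le> 1 \<Longrightarrow> j \<le> 1 \<Longrightarrow> (\<lambda>n. J i (u n) j (v n) / main n) \<longlonglongrightarrow> 0"
    and "\<And>i j. i \<le> 1 \<Longrightarrow> j \<le> 1 \<Longrightarrow> (\<lambda>n. yule_pair.J a \<delta>' b \<delta> j (v n) i (u n) / main n) \<longlonglongrightarrow> L1 i j"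
    and "\<And>i j. i \<le> 1 \<Longrightarrow> j \<le> 1 \<Longrightarrow> (\<lambda>n. H i (u n) j (v n) / main n) \<longlonglongrightarrow> L2 i j"
  shows "(\<lambda>n. total W1 W2 W3 (u n) (v n) / main n) \<longlonglongrightarrow> (\<Sum>j\<le>1. W2 j * L1 0 j) + (\<Sum>i\<le>1. \<Sum>j\<le>1. W3 i j * L2 i j)"
proof -
  have eq: "total W1 W2 W3 (u n) (v n) / main n = (\<Sum>i\<le>1. W1 i * (J i (u n) 0 (v n) / main n))
    + (\<Sum>j\<le>1. W2 j * (yule_pair.J a \<delta>' b \<delta> j (v n) 0 (u n) / main n))
    + (\<Sum>i\<le>1. \<Sum>j\<le>1. W3 i j * (H i (u n) j (v n) / main n))" for n
    unfolding total_def add_divide_distrib sum_divide_distrib by simp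
  have "(\<lambda>n. total W1 W2 W3 (u n) (v n) / main n) \<longlonglongrightarrow> (\<Sum>i\<le>1. W1 i * 0)
    + (\<Sum>j\<le>1. W2 j * L1 0 j) + (\<Sum>i\<le>1. \<Sum>j\<le>1. W3 i j * L2 i j)"
    unfolding eq by (intro tendsto_add tendsto_sum tendsto_mult tendsto_const assms) auto
  then show ?thesis by simp
qed

lemma cum_prod_tendsto:
  assumes ij: "i \<le> 1" "j \<le> 1"
    and uv: "filterlim u at_top sequentially" "filterlim v at_top sequentially"
  shows "(\<lambda>n. src.cum i (u n) 1 * tgt.cum j (v n) 1 / (real (u n) powr (- (1 / b)) * real (v n) powr (- (1 / a))))
    \<longlonglongrightarrow> Gamma (q i) * Gamma (\<delta>' + 1 / a + real j) / wt i j"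
proof -
  have lim: "(\<lambda>n. yule_cum b \<delta> i (u n) 1 / real (u n) powr (- (1 / b))) \<longlonglongrightarrow> Gamma (\<delta> + 1 / b + real i) / (b * Gamma (real i + \<delta>))"
    if y: "yule b \<delta>" and i: "i \<le> 1" and u: "filterlim u at_top sequentially" for b \<delta> i u
  proof -
    interpret yule b \<delta> by (rule y)
    define g where "g = b * Gamma (real i + \<delta>)"
    have g: "g > 0" unfolding g_def using b \<delta> by (intro mult_pos_pos Gamma_real_pos add_nonneg_pos) auto
    obtain C where C: "C \<ge> 0" "\<And>k. k \<ge> 2 \<Longrightarrow> \<bar>cum i k 1 - real k powr (- (1 / b)) / g * Gamma (\<delta> + 1 / b + real i)\<bar>
      \<le> C / real k * (real k powr (- (1 / b)) / g)" using cum_one_asymp[OF i] unfolding g_def by blast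
    have "(\<lambda>n. cum i (u n) 1 / real (u n) powr (- (1 / b)) - Gamma (\<delta> + 1 / b + real i) / g) \<longlonglongrightarrow> 0"
    proof (rule Lim_null_comparison)
      show "\<forall>\<^sub>F n in sequentially. norm (cum i (u n) 1 / real (u n) powr (- (1 / b)) - Gamma (\<delta> + 1 / b + real i) / g)
        \<le> C / g * (1 / real (u n))"
        using eventually_ge_2[OF u]
      proof eventually_elim
        case (elim n)
        define p where "p = real (u n) powr (- (1 / b))"
        have p: "p > 0" using elim by (simp add: p_def)
        have "cum i (u n) 1 / p - Gamma (\<delta> + 1 / b + real i) / g = (cum i (u n) 1 - p / g * Gamma (\<delta> + 1 / b + real i)) / p"
          using p by (simp add: diff_divide_distrib)
        then have "norm (cum i (u n) 1 / p - Gamma (\<delta> + 1 / b + real i) / g) = \<bar>cum i (u n) 1 - p / g * Gamma (\<delta> + 1 / b + real i)\<bar> / p"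
          using p by simp
        also have "\<dots> \<le> C / real (u n) * (p / g) / p"
          using C(2)[OF elim] p unfolding p_def by (intro divide_right_mono) auto
        finally show ?case unfolding p_def[symmetric] using p by (simp add: mult_ac)
      qed
      have "(\<lambda>n. 1 / real (u n)) \<longlonglongrightarrow> 0"
        using filterlim_compose[OF filterlim_real_sequentially u]
        by (intro tendsto_divide_0[OF tendsto_const] filterlim_at_top_imp_at_infinity)
      from tendsto_mult[OF tendsto_const[of "C / g"] this] show "(\<lambda>n. C / g * (1 / real (u n))) \<longlonglongrightarrow> 0"
        by (simp only: mult_zero_right)
    qed
    from tendsto_add[OF this tendsto_const[of "Gamma (\<delta> + 1 / b + real i) / g"]] show ?thesis by (simp add: g_def)
  qed
  have "(\<lambda>n. (src.cum i (u n) 1 / real (u n) powr (- (1 / b))) * (tgt.cum j (v n) 1 / real (v n) powr (- (1 / a))))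
    \<longlonglongrightarrow> (Gamma (q i) / (b * Gamma (real i + \<delta>))) * (Gamma (\<delta>' + 1 / a + real j) / (a * Gamma (real j + \<delta>')))"
    by (intro tendsto_mult lim ij uv src.yule_axioms tgt.yule_axioms)
  then show ?thesis by (simp add: wt_def mult_ac)
qed

lemma xx_eq:
  assumes "k \<ge> 1" "l \<ge> 1"
  shows "xx k l = (real k powr a / real l powr b) powr (1 / a)"
    "yule_pair.xx a b l k = 1 / (real k powr a / real l powr b) powr (1 / b)"
  using assms src.b tgt.b by (simp_all add: powr_divide powr_powr)

text \<open>The regime in which the last argument of kappa in \<open>J\<close> tends to 0 and that
  in the mirrored integral tends to infinity.\<close>

context
  fixes u v :: "nat \<Rightarrow> nat"
  assumes uv: "filterlim u at_top sequentially" "filterlim v at_top sequentially"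
    and lim: "(\<lambda>n. real (u n) powr a / real (v n) powr b) \<longlonglongrightarrow> 0"
begin

lemma ev2: "\<forall>\<^sub>F n in sequentially. u n \<ge> 2 \<and> v n \<ge> 2"
  using eventually_ge_2[OF uv(1)] eventually_ge_2[OF uv(2)] by eventually_elim simp

lemma x_tendsto: "(\<lambda>n. xx (u n) (v n)) \<longlonglongrightarrow> 0"
proof -
  have "(\<lambda>n. (real (u n) powr a / real (v n) powr b) powr (1 / a)) \<longlonglongrightarrow> 0"
    using lim tgt.b by (intro tendsto_zero_powrI[OF _ tendsto_const]) auto
  moreover have "\<forall>\<^sub>F n in sequentially. (real (u n) powr a / real (v n) powr b) powr (1 / a) = xx (u n) (v n)"
    using ev2 by eventually_elim (simp add: xx_eq)
  ultimately show ?thesis by (rule Lim_transform_eventually)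
qed

lemma y_tendsto: "filterlim (\<lambda>n. real (v n) / real (u n) powr (a / b)) at_top sequentially"
proof -
  have "(\<lambda>n. (real (u n) powr a / real (v n) powr b) powr (1 / b)) \<longlonglongrightarrow> 0"
    using lim src.b by (intro tendsto_zero_powrI[OF _ tendsto_const]) auto
  moreover have "\<forall>\<^sub>F n in sequentially. (real (u n) powr a / real (v n) powr b) powr (1 / b) > 0"
    using ev2 by eventually_elim auto
  ultimately have "filterlim (\<lambda>n. inverse ((real (u n) powr a / real (v n) powr b) powr (1 / b))) at_top sequentially"
    by (rule filterlim_inverse_at_top)
  moreover have "\<forall>\<^sub>F n in sequentially. inverse ((real (u n) powr a / real (v n) powr b) powr (1 / b)) = real (v n) / real (u n) powr (a / b)"
    using ev2 by eventually_elim (use xx_eq(2) in \<open>simp add: inverse_eq_divide\<close>)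
  ultimately show ?thesis by (simp add: filterlim_cong)
qed

lemma x_powr_tendsto: "p > 0 \<Longrightarrow> (\<lambda>n. xx (u n) (v n) powr p) \<longlonglongrightarrow> 0"
  using x_tendsto by (intro tendsto_zero_powrI[OF _ tendsto_const]) auto

lemma neg_powr_tendsto: "p < 0 \<Longrightarrow> (\<lambda>n. real (u n) powr p) \<longlonglongrightarrow> 0" "p < 0 \<Longrightarrow> (\<lambda>n. real (v n) powr p) \<longlonglongrightarrow> 0"
  by (intro tendsto_neg_powr filterlim_compose[OF filterlim_real_sequentially] uv; simp)+

lemma J'_limit:
  assumes ij: "i \<le> 1" "j \<le> 1"
  shows "(\<lambda>n. yule_pair.J a \<delta>' b \<delta> j (v n) i (u n) / (real (v n) powr (- (1 / a)) * real (u n) powr (- (a / b) - 1)))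
    \<longlonglongrightarrow> Gamma (\<delta>' + 1 / a + real j) * Gamma (\<delta> + a / b + 1 + real i) / wt i j"
proof -
  interpret swap: yule_pair a \<delta>' b \<delta> by unfold_locales
  have "(\<lambda>n. swap.J j (v n) i (u n) / swap.N0 j i (v n) (u n) * (1 / wt i j))
    \<longlonglongrightarrow> Gamma (\<delta>' + 1 / a + real j) * Gamma (\<delta> + a / b + 1 + real i) * (1 / wt i j)"
    by (intro tendsto_mult tendsto_const swap.J_limit ij uv y_tendsto)
  then show ?thesis using wt_pos[of i j] unfolding swap_N0_wt by simp
qed

text \<open>The main term is the mirrored \<open>J\<close>, both on its own and inside
  \<open>H\<close>. The boundary term of \<open>H\<close> is smaller by the factor u^(- (1 - a - b)
  / b), and \<open>J\<close> by a positive power of \<open>xx\<close>.\<close>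

lemma total_limit_lt:
  assumes ab: "a + b < 1"
  shows "(\<lambda>n. total W1 W2 W3 (u n) (v n) / (real (u n) powr (- ((a + b) / b)) * real (v n) powr (- (1 / a)))) \<longlonglongrightarrow>
    (\<Sum>j\<le>1. W2 j * (Gamma (\<delta>' + 1 / a + real j) * Gamma (\<delta> + a / b + 1 + real 0) / wt 0 j))
    + (\<Sum>i\<le>1. \<Sum>j\<le>1. W3 i j * (1 / (1 - a - b) * (Gamma (\<delta>' + 1 / a + real j) * Gamma (\<delta> + a / b + 1 + real i) / wt i j)))"
proof (rule total_tendsto)
  let ?m = "\<lambda>n. real (u n) powr (- ((a + b) / b)) * real (v n) powr (- (1 / a))"
  have e: "- ((a + b) / b) = - (a / b) - 1" using src.b by (simp add: field_simps)
  fix i j :: nat assume ij: "i \<le> 1" "j \<le> 1"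
  show J': "(\<lambda>n. yule_pair.J a \<delta>' b \<delta> j (v n) i (u n) / ?m n) \<longlonglongrightarrow> Gamma (\<delta>' + 1 / a + real j) * Gamma (\<delta> + a / b + 1 + real i) / wt i j"
    using J'_limit[OF ij] unfolding e by (simp only: mult.commute)
  show J: "(\<lambda>n. J i (u n) j (v n) / ?m n) \<longlonglongrightarrow> 0"
  proof -
    obtain C where C: "C \<ge> 0" "\<And>k l. k \<ge> 2 \<Longrightarrow> l \<ge> 2 \<Longrightarrow> \<bar>J i k j l\<bar> \<le> C * (N0 i j k l * xx k l powr q i)"
      using J_le[OF ij] by blast
    \<comment> \<open>Up to \<open>wt\<close> the quotient of \<open>N0\<close> and the main term is
      xx^(- (1 - a - b) / b), which may be large; the bound xx^q for kappa outweighs it because the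
      exponents add up to \<delta> + i + a/b + 1 > 0.\<close>
    let ?p = "q i - (1 - a - b) / b"
    have "?p = \<delta> + real i + a / b + 1" using src.b by (simp add: field_simps)
    moreover have "0 < \<delta> + real i + a / b + 1" using src.\<delta> src.b tgt.b by (simp add: add_pos_nonneg)
    ultimately have p: "?p > 0" by (simp only:)
    show ?thesis
    proof (rule Lim_null_comparison)
      show "\<forall>\<^sub>F n in sequentially. norm (J i (u n) j (v n) / ?m n) \<le> C / wt i j * xx (u n) (v n) powr ?p"
        using ev2
      proof eventually_elim
        case (elim n)
        then have pos: "real (u n) > 0" "real (v n) > 0" by auto
        have m: "?m n > 0" using pos by simp
        have "xx (u n) (v n) powr (- ((1 - a - b) / b)) = real (u n) powr (- ((1 - a - b) / b)) * real (v n) powr ((1 - a - b) / a)"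
        proof -
          have "b / a * ((1 - a - b) / b) = (1 - a - b) / a" using src.b by simp
          moreover have "xx (u n) (v n) powr (- ((1 - a - b) / b)) = real (u n) powr (- ((1 - a - b) / b)) * real (v n) powr (b / a * ((1 - a - b) / b))"
          proof -
            have "(y / z powr d) powr (- s) = y powr (- s) * z powr (d * s)" if "y > 0" "z > 0" for y z d s :: real
              using that by (simp add: powr_divide powr_powr powr_minus_divide)
            then show ?thesis using pos by blast
          qed
          ultimately show ?thesis by (simp only:)
        qed
        also have "\<dots> = real (u n) powr (- (1 / b)) * real (v n) powr (- (b / a) - 1) / ?m n"
        proof -
          have "- ((1 - a - b) / b) = - (1 / b) - (- ((a + b) / b))" "(1 - a - b) / a = (- (b / a) - 1) - (- (1 / a))"
            using src.b tgt.b by (simp_all add: field_simps)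
          then show ?thesis by (simp only: powr_diff) simp
        qed
        finally have "N0 i j (u n) (v n) * xx (u n) (v n) powr q i / ?m n = 1 / wt i j * (xx (u n) (v n) powr (- ((1 - a - b) / b)) * xx (u n) (v n) powr q i)"
          unfolding N0_wt by simp
        also have "xx (u n) (v n) powr (- ((1 - a - b) / b)) * xx (u n) (v n) powr q i = xx (u n) (v n) powr ?p"
          unfolding powr_add[symmetric] by (simp add: algebra_simps)
        finally have F: "N0 i j (u n) (v n) * xx (u n) (v n) powr q i / ?m n = 1 / wt i j * xx (u n) (v n) powr ?p" .
        have "C * (N0 i j (u n) (v n) * xx (u n) (v n) powr q i) / ?m n = C * (1 / wt i j * xx (u n) (v n) powr ?p)"
          unfolding F[symmetric] by (rule times_divide_eq_right[symmetric])
        then have eq: "C * (N0 i j (u n) (v n) * xx (u n) (v n) powr q i) / ?m n = C / wt i j * xx (u n) (v n) powr ?p"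
          by (simp only: times_divide_eq_left times_divide_eq_right mult_1_left)
        have "norm (J i (u n) j (v n) / ?m n) = \<bar>J i (u n) j (v n)\<bar> / ?m n" using m by simp
        also have "\<dots> \<le> C * (N0 i j (u n) (v n) * xx (u n) (v n) powr q i) / ?m n"
          using C(2) elim m by (intro divide_right_mono) auto
        finally show ?case unfolding eq .
      qed
      show "(\<lambda>n. C / wt i j * xx (u n) (v n) powr ?p) \<longlonglongrightarrow> 0"
        using tendsto_mult[OF tendsto_const[of "C / wt i j"] x_powr_tendsto[OF p]] by simp
    qed
  qed
  have "(\<lambda>n. src.cum i (u n) 1 * tgt.cum j (v n) 1 / ?m n) \<longlonglongrightarrow> Gamma (q i) * Gamma (\<delta>' + 1 / a + real j) / wt i j * 0"
  proof (rule Lim_transform_eventually)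
    have "- ((1 - a - b) / b) < 0" using ab src.b by simp
    from tendsto_mult[OF cum_prod_tendsto[OF ij uv] neg_powr_tendsto(1)[OF this]]
    show "(\<lambda>n. src.cum i (u n) 1 * tgt.cum j (v n) 1 / (real (u n) powr (- (1 / b)) * real (v n) powr (- (1 / a))) * real (u n) powr (- ((1 - a - b) / b)))
      \<longlonglongrightarrow> Gamma (q i) * Gamma (\<delta>' + 1 / a + real j) / wt i j * 0" .
    show "\<forall>\<^sub>F n in sequentially. src.cum i (u n) 1 * tgt.cum j (v n) 1 / (real (u n) powr (- (1 / b)) * real (v n) powr (- (1 / a))) * real (u n) powr (- ((1 - a - b) / b))
      = src.cum i (u n) 1 * tgt.cum j (v n) 1 / ?m n"
      using ev2
    proof eventually_elim
      case (elim n)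
      have "- ((1 - a - b) / b) = - (1 / b) - (- ((a + b) / b))" using src.b by (simp add: field_simps)
      then have "real (u n) powr (- ((1 - a - b) / b)) = real (u n) powr (- (1 / b)) / real (u n) powr (- ((a + b) / b))"
        by (simp only: powr_diff)
      then show ?case using elim by simp
    qed
  qed
  then have cc: "(\<lambda>n. src.cum i (u n) 1 * tgt.cum j (v n) 1 / ?m n) \<longlonglongrightarrow> 0" by simp
  have "H i k j l / y = 1 / (1 - a - b) * (J i k j l / y + yule_pair.J a \<delta>' b \<delta> j l i k / y - src.cum i k 1 * tgt.cum j l 1 / y)" for k l y
  proof -
    have "H i k j l = 1 / (1 - a - b) * (J i k j l + yule_pair.J a \<delta>' b \<delta> j l i k - src.cum i k 1 * tgt.cum j l 1)"
      using H_eq[of i k j l] ab by (simp add: field_simps)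
    then show ?thesis by (simp add: diff_divide_distrib add_divide_distrib mult.commute[of y])
  qed
  then show "(\<lambda>n. H i (u n) j (v n) / ?m n) \<longlonglongrightarrow> 1 / (1 - a - b) * (Gamma (\<delta>' + 1 / a + real j) * Gamma (\<delta> + a / b + 1 + real i) / wt i j)"
    using tendsto_mult[OF tendsto_const tendsto_diff[OF tendsto_add[OF J J'] cc], of "1 / (1 - a - b)"] by simp
qed

text \<open>\<open>m\<close> will be 1 for a + b > 1 and ln u for a + b = 1. Relative to the
  boundary term of \<open>H\<close>, the prefactor of \<open>J\<close> carries the power v^(- (a + b
  - 1) / a).\<close>

lemma J_over_main:
  assumes ij: "i \<le> 1" "j \<le> 1" and m: "\<And>n. m n \<ge> 0" and z: "(\<lambda>n. real (v n) powr (- (a + b - 1) / a) / m n) \<longlonglongrightarrow> 0"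
  shows "(\<lambda>n. J i (u n) j (v n) / (real (u n) powr (- (1 / b)) * real (v n) powr (- (1 / a)) * m n)) \<longlonglongrightarrow> 0"
proof -
  obtain C where C: "C \<ge> 0" "\<And>k l. k \<ge> 2 \<Longrightarrow> l \<ge> 2 \<Longrightarrow> \<bar>J i k j l\<bar> \<le> C * N0 i j k l"
    using J_le[OF ij] by blast
  show ?thesis
  proof (rule Lim_null_comparison)
    show "\<forall>\<^sub>F n in sequentially. norm (J i (u n) j (v n) / (real (u n) powr (- (1 / b)) * real (v n) powr (- (1 / a)) * m n))
      \<le> C / wt i j * (real (v n) powr (- (a + b - 1) / a) / m n)"
      using ev2
    proof eventually_elim
      case (elim n)
      let ?g = "real (u n) powr (- (1 / b)) * real (v n) powr (- (1 / a))"
      have "- (a + b - 1) / a = (- (b / a) - 1) - (- (1 / a))" using tgt.b by (simp add: field_simps)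
      then have v: "real (v n) powr (- (a + b - 1) / a) = real (v n) powr (- (b / a) - 1) / real (v n) powr (- (1 / a))"
        by (simp only: powr_diff)
      have "norm (J i (u n) j (v n) / (?g * m n)) = \<bar>J i (u n) j (v n)\<bar> / (?g * m n)" using m by simp
      also have "\<dots> \<le> C * N0 i j (u n) (v n) / (?g * m n)"
        using C(2) elim m by (intro divide_right_mono mult_nonneg_nonneg) auto
      also have "\<dots> = C / wt i j * (real (v n) powr (- (a + b - 1) / a) / m n)"
        unfolding N0_wt v using elim by simp
      finally show ?case .
    qed
    show "(\<lambda>n. C / wt i j * (real (v n) powr (- (a + b - 1) / a) / m n)) \<longlonglongrightarrow> 0"
      using tendsto_mult[OF tendsto_const[of "C / wt i j"] z] by (simp only: mult_zero_right)
  qed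
qed

lemma J'_over_main:
  assumes ij: "i \<le> 1" "j \<le> 1" and z: "(\<lambda>n. real (u n) powr (- (a + b - 1) / b) / m n) \<longlonglongrightarrow> 0"
  shows "(\<lambda>n. yule_pair.J a \<delta>' b \<delta> j (v n) i (u n) / (real (u n) powr (- (1 / b)) * real (v n) powr (- (1 / a)) * m n)) \<longlonglongrightarrow> 0"
proof (rule Lim_transform_eventually)
  show "(\<lambda>n. yule_pair.J a \<delta>' b \<delta> j (v n) i (u n) / (real (v n) powr (- (1 / a)) * real (u n) powr (- (a / b) - 1))
      * (real (u n) powr (- (a + b - 1) / b) / m n)) \<longlonglongrightarrow> 0"
    using tendsto_mult[OF J'_limit[OF ij] z] by simp
  show "\<forall>\<^sub>F n in sequentially. yule_pair.J a \<delta>' b \<delta> j (v n) i (u n) / (real (v n) powr (- (1 / a)) * real (u n) powr (- (a / b) - 1))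
      * (real (u n) powr (- (a + b - 1) / b) / m n)
    = yule_pair.J a \<delta>' b \<delta> j (v n) i (u n) / (real (u n) powr (- (1 / b)) * real (v n) powr (- (1 / a)) * m n)"
    using ev2
  proof eventually_elim
    case (elim n)
    have "- (a + b - 1) / b = (- (a / b) - 1) - (- (1 / b))" using src.b by (simp add: field_simps)
    then have v: "real (u n) powr (- (a + b - 1) / b) = real (u n) powr (- (a / b) - 1) / real (u n) powr (- (1 / b))"
      by (simp only: powr_diff)
    show ?case unfolding v using elim by simp
  qed
qed

text \<open>The main term is the boundary term of \<open>H\<close>; both \<open>J\<close> integrals
  are smaller by a negative power of a degree. The boundary term is symmetric in source and target,
  which is why both regimes share the constant \<open>Dp\<close>.\<close>

lemma total_limit_gt:
  assumes ab: "a + b > 1"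
  shows "(\<lambda>n. total W1 W2 W3 (u n) (v n) / (real (u n) powr (- (1 / b)) * real (v n) powr (- (1 / a)))) \<longlonglongrightarrow>
    (\<Sum>j\<le>1. W2 j * 0) + (\<Sum>i\<le>1. \<Sum>j\<le>1. W3 i j * (1 / (a + b - 1) * (Gamma (q i) * Gamma (\<delta>' + 1 / a + real j) / wt i j)))"
proof (rule total_tendsto)
  let ?m = "\<lambda>n. real (u n) powr (- (1 / b)) * real (v n) powr (- (1 / a))"
  fix i j :: nat assume ij: "i \<le> 1" "j \<le> 1"
  have n: "- (a + b - 1) / a < 0" "- (a + b - 1) / b < 0" using ab src.b tgt.b by (simp_all add: divide_neg_pos)
  show J: "(\<lambda>n. J i (u n) j (v n) / ?m n) \<longlonglongrightarrow> 0"
    using J_over_main[OF ij, of "\<lambda>_. 1"] neg_powr_tendsto(2)[OF n(1)] by simp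
  show J': "(\<lambda>n. yule_pair.J a \<delta>' b \<delta> j (v n) i (u n) / ?m n) \<longlonglongrightarrow> 0"
    using J'_over_main[OF ij, of "\<lambda>_. 1"] neg_powr_tendsto(1)[OF n(2)] by simp
  have "H i k j l / y = 1 / (a + b - 1) * (src.cum i k 1 * tgt.cum j l 1 / y - (J i k j l / y + yule_pair.J a \<delta>' b \<delta> j l i k / y))" for k l y
  proof -
    have "(a + b - 1) * H i k j l = src.cum i k 1 * tgt.cum j l 1 - (J i k j l + yule_pair.J a \<delta>' b \<delta> j l i k)"
      using H_eq[of i k j l] by (simp add: algebra_simps)
    then have "H i k j l = 1 / (a + b - 1) * (src.cum i k 1 * tgt.cum j l 1 - (J i k j l + yule_pair.J a \<delta>' b \<delta> j l i k))"
      using ab by (simp add: eq_divide_eq mult.commute)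
    then show ?thesis by (simp add: diff_divide_distrib add_divide_distrib mult.commute[of y])
  qed
  then show "(\<lambda>n. H i (u n) j (v n) / ?m n) \<longlonglongrightarrow> 1 / (a + b - 1) * (Gamma (q i) * Gamma (\<delta>' + 1 / a + real j) / wt i j)"
    using tendsto_mult[OF tendsto_const tendsto_diff[OF cum_prod_tendsto[OF ij uv] tendsto_add[OF J J']], of "1 / (a + b - 1)"] by simp
qed

lemma ln_u_at_top: "filterlim (\<lambda>n. ln (real (u n))) at_top sequentially"
  by (intro filterlim_compose[OF ln_at_top] filterlim_compose[OF filterlim_real_sequentially] uv)

lemma inverse_ln_tendsto: "(\<lambda>n. y / ln (real (u n))) \<longlonglongrightarrow> 0"
  using ln_u_at_top by (intro tendsto_divide_0[OF tendsto_const] filterlim_at_top_imp_at_infinity)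

text \<open>ln v is not controlled by ln u, as v may grow much faster. But ln v = (a/b) (ln u - ln
  x), and x^p |ln x| tends to 0.\<close>

lemma ln_v_x_tendsto:
  assumes p: "p > 1"
  shows "(\<lambda>n. (1 + ln (real (v n))) * xx (u n) (v n) powr p / ln (real (u n))) \<longlonglongrightarrow> 0"
proof (rule Lim_null_comparison)
  let ?x = "\<lambda>n. xx (u n) (v n)" and ?l = "\<lambda>n. ln (real (u n))"
  show "\<forall>\<^sub>F n in sequentially. norm ((1 + ln (real (v n))) * ?x n powr p / ?l n)
    \<le> ?x n powr p * (1 / ?l n) + a / b * ?x n powr p + a / b * (2 * (?x n powr (p + 1/2) + ?x n powr (p - 1/2))) * (1 / ?l n)"
    using ev2
  proof eventually_elim
    case (elim n)
    then have pos: "real (u n) > 0" "real (v n) > 0" by auto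
    define x where "x = ?x n"
    define l where "l = ?l n"
    have x: "x > 0" using pos by (simp add: x_def)
    have l: "l > 0" using elim by (simp add: l_def)
    have "ln x = l - b / a * ln (real (v n))" using pos by (simp add: x_def l_def ln_div ln_powr)
    then have lv: "ln (real (v n)) = a / b * (l - ln x)" using src.b tgt.b by (simp add: field_simps)
    have "0 \<le> ln (real (v n))" using elim by simp
    then have "norm ((1 + ln (real (v n))) * x powr p / l) = (1 + ln (real (v n))) * x powr p / l"
      using l by simp
    also have "\<dots> = x powr p * (1 / l) + a / b * x powr p + a / b * ((- ln x) * x powr p) * (1 / l)"
      unfolding lv using l src.b by (simp add: field_simps)
    also have "(- ln x) * x powr p \<le> 2 * (x powr (1/2) + x powr (- (1/2))) * x powr p"
      using abs_ln_le_powr[OF x] by (intro mult_right_mono) auto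
    also have "\<dots> = 2 * (x powr (p + 1/2) + x powr (p - 1/2))"
      unfolding diff_conv_add_uminus powr_add by (simp add: algebra_simps)
    finally show ?case using l src.b tgt.b unfolding x_def l_def by (simp add: mult_left_mono divide_right_mono)
  qed
  have "(\<lambda>n. ?x n powr p * (1 / ?l n) + a / b * ?x n powr p + a / b * (2 * (?x n powr (p + 1/2) + ?x n powr (p - 1/2))) * (1 / ?l n))
    \<longlonglongrightarrow> 0 * 0 + a / b * 0 + a / b * (2 * (0 + 0)) * 0"
    using p by (intro tendsto_intros x_powr_tendsto inverse_ln_tendsto) auto
  then show "(\<lambda>n. ?x n powr p * (1 / ?l n) + a / b * ?x n powr p + a / b * (2 * (?x n powr (p + 1/2) + ?x n powr (p - 1/2))) * (1 / ?l n)) \<longlonglongrightarrow> 0"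
    by simp
qed

text \<open>\<open>J\<close> and its mirror image fall short of the main term by the factor ln u,
  and \<open>Jlog\<close> is negligible by its estimate for small \<open>xx\<close>. What remains is
  the mirrored logarithmic integral, hence ln u rather than ln v.\<close>

lemma total_limit_eq:
  assumes ab: "a + b = 1"
  shows "(\<lambda>n. total W1 W2 W3 (u n) (v n) / (real (u n) powr (- (1 / b)) * real (v n) powr (- (1 / a)) * ln (real (u n)))) \<longlonglongrightarrow>
    (\<Sum>j\<le>1. W2 j * 0) + (\<Sum>i\<le>1. \<Sum>j\<le>1. W3 i j * (1 / b * (Gamma (\<delta>' + 1 / a + real j) * Gamma (\<delta> + a / b + 1 + real i)) / wt i j))"
proof (rule total_tendsto)
  let ?m = "\<lambda>n. real (u n) powr (- (1 / b)) * real (v n) powr (- (1 / a)) * ln (real (u n))"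
  fix i j :: nat assume ij: "i \<le> 1" "j \<le> 1"
  interpret swap: yule_pair a \<delta>' b \<delta> by unfold_locales
  have z: "(\<lambda>n. real (w n) powr 0 / ln (real (u n))) \<longlonglongrightarrow> 0" if "filterlim w at_top sequentially" for w
  proof (rule Lim_transform_eventually[OF inverse_ln_tendsto[of 1]])
    show "\<forall>\<^sub>F n in sequentially. 1 / ln (real (u n)) = real (w n) powr 0 / ln (real (u n))"
      using eventually_ge_2[OF that] by eventually_elim simp
  qed
  have n0: "- (a + b - 1) / a = 0" "- (a + b - 1) / b = 0" using ab by simp_all
  show "(\<lambda>n. J i (u n) j (v n) / ?m n) \<longlonglongrightarrow> 0"
  proof (rule J_over_main[OF ij])
    show "0 \<le> ln (real (u n))" for n by (cases "u n") auto
    show "(\<lambda>n. real (v n) powr (- (a + b - 1) / a) / ln (real (u n))) \<longlonglongrightarrow> 0"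
      unfolding n0 by (rule z[OF uv(2)])
  qed
  show "(\<lambda>n. swap.J j (v n) i (u n) / ?m n) \<longlonglongrightarrow> 0"
  proof (rule J'_over_main[OF ij])
    show "(\<lambda>n. real (u n) powr (- (a + b - 1) / b) / ln (real (u n))) \<longlonglongrightarrow> 0"
      unfolding n0 by (rule z[OF uv(1)])
  qed
  obtain C where C: "C \<ge> 0" "\<And>k l. k \<ge> 2 \<Longrightarrow> l \<ge> 2 \<Longrightarrow> \<bar>Jlog i k j l\<bar> \<le> C * N0 i j k l * ((1 + ln (real l)) * xx k l powr q i)"
    using Jlog_asymp[OF ij ab] by blast
  have e: "- (b / a) - 1 = - (1 / a)" "- (a / b) - 1 = - (1 / b)"
  proof -
    have "b = 1 - a" "a = 1 - b" using ab by auto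
    then have "b / a = 1 / a - 1" "a / b = 1 / b - 1"
      using src.b tgt.b by (metis diff_divide_distrib divide_self less_irrefl)+
    then show "- (b / a) - 1 = - (1 / a)" "- (a / b) - 1 = - (1 / b)" by simp_all
  qed
  have L: "(\<lambda>n. Jlog i (u n) j (v n) / ?m n) \<longlonglongrightarrow> 0"
  proof (rule Lim_null_comparison)
    show "\<forall>\<^sub>F n in sequentially. norm (Jlog i (u n) j (v n) / ?m n)
      \<le> C / wt i j * ((1 + ln (real (v n))) * xx (u n) (v n) powr q i / ln (real (u n)))"
      using ev2
    proof eventually_elim
      case (elim n)
      let ?g = "real (u n) powr (- (1 / b)) * real (v n) powr (- (1 / a))"
      have m: "?g > 0" "ln (real (u n)) > 0" using elim by auto
      have "norm (Jlog i (u n) j (v n) / ?m n) = \<bar>Jlog i (u n) j (v n)\<bar> / ?m n" using m by simp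
      also have "\<dots> \<le> C * N0 i j (u n) (v n) * ((1 + ln (real (v n))) * xx (u n) (v n) powr q i) / ?m n"
        using C(2) elim m by (intro divide_right_mono) auto
      also have "\<dots> = C / wt i j * ((1 + ln (real (v n))) * xx (u n) (v n) powr q i / ln (real (u n)))"
        unfolding N0_wt e using m by simp
      finally show ?case .
    qed
    show "(\<lambda>n. C / wt i j * ((1 + ln (real (v n))) * xx (u n) (v n) powr q i / ln (real (u n)))) \<longlonglongrightarrow> 0"
      using tendsto_mult[OF tendsto_const[of "C / wt i j"] ln_v_x_tendsto[OF q_gt_1]] by simp
  qed
  have "(\<lambda>n. swap.Jlog j (v n) i (u n) / (swap.N0 j i (v n) (u n) * ln (real (u n))) * (1 / wt i j))
    \<longlonglongrightarrow> 1 / b * (Gamma (\<delta>' + 1 / a + real j) * Gamma (\<delta> + a / b + 1 + real i)) * (1 / wt i j)"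
    using ab by (intro tendsto_mult tendsto_const swap.Jlog_limit ij uv y_tendsto) simp
  then have L': "(\<lambda>n. swap.Jlog j (v n) i (u n) / ?m n) \<longlonglongrightarrow> 1 / b * (Gamma (\<delta>' + 1 / a + real j) * Gamma (\<delta> + a / b + 1 + real i)) / wt i j"
    using wt_pos[of i j] unfolding swap_N0_wt e by (simp add: mult_ac)
  show "(\<lambda>n. H i (u n) j (v n) / ?m n) \<longlonglongrightarrow> 1 / b * (Gamma (\<delta>' + 1 / a + real j) * Gamma (\<delta> + a / b + 1 + real i)) / wt i j"
    using tendsto_add[OF L L'] unfolding H_eq_log[OF ab] add_divide_distrib by simp
qed

end

end

lemma sum_le_1: "(\<Sum>i\<le>1. f i) = f 0 + f (1::nat)" for f :: "nat \<Rightarrow> real"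
  by simp

section \<open>Limiting degree frequencies\<close>

context yule
begin

text \<open>An edge arriving at the final time turns degree \<open>k\<close> into k + 1, so (k +
  \<delta>) times the frequency of degree \<open>k\<close> is the marked primitive for degree k + 1
  at u = 1. \<open>p i\<close> is the birth rate of vertices with initial degree
  \<open>i\<close>.\<close>

definition limit_deg :: "(nat \<Rightarrow> real) \<Rightarrow> nat \<Rightarrow> real" where
  "limit_deg p k = (\<Sum>i\<le>1. p i * cum i (k + 1) 1) / (real k + \<delta>)"

lemma limit_deg_mult: "(real k + \<delta>) * limit_deg p k = (\<Sum>i\<le>1. p i * cum i (k + 1) 1)"
  using \<delta> by (simp add: limit_deg_def add_nonneg_pos less_imp_neq[symmetric] del: sum.atMost_Suc)

lemma limit_deg_pred_mult: "k \<ge> 1 \<Longrightarrow> (real k - 1 + \<delta>) * limit_deg p (k - 1) = (\<Sum>i\<le>1. p i * cum i k 1)"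
  using limit_deg_mult[of "k - 1" p] by (simp add: of_nat_diff)

lemma limit_deg_rec:
  "(1 + b * (real k + \<delta>)) * limit_deg p k =
    b * (real k - 1 + \<delta>) * (if k = 0 then 0 else limit_deg p (k - 1)) + p 1 * of_bool (k = 1) + p 0 * of_bool (k = 0)"
proof -
  have k: "real k + \<delta> > 0" using \<delta> by (simp add: add_nonneg_pos)
  have c: "(1 + b * (real k + \<delta>)) * cum i (k + 1) 1 = dens i (k + 1) 1 + b * (real k + \<delta>) * cum i k 1" for i
    using cum_rec[of 1 i "k + 1"] by simp
  have d: "dens i (k + 1) 1 = of_bool (k = i) * (real k + \<delta>)" for i
    by (simp add: dens_one)
  have s: "(\<Sum>i\<le>1. p i * cum i k 1) = (if k = 0 then 0 else (real k - 1 + \<delta>) * limit_deg p (k - 1))"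
    using limit_deg_pred_mult[of k p] by (auto simp: cum_le_index)
  have "(real k + \<delta>) * ((1 + b * (real k + \<delta>)) * limit_deg p k) = (1 + b * (real k + \<delta>)) * (\<Sum>i\<le>1. p i * cum i (k + 1) 1)"
    by (simp only: limit_deg_mult[symmetric] mult_ac)
  also have "\<dots> = (\<Sum>i\<le>1. p i * ((1 + b * (real k + \<delta>)) * cum i (k + 1) 1))"
    by (simp only: sum_distrib_left mult_ac)
  also have "\<dots> = (real k + \<delta>) * (b * (\<Sum>i\<le>1. p i * cum i k 1) + p 1 * of_bool (k = 1) + p 0 * of_bool (k = 0))"
    unfolding c d sum_le_1 by (simp only: distrib_left distrib_right mult_ac add_ac)
  finally have "(1 + b * (real k + \<delta>)) * limit_deg p k = b * (\<Sum>i\<le>1. p i * cum i k 1) + p 1 * of_bool (k = 1) + p 0 * of_bool (k = 0)"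
    using k by (simp only: mult_left_cancel[OF less_imp_neq[symmetric]])
  then show ?thesis unfolding s by (simp add: mult.assoc)
qed

end

section \<open>From uniform inequalities to O-terms\<close>

lemma bigo_degs:
  fixes E h :: "nat \<Rightarrow> nat \<Rightarrow> real"
  assumes "\<And>k l. k \<ge> 2 \<Longrightarrow> l \<ge> 2 \<Longrightarrow> \<bar>E k l\<bar> \<le> C * h k l" "\<And>k l. k \<ge> 2 \<Longrightarrow> l \<ge> 2 \<Longrightarrow> h k l \<ge> 0"
  shows "(\<lambda>(k, l). E k l) \<in> O[degs](\<lambda>(k, l). h k l)"
proof (rule bigoI[of _ C])
  show "\<forall>\<^sub>F x in degs. norm (case x of (k, l) \<Rightarrow> E k l) \<le> C * norm (case x of (k, l) \<Rightarrow> h k l)"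
    using assms by (auto simp: eventually_principal)
qed

lemma swap_bigo:
  "(\<lambda>(k, l). E k l) \<in> O[degs](\<lambda>(k, l). h k l) \<Longrightarrow> (\<lambda>(k, l). E l k) \<in> O[degs](\<lambda>(k, l). h l k)" for E h :: "nat \<Rightarrow> nat \<Rightarrow> real"
  unfolding bigo_def by (fastforce simp: eventually_principal)

text \<open>\<open>E\<close> is (f - g)/g. Where g = 0 the assumed inequality forces f = 0, and
  division by zero gives E = 0.\<close>

lemma relative_error:
  fixes f g h :: "nat \<Rightarrow> nat \<Rightarrow> real"
  assumes fg: "\<And>k l. k \<ge> 2 \<Longrightarrow> l \<ge> 2 \<Longrightarrow> \<bar>f k l - g k l\<bar> \<le> C * h k l * g k l"
    and g: "\<And>k l. g k l \<ge> 0" and h: "\<And>k l. h k l \<ge> 0" and C: "C \<ge> 0"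
  obtains E where "(\<lambda>(k, l). E k l) \<in> O[degs](\<lambda>(k, l). h k l)"
    "\<And>k l. k \<ge> 2 \<Longrightarrow> l \<ge> 2 \<Longrightarrow> f k l = g k l * (1 + E k l)"
proof
  show "(\<lambda>(k, l). (f k l - g k l) / g k l) \<in> O[degs](\<lambda>(k, l). h k l)"
  proof (rule bigo_degs)
    fix k l :: nat assume kl: "k \<ge> 2" "l \<ge> 2"
    show "\<bar>(f k l - g k l) / g k l\<bar> \<le> C * h k l"
    proof (cases "g k l = 0")
      case False
      then have "g k l > 0" using g[of k l] by linarith
      then show ?thesis using fg[OF kl] by (simp add: divide_le_eq)
    qed (use C h in simp)
  qed (rule h)
  fix k l :: nat assume kl: "k \<ge> 2" "l \<ge> 2"
  show "f k l = g k l * (1 + (f k l - g k l) / g k l)"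
    using fg[OF kl] by (cases "g k l = 0") (simp_all add: field_simps)
qed

lemma asymp_equiv_of_tendsto:
  fixes f m :: "nat \<Rightarrow> real"
  assumes "(\<lambda>n. f n / m n) \<longlonglongrightarrow> D" "D \<noteq> 0"
  shows "f \<sim>[sequentially] (\<lambda>n. D * m n)"
proof (rule asymp_equivI')
  show "(\<lambda>n. f n / (D * m n)) \<longlonglongrightarrow> 1"
    using tendsto_divide[OF assms(1) tendsto_const assms(2)] assms(2) by (simp add: mult.commute)
qed

text \<open>1 \<le> ln l / ln 2 removes the summand 1. The term ln l / l is at most ln l / k if k
  \<le> l and at most ln k / l otherwise.\<close>

lemma ln_error_le:
  assumes "k \<ge> 2" "l \<ge> (2::nat)"
  shows "(1 + ln (real l)) * (1 / real k + 1 / real l) \<le> 2 * (1 + 1 / ln 2) * (ln (real l) / real k + ln (real k) / real l)"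
proof -
  have ln: "ln 2 > (0::real)" "ln 2 \<le> ln (real l)" "ln 2 \<le> ln (real k)"
    and ln0: "0 \<le> ln (real k)" "0 \<le> ln (real l)" using assms by auto
  then have "1 + ln (real l) \<le> (1 + 1 / ln 2) * ln (real l)" by (simp add: field_simps)
  moreover have "ln (real l) * (1 / real k + 1 / real l) \<le> 2 * (ln (real l) / real k + ln (real k) / real l)"
  proof (cases "k \<le> l")
    case True
    then have "ln (real l) / real l \<le> ln (real l) / real k" using assms by (intro divide_left_mono) auto
    moreover have "0 \<le> ln (real k) / real l" using ln0 by auto
    ultimately show ?thesis by (simp add: distrib_left)
  next
    case False
    then have "ln (real l) / real l \<le> ln (real k) / real l" using assms by (intro divide_right_mono) auto
    moreover have "0 \<le> ln (real l) / real k" "0 \<le> ln (real k) / real l" using ln0 by auto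
    ultimately show ?thesis by (simp add: distrib_left)
  qed
  ultimately have "(1 + ln (real l)) * (1 / real k + 1 / real l) \<le> (1 + 1 / ln 2) * (ln (real l) * (1 / real k + 1 / real l))"
    using mult_right_mono[of "1 + ln (real l)" "(1 + 1 / ln 2) * ln (real l)" "1 / real k + 1 / real l"] by (simp only: mult.assoc) simp
  also have "\<dots> \<le> (1 + 1 / ln 2) * (2 * (ln (real l) / real k + ln (real k) / real l))"
    using ln \<open>ln (real l) * _ \<le> _\<close> by (intro mult_left_mono) auto
  finally show ?thesis by (simp only: mult_ac)
qed

section \<open>Recurrence and asymptotics of the limit coefficient for abstract weights\<close>

context yule_pair
begin

lemma total_rec:
  "(1 + (b * (real k + \<delta>) + a * (real l + \<delta>'))) * total W1 W2 W3 k l =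
    b * (real k - 1 + \<delta>) * total W1 W2 W3 (k - 1) l + a * (real l - 1 + \<delta>') * total W1 W2 W3 k (l - 1)
    + ((\<Sum>i\<le>1. W1 i * (src.cum i k 1 * tgt.dens 0 l 1)) + (\<Sum>j\<le>1. W2 j * (tgt.cum j l 1 * src.dens 0 k 1))
    + (\<Sum>i\<le>1. \<Sum>j\<le>1. W3 i j * (src.cum i k 1 * tgt.cum j l 1)))"
proof -
  interpret swap: yule_pair a \<delta>' b \<delta> by unfold_locales
  let ?x = "1 + (b * (real k + \<delta>) + a * (real l + \<delta>'))"
  have swap_rec: "?x * swap.J j l i k = tgt.cum j l 1 * src.dens i k 1
      + a * (real l - 1 + \<delta>') * swap.J j (l - 1) i k + b * (real k - 1 + \<delta>) * swap.J j l i (k - 1)" for i j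
    using swap.J_rec[of l k j i] by (simp only: add_ac)
  have x: "?x * (w * y) = w * (?x * y)" for w y by (rule mult.left_commute)
  have "?x * total W1 W2 W3 k l = (\<Sum>i\<le>1. W1 i * (?x * J i k 0 l)) + (\<Sum>j\<le>1. W2 j * (?x * swap.J j l 0 k))
    + (\<Sum>i\<le>1. \<Sum>j\<le>1. W3 i j * (?x * H i k j l))"
    unfolding total_def distrib_left[of ?x] sum_distrib_left x ..
  also have "\<dots> = b * (real k - 1 + \<delta>) * total W1 W2 W3 (k - 1) l + a * (real l - 1 + \<delta>') * total W1 W2 W3 k (l - 1)
    + ((\<Sum>i\<le>1. W1 i * (src.cum i k 1 * tgt.dens 0 l 1)) + (\<Sum>j\<le>1. W2 j * (tgt.cum j l 1 * src.dens 0 k 1))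
    + (\<Sum>i\<le>1. \<Sum>j\<le>1. W3 i j * (src.cum i k 1 * tgt.cum j l 1)))"
    unfolding J_rec H_rec swap_rec total_def sum_le_1 by (simp only: distrib_left mult_ac add_ac)
  finally show ?thesis .
qed

lemma H_commute: "yule_pair.H a \<delta>' b \<delta> j l i k = H i k j l"
proof -
  interpret swap: yule_pair a \<delta>' b \<delta> by unfold_locales
  show ?thesis unfolding H_def swap.H_def by (simp only: mult.commute[of "tgt.cum j l _"] add.commute[of b])
qed

lemma total_zero: "total W1 W2 W3 k 0 = 0" "total W1 W2 W3 0 l = 0"
proof -
  interpret swap: yule_pair a \<delta>' b \<delta> by unfold_locales
  show "total W1 W2 W3 k 0 = 0" "total W1 W2 W3 0 l = 0"
    unfolding total_def J_def swap.J_def H_def by (simp_all add: src.cum_le_index src.dens_le_index tgt.cum_le_index tgt.dens_le_index)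
qed

lemma total_commute: "yule_pair.total a \<delta>' b \<delta> W2 W1 (\<lambda>j i. W3 i j) l k = total W1 W2 W3 k l"
proof -
  interpret swap: yule_pair a \<delta>' b \<delta> by unfold_locales
  show ?thesis unfolding total_def swap.total_def H_commute
    by (simp only: add.commute[of "\<Sum>i\<le>1. W1 i * _ i"] sum.swap[of "\<lambda>j i. W3 i j * H i k j l"])
qed

lemma kap_nonneg: "0 \<le> kap i j k l"
  by (rule kap_le)

text \<open>A single error factor outside the sum over \<open>i\<close> is possible because all
  summands are nonnegative.\<close>

lemma J_sum_asymp:
  assumes W: "\<And>i. W i \<ge> 0"
  obtains E where "(\<lambda>(k, l). E k l) \<in> O[degs](\<lambda>(k, l). 1 / real k + 1 / real l)"
    "\<And>k l. k \<ge> 2 \<Longrightarrow> l \<ge> 2 \<Longrightarrow> (\<Sum>i\<le>1. W i * J i k 0 l) = real k powr (- (1 / b)) * real l powr (- (b / a) - 1) *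
      (\<Sum>i\<le>1. W i / wt i 0 * kappa (q i) (\<delta>' + b / a + 1) (b / a) (xx k l)) * (1 + E k l)"
proof -
  obtain C0 where C0: "C0 \<ge> 0" "\<And>k l. k \<ge> 2 \<Longrightarrow> l \<ge> 2 \<Longrightarrow> \<bar>J 0 k 0 l - N0 0 0 k l * kap 0 0 k l\<bar>
    \<le> C0 * (1 / real k + 1 / real l) * (N0 0 0 k l * kap 0 0 k l)" using J_asymp[of 0 0] by auto
  obtain C1 where C1: "C1 \<ge> 0" "\<And>k l. k \<ge> 2 \<Longrightarrow> l \<ge> 2 \<Longrightarrow> \<bar>J 1 k 0 l - N0 1 0 k l * kap 1 0 k l\<bar>
    \<le> C1 * (1 / real k + 1 / real l) * (N0 1 0 k l * kap 1 0 k l)" using J_asymp[of 1 0] by auto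
  let ?f = "\<lambda>k l. \<Sum>i\<le>1. W i * J i k 0 l" and ?h = "\<lambda>k l. 1 / real k + 1 / real l"
  let ?g = "\<lambda>k l. W 0 * (N0 0 0 k l * kap 0 0 k l) + W 1 * (N0 1 0 k l * kap 1 0 k l)"
  have n: "N0 i j k l * kap i j k l \<ge> 0" for i j k l
    using N0_nonneg kap_nonneg by (rule mult_nonneg_nonneg)
  obtain E where E: "(\<lambda>(k, l). E k l) \<in> O[degs](\<lambda>(k, l). ?h k l)"
    "\<And>k l. k \<ge> 2 \<Longrightarrow> l \<ge> 2 \<Longrightarrow> ?f k l = ?g k l * (1 + E k l)"
  proof (rule relative_error[of ?f ?g "max C0 C1" ?h])
    fix k l :: nat assume kl: "k \<ge> 2" "l \<ge> 2"
    define m where "m = max C0 C1"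
    define h where "h = ?h k l"
    define x0 where "x0 = N0 0 0 k l * kap 0 0 k l"
    define x1 where "x1 = N0 1 0 k l * kap 1 0 k l"
    have "h \<ge> 0" by (simp add: h_def)
    have "\<bar>J 0 k 0 l - x0\<bar> \<le> m * h * x0"
      using C0(2)[OF kl, folded h_def x0_def] \<open>h \<ge> 0\<close> n[of 0 0 k l, folded x0_def]
      by (elim order_trans, intro mult_right_mono) (auto simp: m_def)
    moreover have "\<bar>J 1 k 0 l - x1\<bar> \<le> m * h * x1"
      using C1(2)[OF kl, folded h_def x1_def] \<open>h \<ge> 0\<close> n[of 1 0 k l, folded x1_def]
      by (elim order_trans, intro mult_right_mono) (auto simp: m_def)
    ultimately have "W 0 * \<bar>J 0 k 0 l - x0\<bar> + W 1 * \<bar>J 1 k 0 l - x1\<bar> \<le> W 0 * (m * h * x0) + W 1 * (m * h * x1)"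
      using W by (intro add_mono mult_left_mono)
    moreover have "\<bar>?f k l - (W 0 * x0 + W 1 * x1)\<bar> \<le> W 0 * \<bar>J 0 k 0 l - x0\<bar> + W 1 * \<bar>J 1 k 0 l - x1\<bar>"
    proof -
      have "?f k l - (W 0 * x0 + W 1 * x1) = W 0 * (J 0 k 0 l - x0) + W 1 * (J 1 k 0 l - x1)"
        unfolding sum_le_1 by (simp only: right_diff_distrib)
      then show ?thesis using abs_triangle_ineq[of "W 0 * (J 0 k 0 l - x0)" "W 1 * (J 1 k 0 l - x1)"] W
        by (simp only: abs_mult abs_of_nonneg)
    qed
    ultimately show "\<bar>?f k l - ?g k l\<bar> \<le> max C0 C1 * ?h k l * ?g k l"
      unfolding m_def[symmetric] h_def[symmetric] x0_def[symmetric] x1_def[symmetric]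
      by (simp only: distrib_left mult.left_commute[of _ "m * h"])
  next
    show "?g k l \<ge> 0" for k l using W N0_nonneg kap_nonneg by (intro add_nonneg_nonneg mult_nonneg_nonneg)
  qed (use C0 in auto)
  have g: "?g k l = real k powr (- (1 / b)) * real l powr (- (b / a) - 1) *
      (\<Sum>i\<le>1. W i / wt i 0 * kappa (q i) (\<delta>' + b / a + 1) (b / a) (xx k l))" for k l
    unfolding N0_wt sum_le_1 distrib_left by (simp add: mult_ac)
  show ?thesis by (rule that[OF E(1)]) (use E(2) in \<open>simp only: g\<close>)
qed


lemma J_relative:
  assumes ij: "i \<le> 1" "j \<le> 1"
  obtains E where "(\<lambda>(k, l). E k l) \<in> O[degs](\<lambda>(k, l). 1 / real k + 1 / real l)"
    "\<And>k l. k \<ge> 2 \<Longrightarrow> l \<ge> 2 \<Longrightarrow> J i k j l = N0 i j k l * kap i j k l * (1 + E k l)"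
proof -
  obtain C where C: "C \<ge> 0" "\<forall>k\<ge>2. \<forall>l\<ge>2. \<bar>J i k j l - N0 i j k l * kap i j k l\<bar>
    \<le> C * (1 / real k + 1 / real l) * (N0 i j k l * kap i j k l)" using J_asymp[OF ij] by blast
  show ?thesis
  proof (rule relative_error[of "\<lambda>k l. J i k j l" "\<lambda>k l. N0 i j k l * kap i j k l" C "\<lambda>k l. 1 / real k + 1 / real l"])
    show "N0 i j k l * kap i j k l \<ge> 0" for k l using N0_nonneg kap_nonneg by (rule mult_nonneg_nonneg)
  qed (use C that in auto)
qed

text \<open>The error is subtracted so that it enters \<open>H_asymp\<close>, where the product has
  a minus sign, as + E3.\<close>

lemma cum_prod_asymp:
  assumes ij: "i \<le> 1" "j \<le> 1"
  obtains E where "(\<lambda>(k, l). E k l) \<in> O[degs](\<lambda>(k, l). 1 / real k + 1 / real l)"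
    "\<And>k l. k \<ge> 2 \<Longrightarrow> l \<ge> 2 \<Longrightarrow> src.cum i k 1 * tgt.cum j l 1 =
      real k powr (- (1 / b)) * real l powr (- (1 / a)) / wt i j * (Gamma (q i) * Gamma (\<delta>' + 1 / a + real j) - E k l)"
proof -
  let ?q' = "\<delta>' + 1 / a + real j"
  let ?s = "\<lambda>k. real k powr (- (1 / b)) / (b * Gamma (real i + \<delta>))"
  let ?t = "\<lambda>l. real l powr (- (1 / a)) / (a * Gamma (real j + \<delta>'))"
  obtain C where C: "C \<ge> 0" "\<And>k. k \<ge> 2 \<Longrightarrow> \<bar>src.cum i k 1 - ?s k * Gamma (q i)\<bar> \<le> C / real k * ?s k"
    using src.cum_one_asymp[OF ij(1)] by blast
  obtain D where D: "D \<ge> 0" "\<And>l. l \<ge> 2 \<Longrightarrow> \<bar>tgt.cum j l 1 - ?t l * Gamma ?q'\<bar> \<le> D / real l * ?t l"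
    using tgt.cum_one_asymp[OF ij(2)] by blast
  have G: "Gamma (real i + \<delta>) > 0" "Gamma (real j + \<delta>') > 0"
    using src.\<delta> tgt.\<delta> by (intro Gamma_real_pos; simp)+
  have G': "Gamma (q i) \<ge> 0" "Gamma ?q' \<ge> 0"
    using src.exponent_gt_1[of i] tgt.exponent_gt_1[of j] by (intro less_imp_le Gamma_real_pos; linarith)+
  define e where "e k = src.cum i k 1 / ?s k - Gamma (q i)" for k
  define e' where "e' l = tgt.cum j l 1 / ?t l - Gamma ?q'" for l
  have s: "?s k > 0" if "k \<ge> 2" for k using that G src.b by simp
  have t: "?t l > 0" if "l \<ge> 2" for l using that G tgt.b by simp
  have *: "\<bar>x / s - g\<bar> \<le> c" "x = s * (g + (x / s - g))" if "\<bar>x - s * g\<bar> \<le> c * s" "s > 0" for x s g c :: real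
  proof -
    have "x / s - g = (x - s * g) / s" using that by (simp add: diff_divide_distrib)
    then show "\<bar>x / s - g\<bar> \<le> c" using that by (simp add: divide_le_eq)
  qed (use that in simp)
  have e: "\<bar>e k\<bar> \<le> C / real k" "src.cum i k 1 = ?s k * (Gamma (q i) + e k)" if "k \<ge> 2" for k
    unfolding e_def by (rule *[OF C(2)[OF that] s[OF that]])+
  have e': "\<bar>e' l\<bar> \<le> D / real l" "tgt.cum j l 1 = ?t l * (Gamma ?q' + e' l)" if "l \<ge> 2" for l
    unfolding e'_def by (rule *[OF D(2)[OF that] t[OF that]])+
  define K where "K = C * Gamma ?q' + Gamma (q i) * D + C * D"
  show ?thesis
  proof (rule that)
    show "(\<lambda>(k, l). - (e k * Gamma ?q' + Gamma (q i) * e' l + e k * e' l)) \<in> O[degs](\<lambda>(k, l). 1 / real k + 1 / real l)"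
    proof (rule bigo_degs)
      fix k l :: nat assume kl: "k \<ge> 2" "l \<ge> 2"
      define x where "x = 1 / real k"
      define y where "y = 1 / real l"
      define g where "g = Gamma (q i)"
      define h where "h = Gamma ?q'"
      have xy: "x \<ge> 0" "y \<ge> 0" "x \<le> 1" "y \<le> 1" using kl by (simp_all add: x_def y_def)
      have ek: "\<bar>e k\<bar> \<le> C * x" "\<bar>e' l\<bar> \<le> D * y" using e(1)[OF kl(1)] e'(1)[OF kl(2)] by (simp_all add: x_def y_def)
      have gh: "g \<ge> 0" "h \<ge> 0" using G' by (simp_all only: g_def h_def)
      have 1: "\<bar>e k * h\<bar> \<le> C * x * h" "\<bar>g * e' l\<bar> \<le> g * (D * y)"
        unfolding abs_mult abs_of_nonneg[OF gh(1)] abs_of_nonneg[OF gh(2)]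
        using ek gh by (auto intro: mult_right_mono mult_left_mono)
      have "\<bar>e k * e' l\<bar> \<le> (C * x) * (D * y)"
        unfolding abs_mult using ek C(1) xy by (intro mult_mono) auto
      also have "\<dots> \<le> (C * x) * (D * 1)"
        using xy C(1) D(1) by (intro mult_left_mono) auto
      finally have "\<bar>e k * h + g * e' l + e k * e' l\<bar> \<le> C * x * h + g * (D * y) + C * x * D"
        using 1 by linarith
      also have "\<dots> \<le> (C * h + g * D + C * D) * (x + y)"
      proof -
        have "0 \<le> C * y * h" "0 \<le> g * (D * x)" "0 \<le> C * y * D" using C(1) D(1) gh xy by simp_all
        then show ?thesis by (simp add: algebra_simps)
      qed
      finally show "\<bar>- (e k * Gamma ?q' + Gamma (q i) * e' l + e k * e' l)\<bar> \<le> K * (1 / real k + 1 / real l)"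
        unfolding abs_minus_cancel K_def g_def h_def x_def y_def .
    qed simp
    fix k l :: nat assume kl: "k \<ge> 2" "l \<ge> 2"
    have "src.cum i k 1 * tgt.cum j l 1 = (?s k * ?t l) * ((Gamma (q i) + e k) * (Gamma ?q' + e' l))"
      unfolding e(2)[OF kl(1)] e'(2)[OF kl(2)] by (simp only: mult_ac)
    also have "?s k * ?t l = real k powr (- (1 / b)) * real l powr (- (1 / a)) / wt i j"
      unfolding wt_def times_divide_times_eq by (simp only: mult_ac)
    also have "(Gamma (q i) + e k) * (Gamma ?q' + e' l)
      = Gamma (q i) * Gamma ?q' - - (e k * Gamma ?q' + Gamma (q i) * e' l + e k * e' l)" by (simp add: algebra_simps)
    finally show "src.cum i k 1 * tgt.cum j l 1 = real k powr (- (1 / b)) * real l powr (- (1 / a)) / wt i j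
      * (Gamma (q i) * Gamma ?q' - - (e k * Gamma ?q' + Gamma (q i) * e' l + e k * e' l))" .
  qed
qed

lemma H_asymp:
  assumes ij: "i \<le> 1" "j \<le> 1" and ab: "a + b \<noteq> 1"
  obtains E1 E2 E3 where
    "(\<lambda>(k, l). E1 k l) \<in> O[degs](\<lambda>(k, l). 1 / real k + 1 / real l)"
    "(\<lambda>(k, l). E2 k l) \<in> O[degs](\<lambda>(k, l). 1 / real k + 1 / real l)"
    "(\<lambda>(k, l). E3 k l) \<in> O[degs](\<lambda>(k, l). 1 / real k + 1 / real l)"
    "\<And>k l. k \<ge> 2 \<Longrightarrow> l \<ge> 2 \<Longrightarrow> H i k j l = real k powr (- (1 / b)) * real l powr (- (1 / a)) / wt i j / (1 - a - b) *
      (real l powr ((1 - a - b) / a) * kap i j k l * (1 + E1 k l)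
       + real k powr ((1 - a - b) / b) * yule_pair.kap a \<delta>' b \<delta> j i l k * (1 + E2 k l)
       - Gamma (q i) * Gamma (\<delta>' + 1 / a + real j) + E3 k l)"
proof -
  interpret swap: yule_pair a \<delta>' b \<delta> by unfold_locales
  obtain E1 where E1: "(\<lambda>(k, l). E1 k l) \<in> O[degs](\<lambda>(k, l). 1 / real k + 1 / real l)"
    "\<And>k l. k \<ge> 2 \<Longrightarrow> l \<ge> 2 \<Longrightarrow> J i k j l = N0 i j k l * kap i j k l * (1 + E1 k l)"
    using J_relative[OF ij] by blast
  obtain E2 where E2: "(\<lambda>(k, l). E2 k l) \<in> O[degs](\<lambda>(k, l). 1 / real k + 1 / real l)"
    "\<And>k l. k \<ge> 2 \<Longrightarrow> l \<ge> 2 \<Longrightarrow> swap.J j k i l = swap.N0 j i k l * swap.kap j i k l * (1 + E2 k l)"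
    using swap.J_relative[OF ij(2,1)] by blast
  obtain E3 where E3: "(\<lambda>(k, l). E3 k l) \<in> O[degs](\<lambda>(k, l). 1 / real k + 1 / real l)"
    "\<And>k l. k \<ge> 2 \<Longrightarrow> l \<ge> 2 \<Longrightarrow> src.cum i k 1 * tgt.cum j l 1 =
      real k powr (- (1 / b)) * real l powr (- (1 / a)) / wt i j * (Gamma (q i) * Gamma (\<delta>' + 1 / a + real j) - E3 k l)"
    using cum_prod_asymp[OF ij] by blast
  show ?thesis
  proof (rule that[OF E1(1) _ E3(1)])
    show "(\<lambda>(k, l). E2 l k) \<in> O[degs](\<lambda>(k, l). 1 / real k + 1 / real l)"
      using swap_bigo[OF E2(1)] by (simp add: add.commute)
    fix k l :: nat assume kl: "k \<ge> 2" "l \<ge> 2"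
    define m where "m = real k powr (- (1 / b)) * real l powr (- (1 / a)) / wt i j"
    \<comment> \<open>Both prefactors are written as k^(-1/b) l^(-1/a) times one extra power, as in
      the formula for \<open>cX3\<close>.\<close>
    have e1: "- (b / a) - 1 = - (1 / a) + (1 - a - b) / a" using tgt.b by (simp add: diff_divide_distrib)
    have e2: "- (a / b) - 1 = - (1 / b) + (1 - a - b) / b" using src.b by (simp add: diff_divide_distrib)
    have n1: "N0 i j k l = m * real l powr ((1 - a - b) / a)"
      unfolding N0_wt e1 powr_add m_def by simp
    have n2: "swap.N0 j i l k = m * real k powr ((1 - a - b) / b)"
      unfolding swap_N0_wt e2 powr_add m_def by simp
    have *: "h = m / d * (x + y - g + e)"
      if "d * h = m * x + m * y - m * (g - e)" "d \<noteq> 0" for h m d x y g e :: real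
    proof -
      have "d * h = m * (x + y - g + e)" using that(1) by (simp add: algebra_simps)
      then have "h = m * (x + y - g + e) / d" using that(2) by (simp add: eq_divide_eq mult.commute)
      then show ?thesis by simp
    qed
    show "H i k j l = real k powr (- (1 / b)) * real l powr (- (1 / a)) / wt i j / (1 - a - b) *
      (real l powr ((1 - a - b) / a) * kap i j k l * (1 + E1 k l)
       + real k powr ((1 - a - b) / b) * swap.kap j i l k * (1 + E2 l k)
       - Gamma (q i) * Gamma (\<delta>' + 1 / a + real j) + E3 k l)"
      unfolding m_def[symmetric]
    proof (rule *)
      show "(1 - a - b) * H i k j l = m * (real l powr ((1 - a - b) / a) * kap i j k l * (1 + E1 k l))
       + m * (real k powr ((1 - a - b) / b) * swap.kap j i l k * (1 + E2 l k))
       - m * (Gamma (q i) * Gamma (\<delta>' + 1 / a + real j) - E3 k l)"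
        unfolding H_eq E1(2)[OF kl] E2(2)[OF kl(2,1)] E3(2)[OF kl] n1 n2 m_def[symmetric] by (simp only: mult.assoc)
    qed (use ab in simp)
  qed
qed

lemma H_log_asymp:
  assumes ij: "i \<le> 1" "j \<le> 1" and ab: "a + b = 1"
  obtains E where
    "(\<lambda>(k, l). E k l) \<in> O[degs](\<lambda>(k, l). ln (real l) / real k + ln (real k) / real l)"
    "\<And>k l. k \<ge> 2 \<Longrightarrow> l \<ge> 2 \<Longrightarrow> H i k j l = real k powr (- (1 / b)) * real l powr (- (1 / a)) / wt i j *
      (1 / a * (ln (real l) * kap i j k l - kappa_c2 (q i) (c j) (b / a) (xx k l))
       + 1 / b * (ln (real k) * yule_pair.kap a \<delta>' b \<delta> j i l k - kappa_c2 (\<delta>' + 1 / a + real j) (\<delta> + a / b + 1 + real i) (a / b) (real l / real k powr (a / b)))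
       + E k l)"
proof -
  interpret swap: yule_pair a \<delta>' b \<delta> by unfold_locales
  let ?m = "\<lambda>k l. real k powr (- (1 / b)) * real l powr (- (1 / a)) / wt i j"
  let ?h = "\<lambda>k l. ln (real l) / real k + ln (real k) / real l"
  let ?L = "\<lambda>k l. 1 / a * (ln (real l) * kap i j k l - kappa_c2 (q i) (c j) (b / a) (xx k l))"
  let ?L' = "\<lambda>k l. 1 / b * (ln (real k) * swap.kap j i l k - kappa_c2 (\<delta>' + 1 / a + real j) (\<delta> + a / b + 1 + real i) (a / b) (real l / real k powr (a / b)))"
  obtain C where C: "C \<ge> 0" "\<And>k l. k \<ge> 2 \<Longrightarrow> l \<ge> 2 \<Longrightarrow> \<bar>Jlog i k j l - N0 i j k l * ?L k l\<bar>
    \<le> C * N0 i j k l * ((1 + ln (real l)) * (1 / real k + 1 / real l))"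
    using Jlog_asymp[OF ij ab] by blast
  have ba: "b + a = 1" using ab by simp
  obtain D where D: "D \<ge> 0" "\<And>k l. k \<ge> 2 \<Longrightarrow> l \<ge> 2 \<Longrightarrow> \<bar>swap.Jlog j l i k - swap.N0 j i l k * ?L' k l\<bar>
    \<le> D * swap.N0 j i l k * ((1 + ln (real k)) * (1 / real l + 1 / real k))"
    using swap.Jlog_asymp[OF ij(2,1) ba] by blast
  have e: "- (b / a) - 1 = - (1 / a)" "- (a / b) - 1 = - (1 / b)"
  proof -
    have "b = 1 - a" "a = 1 - b" using ab by auto
    then have "b / a = 1 / a - 1" "a / b = 1 / b - 1"
      using src.b tgt.b by (metis diff_divide_distrib divide_self less_irrefl)+
    then show "- (b / a) - 1 = - (1 / a)" "- (a / b) - 1 = - (1 / b)" by simp_all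
  qed
  have n: "N0 i j k l = ?m k l" "swap.N0 j i l k = ?m k l" for k l
    unfolding N0_wt swap_N0_wt e by (simp_all only: mult.commute)
  define F where "F = 2 * (1 + 1 / ln (2 :: real))"
  show ?thesis
  proof (rule that)
    show "(\<lambda>(k, l). H i k j l / ?m k l - (?L k l + ?L' k l)) \<in> O[degs](\<lambda>(k, l). ?h k l)"
    proof (rule bigo_degs)
      fix k l :: nat assume kl: "k \<ge> 2" "l \<ge> 2"
      define m where "m = ?m k l"
      define h where "h = ?h k l"
      define J1 where "J1 = Jlog i k j l"
      define J2 where "J2 = swap.Jlog j l i k"
      define L1 where "L1 = ?L k l"
      define L2 where "L2 = ?L' k l"
      have m: "m > 0" using kl wt_pos by (simp add: m_def)
      have "\<bar>J1 - m * L1\<bar> \<le> C * m * (F * h)"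
        using order_trans[OF C(2)[OF kl] mult_left_mono[OF ln_error_le[OF kl]]] C(1) m
        unfolding n m_def[symmetric] h_def[symmetric] F_def[symmetric] J1_def[symmetric] L1_def[symmetric] by simp
      moreover have "\<bar>J2 - m * L2\<bar> \<le> D * m * (F * h)"
        using order_trans[OF D(2)[OF kl] mult_left_mono[OF ln_error_le[OF kl(2,1)]]] D(1) m
        unfolding n m_def[symmetric] add.commute[of "ln (real k) / real l"] h_def[symmetric] F_def[symmetric] J2_def[symmetric] L2_def[symmetric] by simp
      ultimately have "\<bar>J1 + J2 - m * (L1 + L2)\<bar> \<le> C * m * (F * h) + D * m * (F * h)"
        unfolding distrib_left by linarith
      then have "\<bar>J1 + J2 - m * (L1 + L2)\<bar> / m \<le> (C * m * (F * h) + D * m * (F * h)) / m"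
        using m by (intro divide_right_mono) auto
      also have "\<bar>J1 + J2 - m * (L1 + L2)\<bar> / m = \<bar>(J1 + J2) / m - (L1 + L2)\<bar>"
      proof -
        have "(J1 + J2) / m - (L1 + L2) = (J1 + J2 - m * (L1 + L2)) / m" using m by (simp add: diff_divide_distrib)
        then show ?thesis using m by simp
      qed
      also have "(C * m * (F * h) + D * m * (F * h)) / m = (C + D) * F * h" using m by (simp add: field_simps)
      finally show "\<bar>H i k j l / ?m k l - (?L k l + ?L' k l)\<bar> \<le> ((C + D) * F) * ?h k l"
        unfolding H_eq_log[OF ab] m_def J1_def J2_def L1_def L2_def h_def .
    next
      fix k l :: nat assume "k \<ge> 2" "l \<ge> 2"
      then show "?h k l \<ge> 0" by simp
    qed
    fix k l :: nat assume kl: "k \<ge> 2" "l \<ge> 2"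
    then have "?m k l > 0" using wt_pos by simp
    moreover have "x = m * (s + (x / m - s))" if "m > 0" for x m s :: real using that by simp
    ultimately show "H i k j l = ?m k l * (?L k l + ?L' k l + (H i k j l / ?m k l - (?L k l + ?L' k l)))" by blast
  qed
qed


lemma Gamma_exponents: "Gamma (\<delta> + 1 / b + real i) > 0" "Gamma (\<delta>' + 1 / a + real i) > 0"
  "Gamma (\<delta> + a / b + 1 + real i) > 0" "Gamma (\<delta>' + b / a + 1 + real i) > 0"
  using src.b src.\<delta> tgt.b tgt.\<delta> by (intro Gamma_real_pos add_pos_nonneg; simp)+

text \<open>Asymptotic equivalence calls for nonzero limits. The weights \<open>W3\<close> and all
  Gamma values are positive, and each of the denominators 1 - a - b, b and a + b - 1 is positive in
  its own case.\<close>

lemma total_asymp: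
  fixes u v :: "nat \<Rightarrow> nat" and W1 W2 :: "nat \<Rightarrow> real" and W3 :: "nat \<Rightarrow> nat \<Rightarrow> real"
  defines "Dlt \<equiv> (\<Sum>j\<le>1. W2 j / wt 0 j * (Gamma (\<delta>' + 1 / a + real j) * Gamma (\<delta> + a / b + 1)))
      + (\<Sum>i\<le>1. \<Sum>j\<le>1. W3 i j / wt i j / (1 - a - b) * (Gamma (\<delta>' + 1 / a + real j) * Gamma (\<delta> + a / b + 1 + real i)))"
    and "Deq \<equiv> \<Sum>i\<le>1. \<Sum>j\<le>1. W3 i j / wt i j / b * (Gamma (\<delta> + 1 / b + real i) * Gamma (\<delta>' + 1 / a + real j))"
    and "Dgt \<equiv> \<Sum>i\<le>1. \<Sum>j\<le>1. W3 i j / wt i j / (a + b - 1) * (Gamma (\<delta> + 1 / b + real i) * Gamma (\<delta>' + 1 / a + real j))"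
  assumes W: "\<And>j. W2 j \<ge> 0" "\<And>i j. W3 i j > 0"
    and uv: "filterlim u at_top sequentially" "filterlim v at_top sequentially"
    and lim: "(\<lambda>n. real (u n) powr a / real (v n) powr b) \<longlonglongrightarrow> 0"
  shows "(\<lambda>n. total W1 W2 W3 (u n) (v n)) \<sim>[sequentially]
    (\<lambda>n. if a + b < 1 then Dlt * (real (u n) powr (- ((a + b) / b)) * real (v n) powr (- (1 / a)))
      else if a + b = 1 then Deq * (real (u n) powr (- (1 / b)) * real (v n) powr (- (1 / a)) * ln (real (u n)))
      else Dgt * (real (u n) powr (- (1 / b)) * real (v n) powr (- (1 / a))))"
proof -
  have pos: "(\<Sum>i\<le>1. \<Sum>j\<le>1. W3 i j / wt i j / d * (x i j * y i j)) > 0"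
    if "d > 0" "\<And>i j. x i j > 0" "\<And>i j. y i j > 0" for d :: real and x y :: "nat \<Rightarrow> nat \<Rightarrow> real"
    using W(2) wt_pos that by (intro sum_pos mult_pos_pos divide_pos_pos) auto
  consider (lt) "a + b < 1" | (eq) "a + b = 1" | (gt) "a + b > 1" by linarith
  then show ?thesis
  proof cases
    case lt
    have "0 \<le> (\<Sum>j\<le>1. W2 j / wt 0 j * (Gamma (\<delta>' + 1 / a + real j) * Gamma (\<delta> + a / b + 1)))"
      using W(1) wt_pos Gamma_exponents Gamma_exponents(3)[of 0]
      by (intro sum_nonneg mult_nonneg_nonneg divide_nonneg_nonneg) (auto intro: less_imp_le)
    moreover have "0 < (\<Sum>i\<le>1. \<Sum>j\<le>1. W3 i j / wt i j / (1 - a - b) * (Gamma (\<delta>' + 1 / a + real j) * Gamma (\<delta> + a / b + 1 + real i)))"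
      using lt Gamma_exponents by (intro pos) auto
    ultimately have "Dlt \<noteq> 0" unfolding Dlt_def by linarith
    have "(\<lambda>n. total W1 W2 W3 (u n) (v n) / (real (u n) powr (- ((a + b) / b)) * real (v n) powr (- (1 / a)))) \<longlonglongrightarrow> Dlt"
      using total_limit_lt[OF uv lim lt, of W1 W2 W3] unfolding Dlt_def by (simp add: mult.commute[of "1 - a - b"])
    from asymp_equiv_of_tendsto[OF this \<open>Dlt \<noteq> 0\<close>] lt show ?thesis by simp
  next
    case eq
    have "a / b + 1 = 1 / b" using eq src.b by (simp add: field_simps)
    then have ab: "\<delta> + a / b + 1 + x = \<delta> + 1 / b + x" for x by linarith
    have "0 < Deq" unfolding Deq_def using src.b Gamma_exponents by (intro pos) auto
    moreover have "(\<lambda>n. total W1 W2 W3 (u n) (v n) / (real (u n) powr (- (1 / b)) * real (v n) powr (- (1 / a)) * ln (real (u n)))) \<longlonglongrightarrow> Deq"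
      using total_limit_eq[OF uv lim eq, of W1 W2 W3] unfolding Deq_def ab by (simp add: mult_ac)
    ultimately show ?thesis using asymp_equiv_of_tendsto[of "\<lambda>n. total W1 W2 W3 (u n) (v n)"] eq by simp
  next
    case gt
    have "0 < Dgt" unfolding Dgt_def using gt Gamma_exponents by (intro pos) auto
    moreover have "(\<lambda>n. total W1 W2 W3 (u n) (v n) / (real (u n) powr (- (1 / b)) * real (v n) powr (- (1 / a)))) \<longlonglongrightarrow> Dgt"
      using total_limit_gt[OF uv lim gt, of W1 W2 W3] unfolding Dgt_def by (simp add: mult_ac)
    ultimately show ?thesis using asymp_equiv_of_tendsto[of "\<lambda>n. total W1 W2 W3 (u n) (v n)"] gt by simp
  qed
qed

end

section \<open>The limit coefficient of the graph process\<close>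

context pref_process
begin

lemma ab_less_1: "a < 1" "b < 1"
proof -
  have "P > 1" "Q > 1" using params unfolding P_def Q_def by (simp_all add: add_pos_pos)
  then show "a < 1" "b < 1" using params unfolding a_def b_def by (simp_all add: divide_less_eq)
qed

sublocale pair: yule_pair b \<delta>out a \<delta>in
  using PQ_pos ab_less_1 params by unfold_locales auto

text \<open>Birth rates by initial degree: a step with probability \<gamma> adds a vertex of
  out-degree 0 and in-degree 1, one with probability \<alpha> the reverse.\<close>

definition \<pi>o :: "nat \<Rightarrow> real" where "\<pi>o i = (if i = 0 then \<gamma> else \<alpha>)"
definition \<pi>i :: "nat \<Rightarrow> real" where "\<pi>i j = (if j = 0 then \<alpha> else \<gamma>)"

text \<open>The divisor \<delta>in offsets the boundary value \<open>dens 0 1 1\<close> = \<delta>in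
  of a new target, and \<delta>out that of a new source; with these weights \<open>total\<close>
  satisfies the recurrence of the concentration argument.\<close>

lemma expected_num_edges_total:
  "\<exists>K. \<forall>t\<ge>card (arcs G0). \<bar>measure_pmf.expectation (M t) (\<lambda>G. real (num_edges k l G))
    - pair.total (\<lambda>i. \<gamma> * \<pi>o i / (Q * \<delta>in)) (\<lambda>j. \<alpha> * \<pi>i j / (P * \<delta>out)) (\<lambda>i j. \<beta> * \<pi>o i * \<pi>i j / (P * Q)) k l * real t\<bar> \<le> K"
proof (rule expected_num_edges[where \<nu>o = "pair.src.limit_deg \<pi>o" and \<nu>i = "pair.tgt.limit_deg \<pi>i"])
  fix k l :: nat
  let ?\<nu>o = "pair.src.limit_deg \<pi>o" and ?\<nu>i = "pair.tgt.limit_deg \<pi>i"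
  let ?W1 = "\<lambda>i. \<gamma> * \<pi>o i / (Q * \<delta>in)" and ?W2 = "\<lambda>j. \<alpha> * \<pi>i j / (P * \<delta>out)" and ?W3 = "\<lambda>i j. \<beta> * \<pi>o i * \<pi>i j / (P * Q)"
  show "(1 + b * (real k + \<delta>out)) * ?\<nu>o k = b * (real k - 1 + \<delta>out) * (if k = 0 then 0 else ?\<nu>o (k - 1)) + \<alpha> * of_bool (k = 1) + \<gamma> * of_bool (k = 0)"
    using pair.src.limit_deg_rec[of k \<pi>o] by (simp only: \<pi>o_def) simp
  show "(1 + a * (real k + \<delta>in)) * ?\<nu>i k = a * (real k - 1 + \<delta>in) * (if k = 0 then 0 else ?\<nu>i (k - 1)) + \<gamma> * of_bool (k = 1) + \<alpha> * of_bool (k = 0)"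
    using pair.tgt.limit_deg_rec[of k \<pi>i] by (simp only: \<pi>i_def) simp
  show "pair.total ?W1 ?W2 ?W3 k 0 = 0" "pair.total ?W1 ?W2 ?W3 0 l = 0" by (rule pair.total_zero)+
  assume kl: "k \<ge> 1" "l \<ge> 1"
  define x where "x i = pair.src.cum i k 1" for i
  define y where "y j = pair.tgt.cum j l 1" for j
  have "(\<Sum>i\<le>1. ?W1 i * (x i * pair.tgt.dens 0 l 1)) = \<gamma> * of_bool (l = 1) * ((\<Sum>i\<le>1. \<pi>o i * x i) / Q)"
    using params unfolding pair.tgt.dens_one sum_le_1 by (simp add: distrib_left add_divide_distrib)
  moreover have "(\<Sum>j\<le>1. ?W2 j * (y j * pair.src.dens 0 k 1)) = \<alpha> * of_bool (k = 1) * ((\<Sum>j\<le>1. \<pi>i j * y j) / P)"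
    using params unfolding pair.src.dens_one sum_le_1 by (simp add: distrib_left add_divide_distrib)
  moreover have "(\<Sum>i\<le>1. \<Sum>j\<le>1. ?W3 i j * (x i * y j)) = \<beta> * ((\<Sum>i\<le>1. \<pi>o i * x i) / Q * ((\<Sum>j\<le>1. \<pi>i j * y j) / P))"
    unfolding sum_le_1 by (simp add: distrib_left distrib_right add_divide_distrib mult_ac)
  moreover note pair.total_rec[of k l ?W1 ?W2 ?W3, folded x_def y_def]
  moreover have "(real k - 1 + \<delta>out) * ?\<nu>o (k - 1) = (\<Sum>i\<le>1. \<pi>o i * x i)"
    unfolding x_def by (rule pair.src.limit_deg_pred_mult[OF kl(1)])
  moreover have "(real l - 1 + \<delta>in) * ?\<nu>i (l - 1) = (\<Sum>j\<le>1. \<pi>i j * y j)"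
    unfolding y_def by (rule pair.tgt.limit_deg_pred_mult[OF kl(2)])
  ultimately show "(1 + (b * (real k + \<delta>out) + a * (real l + \<delta>in))) * pair.total ?W1 ?W2 ?W3 k l =
      b * (real k - 1 + \<delta>out) * pair.total ?W1 ?W2 ?W3 (k - 1) l + a * (real l - 1 + \<delta>in) * pair.total ?W1 ?W2 ?W3 k (l - 1)
      + \<alpha> * of_bool (k = 1) * ((real l - 1 + \<delta>in) * ?\<nu>i (l - 1) / P)
      + \<gamma> * of_bool (l = 1) * ((real k - 1 + \<delta>out) * ?\<nu>o (k - 1) / Q)
      + \<beta> * (((real k - 1 + \<delta>out) * ?\<nu>o (k - 1) / Q) * ((real l - 1 + \<delta>in) * ?\<nu>i (l - 1) / P))"
    by (simp only: add_ac)
qed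

end

theorem theorem3:
  fixes \<alpha> \<beta> \<gamma> \<delta>in \<delta>out a b P Q Dm D0 Dp Dm' D0' :: real
    and A B :: "nat \<Rightarrow> real" and C :: "nat \<Rightarrow> nat \<Rightarrow> real"
  assumes "\<alpha> > 0" "\<beta> > 0" "\<gamma> > 0" "\<alpha> + \<beta> + \<gamma> = 1" "\<delta>in > 0" "\<delta>out > 0"
    and "P = 1 + \<delta>in * (\<alpha> + \<gamma>)" "Q = 1 + \<delta>out * (\<alpha> + \<gamma>)"
    and "a = (1 - \<gamma>) / (1 + \<delta>in * (\<alpha> + \<gamma>))" "b = (1 - \<alpha>) / (1 + \<delta>out * (\<alpha> + \<gamma>))"
    and "A 0 = \<gamma>\<^sup>2 / (Q * a * b * Gamma \<delta>out * Gamma (1 + \<delta>in))"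
    and "A 1 = \<alpha> * \<gamma> / (Q * a * b * Gamma (1 + \<delta>out) * Gamma (1 + \<delta>in))"
    and "B 0 = \<alpha>\<^sup>2 / (P * a * b * Gamma (1 + \<delta>out) * Gamma \<delta>in)"
    and "B 1 = \<alpha> * \<gamma> / (P * a * b * Gamma (1 + \<delta>out) * Gamma (1 + \<delta>in))"
    and "C 0 0 = \<beta> * \<alpha> * \<gamma> / (P * Q * a * b * Gamma \<delta>out * Gamma \<delta>in)"
    and "C 0 1 = \<beta> * \<gamma>\<^sup>2 / (P * Q * a * b * Gamma \<delta>out * Gamma (\<delta>in + 1))"
    and "C 1 0 = \<beta> * \<alpha>\<^sup>2 / (P * Q * a * b * Gamma (\<delta>out + 1) * Gamma \<delta>in)"
    and "C 1 1 = \<beta> * \<alpha> * \<gamma> / (P * Q * a * b * Gamma (\<delta>out + 1) * Gamma (\<delta>in + 1))"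
    and "Dm = (B 0 * Gamma (\<delta>in + 1/a) + B 1 * Gamma (\<delta>in + 1/a + 1)) * Gamma (\<delta>out + a/b + 1)
           + (\<Sum>i\<le>1. \<Sum>j\<le>1. C i j / (1 - a - b) *
                Gamma (\<delta>in + 1/a + real j) * Gamma (\<delta>out + a/b + 1 + real i))"
    and "D0 = (\<Sum>i\<le>1. \<Sum>j\<le>1. C i j / b * Gamma (\<delta>out + 1/b + real i) * Gamma (\<delta>in + 1/a + real j))"
    and "Dp = (\<Sum>i\<le>1. \<Sum>j\<le>1. C i j / (a + b - 1) *
                Gamma (\<delta>out + 1/b + real i) * Gamma (\<delta>in + 1/a + real j))"
    and "Dm' = (A 0 * Gamma (\<delta>out + 1/b) + A 1 * Gamma (\<delta>out + 1/b + 1)) * Gamma (\<delta>in + b/a + 1)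
           + (\<Sum>i\<le>1. \<Sum>j\<le>1. C i j / (1 - a - b) *
                Gamma (\<delta>in + b/a + 1 + real j) * Gamma (\<delta>out + 1/b + real i))"
    and "D0' = (\<Sum>i\<le>1. \<Sum>j\<le>1. C i j / a * Gamma (\<delta>out + 1/b + real i) * Gamma (\<delta>in + 1/a + real j))"
  shows "\<exists>cX cX1 cX2 cX3 :: nat \<Rightarrow> nat \<Rightarrow> real.
    (\<forall>d1\<ge>2. \<forall>d2\<ge>2. cX d1 d2 = cX1 d1 d2 + cX2 d1 d2 + cX3 d1 d2) \<and>
    (\<forall>G0. initial_graph \<delta>in \<delta>out G0 \<longrightarrow> (\<forall>d1\<ge>2. \<forall>d2\<ge>2. \<exists>K. \<forall>t\<ge>card (arcs G0).
       \<bar>measure_pmf.expectation (random_graph \<alpha> \<beta> \<gamma> \<delta>in \<delta>out G0 t) (\<lambda>G. real (num_edges d1 d2 G))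
          - cX d1 d2 * real t\<bar> \<le> K)) \<and>
    (\<exists>E :: nat \<Rightarrow> nat \<Rightarrow> real.
       (\<lambda>(d1, d2). E d1 d2) \<in> O[degs](\<lambda>(d1, d2). 1 / real d1 + 1 / real d2) \<and>
       (\<forall>d1\<ge>2. \<forall>d2\<ge>2. cX1 d1 d2 =
          real d1 powr (- (1/b)) * real d2 powr (- (b/a) - 1) *
          (\<Sum>i\<le>1. A i * kappa (\<delta>out + 1/b + real i) (\<delta>in + b/a + 1) (b/a)
                           (real d1 / real d2 powr (b/a))) * (1 + E d1 d2))) \<and>
    (\<exists>E :: nat \<Rightarrow> nat \<Rightarrow> real.
       (\<lambda>(d1, d2). E d1 d2) \<in> O[degs](\<lambda>(d1, d2). 1 / real d1 + 1 / real d2) \<and>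
       (\<forall>d1\<ge>2. \<forall>d2\<ge>2. cX2 d1 d2 =
          real d1 powr (- (a/b) - 1) * real d2 powr (- (1/a)) *
          (\<Sum>i\<le>1. B i * kappa (\<delta>in + 1/a + real i) (\<delta>out + a/b + 1) (a/b)
                           (real d2 / real d1 powr (a/b))) * (1 + E d1 d2))) \<and>
    (a + b \<noteq> 1 \<longrightarrow> (\<exists>E1 E2 E3 :: nat \<Rightarrow> nat \<Rightarrow> nat \<Rightarrow> nat \<Rightarrow> real.
       (\<forall>E\<in>{E1, E2, E3}. \<forall>i\<le>1. \<forall>j\<le>1.
          (\<lambda>(d1, d2). E i j d1 d2) \<in> O[degs](\<lambda>(d1, d2). 1 / real d1 + 1 / real d2)) \<and>
       (\<forall>d1\<ge>2. \<forall>d2\<ge>2. cX3 d1 d2 =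
          real d1 powr (- (1/b)) * real d2 powr (- (1/a)) *
          (\<Sum>i\<le>1. \<Sum>j\<le>1. C i j / (1 - a - b) *
             (real d2 powr ((1 - a - b) / a) *
                kappa (\<delta>out + 1/b + real i) (\<delta>in + b/a + 1 + real j) (b/a)
                  (real d1 / real d2 powr (b/a)) * (1 + E1 i j d1 d2)
              + real d1 powr ((1 - a - b) / b) *
                kappa (\<delta>in + 1/a + real j) (\<delta>out + a/b + 1 + real i) (a/b)
                  (real d2 / real d1 powr (a/b)) * (1 + E2 i j d1 d2)
              - Gamma (\<delta>out + 1/b + real i) * Gamma (\<delta>in + 1/a + real j) + E3 i j d1 d2))))) \<and>
    (a + b = 1 \<longrightarrow> (\<exists>E :: nat \<Rightarrow> nat \<Rightarrow> nat \<Rightarrow> nat \<Rightarrow> real.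
       (\<forall>i\<le>1. \<forall>j\<le>1.
          (\<lambda>(d1, d2). E i j d1 d2) \<in> O[degs](\<lambda>(d1, d2). ln (real d2) / real d1 + ln (real d1) / real d2)) \<and>
       (\<forall>d1\<ge>2. \<forall>d2\<ge>2. cX3 d1 d2 =
          real d1 powr (- (1/b)) * real d2 powr (- (1/a)) *
          (\<Sum>i\<le>1. \<Sum>j\<le>1. C i j *
             (1/a * kappa (\<delta>out + 1/b + real i) (\<delta>in + 1/a + real j) (b/a)
                      (real d1 / real d2 powr (b/a)) * ln (real d2)
              - 1/a * kappa_c2 (\<delta>out + 1/b + real i) (\<delta>in + 1/a + real j) (b/a)
                      (real d1 / real d2 powr (b/a))
              + 1/b * kappa (\<delta>in + 1/a + real j) (\<delta>out + 1/b + real i) (a/b)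
                      (real d2 / real d1 powr (a/b)) * ln (real d1)
              - 1/b * kappa_c2 (\<delta>in + 1/a + real j) (\<delta>out + 1/b + real i) (a/b)
                      (real d2 / real d1 powr (a/b))
              + E i j d1 d2))))) \<and>
    (\<forall>u v :: nat \<Rightarrow> nat.
       filterlim u at_top sequentially \<and> filterlim v at_top sequentially \<and>
       (\<lambda>n. real (u n) powr a / real (v n) powr b) \<longlonglongrightarrow> 0 \<longrightarrow>
       (\<lambda>n. cX (u n) (v n)) \<sim>[sequentially]
       (\<lambda>n. if a + b < 1 then Dm * real (u n) powr (- ((a + b) / b)) * real (v n) powr (- (1/a))
            else if a + b = 1 then
              D0 * real (u n) powr (- (1/b)) * real (v n) powr (- (1/a)) * ln (real (u n))
            else Dp * real (u n) powr (- (1/b)) * real (v n) powr (- (1/a)))) \<and>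
    (\<forall>u v :: nat \<Rightarrow> nat.
       filterlim u at_top sequentially \<and> filterlim v at_top sequentially \<and>
       filterlim (\<lambda>n. real (u n) powr a / real (v n) powr b) at_top sequentially \<longrightarrow>
       (\<lambda>n. cX (u n) (v n)) \<sim>[sequentially]
       (\<lambda>n. if a + b < 1 then Dm' * real (u n) powr (- (1/b)) * real (v n) powr (- ((a + b) / a))
            else if a + b = 1 then
              D0' * real (u n) powr (- (1/b)) * real (v n) powr (- (1/a)) * ln (real (v n))
            else Dp * real (u n) powr (- (1/b)) * real (v n) powr (- (1/a))))"
proof -
  note params = assms(1-6) and PQ = assms(7,8)
  have PQ1: "P > 1" "Q > 1" using params PQ by (simp_all add: add_pos_pos)
  have ab: "a = (\<alpha> + \<beta>) / P" "b = (\<beta> + \<gamma>) / Q"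
  proof -
    have "1 - \<gamma> = \<alpha> + \<beta>" "1 - \<alpha> = \<beta> + \<gamma>" using assms(4) by linarith+
    then show "a = (\<alpha> + \<beta>) / P" "b = (\<beta> + \<gamma>) / Q" by (simp_all only: assms(7-10))
  qed
  have ab01: "0 < a" "a < 1" "0 < b" "b < 1"
    using params PQ1 unfolding ab by (simp_all add: divide_less_eq)
  interpret oi: yule_pair b \<delta>out a \<delta>in using ab01 params by unfold_locales auto
  interpret io: yule_pair a \<delta>in b \<delta>out by unfold_locales
  define po :: "nat \<Rightarrow> real" where "po i = (if i = 0 then \<gamma> else \<alpha>)" for i
  define pi' :: "nat \<Rightarrow> real" where "pi' j = (if j = 0 then \<alpha> else \<gamma>)" for j
  define W1 where "W1 i = \<gamma> * po i / (Q * \<delta>in)" for i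
  define W2 where "W2 j = \<alpha> * pi' j / (P * \<delta>out)" for j
  define W3 where "W3 i j = \<beta> * po i * pi' j / (P * Q)" for i j
  have W_pos: "W1 i > 0" "W2 j > 0" "W3 i j > 0" for i j
    using params PQ1 by (simp_all add: W1_def W2_def W3_def po_def pi'_def)
  have Gamma_plus1_pos: "Gamma (x + 1) = x * Gamma x" if "x > 0" for x :: real
    using that by (intro Gamma_plus1) (auto elim!: nonpos_Ints_cases)
  have Gamma_Suc: "Gamma (\<delta>in + 1) = \<delta>in * Gamma \<delta>in" "Gamma (\<delta>out + 1) = \<delta>out * Gamma \<delta>out"
    "Gamma (1 + \<delta>in) = \<delta>in * Gamma \<delta>in" "Gamma (1 + \<delta>out) = \<delta>out * Gamma \<delta>out"
    using params by (simp_all only: add.commute[of 1] Gamma_plus1_pos)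
  \<comment> \<open>\<delta> Gamma (\<delta>) = Gamma (1 + \<delta>) absorbs the divisors \<delta>in
    and \<delta>out of the weights, so that the quotients by \<open>wt\<close> are the constants of
    the theorem.\<close>
  have WA: "W1 0 / oi.wt 0 0 = A 0" "W1 1 / oi.wt 1 0 = A 1"
    unfolding assms(11,12) W1_def oi.wt_def po_def by (simp_all add: Gamma_Suc power2_eq_square mult_ac)
  have WB: "W2 0 / oi.wt 0 0 = B 0" "W2 1 / oi.wt 0 1 = B 1"
    unfolding assms(13,14) W2_def oi.wt_def pi'_def by (simp_all add: Gamma_Suc power2_eq_square mult_ac)
  have WC: "W3 0 0 / oi.wt 0 0 = C 0 0" "W3 0 1 / oi.wt 0 1 = C 0 1" "W3 1 0 / oi.wt 1 0 = C 1 0" "W3 1 1 / oi.wt 1 1 = C 1 1"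
    unfolding assms(15-18) W3_def oi.wt_def po_def pi'_def by (simp_all add: power2_eq_square add.commute mult_ac)
  have WC': "W3 i j / oi.wt i j = C i j" if "i \<le> 1" "j \<le> 1" for i j
    using that WC by (auto simp: le_Suc_eq)
  have wt_swap: "io.wt j i = oi.wt i j" for i j by (simp add: io.wt_def oi.wt_def mult_ac)
  define cX where "cX = oi.total W1 W2 W3"
  define cX1 where "cX1 k l = (\<Sum>i\<le>1. W1 i * oi.J i k 0 l)" for k l
  define cX2 where "cX2 k l = (\<Sum>j\<le>1. W2 j * io.J j l 0 k)" for k l
  define cX3 where "cX3 k l = (\<Sum>i\<le>1. \<Sum>j\<le>1. W3 i j * oi.H i k j l)" for k l
  show ?thesis
  proof (rule exI[of _ cX], rule exI[of _ cX1], rule exI[of _ cX2], rule exI[of _ cX3], intro conjI)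
    show "\<forall>d1\<ge>2. \<forall>d2\<ge>2. cX d1 d2 = cX1 d1 d2 + cX2 d1 d2 + cX3 d1 d2"
      by (simp only: cX_def cX1_def cX2_def cX3_def oi.total_def simp_thms)
  next
    show "\<forall>G0. initial_graph \<delta>in \<delta>out G0 \<longrightarrow> (\<forall>d1\<ge>2. \<forall>d2\<ge>2. \<exists>K. \<forall>t\<ge>card (arcs G0).
       \<bar>measure_pmf.expectation (random_graph \<alpha> \<beta> \<gamma> \<delta>in \<delta>out G0 t) (\<lambda>G. real (num_edges d1 d2 G))
          - cX d1 d2 * real t\<bar> \<le> K)"
    proof (intro allI impI)
      fix G0 k l assume "initial_graph \<delta>in \<delta>out G0"
      then interpret pp: pref_process \<alpha> \<beta> \<gamma> \<delta>in \<delta>out G0 using params by unfold_locales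
      have pp: "pp.P = P" "pp.Q = Q" "pp.a = a" "pp.b = b"
        by (simp_all only: pp.P_def pp.Q_def pp.a_def pp.b_def ab PQ)
      have "pp.\<pi>o = po" "pp.\<pi>i = pi'" by (simp_all add: fun_eq_iff pp.\<pi>o_def pp.\<pi>i_def po_def pi'_def)
      then have "(\<lambda>i. \<gamma> * pp.\<pi>o i / (Q * \<delta>in)) = W1" "(\<lambda>j. \<alpha> * pp.\<pi>i j / (P * \<delta>out)) = W2"
        "(\<lambda>i j. \<beta> * pp.\<pi>o i * pp.\<pi>i j / (P * Q)) = W3"
        by (simp_all only: W1_def W2_def W3_def fun_eq_iff simp_thms)
      with pp.expected_num_edges_total[of k l]
      show "\<exists>K. \<forall>t\<ge>card (arcs G0). \<bar>measure_pmf.expectation (random_graph \<alpha> \<beta> \<gamma> \<delta>in \<delta>out G0 t)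
        (\<lambda>G. real (num_edges k l G)) - cX k l * real t\<bar> \<le> K"
        unfolding pp cX_def by (simp only:)
    qed
  next
    obtain E where E: "(\<lambda>(k, l). E k l) \<in> O[degs](\<lambda>(k, l). 1 / real k + 1 / real l)"
      "\<And>k l. k \<ge> 2 \<Longrightarrow> l \<ge> 2 \<Longrightarrow> (\<Sum>i\<le>1. W1 i * oi.J i k 0 l) = real k powr (- (1 / b)) * real l powr (- (b / a) - 1) *
        (\<Sum>i\<le>1. W1 i / oi.wt i 0 * kappa (\<delta>out + 1 / b + real i) (\<delta>in + b / a + 1) (b / a) (real k / real l powr (b / a))) * (1 + E k l)"
      by (rule oi.J_sum_asymp[of W1, OF less_imp_le[OF W_pos(1)]], rule that)
    show "\<exists>E :: nat \<Rightarrow> nat \<Rightarrow> real.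
       (\<lambda>(d1, d2). E d1 d2) \<in> O[degs](\<lambda>(d1, d2). 1 / real d1 + 1 / real d2) \<and>
       (\<forall>d1\<ge>2. \<forall>d2\<ge>2. cX1 d1 d2 =
          real d1 powr (- (1/b)) * real d2 powr (- (b/a) - 1) *
          (\<Sum>i\<le>1. A i * kappa (\<delta>out + 1/b + real i) (\<delta>in + b/a + 1) (b/a)
                           (real d1 / real d2 powr (b/a))) * (1 + E d1 d2))"
      by (intro exI[of _ E] conjI allI impI E(1)) (use E(2) in \<open>simp only: cX1_def sum_le_1 WA\<close>)
  next
    obtain E where E: "(\<lambda>(k, l). E k l) \<in> O[degs](\<lambda>(k, l). 1 / real k + 1 / real l)"
      "\<And>k l. k \<ge> 2 \<Longrightarrow> l \<ge> 2 \<Longrightarrow> (\<Sum>i\<le>1. W2 i * io.J i k 0 l) = real k powr (- (1 / a)) * real l powr (- (a / b) - 1) *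
        (\<Sum>i\<le>1. W2 i / io.wt i 0 * kappa (\<delta>in + 1 / a + real i) (\<delta>out + a / b + 1) (a / b) (real k / real l powr (a / b))) * (1 + E k l)"
      by (rule io.J_sum_asymp[of W2, OF less_imp_le[OF W_pos(2)]], rule that)
    have "(\<lambda>(k, l). E l k) \<in> O[degs](\<lambda>(k, l). 1 / real k + 1 / real l)"
      using swap_bigo[OF E(1)] by (simp only: add.commute)
    moreover have "cX2 k l = real k powr (- (a/b) - 1) * real l powr (- (1/a)) *
          (\<Sum>i\<le>1. B i * kappa (\<delta>in + 1/a + real i) (\<delta>out + a/b + 1) (a/b)
                           (real l / real k powr (a/b))) * (1 + E l k)" if "k \<ge> 2" "l \<ge> 2" for k l
      using E(2)[OF that(2,1)] by (simp only: cX2_def sum_le_1 wt_swap WB mult.commute[of "real l powr _" "real k powr _"])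
    ultimately show "\<exists>E :: nat \<Rightarrow> nat \<Rightarrow> real.
       (\<lambda>(d1, d2). E d1 d2) \<in> O[degs](\<lambda>(d1, d2). 1 / real d1 + 1 / real d2) \<and>
       (\<forall>d1\<ge>2. \<forall>d2\<ge>2. cX2 d1 d2 =
          real d1 powr (- (a/b) - 1) * real d2 powr (- (1/a)) *
          (\<Sum>i\<le>1. B i * kappa (\<delta>in + 1/a + real i) (\<delta>out + a/b + 1) (a/b)
                           (real d2 / real d1 powr (a/b))) * (1 + E d1 d2))"
      by (intro exI[of _ "\<lambda>k l. E l k"] conjI allI impI)
  next
    show "a + b \<noteq> 1 \<longrightarrow> (\<exists>E1 E2 E3 :: nat \<Rightarrow> nat \<Rightarrow> nat \<Rightarrow> nat \<Rightarrow> real.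
       (\<forall>E\<in>{E1, E2, E3}. \<forall>i\<le>1. \<forall>j\<le>1.
          (\<lambda>(d1, d2). E i j d1 d2) \<in> O[degs](\<lambda>(d1, d2). 1 / real d1 + 1 / real d2)) \<and>
       (\<forall>d1\<ge>2. \<forall>d2\<ge>2. cX3 d1 d2 =
          real d1 powr (- (1/b)) * real d2 powr (- (1/a)) *
          (\<Sum>i\<le>1. \<Sum>j\<le>1. C i j / (1 - a - b) *
             (real d2 powr ((1 - a - b) / a) *
                kappa (\<delta>out + 1/b + real i) (\<delta>in + b/a + 1 + real j) (b/a)
                  (real d1 / real d2 powr (b/a)) * (1 + E1 i j d1 d2)
              + real d1 powr ((1 - a - b) / b) *
                kappa (\<delta>in + 1/a + real j) (\<delta>out + a/b + 1 + real i) (a/b)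
                  (real d2 / real d1 powr (a/b)) * (1 + E2 i j d1 d2)
              - Gamma (\<delta>out + 1/b + real i) * Gamma (\<delta>in + 1/a + real j) + E3 i j d1 d2))))"
    proof
      assume ne: "a + b \<noteq> 1"
      let ?m = "\<lambda>k l. real k powr (- (1 / b)) * real l powr (- (1 / a))"
      let ?h = "\<lambda>(k, l). 1 / real k + 1 / real l"
      let ?X = "\<lambda>i j e1 e2 e3 k l. real l powr ((1 - a - b) / a) * oi.kap i j k l * (1 + e1 k l)
         + real k powr ((1 - a - b) / b) * io.kap j i l k * (1 + e2 k l)
         - Gamma (\<delta>out + 1/b + real i) * Gamma (\<delta>in + 1/a + real j) + e3 k l"
      \<comment> \<open>Bundles what is known about the errors for one pair (i, j), so that one
        application of choice yields them as functions of \<open>i\<close> and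
        \<open>j\<close>.\<close>
      define \<Phi> where "\<Phi> i j e1 e2 e3 \<longleftrightarrow>
        (\<lambda>(k, l). e1 k l) \<in> O[degs](?h) \<and> (\<lambda>(k, l). e2 k l) \<in> O[degs](?h) \<and> (\<lambda>(k, l). e3 k l) \<in> O[degs](?h) \<and>
        (\<forall>k\<ge>2. \<forall>l\<ge>2. oi.H i k j l = ?m k l / oi.wt i j / (1 - a - b) * ?X i j e1 e2 e3 k l)"
        for i j and e1 e2 e3 :: "nat \<Rightarrow> nat \<Rightarrow> real"
      have "\<exists>e1 e2 e3. \<Phi> i j e1 e2 e3" if "i \<le> 1" "j \<le> 1" for i j
        by (rule oi.H_asymp[OF that ne]) (unfold \<Phi>_def, blast)
      then obtain E1 E2 E3 where E: "\<And>i j. i \<le> 1 \<Longrightarrow> j \<le> 1 \<Longrightarrow> \<Phi> i j (E1 i j) (E2 i j) (E3 i j)" by metis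
      show "\<exists>E1 E2 E3 :: nat \<Rightarrow> nat \<Rightarrow> nat \<Rightarrow> nat \<Rightarrow> real.
         (\<forall>E\<in>{E1, E2, E3}. \<forall>i\<le>1. \<forall>j\<le>1. (\<lambda>(d1, d2). E i j d1 d2) \<in> O[degs](?h)) \<and>
         (\<forall>d1\<ge>2. \<forall>d2\<ge>2. cX3 d1 d2 = ?m d1 d2 * (\<Sum>i\<le>1. \<Sum>j\<le>1. C i j / (1 - a - b) * ?X i j (E1 i j) (E2 i j) (E3 i j) d1 d2))"
      proof (rule exI[of _ E1], rule exI[of _ E2], rule exI[of _ E3], intro conjI allI impI)
        show "\<forall>E\<in>{E1, E2, E3}. \<forall>i\<le>1. \<forall>j\<le>1. (\<lambda>(d1, d2). E i j d1 d2) \<in> O[degs](?h)"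
          using E unfolding \<Phi>_def by blast
        fix k l :: nat assume kl: "k \<ge> 2" "l \<ge> 2"
        have "cX3 k l = (\<Sum>i\<le>1. \<Sum>j\<le>1. ?m k l * (C i j / (1 - a - b) * ?X i j (E1 i j) (E2 i j) (E3 i j) k l))"
          unfolding cX3_def
        proof (intro sum.cong refl)
          fix i j :: nat assume "i \<in> {..1}" "j \<in> {..1}"
          then have ij: "i \<le> 1" "j \<le> 1" by auto
          have H: "oi.H i k j l = ?m k l / oi.wt i j / (1 - a - b) * ?X i j (E1 i j) (E2 i j) (E3 i j) k l"
            using E[OF ij] kl unfolding \<Phi>_def by blast
          have "w * (m / t / d * x) = m * (w / t / d * x)" for w m t d x :: real by simp
          then show "W3 i j * oi.H i k j l = ?m k l * (C i j / (1 - a - b) * ?X i j (E1 i j) (E2 i j) (E3 i j) k l)"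
            unfolding H WC'[OF ij, symmetric] .
        qed
        then show "cX3 k l = ?m k l * (\<Sum>i\<le>1. \<Sum>j\<le>1. C i j / (1 - a - b) * ?X i j (E1 i j) (E2 i j) (E3 i j) k l)"
          by (simp only: sum_distrib_left)
      qed
    qed
  next
    show "a + b = 1 \<longrightarrow> (\<exists>E :: nat \<Rightarrow> nat \<Rightarrow> nat \<Rightarrow> nat \<Rightarrow> real.
       (\<forall>i\<le>1. \<forall>j\<le>1.
          (\<lambda>(d1, d2). E i j d1 d2) \<in> O[degs](\<lambda>(d1, d2). ln (real d2) / real d1 + ln (real d1) / real d2)) \<and>
       (\<forall>d1\<ge>2. \<forall>d2\<ge>2. cX3 d1 d2 =
          real d1 powr (- (1/b)) * real d2 powr (- (1/a)) *
          (\<Sum>i\<le>1. \<Sum>j\<le>1. C i j *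
             (1/a * kappa (\<delta>out + 1/b + real i) (\<delta>in + 1/a + real j) (b/a)
                      (real d1 / real d2 powr (b/a)) * ln (real d2)
              - 1/a * kappa_c2 (\<delta>out + 1/b + real i) (\<delta>in + 1/a + real j) (b/a)
                      (real d1 / real d2 powr (b/a))
              + 1/b * kappa (\<delta>in + 1/a + real j) (\<delta>out + 1/b + real i) (a/b)
                      (real d2 / real d1 powr (a/b)) * ln (real d1)
              - 1/b * kappa_c2 (\<delta>in + 1/a + real j) (\<delta>out + 1/b + real i) (a/b)
                      (real d2 / real d1 powr (a/b))
              + E i j d1 d2))))"
    proof
      assume eq: "a + b = 1"
      \<comment> \<open>These identities give the second arguments of kappa their form in the
        critical case.\<close>
      have "b / a + 1 = 1 / a" "a / b + 1 = 1 / b" using eq ab01 by (simp_all add: field_simps)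
      then have c: "\<delta>in + b / a + 1 + x = \<delta>in + 1 / a + x" "\<delta>out + a / b + 1 + x = \<delta>out + 1 / b + x" for x by linarith+
      let ?m = "\<lambda>k l. real k powr (- (1 / b)) * real l powr (- (1 / a))"
      let ?h = "\<lambda>(k, l). ln (real l) / real k + ln (real k) / real l"
      let ?k = "\<lambda>i j k l. kappa (\<delta>out + 1/b + real i) (\<delta>in + 1/a + real j) (b/a) (real k / real l powr (b/a))"
      let ?k' = "\<lambda>i j k l. kappa (\<delta>in + 1/a + real j) (\<delta>out + 1/b + real i) (a/b) (real l / real k powr (a/b))"
      let ?d = "\<lambda>i j k l. kappa_c2 (\<delta>out + 1/b + real i) (\<delta>in + 1/a + real j) (b/a) (real k / real l powr (b/a))"
      let ?d' = "\<lambda>i j k l. kappa_c2 (\<delta>in + 1/a + real j) (\<delta>out + 1/b + real i) (a/b) (real l / real k powr (a/b))"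
      let ?X = "\<lambda>i j e k l. 1/a * ?k i j k l * ln (real l) - 1/a * ?d i j k l + 1/b * ?k' i j k l * ln (real k) - 1/b * ?d' i j k l + e k l"
      define \<Phi> where "\<Phi> i j e \<longleftrightarrow> (\<lambda>(k, l). e k l) \<in> O[degs](?h) \<and>
        (\<forall>k\<ge>2. \<forall>l\<ge>2. oi.H i k j l = ?m k l / oi.wt i j *
           (1 / a * (ln (real l) * ?k i j k l - ?d i j k l) + 1 / b * (ln (real k) * ?k' i j k l - ?d' i j k l) + e k l))"
        for i j and e :: "nat \<Rightarrow> nat \<Rightarrow> real"
      have "\<exists>e. \<Phi> i j e" if "i \<le> 1" "j \<le> 1" for i j
        by (rule oi.H_log_asymp[OF that eq]) (unfold \<Phi>_def c, blast)
      then obtain E where E: "\<And>i j. i \<le> 1 \<Longrightarrow> j \<le> 1 \<Longrightarrow> \<Phi> i j (E i j)" by metis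
      show "\<exists>E :: nat \<Rightarrow> nat \<Rightarrow> nat \<Rightarrow> nat \<Rightarrow> real.
         (\<forall>i\<le>1. \<forall>j\<le>1. (\<lambda>(d1, d2). E i j d1 d2) \<in> O[degs](?h)) \<and>
         (\<forall>d1\<ge>2. \<forall>d2\<ge>2. cX3 d1 d2 = ?m d1 d2 * (\<Sum>i\<le>1. \<Sum>j\<le>1. C i j * ?X i j (E i j) d1 d2))"
      proof (rule exI[of _ E], rule conjI)
        show "\<forall>i\<le>1. \<forall>j\<le>1. (\<lambda>(d1, d2). E i j d1 d2) \<in> O[degs](?h)"
          using E unfolding \<Phi>_def by blast
        show "\<forall>k\<ge>2. \<forall>l\<ge>2. cX3 k l = ?m k l * (\<Sum>i\<le>1. \<Sum>j\<le>1. C i j * ?X i j (E i j) k l)"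
        proof (intro allI impI)
          fix k l :: nat assume kl: "k \<ge> 2" "l \<ge> 2"
          have "cX3 k l = (\<Sum>i\<le>1. \<Sum>j\<le>1. ?m k l * (C i j * ?X i j (E i j) k l))"
            unfolding cX3_def
          proof (intro sum.cong refl)
            fix i j :: nat assume "i \<in> {..1}" "j \<in> {..1}"
            then have ij: "i \<le> 1" "j \<le> 1" by auto
            have H: "oi.H i k j l = ?m k l / oi.wt i j *
              (1 / a * (ln (real l) * ?k i j k l - ?d i j k l) + 1 / b * (ln (real k) * ?k' i j k l - ?d' i j k l) + E i j k l)"
              using E[OF ij] kl unfolding \<Phi>_def by blast
            have "w * (m / t * (p * (x * y - z) + p' * (x' * y' - z') + e))
              = m * (w / t * (p * y * x - p * z + p' * y' * x' - p' * z' + e))" for w m t p x y z p' x' y' z' e :: real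
              by (simp add: algebra_simps)
            then show "W3 i j * oi.H i k j l = ?m k l * (C i j * ?X i j (E i j) k l)"
              unfolding H WC'[OF ij, symmetric] .
          qed
          then show "cX3 k l = ?m k l * (\<Sum>i\<le>1. \<Sum>j\<le>1. C i j * ?X i j (E i j) k l)"
            by (simp only: sum_distrib_left)
        qed
      qed
    qed
  next
    show "\<forall>u v :: nat \<Rightarrow> nat.
       filterlim u at_top sequentially \<and> filterlim v at_top sequentially \<and>
       (\<lambda>n. real (u n) powr a / real (v n) powr b) \<longlonglongrightarrow> 0 \<longrightarrow>
       (\<lambda>n. cX (u n) (v n)) \<sim>[sequentially]
       (\<lambda>n. if a + b < 1 then Dm * real (u n) powr (- ((a + b) / b)) * real (v n) powr (- (1/a))
            else if a + b = 1 then
              D0 * real (u n) powr (- (1/b)) * real (v n) powr (- (1/a)) * ln (real (u n))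
            else Dp * real (u n) powr (- (1/b)) * real (v n) powr (- (1/a)))"
    proof (intro allI impI, elim conjE)
      fix u v :: "nat \<Rightarrow> nat"
      assume uv: "filterlim u at_top sequentially" "filterlim v at_top sequentially"
        "(\<lambda>n. real (u n) powr a / real (v n) powr b) \<longlonglongrightarrow> 0"
      have Dm: "Dm = (\<Sum>j\<le>1. W2 j / oi.wt 0 j * (Gamma (\<delta>in + 1 / a + real j) * Gamma (\<delta>out + a / b + 1)))
        + (\<Sum>i\<le>1. \<Sum>j\<le>1. W3 i j / oi.wt i j / (1 - a - b) * (Gamma (\<delta>in + 1 / a + real j) * Gamma (\<delta>out + a / b + 1 + real i)))"
        unfolding assms(19) sum_le_1 WB WC by (simp only: of_nat_0 of_nat_1 add_0_right distrib_right mult.assoc)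
      have D0: "D0 = (\<Sum>i\<le>1. \<Sum>j\<le>1. W3 i j / oi.wt i j / b * (Gamma (\<delta>out + 1 / b + real i) * Gamma (\<delta>in + 1 / a + real j)))"
        unfolding assms(20) sum_le_1 WC by (simp only: mult.assoc)
      have Dp: "Dp = (\<Sum>i\<le>1. \<Sum>j\<le>1. W3 i j / oi.wt i j / (a + b - 1) * (Gamma (\<delta>out + 1 / b + real i) * Gamma (\<delta>in + 1 / a + real j)))"
        unfolding assms(21) sum_le_1 WC by (simp only: mult.assoc)
      show "(\<lambda>n. cX (u n) (v n)) \<sim>[sequentially]
       (\<lambda>n. if a + b < 1 then Dm * real (u n) powr (- ((a + b) / b)) * real (v n) powr (- (1/a))
            else if a + b = 1 then
              D0 * real (u n) powr (- (1/b)) * real (v n) powr (- (1/a)) * ln (real (u n))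
            else Dp * real (u n) powr (- (1/b)) * real (v n) powr (- (1/a)))"
        using oi.total_asymp[of W2 W3 u v W1, OF less_imp_le[OF W_pos(2)] W_pos(3) uv]
        unfolding cX_def Dm D0 Dp by (simp only: mult.assoc)
    qed
  next
    show "\<forall>u v :: nat \<Rightarrow> nat.
       filterlim u at_top sequentially \<and> filterlim v at_top sequentially \<and>
       filterlim (\<lambda>n. real (u n) powr a / real (v n) powr b) at_top sequentially \<longrightarrow>
       (\<lambda>n. cX (u n) (v n)) \<sim>[sequentially]
       (\<lambda>n. if a + b < 1 then Dm' * real (u n) powr (- (1/b)) * real (v n) powr (- ((a + b) / a))
            else if a + b = 1 then
              D0' * real (u n) powr (- (1/b)) * real (v n) powr (- (1/a)) * ln (real (v n))
            else Dp * real (u n) powr (- (1/b)) * real (v n) powr (- (1/a)))"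
    proof (intro allI impI, elim conjE)
      fix u v :: "nat \<Rightarrow> nat"
      assume uv: "filterlim u at_top sequentially" "filterlim v at_top sequentially"
        and "filterlim (\<lambda>n. real (u n) powr a / real (v n) powr b) at_top sequentially"
      then have lim: "(\<lambda>n. real (v n) powr b / real (u n) powr a) \<longlonglongrightarrow> 0"
        using tendsto_inverse_0_at_top[of "\<lambda>n. real (u n) powr a / real (v n) powr b" sequentially] by simp
      have Dm': "Dm' = (\<Sum>i\<le>1. W1 i / io.wt 0 i * (Gamma (\<delta>out + 1 / b + real i) * Gamma (\<delta>in + b / a + 1)))
        + (\<Sum>j\<le>1. \<Sum>i\<le>1. W3 i j / io.wt j i / (1 - b - a) * (Gamma (\<delta>out + 1 / b + real i) * Gamma (\<delta>in + b / a + 1 + real j)))"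
        unfolding assms(22) sum_le_1 wt_swap WA WC
        by (simp add: algebra_simps)
      have D0': "D0' = (\<Sum>j\<le>1. \<Sum>i\<le>1. W3 i j / io.wt j i / a * (Gamma (\<delta>in + 1 / a + real j) * Gamma (\<delta>out + 1 / b + real i)))"
        unfolding assms(23) sum_le_1 wt_swap WC by (simp only: mult_ac add_ac)
      have Dp: "Dp = (\<Sum>j\<le>1. \<Sum>i\<le>1. W3 i j / io.wt j i / (b + a - 1) * (Gamma (\<delta>in + 1 / a + real j) * Gamma (\<delta>out + 1 / b + real i)))"
        unfolding assms(21) sum_le_1 wt_swap WC by (simp only: mult_ac add_ac add.commute[of b a])
      \<comment> \<open>The regime of a large ratio is the one already treated, with source and
        target exchanged.\<close>
      have "cX (u n) (v n) = io.total W2 W1 (\<lambda>j i. W3 i j) (v n) (u n)" for n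
        unfolding cX_def by (rule oi.total_commute[symmetric])
      then show "(\<lambda>n. cX (u n) (v n)) \<sim>[sequentially]
       (\<lambda>n. if a + b < 1 then Dm' * real (u n) powr (- (1/b)) * real (v n) powr (- ((a + b) / a))
            else if a + b = 1 then
              D0' * real (u n) powr (- (1/b)) * real (v n) powr (- (1/a)) * ln (real (v n))
            else Dp * real (u n) powr (- (1/b)) * real (v n) powr (- (1/a)))"
        using io.total_asymp[of W1 "\<lambda>j i. W3 i j" v u W2, OF less_imp_le[OF W_pos(1)] W_pos(3) uv(2,1) lim]
        unfolding Dm' D0' Dp by (simp only: mult.assoc add.commute[of b a] mult.commute[of "real (v _) powr _" "real (u _) powr _"] mult.left_commute[of "real (v _) powr _" "real (u _) powr _"])
    qed
  qed
qed

end
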